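(* Let $(\mathcal{R},\partial)$ be a commutative differential ring with ring of constants $\mathcal{C}$, let $\mathrm{Q}$ be a quasi-integration on it, and let $\mathrm{IDR}(\mathcal{R})$, its maps $\partial$ and $\int$, and $\iota:\mathcal{R}\to\mathrm{IDR}(\mathcal{R})$ be as defined in the context. Then: 1. $(\mathrm{IDR}(\mathcal{R}),\partial,\int)$ is a commutative integro-differential ring. 2. The $\mathcal{C}$-algebra homomorphism $\iota:\mathcal{R}\to\mathrm{IDR}(\mathcal{R})$, $\iota(f)=f\otimes1\otimes1\otimes1_{\mathcal{T}}$, is an injective differential ring homomorphism. 3. For $n\in\{1,2,\dots\}$, $f_0\in\mathcal{R}$, and pure tensors $f=f_1\otimes\dots\otimes f_n\in\mathcal{R}_{\mathrm{T}}^{\otimes n}$, we have $$\iota(f_0)\cdot\int\Big(\iota(f_1)\cdot\int\Big(\iota(f_2)\cdots\int\iota(f_n)\Big)\cdots\Big)=f_0\otimes1\otimes1\otimes f.$$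
   Context: Rings and algebras have a unit, homomorphisms preserve it. A differential ring is a ring with an additive map $\partial$ satisfying the Leibniz rule; its ring of constants is $\ker\partial$. An integro-differential ring $(\mathcal{S},\partial,\int)$ is a differential ring with a $\ker(\partial)$-linear map $\int:\mathcal{S}\to\mathcal{S}$ such that $\partial\int=\mathrm{id}$. Differential ring homomorphisms are ring homomorphisms commuting with $\partial$. Setting: $(\mathcal{R},\partial)$ is a commutative differential ring, $\mathcal{C}=\ker\partial$, and all tensor and symmetric products are over $\mathcal{C}$. A quasi-integration is a $\mathcal{C}$-linear $\mathrm{Q}:\mathcal{R}\to\mathcal{R}$ with $\partial\mathrm{Q}\partial=\partial$ and $\mathrm{Q}\partial\mathrm{Q}=\mathrm{Q}$; one such $\mathrm{Q}$ is fixed. Put $\mathcal{R}_{\mathrm{J}}=\mathrm{Q}\mathcal{R}$ and $\mathcal{R}_{\mathrm{T}}=\ker\mathrm{Q}$, so $\mathcal{R}=\mathcal{C}\oplus\mathcal{R}_{\mathrm{J}}=(\partial\mathcal{R})\oplus\mathcal{R}_{\mathrm{T}}$. Tensors: $\mathcal{T}=\bigoplus_{n\ge0}\mathcal{R}_{\mathrm{T}}^{\otimes n}$ with empty tensor $1_{\mathcal{T}}$; $\widetilde{\mathcal{T}}=\bigoplus_{n\ge1}\mathcal{R}_{\mathrm{T}}^{\otimes n}$. The shuffle product $\sqcup\!\sqcup$ on $\mathcal{T}$ is the $\mathcal{C}$-bilinear product with $t\sqcup\!\sqcup s=t\otimes s$ if $t$ or $s$ has length $0$ and $t\sqcup\!\sqcup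 s=t_1\otimes((t_2\otimes\dots\otimes t_n)\sqcup\!\sqcup s)+s_1\otimes(t\sqcup\!\sqcup(s_2\otimes\dots\otimes s_m))$ for pure tensors of lengths $n,m\ge1$. For a pure tensor $f=f_1\otimes\dots\otimes f_n$, $f_i^j:=f_i\otimes\dots\otimes f_j$, and $f_i^j=1_{\mathcal{T}}$ if $i=j+1$. Constants: $M_1=\mathcal{R}_{\mathrm{J}}\otimes\mathcal{T}$, $M_2=\widetilde{\mathcal{T}}^{\odot2}$ (symmetric square). $\varepsilon(M_1),\varepsilon(M_2)$ are isomorphic copies with isomorphisms $\varepsilon$; for $r\in\mathcal{R}_{\mathrm{J}}$, $\varepsilon(r)$ means $\varepsilon(r\otimes1_{\mathcal{T}})$. $\mathcal{C}_1=\mathrm{Sym}(\varepsilon(M_1))$ and $\mathcal{C}_2=\mathrm{Sym}(\varepsilon(M_2))/J_2$ (unital symmetric $\mathcal{C}$-algebras), where $J_2$ is the ideal generated by all $$\varepsilon((f\sqcup\!\sqcup g)\odot h)-\varepsilon(f\odot(g\sqcup\!\sqcup h))+\sum_{j=0}^{m-1}\Big(\sum_{i=\max(0,1-j)}^{n-1}\varepsilon(f_{i+1}^n\odot g_{j+1}^m)\cdot\varepsilon((f_1^i\sqcup\!\sqcup g_1^j)\odot h)-\sum_{k=\max(0,1-j)}^{l-1}\varepsilon(f\odot(g_1^j\sqcup\!\sqcup h_1^k))\cdot\varepsilon(g_{j+1}^m\odot h_{k+1}^l)\Big)$$ for $n,m,l\ge1$ and pure tensors $f\in\mathcal{R}_{\mathrm{T}}^{\otimes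 n}$, $g\in\mathcal{R}_{\mathrm{T}}^{\otimes m}$, $h\in\mathcal{R}_{\mathrm{T}}^{\otimes l}$. Elements $\varepsilon(\cdot)$ of $\mathcal{C}_2$ denote classes. Product on $\mathcal{C}_2\otimes\mathcal{T}$: the $\mathcal{C}$-bilinear map with, for $c,d\in\mathcal{C}_2$ and pure tensors $f,g$ of lengths $n,m\ge0$, $$(c\otimes f)\cdot(d\otimes g)=(c\cdot d)\otimes(f\sqcup\!\sqcup g)+\sum_{i=0}^{n-1}\sum_{j=0}^{m-1}\big(c\cdot d\cdot\varepsilon(f_{i+1}^n\odot g_{j+1}^m)\big)\otimes(f_1^i\sqcup\!\sqcup g_1^j);$$ this makes $\mathcal{C}_2\otimes\mathcal{T}$ a commutative $\mathcal{C}$-algebra with unit $1\otimes1_{\mathcal{T}}$. $\mathrm{IDR}(\mathcal{R}):=\mathcal{R}\otimes\mathcal{C}_1\otimes\mathcal{C}_2\otimes\mathcal{T}$, the tensor product of the commutative $\mathcal{C}$-algebras $\mathcal{R}$, $\mathcal{C}_1$ and $\mathcal{C}_2\otimes\mathcal{T}$; $\iota(f)=f\otimes1\otimes1\otimes1_{\mathcal{T}}$ for $f\in\mathcal{R}$. For $f_0\in\mathcal{R}$, $c=c_1\otimes c_2\in\mathcal{C}_1\otimes\mathcal{C}_2$ and a pure tensor $f\in\mathcal{R}_{\mathrm{T}}^{\otimes n}$, the $\mathcal{C}$-linear maps $\partial,\int$ on $\mathrm{IDR}(\mathcal{R})$ are given as follows. $\partial(f_0\otimes c\otimes f)=(\partial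 f_0)\otimes c\otimes f$ if $n=0$ and $(\partial f_0)\otimes c\otimes f+(f_0f_1)\otimes c\otimes f_2^n$ if $n>0$. For $n=0$: $\int(f_0\otimes c\otimes f)=(\mathrm{Q}f_0)\otimes c\otimes f-1\otimes(c_1\cdot\varepsilon(\mathrm{Q}f_0))\otimes c_2\otimes f+1\otimes c\otimes((f_0-\partial\mathrm{Q}f_0)\otimes f)$. For $n>0$, recursively: $\int(f_0\otimes c\otimes f)=(\mathrm{Q}f_0)\otimes c\otimes f-1\otimes(c_1\cdot\varepsilon((\mathrm{Q}f_0)\otimes f))\otimes c_2\otimes1_{\mathcal{T}}-\int(((\mathrm{Q}f_0)f_1)\otimes c\otimes f_2^n)+1\otimes c\otimes((f_0-\partial\mathrm{Q}f_0)\otimes f)$. *)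

theory Defs
  imports "HOL-Library.Multiset" "HOL-Algebra.Module" "HOL-Algebra.QuotRing"
begin

section \<open>Differential and integro-differential rings\<close>

definition constants :: "('a, 'b) ring_scheme \<Rightarrow> ('a \<Rightarrow> 'a) \<Rightarrow> 'a set"
  where "constants R D = {c \<in> carrier R. D c = \<zero>\<^bsub>R\<^esub>}"

locale comm_differential_ring = cring R for R (structure) +
  fixes D :: "'a \<Rightarrow> 'a"
  assumes D_closed: "f \<in> carrier R \<Longrightarrow> D f \<in> carrier R"
    and D_add: "\<lbrakk>f \<in> carrier R; g \<in> carrier R\<rbrakk> \<Longrightarrow> D (f \<oplus> g) = D f \<oplus> D g"
    and D_mult: "\<lbrakk>f \<in> carrier R; g \<in> carrier R\<rbrakk> \<Longrightarrow> D (f \<otimes> g) = D f \<otimes> g \<oplus> f \<otimes> D g"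

locale comm_integro_differential_ring = comm_differential_ring +
  fixes I :: "'a \<Rightarrow> 'a"
  assumes I_closed: "f \<in> carrier R \<Longrightarrow> I f \<in> carrier R"
    and I_add: "\<lbrakk>f \<in> carrier R; g \<in> carrier R\<rbrakk> \<Longrightarrow> I (f \<oplus> g) = I f \<oplus> I g"
    and I_linear: "\<lbrakk>c \<in> constants R D; f \<in> carrier R\<rbrakk> \<Longrightarrow> I (c \<otimes> f) = c \<otimes> I f"
    and D_I: "f \<in> carrier R \<Longrightarrow> D (I f) = f"

definition differential_ring_hom ::
    "('a, 'b) ring_scheme \<Rightarrow> ('a \<Rightarrow> 'a) \<Rightarrow> ('c, 'd) ring_scheme \<Rightarrow> ('c \<Rightarrow> 'c) \<Rightarrow> ('a \<Rightarrow> 'c) set"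
  where "differential_ring_hom R D S E = {h \<in> ring_hom R S. \<forall>f\<in>carrier R. h (D f) = E (h f)}"


section \<open>Modules given by generators and relations\<close>

text \<open>
  Modules over a commutative ring \<open>K\<close> are \<^type>\<open>module_scheme\<close> records; the fields \<^const>\<open>mult\<close> and
  \<^const>\<open>one\<close> of a record that is only meant to be a module carry no information.
\<close>

definition linear_maps ::
    "('k, 'x) ring_scheme \<Rightarrow> ('k, 'm, 'y) module_scheme \<Rightarrow> ('k, 'n, 'z) module_scheme \<Rightarrow> ('m \<Rightarrow> 'n) set"
  where "linear_maps K M N = {h \<in> carrier M \<rightarrow> carrier N.
    (\<forall>x\<in>carrier M. \<forall>y\<in>carrier M. h (x \<oplus>\<^bsub>M\<^esub> y) = h x \<oplus>\<^bsub>N\<^esub> h y) \<and>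
    (\<forall>k\<in>carrier K. \<forall>x\<in>carrier M. h (k \<odot>\<^bsub>M\<^esub> x) = k \<odot>\<^bsub>N\<^esub> h x)}"

definition algebra_hom ::
    "('k, 'x) ring_scheme \<Rightarrow> ('k, 'm, 'y) module_scheme \<Rightarrow> ('k, 'n, 'z) module_scheme \<Rightarrow> ('m \<Rightarrow> 'n) set"
  where "algebra_hom K A B = ring_hom A B \<inter> linear_maps K A B"

definition bilinear_maps ::
    "('k, 'x) ring_scheme \<Rightarrow> ('k, 'm, 'y) module_scheme \<Rightarrow> ('k, 'n, 'z) module_scheme \<Rightarrow>
     ('k, 'p, 'w) module_scheme \<Rightarrow> ('m \<Rightarrow> 'n \<Rightarrow> 'p) set"
  where "bilinear_maps K M N P = {b.
    (\<forall>x\<in>carrier M. b x \<in> linear_maps K N P) \<and>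
    (\<forall>y\<in>carrier N. (\<lambda>x. b x y) \<in> linear_maps K M P)}"

text \<open>
  The following two operators pick the linear (bilinear) map with a given property; as functions in
  HOL are total, its values outside the carriers are fixed to be \<^const>\<open>undefined\<close>.
\<close>

definition the_linear ::
    "('k, 'x) ring_scheme \<Rightarrow> ('k, 'm, 'y) module_scheme \<Rightarrow> ('k, 'n, 'z) module_scheme \<Rightarrow>
     (('m \<Rightarrow> 'n) \<Rightarrow> bool) \<Rightarrow> 'm \<Rightarrow> 'n"
  where "the_linear K M N P = (THE h. h \<in> linear_maps K M N \<and> h \<in> extensional (carrier M) \<and> P h)"

definition the_bilinear ::
    "('k, 'x) ring_scheme \<Rightarrow> ('k, 'm, 'y) module_scheme \<Rightarrow> ('k, 'n, 'z) module_scheme \<Rightarrow>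
     ('k, 'p, 'w) module_scheme \<Rightarrow> (('m \<Rightarrow> 'n \<Rightarrow> 'p) \<Rightarrow> bool) \<Rightarrow> 'm \<Rightarrow> 'n \<Rightarrow> 'p"
  where "the_bilinear K M N L P = (THE b. b \<in> bilinear_maps K M N L \<and>
    (\<forall>x y. x \<notin> carrier M \<or> y \<notin> carrier N \<longrightarrow> b x y = undefined) \<and> P b)"

definition submodule_span :: "('k, 'x) ring_scheme \<Rightarrow> ('k, 'm, 'y) module_scheme \<Rightarrow> 'm set \<Rightarrow> 'm set"
  where "submodule_span K M X = \<Inter> {H. submodule H K M \<and> X \<subseteq> H}"

text \<open>
  The quotient of a module by a submodule, or of an algebra by an ideal: \<^const>\<open>FactRing\<close> together
  with the induced scalar multiplication.
\<close>

definition quotient_module :: "('k, 'm, 'y) module_scheme \<Rightarrow> 'm set \<Rightarrow> ('k, 'm set) module"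
  where "quotient_module M H =
    \<lparr>carrier = carrier (M Quot H), mult = mult (M Quot H), one = one (M Quot H),
     zero = zero (M Quot H), add = add (M Quot H),
     smult = (\<lambda>k X. \<Union>x\<in>X. H +>\<^bsub>M\<^esub> (k \<odot>\<^bsub>M\<^esub> x))\<rparr>"

definition free_module :: "('k, 'x) ring_scheme \<Rightarrow> 'g set \<Rightarrow> ('k, 'g \<Rightarrow> 'k) module"
  where "free_module K G =
    \<lparr>carrier = {x. (\<forall>g. x g \<in> carrier K) \<and> finite {g. x g \<noteq> \<zero>\<^bsub>K\<^esub>} \<and> {g. x g \<noteq> \<zero>\<^bsub>K\<^esub>} \<subseteq> G},
     mult = undefined, one = undefined, zero = (\<lambda>g. \<zero>\<^bsub>K\<^esub>), add = (\<lambda>x y g. x g \<oplus>\<^bsub>K\<^esub> y g),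
     smult = (\<lambda>k x g. k \<otimes>\<^bsub>K\<^esub> x g)\<rparr>"

definition basis_vec :: "('k, 'x) ring_scheme \<Rightarrow> 'g \<Rightarrow> 'g \<Rightarrow> 'k"
  where "basis_vec K g = (\<lambda>h. if h = g then \<one>\<^bsub>K\<^esub> else \<zero>\<^bsub>K\<^esub>)"

definition presented_module ::
    "('k, 'x) ring_scheme \<Rightarrow> 'g set \<Rightarrow> ('g \<Rightarrow> 'k) set \<Rightarrow> ('k, ('g \<Rightarrow> 'k) set) module"
  where "presented_module K G X =
    quotient_module (free_module K G) (submodule_span K (free_module K G) X)"

definition presented_gen ::
    "('k, 'x) ring_scheme \<Rightarrow> 'g set \<Rightarrow> ('g \<Rightarrow> 'k) set \<Rightarrow> 'g \<Rightarrow> ('g \<Rightarrow> 'k) set"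
  where "presented_gen K G X g =
    submodule_span K (free_module K G) X +>\<^bsub>free_module K G\<^esub> basis_vec K g"


section \<open>Tensor products, symmetric squares, tensor modules, symmetric algebras\<close>

definition bilinear_rels ::
    "('k, 'x) ring_scheme \<Rightarrow> ('k, 'm, 'y) module_scheme \<Rightarrow> ('k, 'n, 'z) module_scheme \<Rightarrow>
     ('m \<times> 'n \<Rightarrow> 'k) set"
  where "bilinear_rels K M N = (let F = free_module K (carrier M \<times> carrier N); b = basis_vec K in
    {b (x \<oplus>\<^bsub>M\<^esub> x', y) \<ominus>\<^bsub>F\<^esub> (b (x, y) \<oplus>\<^bsub>F\<^esub> b (x', y)) | x x' y.
       x \<in> carrier M \<and> x' \<in> carrier M \<and> y \<in> carrier N} \<union>
    {b (x, y \<oplus>\<^bsub>N\<^esub> y') \<ominus>\<^bsub>F\<^esub> (b (x, y) \<oplus>\<^bsub>F\<^esub> b (x, y')) | x y y'.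
       x \<in> carrier M \<and> y \<in> carrier N \<and> y' \<in> carrier N} \<union>
    {b (k \<odot>\<^bsub>M\<^esub> x, y) \<ominus>\<^bsub>F\<^esub> (k \<odot>\<^bsub>F\<^esub> b (x, y)) | k x y.
       k \<in> carrier K \<and> x \<in> carrier M \<and> y \<in> carrier N} \<union>
    {b (x, k \<odot>\<^bsub>N\<^esub> y) \<ominus>\<^bsub>F\<^esub> (k \<odot>\<^bsub>F\<^esub> b (x, y)) | k x y.
       k \<in> carrier K \<and> x \<in> carrier M \<and> y \<in> carrier N})"

definition tensor_module ::
    "('k, 'x) ring_scheme \<Rightarrow> ('k, 'm, 'y) module_scheme \<Rightarrow> ('k, 'n, 'z) module_scheme \<Rightarrow>
     ('k, ('m \<times> 'n \<Rightarrow> 'k) set) module"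
  where "tensor_module K M N =
    presented_module K (carrier M \<times> carrier N) (bilinear_rels K M N)"

definition tensor ::
    "('k, 'x) ring_scheme \<Rightarrow> ('k, 'm, 'y) module_scheme \<Rightarrow> ('k, 'n, 'z) module_scheme \<Rightarrow>
     'm \<Rightarrow> 'n \<Rightarrow> ('m \<times> 'n \<Rightarrow> 'k) set"
  where "tensor K M N x y = presented_gen K (carrier M \<times> carrier N) (bilinear_rels K M N) (x, y)"

definition tensor_algebra_product ::
    "('k, 'x) ring_scheme \<Rightarrow> ('k, 'm, 'y) module_scheme \<Rightarrow> ('k, 'n, 'z) module_scheme \<Rightarrow>
     ('k, ('m \<times> 'n \<Rightarrow> 'k) set) module"
  where "tensor_algebra_product K A B = (let P = tensor_module K A B; t = tensor K A B in
    P\<lparr>mult := the_bilinear K P P P (\<lambda>p.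
        \<forall>a\<in>carrier A. \<forall>b\<in>carrier B. \<forall>a'\<in>carrier A. \<forall>b'\<in>carrier B.
          p (t a b) (t a' b') = t (a \<otimes>\<^bsub>A\<^esub> a') (b \<otimes>\<^bsub>B\<^esub> b')),
      one := t \<one>\<^bsub>A\<^esub> \<one>\<^bsub>B\<^esub>\<rparr>)"

definition symmetric_square_rels ::
    "('k, 'x) ring_scheme \<Rightarrow> ('k, 'm, 'y) module_scheme \<Rightarrow> ('m \<times> 'm \<Rightarrow> 'k) set"
  where "symmetric_square_rels K M = bilinear_rels K M M \<union>
    {basis_vec K (x, y) \<ominus>\<^bsub>free_module K (carrier M \<times> carrier M)\<^esub> basis_vec K (y, x) | x y.
       x \<in> carrier M \<and> y \<in> carrier M}"

definition symmetric_square ::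
    "('k, 'x) ring_scheme \<Rightarrow> ('k, 'm, 'y) module_scheme \<Rightarrow> ('k, ('m \<times> 'm \<Rightarrow> 'k) set) module"
  where "symmetric_square K M =
    presented_module K (carrier M \<times> carrier M) (symmetric_square_rels K M)"

definition sym_tensor ::
    "('k, 'x) ring_scheme \<Rightarrow> ('k, 'm, 'y) module_scheme \<Rightarrow> 'm \<Rightarrow> 'm \<Rightarrow> ('m \<times> 'm \<Rightarrow> 'k) set"
  where "sym_tensor K M x y =
    presented_gen K (carrier M \<times> carrier M) (symmetric_square_rels K M) (x, y)"

text \<open>
  The direct sum of all tensor powers of \<open>M\<close>: generated by the words over \<open>M\<close> (a word of length \<open>n\<close>
  is a pure tensor of length \<open>n\<close>), subject to linearity in each position.  The relations only
  involve words of equal length, and for \<open>n = 0\<close> one gets the free module on the empty word.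
\<close>

definition word_rels ::
    "('k, 'x) ring_scheme \<Rightarrow> ('k, 'm, 'y) module_scheme \<Rightarrow> ('m list \<Rightarrow> 'k) set"
  where "word_rels K M = (let F = free_module K (lists (carrier M)); b = basis_vec K in
    {b (u @ [x \<oplus>\<^bsub>M\<^esub> y] @ v) \<ominus>\<^bsub>F\<^esub> (b (u @ [x] @ v) \<oplus>\<^bsub>F\<^esub> b (u @ [y] @ v)) | u x y v.
       u \<in> lists (carrier M) \<and> v \<in> lists (carrier M) \<and> x \<in> carrier M \<and> y \<in> carrier M} \<union>
    {b (u @ [k \<odot>\<^bsub>M\<^esub> x] @ v) \<ominus>\<^bsub>F\<^esub> (k \<odot>\<^bsub>F\<^esub> b (u @ [x] @ v)) | u k x v.
       u \<in> lists (carrier M) \<and> v \<in> lists (carrier M) \<and> k \<in> carrier K \<and> x \<in> carrier M})"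

definition word_module ::
    "('k, 'x) ring_scheme \<Rightarrow> ('k, 'm, 'y) module_scheme \<Rightarrow> ('k, ('m list \<Rightarrow> 'k) set) module"
  where "word_module K M = presented_module K (lists (carrier M)) (word_rels K M)"

definition pure_tensor ::
    "('k, 'x) ring_scheme \<Rightarrow> ('k, 'm, 'y) module_scheme \<Rightarrow> 'm list \<Rightarrow> ('m list \<Rightarrow> 'k) set"
  where "pure_tensor K M w = presented_gen K (lists (carrier M)) (word_rels K M) w"

text \<open>
  The list, with multiplicities, of all shuffles of two words.
\<close>

fun word_shuffle :: "'m list \<Rightarrow> 'm list \<Rightarrow> 'm list list" where
  "word_shuffle [] ys = [ys]"
| "word_shuffle xs [] = [xs]"
| "word_shuffle (x # xs) (y # ys) =
     map ((#) x) (word_shuffle xs (y # ys)) @ map ((#) y) (word_shuffle (x # xs) ys)"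

definition shuffle_algebra ::
    "('k, 'x) ring_scheme \<Rightarrow> ('k, 'm, 'y) module_scheme \<Rightarrow> ('k, ('m list \<Rightarrow> 'k) set) module"
  where "shuffle_algebra K M = (let T = word_module K M; w = pure_tensor K M in
    T\<lparr>mult := the_bilinear K T T T (\<lambda>p.
        \<forall>f\<in>lists (carrier M). \<forall>g\<in>lists (carrier M).
          p (w f) (w g) = foldr (\<lambda>h s. w h \<oplus>\<^bsub>T\<^esub> s) (word_shuffle f g) \<zero>\<^bsub>T\<^esub>),
      one := w []\<rparr>)"

text \<open>
  The symmetric algebra: generated as a module by the commutative monomials in the elements of \<open>M\<close>,
  represented by finite multisets, subject to linearity in each factor, and with the product
  induced by the product of monomials.
\<close>

definition monomials :: "'m set \<Rightarrow> 'm multiset set"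
  where "monomials X = {A. set_mset A \<subseteq> X}"

definition monomial_rels ::
    "('k, 'x) ring_scheme \<Rightarrow> ('k, 'm, 'y) module_scheme \<Rightarrow> ('m multiset \<Rightarrow> 'k) set"
  where "monomial_rels K M = (let F = free_module K (monomials (carrier M)); b = basis_vec K in
    {b (add_mset (x \<oplus>\<^bsub>M\<^esub> y) A) \<ominus>\<^bsub>F\<^esub> (b (add_mset x A) \<oplus>\<^bsub>F\<^esub> b (add_mset y A)) | x y A.
       A \<in> monomials (carrier M) \<and> x \<in> carrier M \<and> y \<in> carrier M} \<union>
    {b (add_mset (k \<odot>\<^bsub>M\<^esub> x) A) \<ominus>\<^bsub>F\<^esub> (k \<odot>\<^bsub>F\<^esub> b (add_mset x A)) | k x A.
       A \<in> monomials (carrier M) \<and> k \<in> carrier K \<and> x \<in> carrier M})"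

definition monomial ::
    "('k, 'x) ring_scheme \<Rightarrow> ('k, 'm, 'y) module_scheme \<Rightarrow> 'm multiset \<Rightarrow> ('m multiset \<Rightarrow> 'k) set"
  where "monomial K M A = presented_gen K (monomials (carrier M)) (monomial_rels K M) A"

definition Sym ::
    "('k, 'x) ring_scheme \<Rightarrow> ('k, 'm, 'y) module_scheme \<Rightarrow> ('k, ('m multiset \<Rightarrow> 'k) set) module"
  where "Sym K M =
    (let S = presented_module K (monomials (carrier M)) (monomial_rels K M); m = monomial K M in
    S\<lparr>mult := the_bilinear K S S S (\<lambda>p.
        \<forall>A\<in>monomials (carrier M). \<forall>B\<in>monomials (carrier M). p (m A) (m B) = m (A + B)),
      one := m {#}\<rparr>)"

definition Sym_incl ::
    "('k, 'x) ring_scheme \<Rightarrow> ('k, 'm, 'y) module_scheme \<Rightarrow> 'm \<Rightarrow> ('m multiset \<Rightarrow> 'k) set"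
  where "Sym_incl K M x = monomial K M {#x#}"


section \<open>The integro-differential ring of a quasi-integration\<close>

locale quasi_integration = comm_differential_ring +
  fixes Q :: "'a \<Rightarrow> 'a"
  assumes Q_closed: "f \<in> carrier R \<Longrightarrow> Q f \<in> carrier R"
    and Q_add: "\<lbrakk>f \<in> carrier R; g \<in> carrier R\<rbrakk> \<Longrightarrow> Q (f \<oplus> g) = Q f \<oplus> Q g"
    and Q_linear: "\<lbrakk>c \<in> constants R D; f \<in> carrier R\<rbrakk> \<Longrightarrow> Q (c \<otimes> f) = c \<otimes> Q f"
    and D_Q_D: "f \<in> carrier R \<Longrightarrow> D (Q (D f)) = D f"
    and Q_D_Q: "f \<in> carrier R \<Longrightarrow> Q (D (Q f)) = Q f"
begin

definition C :: "('a, 'b) ring_scheme"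
  where "C = R\<lparr>carrier := constants R D\<rparr>"

definition RC :: "('a, 'a) module"
  where "RC = \<lparr>carrier = carrier R, mult = mult R, one = \<one>, zero = \<zero>, add = add R, smult = mult R\<rparr>"

definition RJ :: "('a, 'a) module"
  where "RJ = RC\<lparr>carrier := Q ` carrier R\<rparr>"

definition RT :: "('a, 'a) module"
  where "RT = RC\<lparr>carrier := {f \<in> carrier R. Q f = \<zero>}\<rparr>"

abbreviation RT_words :: "'a list set"
  where "RT_words \<equiv> lists (carrier RT)"

definition T :: "('a, ('a list \<Rightarrow> 'a) set) module"
  where "T = shuffle_algebra C RT"

definition pure :: "'a list \<Rightarrow> ('a list \<Rightarrow> 'a) set"
  where "pure f = pure_tensor C RT f"

definition T_pos :: "('a, ('a list \<Rightarrow> 'a) set) module"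
  where "T_pos = T\<lparr>carrier := submodule_span C T (pure ` (RT_words - {[]}))\<rparr>"

definition M1 :: "('a, ('a \<times> ('a list \<Rightarrow> 'a) set \<Rightarrow> 'a) set) module"
  where "M1 = tensor_module C RJ T"

definition M2 :: "('a, (('a list \<Rightarrow> 'a) set \<times> ('a list \<Rightarrow> 'a) set \<Rightarrow> 'a) set) module"
  where "M2 = symmetric_square C T_pos"

text \<open>
  The isomorphic copies of \<open>M1\<close> and \<open>M2\<close> are their images under the canonical maps to the symmetric
  algebras.  So \<open>eps1 r t\<close> and \<open>eps2 s t\<close> are the elements \<open>\<epsilon>(r \<otimes> t)\<close> and \<open>\<epsilon>(s \<odot> t)\<close>, and \<open>eps2_Sym s t\<close>
  is the representative of the latter in the symmetric algebra of \<open>M2\<close>.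
\<close>

definition C1 where "C1 = Sym C M1"

definition eps1 where "eps1 r t = Sym_incl C M1 (tensor C RJ T r t)"

definition eps2_Sym where "eps2_Sym s t = Sym_incl C M2 (sym_tensor C T_pos s t)"

text \<open>
  For words \<open>f\<close> we have \<open>f\<^sub>1 \<otimes> \<dots> \<otimes> f\<^sub>i = take i f\<close> and \<open>f\<^sub>i\<^sub>+\<^sub>1 \<otimes> \<dots> \<otimes> f\<^sub>n = drop i f\<close>.  The lower bound \<open>1 - j\<close>
  below is truncated subtraction, i.e. \<open>max 0 (1 - j)\<close>.
\<close>

definition J2_gen where
  "J2_gen f g h = (let S = Sym C M2; e = eps2_Sym; sh = (\<lambda>u v. pure u \<otimes>\<^bsub>T\<^esub> pure v) in
     (e (sh f g) (pure h) \<ominus>\<^bsub>S\<^esub> e (pure f) (sh g h)) \<oplus>\<^bsub>S\<^esub>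
     (\<Oplus>\<^bsub>S\<^esub> j \<in> {0..<length g}.
        (\<Oplus>\<^bsub>S\<^esub> i \<in> {1 - j..<length f}.
           e (pure (drop i f)) (pure (drop j g)) \<otimes>\<^bsub>S\<^esub> e (sh (take i f) (take j g)) (pure h))
        \<ominus>\<^bsub>S\<^esub>
        (\<Oplus>\<^bsub>S\<^esub> k \<in> {1 - j..<length h}.
           e (pure f) (sh (take j g) (take k h)) \<otimes>\<^bsub>S\<^esub> e (pure (drop j g)) (pure (drop k h)))))"

definition J2 where
  "J2 = Idl\<^bsub>Sym C M2\<^esub> {J2_gen f g h | f g h.
     f \<in> RT_words - {[]} \<and> g \<in> RT_words - {[]} \<and> h \<in> RT_words - {[]}}"

definition C2 where "C2 = quotient_module (Sym C M2) J2"

definition eps2 where "eps2 s t = J2 +>\<^bsub>Sym C M2\<^esub> eps2_Sym s t"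

definition C2_T where
  "C2_T = (let P = tensor_module C C2 T; t = tensor C C2 T in
    P\<lparr>mult := the_bilinear C P P P (\<lambda>p.
        \<forall>c\<in>carrier C2. \<forall>d\<in>carrier C2. \<forall>f\<in>RT_words. \<forall>g\<in>RT_words.
          p (t c (pure f)) (t d (pure g)) =
            t (c \<otimes>\<^bsub>C2\<^esub> d) (pure f \<otimes>\<^bsub>T\<^esub> pure g) \<oplus>\<^bsub>P\<^esub>
            (\<Oplus>\<^bsub>P\<^esub> i \<in> {0..<length f}. \<Oplus>\<^bsub>P\<^esub> j \<in> {0..<length g}.
               t (c \<otimes>\<^bsub>C2\<^esub> d \<otimes>\<^bsub>C2\<^esub> eps2 (pure (drop i f)) (pure (drop j g)))
                 (pure (take i f) \<otimes>\<^bsub>T\<^esub> pure (take j g)))),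
      one := t \<one>\<^bsub>C2\<^esub> (pure [])\<rparr>)"

definition C1_C2_T where "C1_C2_T = tensor_algebra_product C C1 C2_T"

definition IDR where "IDR = tensor_algebra_product C RC C1_C2_T"

text \<open>The element \<open>f\<^sub>0 \<otimes> c\<^sub>1 \<otimes> c\<^sub>2 \<otimes> f\<close> for a pure tensor \<open>f\<close>.\<close>

definition elt where
  "elt f\<^sub>0 c\<^sub>1 c\<^sub>2 f =
     tensor C RC C1_C2_T f\<^sub>0 (tensor C C1 C2_T c\<^sub>1 (tensor C C2 T c\<^sub>2 (pure f)))"

definition iota where "iota f = elt f \<one>\<^bsub>C1\<^esub> \<one>\<^bsub>C2\<^esub> []"

definition deriv where
  "deriv = the_linear C IDR IDR (\<lambda>E.
     \<forall>f\<^sub>0\<in>carrier R. \<forall>c\<^sub>1\<in>carrier C1. \<forall>c\<^sub>2\<in>carrier C2.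
       E (elt f\<^sub>0 c\<^sub>1 c\<^sub>2 []) = elt (D f\<^sub>0) c\<^sub>1 c\<^sub>2 [] \<and>
       (\<forall>f\<^sub>1\<in>carrier RT. \<forall>f\<in>RT_words.
         E (elt f\<^sub>0 c\<^sub>1 c\<^sub>2 (f\<^sub>1 # f)) =
           elt (D f\<^sub>0) c\<^sub>1 c\<^sub>2 (f\<^sub>1 # f) \<oplus>\<^bsub>IDR\<^esub> elt (f\<^sub>0 \<otimes> f\<^sub>1) c\<^sub>1 c\<^sub>2 f))"

definition integral where
  "integral = the_linear C IDR IDR (\<lambda>I.
     \<forall>f\<^sub>0\<in>carrier R. \<forall>c\<^sub>1\<in>carrier C1. \<forall>c\<^sub>2\<in>carrier C2.
       I (elt f\<^sub>0 c\<^sub>1 c\<^sub>2 []) =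
         (elt (Q f\<^sub>0) c\<^sub>1 c\<^sub>2 []
         \<ominus>\<^bsub>IDR\<^esub> elt \<one> (c\<^sub>1 \<otimes>\<^bsub>C1\<^esub> eps1 (Q f\<^sub>0) (pure [])) c\<^sub>2 [])
         \<oplus>\<^bsub>IDR\<^esub> elt \<one> c\<^sub>1 c\<^sub>2 [f\<^sub>0 \<ominus> D (Q f\<^sub>0)] \<and>
       (\<forall>f\<^sub>1\<in>carrier RT. \<forall>f\<in>RT_words.
         I (elt f\<^sub>0 c\<^sub>1 c\<^sub>2 (f\<^sub>1 # f)) =
           ((elt (Q f\<^sub>0) c\<^sub>1 c\<^sub>2 (f\<^sub>1 # f)
           \<ominus>\<^bsub>IDR\<^esub> elt \<one> (c\<^sub>1 \<otimes>\<^bsub>C1\<^esub> eps1 (Q f\<^sub>0) (pure (f\<^sub>1 # f))) c\<^sub>2 [])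
           \<ominus>\<^bsub>IDR\<^esub> I (elt (Q f\<^sub>0 \<otimes> f\<^sub>1) c\<^sub>1 c\<^sub>2 f))
           \<oplus>\<^bsub>IDR\<^esub> elt \<one> c\<^sub>1 c\<^sub>2 ((f\<^sub>0 \<ominus> D (Q f\<^sub>0)) # f\<^sub>1 # f)))"

fun iterated_integral where
  "iterated_integral [f] = integral (iota f)"
| "iterated_integral (f # g # fs) = integral (iota f \<otimes>\<^bsub>IDR\<^esub> iterated_integral (g # fs))"

end

end

theory Submission
  imports Defs
begin

text \<open>
  All modules are given by generators, so every map and product is determined by its values on
  generators and exists because these values are multilinear.  For words, the product of \<open>C\<^sub>2 \<otimes> T\<close>
  satisfies \<open>(x f) \<cdot> (y g) = x (f \<cdot> (y g)) + y ((x f) \<cdot> g) + \<epsilon>(x f \<odot> y g)\<close>, which gives commutativity by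
  induction and the Leibniz rule at once.  Triple products satisfy the analogous recursion, so that
  \<open>(f \<cdot> g) \<cdot> h\<close> and \<open>(g \<cdot> h) \<cdot> f\<close> differ, by induction on the total length, only in the part of tensor
  length zero, where their equality is the vanishing of the generators of \<open>J\<^sub>2\<close>.

  The identity \<open>\<partial>\<integral> = id\<close> follows along the recursion for \<open>\<integral>\<close>.  Elements \<open>1 \<otimes> c \<otimes> d \<otimes> 1\<close> commute with \<open>\<integral>\<close>,
  and \<open>z - \<integral>\<partial>z\<close> is always a combination of such elements; hence so is every constant \<open>z\<close>, and \<open>\<integral>\<close> is
  linear over the constants.  The augmentations of \<open>C\<^sub>1\<close>, \<open>C\<^sub>2\<close> and \<open>T\<close> yield a linear retraction of \<open>\<iota>\<close>.
\<close>

section \<open>Linear and bilinear maps\<close>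

text \<open>\<open>deriv\<close>, \<open>integral\<close> and all products are picked by
  \<open>THE\<close> from conditions on generators, so none of them can be computed with before
  existence and uniqueness are shown. For products of words, existence is the delicate point:
  multilinearity is hard to read off the double sums over prefixes and suffixes, but it is inherited
  along a recursion that removes one first letter at a time. Hence the recursion precedes the
  linearity proofs.

  Extending \<epsilon> by zero to the empty tensor lets all sums start at 0. The part of length zero
  that is new in (f g) h is then \<open>triple f g h\<close>. Stating associativity as a rotation
  keeps every triple product bracketed to the left, so that a single recursion serves both sides;
  commutativity turns the rotation back into associativity.

  Linearity of the integral over \<open>C\<close> comes with its definition, but the constants of
  the new ring also contain the coefficients from \<open>C1\<close> and \<open>C2\<close>. They are
  shown to lie among the elements over which the integral is linear, without being computed
  beforehand.\<close>

lemma linear_mapsI: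
  assumes "\<And>x. x \<in> carrier M \<Longrightarrow> h x \<in> carrier N"
    and "\<And>x y. \<lbrakk>x \<in> carrier M; y \<in> carrier M\<rbrakk> \<Longrightarrow> h (x \<oplus>\<^bsub>M\<^esub> y) = h x \<oplus>\<^bsub>N\<^esub> h y"
    and "\<And>k x. \<lbrakk>k \<in> carrier K; x \<in> carrier M\<rbrakk> \<Longrightarrow> h (k \<odot>\<^bsub>M\<^esub> x) = k \<odot>\<^bsub>N\<^esub> h x"
  shows "h \<in> linear_maps K M N"
  using assms by (auto simp: linear_maps_def)

lemma linear_maps_closed: "\<lbrakk>h \<in> linear_maps K M N; x \<in> carrier M\<rbrakk> \<Longrightarrow> h x \<in> carrier N"
  and linear_maps_add: "\<lbrakk>h \<in> linear_maps K M N; x \<in> carrier M; y \<in> carrier M\<rbrakk>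
      \<Longrightarrow> h (x \<oplus>\<^bsub>M\<^esub> y) = h x \<oplus>\<^bsub>N\<^esub> h y"
  and linear_maps_smult: "\<lbrakk>h \<in> linear_maps K M N; k \<in> carrier K; x \<in> carrier M\<rbrakk>
      \<Longrightarrow> h (k \<odot>\<^bsub>M\<^esub> x) = k \<odot>\<^bsub>N\<^esub> h x"
  by (auto simp: linear_maps_def)

lemma module_cring: "module K M \<Longrightarrow> cring K"
  by (simp add: module_def)

lemma (in module) minus_eq_smult:
  "x \<in> carrier M \<Longrightarrow> \<ominus>\<^bsub>M\<^esub> x = (\<ominus> \<one>) \<odot>\<^bsub>M\<^esub> x"
  by (simp add: smult_l_minus)

lemma linear_maps_zero:
  assumes "module K M" "module K N" "h \<in> linear_maps K M N"
  shows "h \<zero>\<^bsub>M\<^esub> = \<zero>\<^bsub>N\<^esub>"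
proof -
  interpret M: module K M by fact
  interpret N: module K N by fact
  have "h (\<zero>\<^bsub>K\<^esub> \<odot>\<^bsub>M\<^esub> \<zero>\<^bsub>M\<^esub>) = \<zero>\<^bsub>K\<^esub> \<odot>\<^bsub>N\<^esub> h \<zero>\<^bsub>M\<^esub>"
    using assms(3) by (intro linear_maps_smult) auto
  then show ?thesis
    using linear_maps_closed[OF assms(3) M.M.zero_closed] by simp
qed

lemma linear_maps_neg:
  assumes "module K M" "module K N" "h \<in> linear_maps K M N" "x \<in> carrier M"
  shows "h (\<ominus>\<^bsub>M\<^esub> x) = \<ominus>\<^bsub>N\<^esub> h x"
proof -
  interpret M: module K M by fact
  interpret N: module K N by fact
  show ?thesis
    using assms(3,4) by (simp add: M.minus_eq_smult N.minus_eq_smult linear_maps_smult linear_maps_closed)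
qed

lemma linear_maps_minus:
  assumes "module K M" "module K N" "h \<in> linear_maps K M N" "x \<in> carrier M" "y \<in> carrier M"
  shows "h (x \<ominus>\<^bsub>M\<^esub> y) = h x \<ominus>\<^bsub>N\<^esub> h y"
proof -
  interpret M: module K M by fact
  interpret N: module K N by fact
  show ?thesis
    using assms by (simp add: a_minus_def linear_maps_add linear_maps_neg)
qed

lemma linear_maps_finsum:
  assumes "module K M" "module K N" "h \<in> linear_maps K M N" "f \<in> S \<rightarrow> carrier M"
  shows "h (\<Oplus>\<^bsub>M\<^esub> i \<in> S. f i) = (\<Oplus>\<^bsub>N\<^esub> i \<in> S. h (f i))"
proof (cases "finite S")
  case True
  interpret M: module K M by fact
  interpret N: module K N by fact
  show ?thesis
    using True assms(4)
  proof (induction S)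
    case empty
    show ?case by (simp add: linear_maps_zero[OF assms(1-3)])
  next
    case (insert i S)
    then show ?case
      using assms(3) by (simp add: linear_maps_add linear_maps_closed Pi_def M.M.finsum_closed)
  qed
next
  case False
  interpret M: module K M by fact
  interpret N: module K N by fact
  show ?thesis using False by (simp add: linear_maps_zero[OF assms(1-3)])
qed

lemma linear_maps_zero_map:
  assumes "module K N" shows "(\<lambda>_. \<zero>\<^bsub>N\<^esub>) \<in> linear_maps K M N"
proof -
  interpret N: module K N by fact
  show ?thesis by (rule linear_mapsI) auto
qed

lemma linear_maps_add_map:
  assumes "module K N" "h \<in> linear_maps K M N" "h' \<in> linear_maps K M N"
  shows "(\<lambda>x. h x \<oplus>\<^bsub>N\<^esub> h' x) \<in> linear_maps K M N"
proof -
  interpret N: module K N by fact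
  show ?thesis
    by (intro linear_mapsI)
      (auto simp: assms(2,3)[THEN linear_maps_closed] assms(2,3)[THEN linear_maps_add]
        assms(2,3)[THEN linear_maps_smult] N.smult_r_distr N.M.a_ac)
qed

lemma linear_maps_smult_map:
  assumes "module K N" "k \<in> carrier K" "h \<in> linear_maps K M N"
  shows "(\<lambda>x. k \<odot>\<^bsub>N\<^esub> h x) \<in> linear_maps K M N"
proof -
  interpret N: module K N by fact
  show ?thesis
    using assms(2)
    by (intro linear_mapsI)
      (auto simp: linear_maps_closed[OF assms(3)] linear_maps_add[OF assms(3)]
        linear_maps_smult[OF assms(3)] N.smult_r_distr
        N.R.m_comm simp flip: N.smult_assoc1)
qed

lemma linear_maps_neg_map:
  assumes "module K N" "h \<in> linear_maps K M N"
  shows "(\<lambda>x. \<ominus>\<^bsub>N\<^esub> h x) \<in> linear_maps K M N"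
proof -
  interpret N: module K N by fact
  show ?thesis
    using assms(2)
    by (intro linear_mapsI)
      (auto simp: linear_maps_closed[OF assms(2)] linear_maps_add[OF assms(2)]
        linear_maps_smult[OF assms(2)] N.M.minus_add
        N.smult_r_minus N.M.a_comm)
qed

lemma linear_maps_minus_map:
  assumes "module K N" "h \<in> linear_maps K M N" "h' \<in> linear_maps K M N"
  shows "(\<lambda>x. h x \<ominus>\<^bsub>N\<^esub> h' x) \<in> linear_maps K M N"
  unfolding a_minus_def
  using assms by (intro linear_maps_add_map linear_maps_neg_map)

lemma linear_maps_compose:
  assumes "h \<in> linear_maps K M N" "h' \<in> linear_maps K N L"
  shows "(\<lambda>x. h' (h x)) \<in> linear_maps K M L"
  using assms by (auto simp: linear_maps_def Pi_def)

lemma linear_maps_ident: "(\<lambda>x. x) \<in> linear_maps K M M"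
  by (auto simp: linear_maps_def)

text \<open>Linearity only concerns values on the carrier, which is closed under the operations, so
  an identity valid merely there may be used to rewrite a map. Most computation rules below hold
  only on carriers.\<close>

lemma linear_maps_cong:
  assumes "module K M" and h: "h \<in> linear_maps K M N" and eq: "\<And>x. x \<in> carrier M \<Longrightarrow> h x = h' x"
  shows "h' \<in> linear_maps K M N"
proof -
  interpret M: module K M by fact
  show ?thesis
  proof (rule linear_mapsI)
    show "h' x \<in> carrier N" if "x \<in> carrier M" for x
      using linear_maps_closed[OF h that] eq[OF that] by simp
    show "h' (x \<oplus>\<^bsub>M\<^esub> y) = h' x \<oplus>\<^bsub>N\<^esub> h' y" if "x \<in> carrier M" "y \<in> carrier M" for x y
      using linear_maps_add[OF h that] eq[OF that(1)] eq[OF that(2)] eq[OF M.M.a_closed[OF that]] by simp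
    show "h' (k \<odot>\<^bsub>M\<^esub> x) = k \<odot>\<^bsub>N\<^esub> h' x" if "k \<in> carrier K" "x \<in> carrier M" for k x
      using linear_maps_smult[OF h that] eq[OF that(2)] eq[OF M.smult_closed[OF that]] by simp
  qed
qed

lemma linear_maps_record_cong:
  assumes "carrier M' = carrier M" "add M' = add M" "smult M' = smult M"
    and "carrier N' = carrier N" "add N' = add N" "smult N' = smult N"
  shows "linear_maps K M' N' = linear_maps K M N"
  using assms by (simp add: linear_maps_def)

lemma bilinear_mapsI:
  assumes "\<And>x. x \<in> carrier M \<Longrightarrow> b x \<in> linear_maps K N L"
    and "\<And>y. y \<in> carrier N \<Longrightarrow> (\<lambda>x. b x y) \<in> linear_maps K M L"
  shows "b \<in> bilinear_maps K M N L"
  using assms by (auto simp: bilinear_maps_def)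

lemma bilinear_maps_right: "\<lbrakk>b \<in> bilinear_maps K M N L; x \<in> carrier M\<rbrakk> \<Longrightarrow> b x \<in> linear_maps K N L"
  and bilinear_maps_left: "\<lbrakk>b \<in> bilinear_maps K M N L; y \<in> carrier N\<rbrakk>
      \<Longrightarrow> (\<lambda>x. b x y) \<in> linear_maps K M L"
  by (auto simp: bilinear_maps_def)

lemma bilinear_maps_closed:
  "\<lbrakk>b \<in> bilinear_maps K M N L; x \<in> carrier M; y \<in> carrier N\<rbrakk> \<Longrightarrow> b x y \<in> carrier L"
  by (rule linear_maps_closed[OF bilinear_maps_right])

lemma bilinear_maps_add_right:
  "\<lbrakk>b \<in> bilinear_maps K M N L; x \<in> carrier M; y \<in> carrier N; y' \<in> carrier N\<rbrakk>
    \<Longrightarrow> b x (y \<oplus>\<^bsub>N\<^esub> y') = b x y \<oplus>\<^bsub>L\<^esub> b x y'"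
  by (rule linear_maps_add[OF bilinear_maps_right])

lemma bilinear_maps_smult_right:
  "\<lbrakk>b \<in> bilinear_maps K M N L; x \<in> carrier M; k \<in> carrier K; y \<in> carrier N\<rbrakk>
    \<Longrightarrow> b x (k \<odot>\<^bsub>N\<^esub> y) = k \<odot>\<^bsub>L\<^esub> b x y"
  by (rule linear_maps_smult[OF bilinear_maps_right])

lemma bilinear_maps_add_left:
  "\<lbrakk>b \<in> bilinear_maps K M N L; x \<in> carrier M; x' \<in> carrier M; y \<in> carrier N\<rbrakk>
    \<Longrightarrow> b (x \<oplus>\<^bsub>M\<^esub> x') y = b x y \<oplus>\<^bsub>L\<^esub> b x' y"
  by (rule linear_maps_add[OF bilinear_maps_left])

lemma bilinear_maps_smult_left:
  "\<lbrakk>b \<in> bilinear_maps K M N L; k \<in> carrier K; x \<in> carrier M; y \<in> carrier N\<rbrakk>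
    \<Longrightarrow> b (k \<odot>\<^bsub>M\<^esub> x) y = k \<odot>\<^bsub>L\<^esub> b x y"
  by (rule linear_maps_smult[OF bilinear_maps_left])

lemma bilinear_maps_zero_right:
  "\<lbrakk>module K N; module K L; b \<in> bilinear_maps K M N L; x \<in> carrier M\<rbrakk> \<Longrightarrow> b x \<zero>\<^bsub>N\<^esub> = \<zero>\<^bsub>L\<^esub>"
  by (rule linear_maps_zero[OF _ _ bilinear_maps_right])

lemma bilinear_maps_zero_left:
  "\<lbrakk>module K M; module K L; b \<in> bilinear_maps K M N L; y \<in> carrier N\<rbrakk> \<Longrightarrow> b \<zero>\<^bsub>M\<^esub> y = \<zero>\<^bsub>L\<^esub>"
  by (rule linear_maps_zero[OF _ _ bilinear_maps_left])

lemma bilinear_maps_compose: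
  assumes "b \<in> bilinear_maps K M N L" "h \<in> linear_maps K L L'"
  shows "(\<lambda>x y. h (b x y)) \<in> bilinear_maps K M N L'"
  by (intro bilinear_mapsI linear_maps_compose[OF bilinear_maps_right[OF assms(1)] assms(2)]
      linear_maps_compose[OF bilinear_maps_left[OF assms(1)] assms(2)])

lemma bilinear_maps_flip:
  "b \<in> bilinear_maps K M N L \<Longrightarrow> (\<lambda>x y. b y x) \<in> bilinear_maps K N M L"
  by (auto simp: bilinear_maps_def)

section \<open>Generating families\<close>

text \<open>Phrased as an induction principle: \<open>H\<close> need not lie in the carrier nor be
  closed under negation. The family is indexed by an arbitrary type, so that pairs, words and
  multisets can name generators without being elements of the module.\<close>

definition generating_family ::
    "('k, 'x) ring_scheme \<Rightarrow> ('k, 'm, 'y) module_scheme \<Rightarrow> ('g \<Rightarrow> 'm) \<Rightarrow> 'g set \<Rightarrow> bool"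
  where "generating_family K M \<gamma> G \<longleftrightarrow> \<gamma> \<in> G \<rightarrow> carrier M \<and>
    (\<forall>H. \<zero>\<^bsub>M\<^esub> \<in> H \<and> (\<forall>x\<in>H. \<forall>y\<in>H. x \<oplus>\<^bsub>M\<^esub> y \<in> H) \<and> (\<forall>k\<in>carrier K. \<forall>x\<in>H. k \<odot>\<^bsub>M\<^esub> x \<in> H) \<and>
         \<gamma> ` G \<subseteq> H \<longrightarrow> carrier M \<subseteq> H)"

lemma generating_family_closed: "\<lbrakk>generating_family K M \<gamma> G; g \<in> G\<rbrakk> \<Longrightarrow> \<gamma> g \<in> carrier M"
  by (auto simp: generating_family_def)

text \<open>The principle is applied to the set of those elements of the carrier that satisfy
  \<open>P\<close>, which makes membership in the carrier available in the cases for sums and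
  multiples.\<close>

lemma generating_family_induct [consumes 3, case_names zero add smult gen]:
  assumes M: "module K M"
    and G: "generating_family K M \<gamma> G" and x: "x \<in> carrier M"
    and "P \<zero>\<^bsub>M\<^esub>"
    and "\<And>x y. \<lbrakk>x \<in> carrier M; y \<in> carrier M; P x; P y\<rbrakk> \<Longrightarrow> P (x \<oplus>\<^bsub>M\<^esub> y)"
    and "\<And>k x. \<lbrakk>k \<in> carrier K; x \<in> carrier M; P x\<rbrakk> \<Longrightarrow> P (k \<odot>\<^bsub>M\<^esub> x)"
    and "\<And>g. g \<in> G \<Longrightarrow> P (\<gamma> g)"
  shows "P x"
proof -
  interpret M: module K M by fact
  have "carrier M \<subseteq> {x \<in> carrier M. P x}"
    using G[unfolded generating_family_def, THEN conjunct2, rule_format, of "{x \<in> carrier M. P x}"]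
      assms(4-) generating_family_closed[OF G] by (simp add: image_subset_iff)
  then show ?thesis using x by auto
qed

lemma generating_familyI:
  assumes "\<And>g. g \<in> G \<Longrightarrow> \<gamma> g \<in> carrier M"
    and "\<And>x P. \<lbrakk>x \<in> carrier M; P \<zero>\<^bsub>M\<^esub>;
        \<And>x y. \<lbrakk>P x; P y\<rbrakk> \<Longrightarrow> P (x \<oplus>\<^bsub>M\<^esub> y);
        \<And>k x. \<lbrakk>k \<in> carrier K; P x\<rbrakk> \<Longrightarrow> P (k \<odot>\<^bsub>M\<^esub> x);
        \<And>g. g \<in> G \<Longrightarrow> P (\<gamma> g)\<rbrakk> \<Longrightarrow> P x"
  shows "generating_family K M \<gamma> G"
  unfolding generating_family_def
proof (intro conjI allI impI subsetI)
  fix H x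
  assume H: "\<zero>\<^bsub>M\<^esub> \<in> H \<and> (\<forall>x\<in>H. \<forall>y\<in>H. x \<oplus>\<^bsub>M\<^esub> y \<in> H) \<and> (\<forall>k\<in>carrier K. \<forall>x\<in>H. k \<odot>\<^bsub>M\<^esub> x \<in> H) \<and> \<gamma> ` G \<subseteq> H"
    and "x \<in> carrier M"
  then show "x \<in> H" using assms(2)[of x "\<lambda>x. x \<in> H"] by blast
qed (use assms(1) in auto)

lemma generating_family_ident: "generating_family K M (\<lambda>x. x) (carrier M)"
  by (auto simp: generating_family_def)

lemma generating_family_record_cong:
  assumes "carrier M' = carrier M" "add M' = add M" "smult M' = smult M" "zero M' = zero M"
  shows "generating_family K M' \<gamma> G = generating_family K M \<gamma> G"
  using assms by (simp add: generating_family_def)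

lemma linear_maps_eqI:
  assumes "module K M" "module K N" "generating_family K M \<gamma> G"
    and h: "h \<in> linear_maps K M N" "h' \<in> linear_maps K M N"
    and eq: "\<And>g. g \<in> G \<Longrightarrow> h (\<gamma> g) = h' (\<gamma> g)" and "x \<in> carrier M"
  shows "h x = h' x"
  using assms(1,3,7)
  by (induction rule: generating_family_induct)
    (use assms in \<open>auto simp: linear_maps_zero linear_maps_add linear_maps_smult\<close>)

lemma bilinear_maps_eqI:
  assumes M: "module K M" and N: "module K N" and L: "module K L"
    and gM: "generating_family K M \<gamma> G" and gN: "generating_family K N \<delta> H"
    and b: "b \<in> bilinear_maps K M N L" and b': "b' \<in> bilinear_maps K M N L"
    and eq: "\<And>g h. \<lbrakk>g \<in> G; h \<in> H\<rbrakk> \<Longrightarrow> b (\<gamma> g) (\<delta> h) = b' (\<gamma> g) (\<delta> h)"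
    and "x \<in> carrier M" "y \<in> carrier N"
  shows "b x y = b' x y"
proof (rule linear_maps_eqI[OF M L gM bilinear_maps_left[OF b] bilinear_maps_left[OF b']])
  fix g assume g: "g \<in> G"
  note gc = generating_family_closed[OF gM g]
  show "b (\<gamma> g) y = b' (\<gamma> g) y"
    by (rule linear_maps_eqI[OF N L gN bilinear_maps_right[OF b gc] bilinear_maps_right[OF b' gc]])
      (use g eq \<open>y \<in> carrier N\<close> in auto)
qed fact+

text \<open>Generators are usually not a basis, so a prescription of values on them may contradict
  the relations. This predicate says that it does not. It is stable under sums and multiples of
  prescriptions, which makes it usable as an induction claim.\<close>

definition extends_linearly ::
    "('k, 'x) ring_scheme \<Rightarrow> ('k, 'm, 'y) module_scheme \<Rightarrow> ('g \<Rightarrow> 'm) \<Rightarrow> 'g set \<Rightarrow>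
     ('k, 'n, 'z) module_scheme \<Rightarrow> ('g \<Rightarrow> 'n) \<Rightarrow> bool"
  where "extends_linearly K M \<gamma> G N \<phi> \<longleftrightarrow> (\<exists>h\<in>linear_maps K M N. \<forall>g\<in>G. h (\<gamma> g) = \<phi> g)"

lemma extends_linearlyI:
  "\<lbrakk>h \<in> linear_maps K M N; \<And>g. g \<in> G \<Longrightarrow> h (\<gamma> g) = \<phi> g\<rbrakk> \<Longrightarrow> extends_linearly K M \<gamma> G N \<phi>"
  by (auto simp: extends_linearly_def)

lemma extends_linearlyE:
  assumes "extends_linearly K M \<gamma> G N \<phi>"
  obtains h where "h \<in> linear_maps K M N" "\<And>g. g \<in> G \<Longrightarrow> h (\<gamma> g) = \<phi> g"
  using assms by (auto simp: extends_linearly_def)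

lemma extends_linearly_cong:
  "(\<And>g. g \<in> G \<Longrightarrow> \<phi> g = \<psi> g) \<Longrightarrow> extends_linearly K M \<gamma> G N \<phi> = extends_linearly K M \<gamma> G N \<psi>"
  by (simp add: extends_linearly_def)

lemma extends_linearly_ident:
  "h \<in> linear_maps K M N \<Longrightarrow> extends_linearly K M (\<lambda>x. x) (carrier M) N h"
  by (auto simp: extends_linearly_def)

lemma extends_linearly_zero:
  "module K N \<Longrightarrow> extends_linearly K M \<gamma> G N (\<lambda>_. \<zero>\<^bsub>N\<^esub>)"
  by (rule extends_linearlyI[OF linear_maps_zero_map]) auto

lemma extends_linearly_add:
  assumes "module K N" "extends_linearly K M \<gamma> G N \<phi>" "extends_linearly K M \<gamma> G N \<psi>"
  shows "extends_linearly K M \<gamma> G N (\<lambda>g. \<phi> g \<oplus>\<^bsub>N\<^esub> \<psi> g)"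
proof -
  obtain h h' where "h \<in> linear_maps K M N" "\<And>g. g \<in> G \<Longrightarrow> h (\<gamma> g) = \<phi> g"
    and "h' \<in> linear_maps K M N" "\<And>g. g \<in> G \<Longrightarrow> h' (\<gamma> g) = \<psi> g"
    using assms by (auto elim!: extends_linearlyE)
  then show ?thesis using assms(1) by (intro extends_linearlyI[OF linear_maps_add_map[of K N h M h']]) auto
qed

lemma extends_linearly_smult:
  assumes "module K N" "k \<in> carrier K" "extends_linearly K M \<gamma> G N \<phi>"
  shows "extends_linearly K M \<gamma> G N (\<lambda>g. k \<odot>\<^bsub>N\<^esub> \<phi> g)"
proof -
  obtain h where "h \<in> linear_maps K M N" "\<And>g. g \<in> G \<Longrightarrow> h (\<gamma> g) = \<phi> g"
    using assms by (auto elim!: extends_linearlyE)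
  then show ?thesis using assms(1,2) by (intro extends_linearlyI[OF linear_maps_smult_map]) auto
qed

text \<open>It suffices to extend in each argument separately, with the other one fixed at a
  generator. Extending in the first argument gives maps \<open>p h\<close>; the elements
  \<open>x\<close> for which \<open>p h x\<close> extends linearly in \<open>h\<close> are closed
  under sums and multiples and include the generators, hence exhaust \<open>M\<close>.\<close>

lemma bilinear_extension:
  assumes M: "module K M" and N: "module K N" and L: "module K L"
    and gM: "generating_family K M \<gamma> G" and gN: "generating_family K N \<delta> H"
    and l: "\<And>h. h \<in> H \<Longrightarrow> extends_linearly K M \<gamma> G L (\<lambda>g. \<phi> g h)"
    and r: "\<And>g. g \<in> G \<Longrightarrow> extends_linearly K N \<delta> H L (\<phi> g)"
  obtains b where "b \<in> bilinear_maps K M N L"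
    "\<And>g h. \<lbrakk>g \<in> G; h \<in> H\<rbrakk> \<Longrightarrow> b (\<gamma> g) (\<delta> h) = \<phi> g h"
proof -
  interpret M: module K M by fact
  interpret N: module K N by fact
  obtain p where p: "\<And>h. h \<in> H \<Longrightarrow> p h \<in> linear_maps K M L"
    "\<And>g h. \<lbrakk>g \<in> G; h \<in> H\<rbrakk> \<Longrightarrow> p h (\<gamma> g) = \<phi> g h"
    using l unfolding extends_linearly_def by metis
  have ext: "extends_linearly K N \<delta> H L (\<lambda>h. p h x)" if "x \<in> carrier M" for x
    using M gM that
  proof (induction rule: generating_family_induct)
    case zero
    have "extends_linearly K N \<delta> H L (\<lambda>_. \<zero>\<^bsub>L\<^esub>)" using L by (rule extends_linearly_zero)
    then show ?case
      using linear_maps_zero[OF M L p(1)] by (subst extends_linearly_cong) auto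
  next
    case (add x y)
    then have "extends_linearly K N \<delta> H L (\<lambda>h. p h x \<oplus>\<^bsub>L\<^esub> p h y)"
      using L by (intro extends_linearly_add)
    then show ?case
      using linear_maps_add[OF p(1)] add by (subst extends_linearly_cong) auto
  next
    case (smult k x)
    then have "extends_linearly K N \<delta> H L (\<lambda>h. k \<odot>\<^bsub>L\<^esub> p h x)"
      using L by (intro extends_linearly_smult)
    then show ?case
      using linear_maps_smult[OF p(1)] smult by (subst extends_linearly_cong) auto
  next
    case (gen g)
    then show ?case using p(2) r[OF gen] by (subst extends_linearly_cong) auto
  qed
  then obtain b where b: "\<And>x. x \<in> carrier M \<Longrightarrow> b x \<in> linear_maps K N L"
    "\<And>x h. \<lbrakk>x \<in> carrier M; h \<in> H\<rbrakk> \<Longrightarrow> b x (\<delta> h) = p h x"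
    unfolding extends_linearly_def by metis
  \<comment> \<open>The maps \<open>b x\<close> were chosen independently for each \<open>x\<close>.
    Linearity in \<open>x\<close> comes from uniqueness: both sides are linear in \<open>y\<close>
    and agree on the generators \<open>\<delta> h\<close>.\<close>
  have "(\<lambda>x. b x y) \<in> linear_maps K M L" if y: "y \<in> carrier N" for y
  proof (rule linear_mapsI)
    fix x assume "x \<in> carrier M"
    then show "b x y \<in> carrier L" using b(1) y by (simp add: linear_maps_closed[of "b x" K N L])
  next
    fix x x' assume x: "x \<in> carrier M" "x' \<in> carrier M"
    show "b (x \<oplus>\<^bsub>M\<^esub> x') y = b x y \<oplus>\<^bsub>L\<^esub> b x' y"
      by (rule linear_maps_eqI[OF N L gN b(1) linear_maps_add_map[OF L b(1)[OF x(1)] b(1)[OF x(2)]] _ y])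
        (simp_all add: x b(2) linear_maps_add[OF p(1)])
  next
    fix k x assume k: "k \<in> carrier K" and x: "x \<in> carrier M"
    show "b (k \<odot>\<^bsub>M\<^esub> x) y = k \<odot>\<^bsub>L\<^esub> b x y"
      by (rule linear_maps_eqI[OF N L gN b(1) linear_maps_smult_map[OF L k b(1)[OF x]] _ y])
        (simp_all add: k x b(2) linear_maps_smult[OF p(1)])
  qed
  then have "b \<in> bilinear_maps K M N L" using b(1) by (intro bilinear_mapsI)
  moreover have "b (\<gamma> g) (\<delta> h) = \<phi> g h" if "g \<in> G" "h \<in> H" for g h
    using b(2) p(2) generating_family_closed[OF gM] that by auto
  ultimately show ?thesis using that by blast
qed

text \<open>\<open>P\<close> may be any condition, for instance a recursive one, so uniqueness is
  assumed only in the form that \<open>P\<close> fixes the values on generators. Since the operator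
  selects an extensional map, \<open>P\<close> is required of the restriction of
  \<open>h\<close>.\<close>

lemma the_linear_ex1:
  assumes "module K M" "module K N" "generating_family K M \<gamma> G" "h \<in> linear_maps K M N" "P h"
    and "\<And>h'. \<lbrakk>h' \<in> linear_maps K M N; P h'\<rbrakk> \<Longrightarrow> \<forall>g\<in>G. h' (\<gamma> g) = h (\<gamma> g)"
    and "P (restrict h (carrier M))"
  shows "the_linear K M N P \<in> linear_maps K M N \<and> P (the_linear K M N P)"
proof -
  have "\<exists>!h. h \<in> linear_maps K M N \<and> h \<in> extensional (carrier M) \<and> P h"
  proof (rule ex1I[of _ "restrict h (carrier M)"])
    show "restrict h (carrier M) \<in> linear_maps K M N \<and> restrict h (carrier M) \<in> extensional (carrier M)
        \<and> P (restrict h (carrier M))"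
      by (intro conjI assms(7) restrict_extensional linear_maps_cong[OF assms(1,4)]) simp
  next
    fix h' assume h': "h' \<in> linear_maps K M N \<and> h' \<in> extensional (carrier M) \<and> P h'"
    have "h' x = h x" if "x \<in> carrier M" for x
      by (rule linear_maps_eqI[OF assms(1-3) _ assms(4)])
        (use assms(6)[of h'] h' that in \<open>blast+\<close>)
    then show "h' = restrict h (carrier M)"
      using h' by (auto simp: extensional_def restrict_def)
  qed
  from theI'[OF this] show ?thesis by (simp add: the_linear_def)
qed

lemma the_bilinear_ex1:
  assumes "module K M" "module K N" "module K L"
    and "generating_family K M \<gamma> G" "generating_family K N \<delta> H"
    and b: "b \<in> bilinear_maps K M N L"
    and uniq: "\<And>b'. \<lbrakk>b' \<in> bilinear_maps K M N L; P b'\<rbrakk> \<Longrightarrow> \<forall>g\<in>G. \<forall>h\<in>H. b' (\<gamma> g) (\<delta> h) = b (\<gamma> g) (\<delta> h)"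
    and P: "P (\<lambda>x y. if x \<in> carrier M \<and> y \<in> carrier N then b x y else undefined)" (is "P ?r")
  shows "the_bilinear K M N L P \<in> bilinear_maps K M N L \<and> P (the_bilinear K M N L P)"
proof -
  interpret M: module K M by fact
  interpret N: module K N by fact
  have "\<exists>!b. b \<in> bilinear_maps K M N L \<and>
      (\<forall>x y. x \<notin> carrier M \<or> y \<notin> carrier N \<longrightarrow> b x y = undefined) \<and> P b"
  proof (rule ex1I[of _ ?r])
    have "?r \<in> bilinear_maps K M N L"
    proof (rule bilinear_mapsI)
      fix x assume "x \<in> carrier M"
      then show "?r x \<in> linear_maps K N L"
        by (intro linear_maps_cong[OF assms(2) bilinear_maps_right[OF b]]) simp_all
    next
      fix y assume "y \<in> carrier N"
      then show "(\<lambda>x. ?r x y) \<in> linear_maps K M L"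
        by (intro linear_maps_cong[OF assms(1) bilinear_maps_left[OF b]]) simp_all
    qed
    then show "?r \<in> bilinear_maps K M N L \<and>
      (\<forall>x y. x \<notin> carrier M \<or> y \<notin> carrier N \<longrightarrow> ?r x y = undefined) \<and> P ?r"
      using P by simp
  next
    fix b' assume b': "b' \<in> bilinear_maps K M N L \<and>
      (\<forall>x y. x \<notin> carrier M \<or> y \<notin> carrier N \<longrightarrow> b' x y = undefined) \<and> P b'"
    have "b' x y = b x y" if "x \<in> carrier M" "y \<in> carrier N" for x y
      by (rule bilinear_maps_eqI[OF assms(1-5) _ b])
        (use uniq[of b'] b' that in \<open>blast+\<close>)
    then show "b' = ?r" using b' by (intro ext) auto
  qed
  from theI'[OF this] show ?thesis by (simp add: the_bilinear_def)
qed

section \<open>Modules given by generators and relations\<close>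

lemma (in abelian_group) minus_eq_zero_iff:
  assumes "x \<in> carrier G" "y \<in> carrier G"
  shows "x \<ominus> y = \<zero> \<longleftrightarrow> x = y"
proof
  assume "x \<ominus> y = \<zero>"
  then have "(x \<oplus> \<ominus> y) \<oplus> y = \<zero> \<oplus> y" by (simp add: a_minus_def)
  then show "x = y" using assms by (simp add: a_assoc l_neg)
qed (use assms in \<open>simp add: a_minus_def r_neg\<close>)

section \<open>Free modules\<close>

lemma free_module_simps:
  "carrier (free_module K G) =
    {x. (\<forall>g. x g \<in> carrier K) \<and> finite {g. x g \<noteq> \<zero>\<^bsub>K\<^esub>} \<and> {g. x g \<noteq> \<zero>\<^bsub>K\<^esub>} \<subseteq> G}"
  "zero (free_module K G) = (\<lambda>g. \<zero>\<^bsub>K\<^esub>)"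
  "add (free_module K G) = (\<lambda>x y g. x g \<oplus>\<^bsub>K\<^esub> y g)"
  "smult (free_module K G) = (\<lambda>k x g. k \<otimes>\<^bsub>K\<^esub> x g)"
  by (simp_all add: free_module_def)

lemma module_free_module:
  assumes "cring K"
  shows "module K (free_module K G)"
proof -
  interpret K: cring K by fact
  have supp_add: "finite {g. x g \<oplus>\<^bsub>K\<^esub> y g \<noteq> \<zero>\<^bsub>K\<^esub>}" "{g. x g \<oplus>\<^bsub>K\<^esub> y g \<noteq> \<zero>\<^bsub>K\<^esub>} \<subseteq> G"
    if "x \<in> carrier (free_module K G)" "y \<in> carrier (free_module K G)" for x y
  proof -
    have "{g. x g \<oplus>\<^bsub>K\<^esub> y g \<noteq> \<zero>\<^bsub>K\<^esub>} \<subseteq> {g. x g \<noteq> \<zero>\<^bsub>K\<^esub>} \<union> {g. y g \<noteq> \<zero>\<^bsub>K\<^esub>}"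
      by auto
    then show "finite {g. x g \<oplus>\<^bsub>K\<^esub> y g \<noteq> \<zero>\<^bsub>K\<^esub>}" "{g. x g \<oplus>\<^bsub>K\<^esub> y g \<noteq> \<zero>\<^bsub>K\<^esub>} \<subseteq> G"
      using that by (auto simp: free_module_simps intro: finite_subset)
  qed
  have supp_smult: "finite {g. k \<otimes>\<^bsub>K\<^esub> x g \<noteq> \<zero>\<^bsub>K\<^esub>}" "{g. k \<otimes>\<^bsub>K\<^esub> x g \<noteq> \<zero>\<^bsub>K\<^esub>} \<subseteq> G"
    if "k \<in> carrier K" "x \<in> carrier (free_module K G)" for k x
  proof -
    have "{g. k \<otimes>\<^bsub>K\<^esub> x g \<noteq> \<zero>\<^bsub>K\<^esub>} \<subseteq> {g. x g \<noteq> \<zero>\<^bsub>K\<^esub>}"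
      using that by auto
    then show "finite {g. k \<otimes>\<^bsub>K\<^esub> x g \<noteq> \<zero>\<^bsub>K\<^esub>}" "{g. k \<otimes>\<^bsub>K\<^esub> x g \<noteq> \<zero>\<^bsub>K\<^esub>} \<subseteq> G"
      using that by (auto simp: free_module_simps intro: finite_subset)
  qed
  have neg: "(\<lambda>g. \<ominus>\<^bsub>K\<^esub> x g) \<in> carrier (free_module K G)" if "x \<in> carrier (free_module K G)" for x
  proof -
    have "{g. \<ominus>\<^bsub>K\<^esub> x g \<noteq> \<zero>\<^bsub>K\<^esub>} \<subseteq> {g. x g \<noteq> \<zero>\<^bsub>K\<^esub>}"
      by auto
    then show ?thesis
      using that by (auto simp: free_module_simps intro: finite_subset)
  qed
  show ?thesis
  proof (intro moduleI abelian_groupI)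
    show "cring K" by fact
  next
    fix x y assume "x \<in> carrier (free_module K G)" "y \<in> carrier (free_module K G)"
    with supp_add[OF this] show "x \<oplus>\<^bsub>free_module K G\<^esub> y \<in> carrier (free_module K G)"
      by (simp add: free_module_simps)
  next
    fix x assume "x \<in> carrier (free_module K G)"
    then show "\<exists>y\<in>carrier (free_module K G). y \<oplus>\<^bsub>free_module K G\<^esub> x = \<zero>\<^bsub>free_module K G\<^esub>"
      using neg by (intro bexI[of _ "\<lambda>g. \<ominus>\<^bsub>K\<^esub> x g"]) (auto simp: free_module_simps K.l_neg)
  next
    fix k x assume "k \<in> carrier K" "x \<in> carrier (free_module K G)"
    with supp_smult[OF this] show "k \<odot>\<^bsub>free_module K G\<^esub> x \<in> carrier (free_module K G)"
      by (simp add: free_module_simps)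
  qed (auto simp: free_module_simps K.a_ac K.l_distr K.r_distr K.m_assoc)
qed

lemma basis_vec_closed:
  assumes "cring K" "g \<in> G"
  shows "basis_vec K g \<in> carrier (free_module K G)"
proof -
  interpret K: cring K by fact
  have "{h. basis_vec K g h \<noteq> \<zero>\<^bsub>K\<^esub>} \<subseteq> {g}" by (auto simp: basis_vec_def)
  then show ?thesis
    using assms(2) finite_subset by (fastforce simp: free_module_simps basis_vec_def)
qed

lemma generating_family_basis_vec:
  assumes "cring K"
  shows "generating_family K (free_module K G) (basis_vec K) G"
proof (rule generating_familyI)
  interpret K: cring K by fact
  show "basis_vec K g \<in> carrier (free_module K G)" if "g \<in> G" for g
    using assms that by (rule basis_vec_closed)
  fix x P
  assume x: "x \<in> carrier (free_module K G)"
    and zero: "P \<zero>\<^bsub>free_module K G\<^esub>"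
    and add: "\<And>x y. \<lbrakk>P x; P y\<rbrakk> \<Longrightarrow> P (x \<oplus>\<^bsub>free_module K G\<^esub> y)"
    and smult: "\<And>k x. \<lbrakk>k \<in> carrier K; P x\<rbrakk> \<Longrightarrow> P (k \<odot>\<^bsub>free_module K G\<^esub> x)"
    and gen: "\<And>g. g \<in> G \<Longrightarrow> P (basis_vec K g)"
  \<comment> \<open>Induction on a finite set containing the support: one coordinate is cleared, and
    the corresponding multiple of a basis vector is added back.\<close>
  have *: "P x" if "finite S" "S \<subseteq> G" "\<forall>g. x g \<in> carrier K" "\<forall>g. g \<notin> S \<longrightarrow> x g = \<zero>\<^bsub>K\<^esub>" for S x
    using that
  proof (induction S arbitrary: x)
    case empty
    then have "x = (\<lambda>g. \<zero>\<^bsub>K\<^esub>)" by auto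
    then show ?case using zero by (simp add: free_module_simps)
  next
    case (insert g S)
    have "P (x(g := \<zero>\<^bsub>K\<^esub>))" by (rule insert.IH) (use insert.prems in auto)
    moreover have "P (x g \<odot>\<^bsub>free_module K G\<^esub> basis_vec K g)" using insert.prems by (intro smult gen) auto
    ultimately have "P (x(g := \<zero>\<^bsub>K\<^esub>) \<oplus>\<^bsub>free_module K G\<^esub> x g \<odot>\<^bsub>free_module K G\<^esub> basis_vec K g)"
      by (rule add)
    moreover have "x(g := \<zero>\<^bsub>K\<^esub>) \<oplus>\<^bsub>free_module K G\<^esub> x g \<odot>\<^bsub>free_module K G\<^esub> basis_vec K g = x"
      using insert.prems by (auto simp: free_module_simps basis_vec_def)
    ultimately show ?case by simp
  qed
  show "P x"
    by (rule *[of "{g. x g \<noteq> \<zero>\<^bsub>K\<^esub>}"]) (use x in \<open>auto simp: free_module_simps\<close>)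
qed

lemma extends_linearly_free_module:
  assumes "module K N" "\<And>g. g \<in> G \<Longrightarrow> \<phi> g \<in> carrier N"
  shows "extends_linearly K (free_module K G) (basis_vec K) G N \<phi>"
proof -
  interpret N: module K N by fact
  define h where "h x = (\<Oplus>\<^bsub>N\<^esub> g \<in> {g. x g \<noteq> \<zero>\<^bsub>K\<^esub>}. x g \<odot>\<^bsub>N\<^esub> \<phi> g)" for x
  \<comment> \<open>The sum may be taken over any finite set of generators that contains the
    support, so that two vectors can be compared over a common index set.\<close>
  have h_eq: "h x = (\<Oplus>\<^bsub>N\<^esub> g \<in> S. x g \<odot>\<^bsub>N\<^esub> \<phi> g)"
    if "finite S" "S \<subseteq> G" "\<forall>g. x g \<in> carrier K" "{g. x g \<noteq> \<zero>\<^bsub>K\<^esub>} \<subseteq> S" for x S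
    unfolding h_def using that assms(2)
    by (intro N.M.add.finprod_mono_neutral_cong_left) auto
  have h: "h \<in> linear_maps K (free_module K G) N"
  proof (rule linear_mapsI)
    fix x assume "x \<in> carrier (free_module K G)"
    then show "h x \<in> carrier N"
      unfolding h_def using assms(2) by (intro N.M.finsum_closed) (auto simp: free_module_simps)
  next
    fix x y assume xy: "x \<in> carrier (free_module K G)" "y \<in> carrier (free_module K G)"
    let ?S = "{g. x g \<noteq> \<zero>\<^bsub>K\<^esub>} \<union> {g. y g \<noteq> \<zero>\<^bsub>K\<^esub>}"
    have S: "finite ?S" "?S \<subseteq> G" "\<forall>g. x g \<in> carrier K" "\<forall>g. y g \<in> carrier K"
      using xy by (auto simp: free_module_simps)
    have "h (x \<oplus>\<^bsub>free_module K G\<^esub> y) = (\<Oplus>\<^bsub>N\<^esub> g \<in> ?S. (x g \<oplus>\<^bsub>K\<^esub> y g) \<odot>\<^bsub>N\<^esub> \<phi> g)"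
      using S by (subst h_eq[of ?S]) (auto simp: free_module_simps)
    also have "\<dots> = (\<Oplus>\<^bsub>N\<^esub> g \<in> ?S. x g \<odot>\<^bsub>N\<^esub> \<phi> g \<oplus>\<^bsub>N\<^esub> y g \<odot>\<^bsub>N\<^esub> \<phi> g)"
      using S assms(2) by (intro N.M.finsum_cong') (auto simp: N.smult_l_distr subset_iff)
    also have "\<dots> = h x \<oplus>\<^bsub>N\<^esub> h y"
      using S assms(2) by (subst N.M.finsum_addf) (auto simp: h_eq[of ?S] subset_iff)
    finally show "h (x \<oplus>\<^bsub>free_module K G\<^esub> y) = h x \<oplus>\<^bsub>N\<^esub> h y" .
  next
    fix k x assume k: "k \<in> carrier K" and x: "x \<in> carrier (free_module K G)"
    let ?S = "{g. x g \<noteq> \<zero>\<^bsub>K\<^esub>}"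
    have S: "finite ?S" "?S \<subseteq> G" "\<forall>g. x g \<in> carrier K"
      using x by (auto simp: free_module_simps)
    have "h (k \<odot>\<^bsub>free_module K G\<^esub> x) = (\<Oplus>\<^bsub>N\<^esub> g \<in> ?S. (k \<otimes>\<^bsub>K\<^esub> x g) \<odot>\<^bsub>N\<^esub> \<phi> g)"
      using S k by (subst h_eq[of ?S]) (auto simp: free_module_simps)
    also have "\<dots> = (\<Oplus>\<^bsub>N\<^esub> g \<in> ?S. k \<odot>\<^bsub>N\<^esub> (x g \<odot>\<^bsub>N\<^esub> \<phi> g))"
      using S k assms(2) by (intro N.M.finsum_cong') (auto simp: N.smult_assoc1 subset_iff)
    also have "\<dots> = k \<odot>\<^bsub>N\<^esub> h x"
      using S k assms(2) by (subst N.finsum_smult_ldistr[symmetric]) (auto simp: h_def subset_iff)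
    finally show "h (k \<odot>\<^bsub>free_module K G\<^esub> x) = k \<odot>\<^bsub>N\<^esub> h x" .
  qed
  have "h (basis_vec K g) = \<phi> g" if g: "g \<in> G" for g
  proof -
    have "h (basis_vec K g) = (\<Oplus>\<^bsub>N\<^esub> g' \<in> {g}. basis_vec K g g' \<odot>\<^bsub>N\<^esub> \<phi> g')"
      using g by (intro h_eq) (auto simp: basis_vec_def)
    also have "\<dots> = \<phi> g"
      using g assms(2)[OF g] by (simp add: basis_vec_def)
    finally show ?thesis .
  qed
  then show ?thesis by (intro extends_linearlyI[OF h])
qed

section \<open>Quotients by submodules\<close>

lemma quotient_module_simps:
  "carrier (quotient_module M H) = a_rcosets\<^bsub>M\<^esub> H"
  "zero (quotient_module M H) = H"
  "one (quotient_module M H) = H +>\<^bsub>M\<^esub> \<one>\<^bsub>M\<^esub>"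
  "add (quotient_module M H) = set_add M"
  "mult (quotient_module M H) = rcoset_mult M H"
  "smult (quotient_module M H) = (\<lambda>k X. \<Union>x\<in>X. H +>\<^bsub>M\<^esub> (k \<odot>\<^bsub>M\<^esub> x))"
  by (simp_all add: quotient_module_def FactRing_def)

lemma (in module) abelian_subgroup_submodule:
  "submodule H R M \<Longrightarrow> abelian_subgroup H M"
  by (intro abelian_subgroupI3 additive_subgroupI) (simp_all add: submodule_def M.abelian_group_axioms)

lemma (in module) coset_eq_iff:
  assumes H: "submodule H R M" and x: "x \<in> carrier M" "y \<in> carrier M"
  shows "H +>\<^bsub>M\<^esub> x = H +>\<^bsub>M\<^esub> y \<longleftrightarrow> x \<ominus>\<^bsub>M\<^esub> y \<in> H"
proof -
  interpret H: abelian_subgroup H M using H by (rule abelian_subgroup_submodule)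
  show ?thesis
    unfolding a_minus_def
    using x H.a_rcos_module[of y x] H.a_rcos_self[of x] H.a_repr_independence'[of x y] by metis
qed

lemma coset_linear:
  assumes M: "module K M" and H: "submodule H K M"
  shows "(\<lambda>x. H +>\<^bsub>M\<^esub> x) \<in> linear_maps K M (quotient_module M H)"
proof (rule linear_mapsI)
  interpret M: module K M by fact
  interpret H: abelian_subgroup H M using H by (rule M.abelian_subgroup_submodule)
  show "H +>\<^bsub>M\<^esub> x \<in> carrier (quotient_module M H)" if "x \<in> carrier M" for x
    using that H.a_subset by (simp add: quotient_module_simps M.M.a_rcosetsI)
  show "H +>\<^bsub>M\<^esub> (x \<oplus>\<^bsub>M\<^esub> y) = (H +>\<^bsub>M\<^esub> x) \<oplus>\<^bsub>quotient_module M H\<^esub> (H +>\<^bsub>M\<^esub> y)"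
    if "x \<in> carrier M" "y \<in> carrier M" for x y
    using that by (simp add: quotient_module_simps H.a_rcos_sum)
  fix k x assume k: "k \<in> carrier K" and x: "x \<in> carrier M"
  \<comment> \<open>A scalar multiple in the quotient is a union of cosets, one for each
    representative. It is a single coset because all of these coincide.\<close>
  have "H +>\<^bsub>M\<^esub> (k \<odot>\<^bsub>M\<^esub> x') = H +>\<^bsub>M\<^esub> (k \<odot>\<^bsub>M\<^esub> x)" if x': "x' \<in> H +>\<^bsub>M\<^esub> x" for x'
  proof -
    have c: "x' \<in> carrier M" using x x' by (rule H.a_elemrcos_carrier)
    have "k \<odot>\<^bsub>M\<^esub> (x' \<ominus>\<^bsub>M\<^esub> x) \<in> H"
      using H.a_rcos_module_imp[OF x x'] k H by (auto simp: a_minus_def intro: submodule.smult_closed)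
    then show ?thesis
      using k x c M.coset_eq_iff[OF H, of "k \<odot>\<^bsub>M\<^esub> x'" "k \<odot>\<^bsub>M\<^esub> x"]
      by (simp add: a_minus_def M.smult_r_distr M.smult_r_minus)
  qed
  moreover have "x \<in> H +>\<^bsub>M\<^esub> x" using x by (rule H.a_rcos_self)
  ultimately show "H +>\<^bsub>M\<^esub> (k \<odot>\<^bsub>M\<^esub> x) = k \<odot>\<^bsub>quotient_module M H\<^esub> (H +>\<^bsub>M\<^esub> x)"
    unfolding quotient_module_simps by blast
qed

lemma quotient_module_carrierE:
  assumes "X \<in> carrier (quotient_module M H)"
  obtains x where "x \<in> carrier M" "X = H +>\<^bsub>M\<^esub> x"
  using assms by (auto simp: quotient_module_simps A_RCOSETS_def')

lemma module_quotient_module: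
  assumes M: "module K M" and H: "submodule H K M"
  shows "module K (quotient_module M H)"
proof -
  interpret M: module K M by fact
  interpret H: abelian_subgroup H M using H by (rule M.abelian_subgroup_submodule)
  note lin = coset_linear[OF M H]
  let ?Q = "quotient_module M H"
  show ?thesis
  proof (rule moduleI)
    show "cring K" ..
    show "abelian_group ?Q"
    proof (rule abelian_groupI)
      have zero: "\<zero>\<^bsub>?Q\<^esub> = H +>\<^bsub>M\<^esub> \<zero>\<^bsub>M\<^esub>"
        using H.a_subset by (simp add: quotient_module_simps)
      show "\<zero>\<^bsub>?Q\<^esub> \<in> carrier ?Q"
        unfolding zero by (rule linear_maps_closed[OF lin]) simp
      show "\<zero>\<^bsub>?Q\<^esub> \<oplus>\<^bsub>?Q\<^esub> X = X" if "X \<in> carrier ?Q" for X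
        using that unfolding zero
        by (auto elim!: quotient_module_carrierE simp flip: linear_maps_add[OF lin])
      show "\<exists>Y\<in>carrier ?Q. Y \<oplus>\<^bsub>?Q\<^esub> X = \<zero>\<^bsub>?Q\<^esub>" if "X \<in> carrier ?Q" for X
      proof -
        obtain x where x: "x \<in> carrier M" "X = H +>\<^bsub>M\<^esub> x"
          using \<open>X \<in> carrier ?Q\<close> by (rule quotient_module_carrierE)
        show ?thesis
          unfolding zero x(2)
          by (rule bexI[of _ "H +>\<^bsub>M\<^esub> (\<ominus>\<^bsub>M\<^esub> x)"])
            (use x in \<open>auto simp: linear_maps_closed[OF lin] M.M.l_neg simp flip: linear_maps_add[OF lin]\<close>)
      qed
    qed (auto elim!: quotient_module_carrierE simp: linear_maps_closed[OF lin] M.M.a_ac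
        simp flip: linear_maps_add[OF lin])
    show "a \<odot>\<^bsub>?Q\<^esub> X \<in> carrier ?Q" if "a \<in> carrier K" "X \<in> carrier ?Q" for a X
      using that linear_maps_closed[OF lin]
      by (auto elim!: quotient_module_carrierE simp flip: linear_maps_smult[OF lin])
    show "(a \<oplus>\<^bsub>K\<^esub> b) \<odot>\<^bsub>?Q\<^esub> X = a \<odot>\<^bsub>?Q\<^esub> X \<oplus>\<^bsub>?Q\<^esub> b \<odot>\<^bsub>?Q\<^esub> X"
      if "a \<in> carrier K" "b \<in> carrier K" "X \<in> carrier ?Q" for a b X
      using that
      by (auto elim!: quotient_module_carrierE simp: M.smult_l_distr
          simp flip: linear_maps_smult[OF lin] linear_maps_add[OF lin])
    show "a \<odot>\<^bsub>?Q\<^esub> (X \<oplus>\<^bsub>?Q\<^esub> Y) = a \<odot>\<^bsub>?Q\<^esub> X \<oplus>\<^bsub>?Q\<^esub> a \<odot>\<^bsub>?Q\<^esub> Y"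
      if "a \<in> carrier K" "X \<in> carrier ?Q" "Y \<in> carrier ?Q" for a X Y
      using that
      by (auto elim!: quotient_module_carrierE simp: M.smult_r_distr
          simp flip: linear_maps_smult[OF lin] linear_maps_add[OF lin])
    show "(a \<otimes>\<^bsub>K\<^esub> b) \<odot>\<^bsub>?Q\<^esub> X = a \<odot>\<^bsub>?Q\<^esub> (b \<odot>\<^bsub>?Q\<^esub> X)"
      if "a \<in> carrier K" "b \<in> carrier K" "X \<in> carrier ?Q" for a b X
      using that
      by (auto elim!: quotient_module_carrierE simp: M.smult_assoc1
          simp flip: linear_maps_smult[OF lin])
    show "\<one>\<^bsub>K\<^esub> \<odot>\<^bsub>?Q\<^esub> X = X" if "X \<in> carrier ?Q" for X
      using that
      by (auto elim!: quotient_module_carrierE simp flip: linear_maps_smult[OF lin])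
  qed
qed

lemma generating_family_quotient_module:
  assumes M: "module K M" and H: "submodule H K M" and G: "generating_family K M \<gamma> G"
  shows "generating_family K (quotient_module M H) (\<lambda>g. H +>\<^bsub>M\<^esub> \<gamma> g) G"
proof (rule generating_familyI)
  note lin = coset_linear[OF M H]
  show "H +>\<^bsub>M\<^esub> \<gamma> g \<in> carrier (quotient_module M H)" if "g \<in> G" for g
    by (rule linear_maps_closed[OF lin generating_family_closed[OF G that]])
  fix X P
  assume X: "X \<in> carrier (quotient_module M H)"
    and zero: "P \<zero>\<^bsub>quotient_module M H\<^esub>"
    and add: "\<And>x y. \<lbrakk>P x; P y\<rbrakk> \<Longrightarrow> P (x \<oplus>\<^bsub>quotient_module M H\<^esub> y)"
    and smult: "\<And>k x. \<lbrakk>k \<in> carrier K; P x\<rbrakk> \<Longrightarrow> P (k \<odot>\<^bsub>quotient_module M H\<^esub> x)"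
    and gen: "\<And>g. g \<in> G \<Longrightarrow> P (H +>\<^bsub>M\<^esub> \<gamma> g)"
  obtain x where x: "x \<in> carrier M" "X = H +>\<^bsub>M\<^esub> x"
    using X by (rule quotient_module_carrierE)
  have "P (H +>\<^bsub>M\<^esub> x)"
    using M G x(1)
  proof (induction rule: generating_family_induct)
    case zero
    show ?case
      using \<open>P \<zero>\<^bsub>quotient_module M H\<^esub>\<close>
      by (simp add: linear_maps_zero[OF M module_quotient_module[OF M H] lin])
  qed (simp_all add: add smult gen linear_maps_add[OF lin] linear_maps_smult[OF lin])
  then show "P X" using x by simp
qed

lemma linear_map_quotient_module:
  assumes M: "module K M" and N: "module K N" and H: "submodule H K M"
    and h: "h \<in> linear_maps K M N" and ker: "\<And>x. x \<in> H \<Longrightarrow> h x = \<zero>\<^bsub>N\<^esub>"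
  obtains h' where "h' \<in> linear_maps K (quotient_module M H) N"
    "\<And>x. x \<in> carrier M \<Longrightarrow> h' (H +>\<^bsub>M\<^esub> x) = h x"
proof -
  interpret M: module K M by fact
  interpret N: module K N by fact
  interpret H: abelian_subgroup H M using H by (rule M.abelian_subgroup_submodule)
  note lin = coset_linear[OF M H]
  \<comment> \<open>A representative is chosen by \<open>SOME\<close>; the value does not depend on
    the choice because \<open>h\<close> vanishes on \<open>H\<close>.\<close>
  define h' where "h' X = h (SOME x. x \<in> carrier M \<and> X = H +>\<^bsub>M\<^esub> x)" for X
  have eq: "h' (H +>\<^bsub>M\<^esub> x) = h x" if x: "x \<in> carrier M" for x
  proof -
    define y where "y = (SOME y. y \<in> carrier M \<and> H +>\<^bsub>M\<^esub> x = H +>\<^bsub>M\<^esub> y)"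
    have y: "y \<in> carrier M \<and> H +>\<^bsub>M\<^esub> x = H +>\<^bsub>M\<^esub> y"
      unfolding y_def by (rule someI[of _ x]) (use x in simp)
    then have "h (y \<ominus>\<^bsub>M\<^esub> x) = \<zero>\<^bsub>N\<^esub>"
      using M.coset_eq_iff[OF H, of y x] x by (intro ker) simp
    then have "h y = h x"
      using linear_maps_minus[OF M N h, of y x] linear_maps_closed[OF h] x y
        by (simp add: N.M.minus_eq_zero_iff)
    then show ?thesis unfolding h'_def y_def .
  qed
  have "h' \<in> linear_maps K (quotient_module M H) N"
  proof (rule linear_mapsI)
    show "h' X \<in> carrier N" if "X \<in> carrier (quotient_module M H)" for X
      using that by (auto elim!: quotient_module_carrierE simp: eq linear_maps_closed[OF h])
    show "h' (X \<oplus>\<^bsub>quotient_module M H\<^esub> Y) = h' X \<oplus>\<^bsub>N\<^esub> h' Y"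
      if "X \<in> carrier (quotient_module M H)" "Y \<in> carrier (quotient_module M H)" for X Y
      using that
      by (auto elim!: quotient_module_carrierE simp: eq linear_maps_add[OF h]
          simp flip: linear_maps_add[OF lin])
    show "h' (k \<odot>\<^bsub>quotient_module M H\<^esub> X) = k \<odot>\<^bsub>N\<^esub> h' X"
      if "k \<in> carrier K" "X \<in> carrier (quotient_module M H)" for k X
      using that
      by (auto elim!: quotient_module_carrierE simp: eq linear_maps_smult[OF h]
          simp flip: linear_maps_smult[OF lin])
  qed
  with eq show ?thesis by (intro that)
qed

lemma submodule_kernel:
  assumes M: "module K M" and N: "module K N" and h: "h \<in> linear_maps K M N"
  shows "submodule {x \<in> carrier M. h x = \<zero>\<^bsub>N\<^esub>} K M"
proof -
  interpret M: module K M by fact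
  interpret N: module K N by fact
  show ?thesis
    by (rule M.submoduleI)
      (auto simp: linear_maps_zero[OF M N h] linear_maps_neg[OF M N h] linear_maps_add[OF h]
        linear_maps_smult[OF h])
qed

lemma submodule_span_submodule:
  assumes M: "module K M" and X: "X \<subseteq> carrier M"
  shows "submodule (submodule_span K M X) K M"
proof -
  interpret M: module K M by fact
  have c: "submodule (carrier M) K M" by (rule M.carrier_is_submodule)
  show ?thesis
  proof (rule M.submoduleI)
    show "submodule_span K M X \<subseteq> carrier M"
      using c X by (auto simp: submodule_span_def)
    show "\<zero>\<^bsub>M\<^esub> \<in> submodule_span K M X"
      by (auto simp: submodule_span_def submodule_def dest!: subgroup.one_closed)
  qed (auto simp: submodule_span_def dest: M.submoduleE)
qed

lemma submodule_span_superset: "X \<subseteq> submodule_span K M X"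
  by (auto simp: submodule_span_def)

lemma submodule_span_least: "\<lbrakk>submodule H K M; X \<subseteq> H\<rbrakk> \<Longrightarrow> submodule_span K M X \<subseteq> H"
  by (auto simp: submodule_span_def)

lemma generating_family_submodule_span:
  assumes M: "module K M" and X: "\<gamma> ` G \<subseteq> carrier M"
  shows "generating_family K (M\<lparr>carrier := submodule_span K M (\<gamma> ` G)\<rparr>) \<gamma> G"
proof (rule generating_familyI)
  interpret M: module K M by fact
  show "\<gamma> g \<in> carrier (M\<lparr>carrier := submodule_span K M (\<gamma> ` G)\<rparr>)" if "g \<in> G" for g
    using that submodule_span_superset[of "\<gamma> ` G" K M] by auto
  fix x P
  assume x: "x \<in> carrier (M\<lparr>carrier := submodule_span K M (\<gamma> ` G)\<rparr>)"
    and P: "P \<zero>\<^bsub>M\<lparr>carrier := submodule_span K M (\<gamma> ` G)\<rparr>\<^esub>"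
      "\<And>x y. \<lbrakk>P x; P y\<rbrakk> \<Longrightarrow> P (x \<oplus>\<^bsub>M\<lparr>carrier := submodule_span K M (\<gamma> ` G)\<rparr>\<^esub> y)"
      "\<And>k x. \<lbrakk>k \<in> carrier K; P x\<rbrakk> \<Longrightarrow> P (k \<odot>\<^bsub>M\<lparr>carrier := submodule_span K M (\<gamma> ` G)\<rparr>\<^esub> x)"
      "\<And>g. g \<in> G \<Longrightarrow> P (\<gamma> g)"
  have "submodule {x \<in> carrier M. P x} K M"
  proof (rule M.submoduleI)
    \<comment> \<open>A submodule must be closed under negation, about which nothing is assumed for
      \<open>P\<close>; it is multiplication by the scalar -1.\<close>
    show "\<ominus>\<^bsub>M\<^esub> a \<in> {x \<in> carrier M. P x}" if "a \<in> {x \<in> carrier M. P x}" for a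
      using that P(3)[of "\<ominus>\<^bsub>K\<^esub> \<one>\<^bsub>K\<^esub>" a] by (simp add: M.minus_eq_smult)
    show "a \<oplus>\<^bsub>M\<^esub> b \<in> {x \<in> carrier M. P x}"
      if "a \<in> {x \<in> carrier M. P x}" "b \<in> {x \<in> carrier M. P x}" for a b
      using that P(2)[of a b] by simp
    show "k \<odot>\<^bsub>M\<^esub> a \<in> {x \<in> carrier M. P x}"
      if "k \<in> carrier K" "a \<in> {x \<in> carrier M. P x}" for k a
      using that P(3)[of k a] by simp
  qed (use P(1) in auto)
  then have "submodule_span K M (\<gamma> ` G) \<subseteq> {x \<in> carrier M. P x}"
    by (rule submodule_span_least) (use P(4) X in blast)
  then show "P x" using x by auto
qed

section \<open>Modules presented by generators and relations\<close>

lemma module_presented_module: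
  assumes "cring K" "X \<subseteq> carrier (free_module K G)"
  shows "module K (presented_module K G X)"
  unfolding presented_module_def
  using assms by (intro module_quotient_module submodule_span_submodule module_free_module)

lemma generating_family_presented_gen:
  assumes "cring K" "X \<subseteq> carrier (free_module K G)"
  shows "generating_family K (presented_module K G X) (presented_gen K G X) G"
  using generating_family_quotient_module[OF module_free_module[OF assms(1)]
      submodule_span_submodule[OF module_free_module[OF assms(1)] assms(2)]
      generating_family_basis_vec[OF assms(1)]]
  by (simp add: presented_module_def presented_gen_def[abs_def])

text \<open>The interface for all presentations below. A relation \<open>a \<ominus> b\<close> turns
  into the equation \<open>p a = p b\<close>, so the relations for tensors, symmetric squares, words
  and monomials can be exploited without looking at cosets.\<close>

lemma presented_projection:
  assumes K: "cring K" and X: "X \<subseteq> carrier (free_module K G)"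
  obtains p where "p \<in> linear_maps K (free_module K G) (presented_module K G X)"
    "\<And>g. p (basis_vec K g) = presented_gen K G X g"
    "\<And>x. x \<in> X \<Longrightarrow> p x = \<zero>\<^bsub>presented_module K G X\<^esub>"
proof
  let ?F = "free_module K G" and ?H = "submodule_span K (free_module K G) X"
  note F = module_free_module[OF K, of G]
  note H = submodule_span_submodule[OF F X]
  interpret F: module K ?F by (rule F)
  interpret H: abelian_subgroup ?H ?F using H by (rule F.abelian_subgroup_submodule)
  show "(\<lambda>x. ?H +>\<^bsub>?F\<^esub> x) \<in> linear_maps K ?F (presented_module K G X)"
    unfolding presented_module_def by (rule coset_linear[OF F H])
  show "?H +>\<^bsub>?F\<^esub> basis_vec K g = presented_gen K G X g" for g
    by (simp add: presented_gen_def)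
  show "?H +>\<^bsub>?F\<^esub> x = \<zero>\<^bsub>presented_module K G X\<^esub>" if "x \<in> X" for x
    using that submodule_span_superset[of X K ?F]
    by (auto simp: presented_module_def quotient_module_simps intro!: H.a_rcos_const)
qed

text \<open>The universal property of a presentation. The linear map on the free module is only
  known to exist, therefore the relations are to be killed by every linear map with the given values
  on the generators.\<close>

lemma extends_linearly_presented_module:
  assumes K: "cring K" and X: "X \<subseteq> carrier (free_module K G)" and N: "module K N"
    and \<phi>: "\<And>g. g \<in> G \<Longrightarrow> \<phi> g \<in> carrier N"
    and ker: "\<And>h x. \<lbrakk>h \<in> linear_maps K (free_module K G) N; \<And>g. g \<in> G \<Longrightarrow> h (basis_vec K g) = \<phi> g; x \<in> X\<rbrakk>
      \<Longrightarrow> h x = \<zero>\<^bsub>N\<^esub>"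
  shows "extends_linearly K (presented_module K G X) (presented_gen K G X) G N \<phi>"
proof -
  let ?F = "free_module K G" and ?H = "submodule_span K (free_module K G) X"
  note F = module_free_module[OF K, of G]
  note H = submodule_span_submodule[OF F X]
  obtain h where h: "h \<in> linear_maps K ?F N" "\<And>g. g \<in> G \<Longrightarrow> h (basis_vec K g) = \<phi> g"
    using extends_linearly_free_module[OF N, of G \<phi>] \<phi> by (auto elim!: extends_linearlyE)
  have sub: "?H \<subseteq> {x \<in> carrier ?F. h x = \<zero>\<^bsub>N\<^esub>}"
    by (rule submodule_span_least[OF submodule_kernel[OF F N h(1)]]) (use X ker[OF h] in blast)
  obtain h' where h': "h' \<in> linear_maps K (quotient_module ?F ?H) N"
    "\<And>x. x \<in> carrier ?F \<Longrightarrow> h' (?H +>\<^bsub>?F\<^esub> x) = h x"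
    by (rule linear_map_quotient_module[OF F N H h(1)]) (use sub in blast)+
  have "h' (presented_gen K G X g) = \<phi> g" if "g \<in> G" for g
    using h'(2)[OF basis_vec_closed[OF K that]] h(2)[OF that] by (simp add: presented_gen_def)
  then show ?thesis
    using h'(1) by (intro extends_linearlyI) (simp_all add: presented_module_def)
qed

section \<open>Tensor products\<close>

lemma bilinear_rels_cases:
  assumes "r \<in> bilinear_rels K M N"
  obtains
    (add_left) x x' y where "x \<in> carrier M" "x' \<in> carrier M" "y \<in> carrier N"
      "r = basis_vec K (x \<oplus>\<^bsub>M\<^esub> x', y) \<ominus>\<^bsub>free_module K (carrier M \<times> carrier N)\<^esub>
         (basis_vec K (x, y) \<oplus>\<^bsub>free_module K (carrier M \<times> carrier N)\<^esub> basis_vec K (x', y))"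
  | (add_right) x y y' where "x \<in> carrier M" "y \<in> carrier N" "y' \<in> carrier N"
      "r = basis_vec K (x, y \<oplus>\<^bsub>N\<^esub> y') \<ominus>\<^bsub>free_module K (carrier M \<times> carrier N)\<^esub>
         (basis_vec K (x, y) \<oplus>\<^bsub>free_module K (carrier M \<times> carrier N)\<^esub> basis_vec K (x, y'))"
  | (smult_left) k x y where "k \<in> carrier K" "x \<in> carrier M" "y \<in> carrier N"
      "r = basis_vec K (k \<odot>\<^bsub>M\<^esub> x, y) \<ominus>\<^bsub>free_module K (carrier M \<times> carrier N)\<^esub>
         (k \<odot>\<^bsub>free_module K (carrier M \<times> carrier N)\<^esub> basis_vec K (x, y))"
  | (smult_right) k x y where "k \<in> carrier K" "x \<in> carrier M" "y \<in> carrier N"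
      "r = basis_vec K (x, k \<odot>\<^bsub>N\<^esub> y) \<ominus>\<^bsub>free_module K (carrier M \<times> carrier N)\<^esub>
         (k \<odot>\<^bsub>free_module K (carrier M \<times> carrier N)\<^esub> basis_vec K (x, y))"
  using assms unfolding bilinear_rels_def Let_def by blast

lemma bilinear_relsI:
  shows bilinear_rels_add_left: "\<lbrakk>x \<in> carrier M; x' \<in> carrier M; y \<in> carrier N\<rbrakk> \<Longrightarrow>
      basis_vec K (x \<oplus>\<^bsub>M\<^esub> x', y) \<ominus>\<^bsub>free_module K (carrier M \<times> carrier N)\<^esub>
        (basis_vec K (x, y) \<oplus>\<^bsub>free_module K (carrier M \<times> carrier N)\<^esub> basis_vec K (x', y)) \<in> bilinear_rels K M N"
    and bilinear_rels_add_right: "\<lbrakk>x \<in> carrier M; y \<in> carrier N; y' \<in> carrier N\<rbrakk> \<Longrightarrow>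
      basis_vec K (x, y \<oplus>\<^bsub>N\<^esub> y') \<ominus>\<^bsub>free_module K (carrier M \<times> carrier N)\<^esub>
        (basis_vec K (x, y) \<oplus>\<^bsub>free_module K (carrier M \<times> carrier N)\<^esub> basis_vec K (x, y')) \<in> bilinear_rels K M N"
    and bilinear_rels_smult_left: "\<lbrakk>k \<in> carrier K; x \<in> carrier M; y \<in> carrier N\<rbrakk> \<Longrightarrow>
      basis_vec K (k \<odot>\<^bsub>M\<^esub> x, y) \<ominus>\<^bsub>free_module K (carrier M \<times> carrier N)\<^esub> (k \<odot>\<^bsub>free_module K (carrier M \<times> carrier N)\<^esub> basis_vec K (x, y)) \<in> bilinear_rels K M N"
    and bilinear_rels_smult_right: "\<lbrakk>k \<in> carrier K; x \<in> carrier M; y \<in> carrier N\<rbrakk> \<Longrightarrow>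
      basis_vec K (x, k \<odot>\<^bsub>N\<^esub> y) \<ominus>\<^bsub>free_module K (carrier M \<times> carrier N)\<^esub> (k \<odot>\<^bsub>free_module K (carrier M \<times> carrier N)\<^esub> basis_vec K (x, y)) \<in> bilinear_rels K M N"
  unfolding bilinear_rels_def Let_def
     apply (rule UnI1, rule UnI1, rule UnI1, intro CollectI exI conjI, rule refl; assumption)
    apply (rule UnI1, rule UnI1, rule UnI2, intro CollectI exI conjI, rule refl; assumption)
   apply (rule UnI1, rule UnI2, intro CollectI exI conjI, rule refl; assumption)
  apply (rule UnI2, intro CollectI exI conjI, rule refl; assumption)
  done

lemma bilinear_rels_closed:
  assumes "module K M" "module K N"
  shows "bilinear_rels K M N \<subseteq> carrier (free_module K (carrier M \<times> carrier N))"
proof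
  interpret M: module K M by fact
  interpret N: module K N by fact
  have K: "cring K" ..
  interpret F: module K "free_module K (carrier M \<times> carrier N)" by (rule module_free_module[OF K])
  fix r assume "r \<in> bilinear_rels K M N"
  then show "r \<in> carrier (free_module K (carrier M \<times> carrier N))"
    by (cases rule: bilinear_rels_cases) (simp_all add: basis_vec_closed[OF K])
qed

lemma module_tensor_module:
  assumes "module K M" "module K N"
  shows "module K (tensor_module K M N)"
  unfolding tensor_module_def
  by (rule module_presented_module[OF module_cring[OF assms(1)] bilinear_rels_closed[OF assms]])

lemma tensor_bilinear:
  assumes M: "module K M" and N: "module K N"
  shows "tensor K M N \<in> bilinear_maps K M N (tensor_module K M N)"
proof -
  interpret M: module K M by fact
  interpret N: module K N by fact
  let ?F = "free_module K (carrier M \<times> carrier N)" and ?T = "tensor_module K M N"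
  have K: "cring K" ..
  note F = module_free_module[OF K, of "carrier M \<times> carrier N"]
  interpret F: module K ?F by (rule F)
  note T = module_tensor_module[OF M N]
  interpret T: module K ?T by (rule T)
  obtain p where p: "p \<in> linear_maps K ?F ?T"
    and pb: "\<And>g. p (basis_vec K g) = presented_gen K (carrier M \<times> carrier N) (bilinear_rels K M N) g"
    and pz: "\<And>x. x \<in> bilinear_rels K M N \<Longrightarrow> p x = \<zero>\<^bsub>?T\<^esub>"
    by (rule presented_projection[OF K bilinear_rels_closed[OF M N], folded tensor_module_def]) (rule that)
  have t: "tensor K M N x y = p (basis_vec K (x, y))" for x y
    by (simp add: tensor_def pb)
  note lin = linear_maps_add[OF p] linear_maps_smult[OF p] linear_maps_minus[OF F T p]
    linear_maps_closed[OF p]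
  note bc = basis_vec_closed[OF K, of _ "carrier M \<times> carrier N"]
  have eqI: "p a = p b" if "a \<ominus>\<^bsub>?F\<^esub> b \<in> bilinear_rels K M N" "a \<in> carrier ?F" "b \<in> carrier ?F" for a b
    using pz[OF that(1)] that(2,3) by (simp add: lin T.M.minus_eq_zero_iff)
  show ?thesis
  proof (intro bilinear_mapsI linear_mapsI)
    fix x y y' assume *: "x \<in> carrier M" "y \<in> carrier N" "y' \<in> carrier N"
    have "p (basis_vec K (x, y \<oplus>\<^bsub>N\<^esub> y')) = p (basis_vec K (x, y) \<oplus>\<^bsub>?F\<^esub> basis_vec K (x, y'))"
      by (rule eqI[OF bilinear_rels_add_right]) (use * in \<open>auto simp: bc\<close>)
    then show "tensor K M N x (y \<oplus>\<^bsub>N\<^esub> y') = tensor K M N x y \<oplus>\<^bsub>?T\<^esub> tensor K M N x y'"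
      using * by (simp add: t lin bc)
  next
    fix x y k assume *: "x \<in> carrier M" "y \<in> carrier N" "k \<in> carrier K"
    have "p (basis_vec K (x, k \<odot>\<^bsub>N\<^esub> y)) = p (k \<odot>\<^bsub>?F\<^esub> basis_vec K (x, y))"
      by (rule eqI[OF bilinear_rels_smult_right]) (use * in \<open>auto simp: bc\<close>)
    then show "tensor K M N x (k \<odot>\<^bsub>N\<^esub> y) = k \<odot>\<^bsub>?T\<^esub> tensor K M N x y"
      using * by (simp add: t lin bc)
  next
    fix x x' y assume *: "x \<in> carrier M" "x' \<in> carrier M" "y \<in> carrier N"
    have "p (basis_vec K (x \<oplus>\<^bsub>M\<^esub> x', y)) = p (basis_vec K (x, y) \<oplus>\<^bsub>?F\<^esub> basis_vec K (x', y))"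
      by (rule eqI[OF bilinear_rels_add_left]) (use * in \<open>auto simp: bc\<close>)
    then show "tensor K M N (x \<oplus>\<^bsub>M\<^esub> x') y = tensor K M N x y \<oplus>\<^bsub>?T\<^esub> tensor K M N x' y"
      using * by (simp add: t lin bc)
  next
    fix x y k assume *: "y \<in> carrier N" "k \<in> carrier K" "x \<in> carrier M"
    have "p (basis_vec K (k \<odot>\<^bsub>M\<^esub> x, y)) = p (k \<odot>\<^bsub>?F\<^esub> basis_vec K (x, y))"
      by (rule eqI[OF bilinear_rels_smult_left]) (use * in \<open>auto simp: bc\<close>)
    then show "tensor K M N (k \<odot>\<^bsub>M\<^esub> x) y = k \<odot>\<^bsub>?T\<^esub> tensor K M N x y"
      using * by (simp add: t lin bc)
  qed (simp_all add: t lin bc)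
qed

lemma generating_family_tensor_carrier:
  assumes "module K M" "module K N"
  shows "generating_family K (tensor_module K M N) (\<lambda>(x, y). tensor K M N x y) (carrier M \<times> carrier N)"
proof -
  have "(\<lambda>(x, y). tensor K M N x y) = presented_gen K (carrier M \<times> carrier N) (bilinear_rels K M N)"
    by (simp add: tensor_def fun_eq_iff)
  then show ?thesis
    using generating_family_presented_gen[OF module_cring[OF assms(1)] bilinear_rels_closed[OF assms]]
    by (simp add: tensor_module_def)
qed

lemma generating_family_tensor:
  assumes M: "module K M" and N: "module K N"
    and G: "generating_family K M \<gamma> G" and H: "generating_family K N \<delta> H"
  shows "generating_family K (tensor_module K M N) (\<lambda>(g, h). tensor K M N (\<gamma> g) (\<delta> h)) (G \<times> H)"
proof (rule generating_familyI)
  note t = tensor_bilinear[OF M N]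
  note T = module_tensor_module[OF M N]
  show "(case p of (g, h) \<Rightarrow> tensor K M N (\<gamma> g) (\<delta> h)) \<in> carrier (tensor_module K M N)"
    if "p \<in> G \<times> H" for p
    using that by (auto intro!: bilinear_maps_closed[OF t] generating_family_closed[OF G]
        generating_family_closed[OF H])
  fix z P
  assume z: "z \<in> carrier (tensor_module K M N)"
    and P0: "P \<zero>\<^bsub>tensor_module K M N\<^esub>"
    and Padd: "\<And>x y. \<lbrakk>P x; P y\<rbrakk> \<Longrightarrow> P (x \<oplus>\<^bsub>tensor_module K M N\<^esub> y)"
    and Psmult: "\<And>k x. \<lbrakk>k \<in> carrier K; P x\<rbrakk> \<Longrightarrow> P (k \<odot>\<^bsub>tensor_module K M N\<^esub> x)"
    and Pgen: "\<And>p. p \<in> G \<times> H \<Longrightarrow> P (case p of (g, h) \<Rightarrow> tensor K M N (\<gamma> g) (\<delta> h))"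
  have P1: "P (tensor K M N x (\<delta> h))" if x: "x \<in> carrier M" and h: "h \<in> H" for x h
    using M G x
  proof (induction rule: generating_family_induct)
    case zero
    show ?case
      using P0 by (simp add: bilinear_maps_zero_left[OF M T t generating_family_closed[OF H h]])
  next
    case (gen g)
    then show ?case using Pgen[of "(g, h)"] h by simp
  qed (simp_all add: Padd Psmult bilinear_maps_add_left[OF t] bilinear_maps_smult_left[OF t]
      generating_family_closed[OF H h])
  have P2: "P (tensor K M N x y)" if x: "x \<in> carrier M" and y: "y \<in> carrier N" for x y
    using N H y
  proof (induction rule: generating_family_induct)
    case zero
    show ?case using P0 by (simp add: bilinear_maps_zero_right[OF N T t x])
  qed (simp_all add: Padd Psmult bilinear_maps_add_right[OF t] bilinear_maps_smult_right[OF t] x P1)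
  show "P z"
    using T generating_family_tensor_carrier[OF M N] z
    by (induction rule: generating_family_induct) (auto simp: P0 Padd Psmult P2)
qed

lemma linear_map_tensor:
  assumes M: "module K M" and N: "module K N" and L: "module K L" and b: "b \<in> bilinear_maps K M N L"
  obtains h where "h \<in> linear_maps K (tensor_module K M N) L"
    "\<And>x y. \<lbrakk>x \<in> carrier M; y \<in> carrier N\<rbrakk> \<Longrightarrow> h (tensor K M N x y) = b x y"
proof -
  interpret M: module K M by fact
  interpret N: module K N by fact
  interpret L: module K L by fact
  let ?F = "free_module K (carrier M \<times> carrier N)"
  have K: "cring K" ..
  note F = module_free_module[OF K, of "carrier M \<times> carrier N"]
  interpret F: module K ?F by (rule F)
  have "extends_linearly K (presented_module K (carrier M \<times> carrier N) (bilinear_rels K M N))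
      (presented_gen K (carrier M \<times> carrier N) (bilinear_rels K M N)) (carrier M \<times> carrier N) L
      (\<lambda>(x, y). b x y)"
  proof (rule extends_linearly_presented_module[OF K bilinear_rels_closed[OF M N] L])
    show "(case g of (x, y) \<Rightarrow> b x y) \<in> carrier L" if "g \<in> carrier M \<times> carrier N" for g
      using that by (auto simp: bilinear_maps_closed[OF b])
    fix h r
    assume h: "h \<in> linear_maps K ?F L"
      and hb: "\<And>g. g \<in> carrier M \<times> carrier N \<Longrightarrow> h (basis_vec K g) = (case g of (x, y) \<Rightarrow> b x y)"
      and r: "r \<in> bilinear_rels K M N"
    note simps = linear_maps_add[OF h] linear_maps_smult[OF h] linear_maps_minus[OF F L h] hb
      basis_vec_closed[OF K, of _ "carrier M \<times> carrier N"] L.M.minus_eq_zero_iff bilinear_maps_closed[OF b]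
    from r show "h r = \<zero>\<^bsub>L\<^esub>"
    proof (cases rule: bilinear_rels_cases)
      case add_left
      then show ?thesis by (simp add: simps bilinear_maps_add_left[OF b])
    next
      case add_right
      then show ?thesis by (simp add: simps bilinear_maps_add_right[OF b])
    next
      case smult_left
      then show ?thesis by (simp add: simps bilinear_maps_smult_left[OF b])
    next
      case smult_right
      then show ?thesis by (simp add: simps bilinear_maps_smult_right[OF b])
    qed
  qed
  then show ?thesis
    by (rule extends_linearlyE) (use that in \<open>force simp: tensor_module_def tensor_def\<close>)
qed

lemma extends_linearly_tensor:
  assumes M: "module K M" and N: "module K N" and L: "module K L"
    and G: "generating_family K M \<gamma> G" and H: "generating_family K N \<delta> H"
    and l: "\<And>h. h \<in> H \<Longrightarrow> extends_linearly K M \<gamma> G L (\<lambda>g. \<phi> g h)"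
    and r: "\<And>g. g \<in> G \<Longrightarrow> extends_linearly K N \<delta> H L (\<phi> g)"
  shows "extends_linearly K (tensor_module K M N) (\<lambda>(g, h). tensor K M N (\<gamma> g) (\<delta> h)) (G \<times> H) L
    (\<lambda>(g, h). \<phi> g h)"
proof -
  obtain b where b: "b \<in> bilinear_maps K M N L"
    "\<And>g h. \<lbrakk>g \<in> G; h \<in> H\<rbrakk> \<Longrightarrow> b (\<gamma> g) (\<delta> h) = \<phi> g h"
    by (rule bilinear_extension[OF M N L G H l r]) (assumption | rule that)+
  obtain p where p: "p \<in> linear_maps K (tensor_module K M N) L"
    "\<And>x y. \<lbrakk>x \<in> carrier M; y \<in> carrier N\<rbrakk> \<Longrightarrow> p (tensor K M N x y) = b x y"
    by (rule linear_map_tensor[OF M N L b(1)]) (rule that)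
  show ?thesis
    using b(2) generating_family_closed[OF G] generating_family_closed[OF H]
    by (intro extends_linearlyI[OF p(1)]) (auto simp: p(2))
qed

section \<open>Symmetric squares\<close>

lemma symmetric_square_rels_closed:
  assumes M: "module K M"
  shows "symmetric_square_rels K M \<subseteq> carrier (free_module K (carrier M \<times> carrier M))"
proof -
  have K: "cring K" by (rule module_cring[OF M])
  interpret F: module K "free_module K (carrier M \<times> carrier M)" by (rule module_free_module[OF K])
  show ?thesis
    using bilinear_rels_closed[OF M M] by (auto simp: symmetric_square_rels_def basis_vec_closed[OF K])
qed

lemma module_symmetric_square: "module K M \<Longrightarrow> module K (symmetric_square K M)"
  unfolding symmetric_square_def
  by (intro module_presented_module symmetric_square_rels_closed) (rule module_cring)

lemma sym_tensor_bilinear_commute: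
  assumes M: "module K M"
  shows sym_tensor_bilinear: "sym_tensor K M \<in> bilinear_maps K M M (symmetric_square K M)"
    and sym_tensor_commute: "\<lbrakk>x \<in> carrier M; y \<in> carrier M\<rbrakk> \<Longrightarrow> sym_tensor K M x y = sym_tensor K M y x"
proof -
  interpret M: module K M by fact
  let ?F = "free_module K (carrier M \<times> carrier M)" and ?T = "symmetric_square K M"
  have K: "cring K" ..
  note F = module_free_module[OF K, of "carrier M \<times> carrier M"]
  interpret F: module K ?F by (rule F)
  note T = module_symmetric_square[OF M]
  interpret T: module K ?T by (rule T)
  obtain p where p: "p \<in> linear_maps K ?F ?T"
    and pb: "\<And>g. p (basis_vec K g) = presented_gen K (carrier M \<times> carrier M) (symmetric_square_rels K M) g"
    and pz: "\<And>x. x \<in> symmetric_square_rels K M \<Longrightarrow> p x = \<zero>\<^bsub>?T\<^esub>"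
    by (rule presented_projection[OF K symmetric_square_rels_closed[OF M], folded symmetric_square_def])
      (rule that)
  have t: "sym_tensor K M x y = p (basis_vec K (x, y))" for x y
    by (simp add: sym_tensor_def pb)
  note lin = linear_maps_add[OF p] linear_maps_smult[OF p] linear_maps_minus[OF F T p]
    linear_maps_closed[OF p]
  note bc = basis_vec_closed[OF K, of _ "carrier M \<times> carrier M"]
  have eqI: "p a = p b"
    if "a \<ominus>\<^bsub>?F\<^esub> b \<in> symmetric_square_rels K M" "a \<in> carrier ?F" "b \<in> carrier ?F" for a b
    using pz[OF that(1)] that(2,3) by (simp add: lin T.M.minus_eq_zero_iff)
  have commute: "sym_tensor K M x y = sym_tensor K M y x" if xy: "x \<in> carrier M" "y \<in> carrier M" for x y
  proof -
    have "basis_vec K (x, y) \<ominus>\<^bsub>?F\<^esub> basis_vec K (y, x) \<in> symmetric_square_rels K M"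
      unfolding symmetric_square_rels_def using xy by blast
    then have "p (basis_vec K (x, y)) = p (basis_vec K (y, x))"
      by (rule eqI) (use xy in \<open>auto simp: bc\<close>)
    then show ?thesis by (simp only: t)
  qed
  then show "\<lbrakk>x \<in> carrier M; y \<in> carrier M\<rbrakk> \<Longrightarrow> sym_tensor K M x y = sym_tensor K M y x" .
  have rels: "r \<in> symmetric_square_rels K M" if "r \<in> bilinear_rels K M M" for r
    using that by (simp add: symmetric_square_rels_def)
  \<comment> \<open>Linearity is derived from the relations in the second argument only; the first
    argument follows by symmetry.\<close>
  have right: "sym_tensor K M x \<in> linear_maps K M ?T" if x: "x \<in> carrier M" for x
  proof (rule linear_mapsI)
    fix y y' assume *: "y \<in> carrier M" "y' \<in> carrier M"
    have "p (basis_vec K (x, y \<oplus>\<^bsub>M\<^esub> y')) = p (basis_vec K (x, y) \<oplus>\<^bsub>?F\<^esub> basis_vec K (x, y'))"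
      by (rule eqI[OF rels[OF bilinear_rels_add_right]]) (use x * in \<open>auto simp: bc\<close>)
    then show "sym_tensor K M x (y \<oplus>\<^bsub>M\<^esub> y') = sym_tensor K M x y \<oplus>\<^bsub>?T\<^esub> sym_tensor K M x y'"
      using x * by (simp add: t lin bc)
  next
    fix k y assume *: "k \<in> carrier K" "y \<in> carrier M"
    have "p (basis_vec K (x, k \<odot>\<^bsub>M\<^esub> y)) = p (k \<odot>\<^bsub>?F\<^esub> basis_vec K (x, y))"
      by (rule eqI[OF rels[OF bilinear_rels_smult_right]]) (use x * in \<open>auto simp: bc\<close>)
    then show "sym_tensor K M x (k \<odot>\<^bsub>M\<^esub> y) = k \<odot>\<^bsub>?T\<^esub> sym_tensor K M x y"
      using x * by (simp add: t lin bc)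
  qed (simp add: t lin bc x)
  show "sym_tensor K M \<in> bilinear_maps K M M ?T"
  proof (rule bilinear_mapsI[OF right])
    show "(\<lambda>x. sym_tensor K M x y) \<in> linear_maps K M ?T" if y: "y \<in> carrier M" for y
      by (rule linear_maps_cong[OF M right[OF y]]) (rule commute[OF y])
  qed
qed

section \<open>Words and shuffles\<close>

text \<open>Words of all lengths are treated at once: \<open>\<phi>\<close> is a family of
  multilinear maps, one for each length, and its value at the empty word is only required to lie in
  \<open>N\<close>. Such families correspond to linear maps on the sum of all tensor powers.\<close>

definition multilinear ::
    "('k, 'x) ring_scheme \<Rightarrow> ('k, 'm, 'y) module_scheme \<Rightarrow> ('k, 'n, 'z) module_scheme \<Rightarrow> ('m list \<Rightarrow> 'n) \<Rightarrow> bool"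
  where "multilinear K M N \<phi> \<longleftrightarrow> \<phi> \<in> lists (carrier M) \<rightarrow> carrier N \<and>
    (\<forall>u\<in>lists (carrier M). \<forall>v\<in>lists (carrier M). (\<lambda>x. \<phi> (u @ [x] @ v)) \<in> linear_maps K M N)"

lemma multilinear_closed: "\<lbrakk>multilinear K M N \<phi>; w \<in> lists (carrier M)\<rbrakk> \<Longrightarrow> \<phi> w \<in> carrier N"
  by (auto simp: multilinear_def)

lemma multilinear_linear:
  "\<lbrakk>multilinear K M N \<phi>; u \<in> lists (carrier M); v \<in> lists (carrier M)\<rbrakk>
    \<Longrightarrow> (\<lambda>x. \<phi> (u @ [x] @ v)) \<in> linear_maps K M N"
  unfolding multilinear_def by blast

lemma multilinear_ConsD:
  assumes "multilinear K M N \<phi>"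
  shows "x \<in> carrier M \<Longrightarrow> multilinear K M N (\<lambda>w. \<phi> (x # w))"
    and "w \<in> lists (carrier M) \<Longrightarrow> (\<lambda>x. \<phi> (x # w)) \<in> linear_maps K M N"
proof -
  show "multilinear K M N (\<lambda>w. \<phi> (x # w))" if x: "x \<in> carrier M"
    unfolding multilinear_def
  proof (intro conjI ballI)
    show "(\<lambda>w. \<phi> (x # w)) \<in> lists (carrier M) \<rightarrow> carrier N"
      using x multilinear_closed[OF assms] by auto
    fix u v assume "u \<in> lists (carrier M)" "v \<in> lists (carrier M)"
    then show "(\<lambda>xa. \<phi> (x # u @ [xa] @ v)) \<in> linear_maps K M N"
      using multilinear_linear[OF assms, of "x # u" v] x by simp
  qed
  show "(\<lambda>x. \<phi> (x # w)) \<in> linear_maps K M N" if "w \<in> lists (carrier M)"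
    using multilinear_linear[OF assms, of "[]" w] that by simp
qed

text \<open>A position in a nonempty word is either its head or a position of its tail. In this form
  the property suits functions defined by cases on whether a word is empty: the derivative, the
  extension of \<epsilon> by zero, and the retraction of \<open>iota\<close>.\<close>

lemma multilinear_ConsI:
  assumes "\<phi> [] \<in> carrier N"
    and "\<And>x. x \<in> carrier M \<Longrightarrow> multilinear K M N (\<lambda>w. \<phi> (x # w))"
    and "\<And>w. w \<in> lists (carrier M) \<Longrightarrow> (\<lambda>x. \<phi> (x # w)) \<in> linear_maps K M N"
  shows "multilinear K M N \<phi>"
  unfolding multilinear_def
proof (intro conjI ballI)
  show "\<phi> \<in> lists (carrier M) \<rightarrow> carrier N"
  proof
    fix w assume "w \<in> lists (carrier M)"
    then show "\<phi> w \<in> carrier N"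
      using assms(1) multilinear_closed[OF assms(2)] by (cases w) auto
  qed
  fix u v assume "u \<in> lists (carrier M)" "v \<in> lists (carrier M)"
  then show "(\<lambda>x. \<phi> (u @ [x] @ v)) \<in> linear_maps K M N"
    using assms(3) multilinear_linear[OF assms(2)] by (cases u) auto
qed

lemma word_rels_cases:
  assumes "r \<in> word_rels K M"
  obtains
    (add) u x y v where "u \<in> lists (carrier M)" "v \<in> lists (carrier M)" "x \<in> carrier M" "y \<in> carrier M"
      "r = basis_vec K (u @ [x \<oplus>\<^bsub>M\<^esub> y] @ v) \<ominus>\<^bsub>free_module K (lists (carrier M))\<^esub>
        (basis_vec K (u @ [x] @ v) \<oplus>\<^bsub>free_module K (lists (carrier M))\<^esub> basis_vec K (u @ [y] @ v))"
  | (smult) u k x v where "u \<in> lists (carrier M)" "v \<in> lists (carrier M)" "k \<in> carrier K" "x \<in> carrier M"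
      "r = basis_vec K (u @ [k \<odot>\<^bsub>M\<^esub> x] @ v) \<ominus>\<^bsub>free_module K (lists (carrier M))\<^esub>
        (k \<odot>\<^bsub>free_module K (lists (carrier M))\<^esub> basis_vec K (u @ [x] @ v))"
  using assms unfolding word_rels_def Let_def by blast

lemma word_relsI:
  shows word_rels_add: "\<lbrakk>u \<in> lists (carrier M); v \<in> lists (carrier M); x \<in> carrier M; y \<in> carrier M\<rbrakk> \<Longrightarrow>
      basis_vec K (u @ [x \<oplus>\<^bsub>M\<^esub> y] @ v) \<ominus>\<^bsub>free_module K (lists (carrier M))\<^esub>
        (basis_vec K (u @ [x] @ v) \<oplus>\<^bsub>free_module K (lists (carrier M))\<^esub> basis_vec K (u @ [y] @ v)) \<in> word_rels K M"
    and word_rels_smult: "\<lbrakk>u \<in> lists (carrier M); v \<in> lists (carrier M); k \<in> carrier K; x \<in> carrier M\<rbrakk> \<Longrightarrow>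
      basis_vec K (u @ [k \<odot>\<^bsub>M\<^esub> x] @ v) \<ominus>\<^bsub>free_module K (lists (carrier M))\<^esub>
        (k \<odot>\<^bsub>free_module K (lists (carrier M))\<^esub> basis_vec K (u @ [x] @ v)) \<in> word_rels K M"
  unfolding word_rels_def Let_def
   apply (rule UnI1, intro CollectI exI conjI, rule refl; assumption)
  apply (rule UnI2, intro CollectI exI conjI, rule refl; assumption)
  done

lemma word_rels_closed:
  assumes "module K M"
  shows "word_rels K M \<subseteq> carrier (free_module K (lists (carrier M)))"
proof
  interpret M: module K M by fact
  have K: "cring K" ..
  interpret F: module K "free_module K (lists (carrier M))" by (rule module_free_module[OF K])
  fix r assume "r \<in> word_rels K M"
  then show "r \<in> carrier (free_module K (lists (carrier M)))"
    by (cases rule: word_rels_cases) (simp_all add: basis_vec_closed[OF K])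
qed

lemma module_word_module: "module K M \<Longrightarrow> module K (word_module K M)"
  unfolding word_module_def by (intro module_presented_module word_rels_closed) (rule module_cring)

lemma generating_family_pure_tensor:
  assumes "module K M"
  shows "generating_family K (word_module K M) (pure_tensor K M) (lists (carrier M))"
  using generating_family_presented_gen[OF module_cring[OF assms] word_rels_closed[OF assms]]
  by (simp add: word_module_def pure_tensor_def[abs_def])

lemma multilinear_pure_tensor:
  assumes M: "module K M"
  shows "multilinear K M (word_module K M) (pure_tensor K M)"
proof -
  interpret M: module K M by fact
  let ?F = "free_module K (lists (carrier M))" and ?T = "word_module K M"
  have K: "cring K" ..
  note F = module_free_module[OF K, of "lists (carrier M)"]
  interpret F: module K ?F by (rule F)
  note T = module_word_module[OF M]
  interpret T: module K ?T by (rule T)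
  obtain p where p: "p \<in> linear_maps K ?F ?T"
    and pb: "\<And>g. p (basis_vec K g) = presented_gen K (lists (carrier M)) (word_rels K M) g"
    and pz: "\<And>x. x \<in> word_rels K M \<Longrightarrow> p x = \<zero>\<^bsub>?T\<^esub>"
    by (rule presented_projection[OF K word_rels_closed[OF M], folded word_module_def]) (rule that)
  have t: "pure_tensor K M w = p (basis_vec K w)" for w
    by (simp add: pure_tensor_def pb)
  note lin = linear_maps_add[OF p] linear_maps_smult[OF p] linear_maps_minus[OF F T p]
    linear_maps_closed[OF p]
  note bc = basis_vec_closed[OF K, of _ "lists (carrier M)"]
  have eqI: "p a = p b" if "a \<ominus>\<^bsub>?F\<^esub> b \<in> word_rels K M" "a \<in> carrier ?F" "b \<in> carrier ?F" for a b
    using pz[OF that(1)] that(2,3) by (simp add: lin T.M.minus_eq_zero_iff)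
  show ?thesis
    unfolding multilinear_def
  proof (intro conjI ballI linear_mapsI)
    fix u v x y
    assume *: "u \<in> lists (carrier M)" "v \<in> lists (carrier M)" "x \<in> carrier M" "y \<in> carrier M"
    have "p (basis_vec K (u @ [x \<oplus>\<^bsub>M\<^esub> y] @ v)) =
        p (basis_vec K (u @ [x] @ v) \<oplus>\<^bsub>?F\<^esub> basis_vec K (u @ [y] @ v))"
      by (rule eqI[OF word_rels_add]) (use * in \<open>auto simp: bc\<close>)
    then show "pure_tensor K M (u @ [x \<oplus>\<^bsub>M\<^esub> y] @ v) =
        pure_tensor K M (u @ [x] @ v) \<oplus>\<^bsub>?T\<^esub> pure_tensor K M (u @ [y] @ v)"
      using * by (simp add: t lin bc)
  next
    fix u v k x
    assume *: "u \<in> lists (carrier M)" "v \<in> lists (carrier M)" "k \<in> carrier K" "x \<in> carrier M"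
    have "p (basis_vec K (u @ [k \<odot>\<^bsub>M\<^esub> x] @ v)) = p (k \<odot>\<^bsub>?F\<^esub> basis_vec K (u @ [x] @ v))"
      by (rule eqI[OF word_rels_smult]) (use * in \<open>auto simp: bc\<close>)
    then show "pure_tensor K M (u @ [k \<odot>\<^bsub>M\<^esub> x] @ v) = k \<odot>\<^bsub>?T\<^esub> pure_tensor K M (u @ [x] @ v)"
      using * by (simp add: t lin bc)
  qed (auto simp: t lin bc)
qed

text \<open>The two kinds of relations between words say precisely that each position is additive
  and homogeneous, so a multilinear family respects them.\<close>

lemma extends_linearly_word_module:
  assumes M: "module K M" and N: "module K N" and \<phi>: "multilinear K M N \<phi>"
  shows "extends_linearly K (word_module K M) (pure_tensor K M) (lists (carrier M)) N \<phi>"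
proof -
  interpret M: module K M by fact
  interpret N: module K N by fact
  let ?F = "free_module K (lists (carrier M))"
  have K: "cring K" ..
  note F = module_free_module[OF K, of "lists (carrier M)"]
  interpret F: module K ?F by (rule F)
  have "extends_linearly K (presented_module K (lists (carrier M)) (word_rels K M))
      (presented_gen K (lists (carrier M)) (word_rels K M)) (lists (carrier M)) N \<phi>"
  proof (rule extends_linearly_presented_module[OF K word_rels_closed[OF M] N multilinear_closed[OF \<phi>]])
    fix h r
    assume h: "h \<in> linear_maps K ?F N"
      and hb: "\<And>w. w \<in> lists (carrier M) \<Longrightarrow> h (basis_vec K w) = \<phi> w"
      and r: "r \<in> word_rels K M"
    note simps = linear_maps_add[OF h] linear_maps_smult[OF h] linear_maps_minus[OF F N h] hb
      basis_vec_closed[OF K, of _ "lists (carrier M)"] N.M.minus_eq_zero_iff multilinear_closed[OF \<phi>]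
    from r show "h r = \<zero>\<^bsub>N\<^esub>"
    proof (cases rule: word_rels_cases)
      case (add u x y v)
      then show ?thesis
        using linear_maps_add[OF multilinear_linear[OF \<phi> add(1,2)] add(3,4)] by (simp add: simps)
    next
      case (smult u k x v)
      then show ?thesis
        using linear_maps_smult[OF multilinear_linear[OF \<phi> smult(1,2)] smult(3,4)] by (simp add: simps)
    qed
  qed
  then show ?thesis by (simp add: word_module_def pure_tensor_def[abs_def])
qed

lemma multilinear_cong:
  assumes M: "module K M" and "multilinear K M N \<phi>" "\<And>w. w \<in> lists (carrier M) \<Longrightarrow> \<phi> w = \<psi> w"
  shows "multilinear K M N \<psi>"
  unfolding multilinear_def
proof (intro conjI ballI)
  show "\<psi> \<in> lists (carrier M) \<rightarrow> carrier N"
    using multilinear_closed[OF assms(2)] by (auto simp flip: assms(3))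
  fix u v assume *: "u \<in> lists (carrier M)" "v \<in> lists (carrier M)"
  show "(\<lambda>x. \<psi> (u @ [x] @ v)) \<in> linear_maps K M N"
    by (rule linear_maps_cong[OF M multilinear_linear[OF assms(2) *]]) (use * in \<open>auto intro!: assms(3)\<close>)
qed

lemma multilinear_compose:
  assumes "multilinear K M N \<phi>" "h \<in> linear_maps K N L"
  shows "multilinear K M L (\<lambda>w. h (\<phi> w))"
  unfolding multilinear_def
proof (intro conjI ballI)
  show "(\<lambda>w. h (\<phi> w)) \<in> lists (carrier M) \<rightarrow> carrier L"
    by (intro funcsetI linear_maps_closed[OF assms(2)] multilinear_closed[OF assms(1)])
  fix u v assume "u \<in> lists (carrier M)" "v \<in> lists (carrier M)"
  then show "(\<lambda>x. h (\<phi> (u @ [x] @ v))) \<in> linear_maps K M L"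
    by (rule linear_maps_compose[OF multilinear_linear[OF assms(1)] assms(2)])
qed

lemma multilinear_add:
  assumes N: "module K N" and "multilinear K M N \<phi>" "multilinear K M N \<psi>"
  shows "multilinear K M N (\<lambda>w. \<phi> w \<oplus>\<^bsub>N\<^esub> \<psi> w)"
proof -
  interpret N: module K N by fact
  show ?thesis
    unfolding multilinear_def
  proof (intro conjI ballI)
    show "(\<lambda>w. \<phi> w \<oplus>\<^bsub>N\<^esub> \<psi> w) \<in> lists (carrier M) \<rightarrow> carrier N"
      by (intro funcsetI N.M.a_closed multilinear_closed[OF assms(2)] multilinear_closed[OF assms(3)])
    fix u v assume *: "u \<in> lists (carrier M)" "v \<in> lists (carrier M)"
    show "(\<lambda>x. \<phi> (u @ [x] @ v) \<oplus>\<^bsub>N\<^esub> \<psi> (u @ [x] @ v)) \<in> linear_maps K M N"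
      by (rule linear_maps_add_map[OF N multilinear_linear[OF assms(2) *] multilinear_linear[OF assms(3) *]])
  qed
qed

lemma multilinear_minus:
  assumes N: "module K N" and \<phi>: "multilinear K M N \<phi>" and \<psi>: "multilinear K M N \<psi>"
  shows "multilinear K M N (\<lambda>w. \<phi> w \<ominus>\<^bsub>N\<^esub> \<psi> w)"
proof -
  interpret N: module K N by fact
  show ?thesis
    unfolding multilinear_def
    using linear_maps_minus_map[OF N multilinear_linear[OF \<phi>] multilinear_linear[OF \<psi>]]
      multilinear_closed[OF \<phi>] multilinear_closed[OF \<psi>] by auto
qed

lemma multilinear_zero: "module K N \<Longrightarrow> multilinear K M N (\<lambda>_. \<zero>\<^bsub>N\<^esub>)"
  unfolding multilinear_def
  by (auto intro!: linear_maps_zero_map abelian_monoid.zero_closed simp: module_def abelian_group_def)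

section \<open>Algebras\<close>

text \<open>The algebras are obtained by overwriting \<open>mult\<close> and \<open>one\<close> in a
  module record, and the module axioms see only the remaining fields.\<close>

lemma module_record_cong:
  assumes M: "module K M"
    and eq: "carrier M' = carrier M" "add M' = add M" "zero M' = zero M" "smult M' = smult M"
  shows "module K M'"
proof -
  interpret M: module K M by fact
  show ?thesis
  proof (intro moduleI abelian_groupI)
    show "cring K" ..
    show "\<exists>y\<in>carrier M'. y \<oplus>\<^bsub>M'\<^esub> x = \<zero>\<^bsub>M'\<^esub>" if "x \<in> carrier M'" for x
      using that by (intro bexI[of _ "\<ominus>\<^bsub>M\<^esub> x"]) (simp_all add: eq M.M.l_neg)
  qed (simp_all add: eq M.M.a_ac M.smult_l_distr M.smult_r_distr M.smult_assoc1)
qed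

lemma bilinear_maps_record_cong:
  assumes "carrier M' = carrier M" "add M' = add M" "smult M' = smult M"
    and "carrier N' = carrier N" "add N' = add N" "smult N' = smult N"
    and "carrier L' = carrier L" "add L' = add L" "smult L' = smult L"
  shows "bilinear_maps K M' N' L' = bilinear_maps K M N L"
  using assms by (simp add: bilinear_maps_def linear_maps_def)

lemma bilinear_maps_precompose:
  assumes b: "b \<in> bilinear_maps K M N L" and f: "f \<in> linear_maps K M' M" and g: "g \<in> linear_maps K N' N"
  shows "(\<lambda>x y. b (f x) (g y)) \<in> bilinear_maps K M' N' L"
proof (rule bilinear_mapsI)
  show "(\<lambda>y. b (f x) (g y)) \<in> linear_maps K N' L" if "x \<in> carrier M'" for x
    by (rule linear_maps_compose[OF g bilinear_maps_right[OF b linear_maps_closed[OF f that]]])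
  show "(\<lambda>x. b (f x) (g y)) \<in> linear_maps K M' L" if "y \<in> carrier N'" for y
    by (rule linear_maps_compose[OF f bilinear_maps_left[OF b linear_maps_closed[OF g that]]])
qed

text \<open>The common treatment of all products: tensor products of algebras, symmetric algebras,
  shuffles and the product on \<open>C2_T\<close>. The hypothesis on \<open>P\<close> matches the
  condition in the definition of the product with a prescription on pairs of generators.\<close>

lemma the_bilinear_eval:
  assumes M: "module K M" and N: "module K N" and L: "module K L"
    and G: "generating_family K M \<gamma> G" and H: "generating_family K N \<delta> H"
    and l: "\<And>h. h \<in> H \<Longrightarrow> extends_linearly K M \<gamma> G L (\<lambda>g. \<phi> g h)"
    and r: "\<And>g. g \<in> G \<Longrightarrow> extends_linearly K N \<delta> H L (\<phi> g)"
    and P: "\<And>p. P p \<longleftrightarrow> (\<forall>g\<in>G. \<forall>h\<in>H. p (\<gamma> g) (\<delta> h) = \<phi> g h)"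
  shows "the_bilinear K M N L P \<in> bilinear_maps K M N L"
    and "\<And>g h. \<lbrakk>g \<in> G; h \<in> H\<rbrakk> \<Longrightarrow> the_bilinear K M N L P (\<gamma> g) (\<delta> h) = \<phi> g h"
proof -
  obtain b where b: "b \<in> bilinear_maps K M N L"
    "\<And>g h. \<lbrakk>g \<in> G; h \<in> H\<rbrakk> \<Longrightarrow> b (\<gamma> g) (\<delta> h) = \<phi> g h"
    by (rule bilinear_extension[OF M N L G H l r]) (assumption | rule that)+
  have "the_bilinear K M N L P \<in> bilinear_maps K M N L \<and> P (the_bilinear K M N L P)"
    using generating_family_closed[OF G] generating_family_closed[OF H]
    by (intro the_bilinear_ex1[OF M N L G H b(1)]) (auto simp: P b(2))
  then show "the_bilinear K M N L P \<in> bilinear_maps K M N L"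
    and "\<And>g h. \<lbrakk>g \<in> G; h \<in> H\<rbrakk> \<Longrightarrow> the_bilinear K M N L P (\<gamma> g) (\<delta> h) = \<phi> g h"
    by (auto simp: P)
qed

lemma the_linear_eval:
  assumes M: "module K M" and N: "module K N" and G: "generating_family K M \<gamma> G"
    and e: "extends_linearly K M \<gamma> G N \<phi>" and P: "\<And>p. P p \<longleftrightarrow> (\<forall>g\<in>G. p (\<gamma> g) = \<phi> g)"
  shows "the_linear K M N P \<in> linear_maps K M N"
    and "\<And>g. g \<in> G \<Longrightarrow> the_linear K M N P (\<gamma> g) = \<phi> g"
proof -
  obtain h where h: "h \<in> linear_maps K M N" "\<And>g. g \<in> G \<Longrightarrow> h (\<gamma> g) = \<phi> g"
    by (rule extends_linearlyE[OF e]) (rule that)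
  have "the_linear K M N P \<in> linear_maps K M N \<and> P (the_linear K M N P)"
    using generating_family_closed[OF G]
    by (intro the_linear_ex1[OF M N G h(1)]) (auto simp: P h(2))
  then show "the_linear K M N P \<in> linear_maps K M N"
    and "\<And>g. g \<in> G \<Longrightarrow> the_linear K M N P (\<gamma> g) = \<phi> g"
    by (auto simp: P)
qed

lemma (in algebra) smult_assoc3:
  "\<lbrakk>a \<in> carrier R; x \<in> carrier M; y \<in> carrier M\<rbrakk> \<Longrightarrow> x \<otimes>\<^bsub>M\<^esub> (a \<odot>\<^bsub>M\<^esub> y) = a \<odot>\<^bsub>M\<^esub> (x \<otimes>\<^bsub>M\<^esub> y)"
  using smult_assoc2[of a y x] by (simp add: cring.cring_simprules(14)[OF M_cring])

lemma algebra_mult_bilinear: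
  assumes "algebra K A"
  shows "mult A \<in> bilinear_maps K A A A"
proof -
  interpret cA: cring A using assms by (simp add: algebra.M_cring)
  interpret mA: module K A using assms by (simp add: algebra.module)
  interpret A: algebra K A by fact
  show ?thesis
    by (intro bilinear_mapsI linear_mapsI)
      (simp_all add: cA.r_distr cA.l_distr mA.smult_r_distr A.smult_assoc2 A.smult_assoc3)
qed

text \<open>Each law equates maps that are linear in every argument, so it can be checked on
  generators. For associativity \<open>assoc1\<close>, \<open>assoc2\<close> and
  \<open>assoc3\<close> release the three arguments one after the other.\<close>

lemma algebraI_generators:
  assumes M: "module K M" and G: "generating_family K M \<gamma> G"
    and b: "mult M \<in> bilinear_maps K M M M" and one: "\<one>\<^bsub>M\<^esub> \<in> carrier M"
    and comm: "\<And>g h. \<lbrakk>g \<in> G; h \<in> G\<rbrakk> \<Longrightarrow> \<gamma> g \<otimes>\<^bsub>M\<^esub> \<gamma> h = \<gamma> h \<otimes>\<^bsub>M\<^esub> \<gamma> g"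
    and assoc: "\<And>g h k. \<lbrakk>g \<in> G; h \<in> G; k \<in> G\<rbrakk> \<Longrightarrow>
      (\<gamma> g \<otimes>\<^bsub>M\<^esub> \<gamma> h) \<otimes>\<^bsub>M\<^esub> \<gamma> k = \<gamma> g \<otimes>\<^bsub>M\<^esub> (\<gamma> h \<otimes>\<^bsub>M\<^esub> \<gamma> k)"
    and unit: "\<And>g. g \<in> G \<Longrightarrow> \<one>\<^bsub>M\<^esub> \<otimes>\<^bsub>M\<^esub> \<gamma> g = \<gamma> g"
  shows "algebra K M"
proof -
  interpret M: module K M by fact
  note g = generating_family_closed[OF G]
  note c = bilinear_maps_closed[OF b]
  note lin_r = bilinear_maps_right[OF b] and lin_l = bilinear_maps_left[OF b]
  have comm': "x \<otimes>\<^bsub>M\<^esub> y = y \<otimes>\<^bsub>M\<^esub> x" if "x \<in> carrier M" "y \<in> carrier M" for x y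
    by (rule bilinear_maps_eqI[OF M M M G G b bilinear_maps_flip[OF b] comm that])
  have unit': "\<one>\<^bsub>M\<^esub> \<otimes>\<^bsub>M\<^esub> x = x" if "x \<in> carrier M" for x
    by (rule linear_maps_eqI[OF M M G lin_r[OF one] linear_maps_ident unit that])
  have assoc1: "(x \<otimes>\<^bsub>M\<^esub> \<gamma> h) \<otimes>\<^bsub>M\<^esub> \<gamma> k = x \<otimes>\<^bsub>M\<^esub> (\<gamma> h \<otimes>\<^bsub>M\<^esub> \<gamma> k)"
    if "x \<in> carrier M" "h \<in> G" "k \<in> G" for x h k
    by (rule linear_maps_eqI[OF M M G linear_maps_compose[OF lin_l lin_l] lin_l assoc])
      (use that in \<open>simp_all add: g c\<close>)
  have assoc2: "(x \<otimes>\<^bsub>M\<^esub> y) \<otimes>\<^bsub>M\<^esub> \<gamma> k = x \<otimes>\<^bsub>M\<^esub> (y \<otimes>\<^bsub>M\<^esub> \<gamma> k)"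
    if "x \<in> carrier M" "y \<in> carrier M" "k \<in> G" for x y k
    by (rule linear_maps_eqI[OF M M G linear_maps_compose[OF lin_r lin_l]
          linear_maps_compose[OF lin_l lin_r] assoc1])
      (use that in \<open>simp_all add: g c\<close>)
  have assoc3: "(x \<otimes>\<^bsub>M\<^esub> y) \<otimes>\<^bsub>M\<^esub> z = x \<otimes>\<^bsub>M\<^esub> (y \<otimes>\<^bsub>M\<^esub> z)"
    if "x \<in> carrier M" "y \<in> carrier M" "z \<in> carrier M" for x y z
    by (rule linear_maps_eqI[OF M M G lin_r linear_maps_compose[OF lin_r lin_r] assoc2])
      (use that in \<open>simp_all add: g c\<close>)
  have "cring M"
  proof (rule cringI)
    show "abelian_group M" ..
    show "comm_monoid M"
      by (rule comm_monoidI) (simp_all add: c one assoc3 unit', rule comm')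
  qed (simp add: bilinear_maps_add_left[OF b])
  moreover have "cring K" ..
  ultimately show ?thesis
    by (intro algebraI) (simp_all add: M.smult_l_distr M.smult_r_distr M.smult_assoc1
        bilinear_maps_smult_left[OF b])
qed

lemma tensor_algebra_product_simps:
  "carrier (tensor_algebra_product K A B) = carrier (tensor_module K A B)"
  "zero (tensor_algebra_product K A B) = zero (tensor_module K A B)"
  "add (tensor_algebra_product K A B) = add (tensor_module K A B)"
  "smult (tensor_algebra_product K A B) = smult (tensor_module K A B)"
  "one (tensor_algebra_product K A B) = tensor K A B \<one>\<^bsub>A\<^esub> \<one>\<^bsub>B\<^esub>"
  by (simp_all add: tensor_algebra_product_def Let_def)

lemma tensor_algebra_product_mult:
  assumes A: "algebra K A" and B: "algebra K B"
  shows tensor_algebra_product_bilinear: "mult (tensor_algebra_product K A B) \<in>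
      bilinear_maps K (tensor_module K A B) (tensor_module K A B) (tensor_module K A B)"
    and tensor_algebra_product_tensor:
      "\<lbrakk>a \<in> carrier A; b \<in> carrier B; a' \<in> carrier A; b' \<in> carrier B\<rbrakk> \<Longrightarrow>
        tensor K A B a b \<otimes>\<^bsub>tensor_algebra_product K A B\<^esub> tensor K A B a' b' =
        tensor K A B (a \<otimes>\<^bsub>A\<^esub> a') (b \<otimes>\<^bsub>B\<^esub> b')"
proof -
  interpret cA: cring A using assms by (simp add: algebra.M_cring)
  interpret mA: module K A using assms by (simp add: algebra.module)
  interpret A: algebra K A by fact
  interpret cB: cring B using assms by (simp add: algebra.M_cring)
  interpret mB: module K B using assms by (simp add: algebra.module)
  interpret B: algebra K B by fact
  have mA: "module K A" and mB: "module K B" by (rule A.module, rule B.module)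
  note P = module_tensor_module[OF mA mB] and t = tensor_bilinear[OF mA mB]
  note gen = generating_family_tensor_carrier[OF mA mB]
  note bA = algebra_mult_bilinear[OF A] and bB = algebra_mult_bilinear[OF B]
  let ?P = "tensor_module K A B" and ?t = "tensor K A B" and ?G = "carrier A \<times> carrier B"
  let ?\<phi> = "\<lambda>(a, b) (a', b'). ?t (a \<otimes>\<^bsub>A\<^esub> a') (b \<otimes>\<^bsub>B\<^esub> b')"
  have l: "extends_linearly K ?P (\<lambda>(x, y). ?t x y) ?G ?P (\<lambda>g. ?\<phi> g h)" if h: "h \<in> ?G" for h
  proof -
    obtain a' b' where ab: "h = (a', b')" "a' \<in> carrier A" "b' \<in> carrier B" using h by auto
    obtain q where "q \<in> linear_maps K ?P ?P"
      "\<And>x y. \<lbrakk>x \<in> carrier A; y \<in> carrier B\<rbrakk> \<Longrightarrow> q (?t x y) = ?t (x \<otimes>\<^bsub>A\<^esub> a') (y \<otimes>\<^bsub>B\<^esub> b')"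
      by (rule linear_map_tensor[OF mA mB P
            bilinear_maps_precompose[OF t bilinear_maps_left[OF bA ab(2)] bilinear_maps_left[OF bB ab(3)]]])
        (rule that)
    then show ?thesis by (intro extends_linearlyI[of q]) (auto simp: ab(1))
  qed
  have r: "extends_linearly K ?P (\<lambda>(x, y). ?t x y) ?G ?P (?\<phi> g)" if g: "g \<in> ?G" for g
  proof -
    obtain a b where ab: "g = (a, b)" "a \<in> carrier A" "b \<in> carrier B" using g by auto
    obtain q where "q \<in> linear_maps K ?P ?P"
      "\<And>x y. \<lbrakk>x \<in> carrier A; y \<in> carrier B\<rbrakk> \<Longrightarrow> q (?t x y) = ?t (a \<otimes>\<^bsub>A\<^esub> x) (b \<otimes>\<^bsub>B\<^esub> y)"
      by (rule linear_map_tensor[OF mA mB P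
            bilinear_maps_precompose[OF t bilinear_maps_right[OF bA ab(2)] bilinear_maps_right[OF bB ab(3)]]])
        (rule that)
    then show ?thesis by (intro extends_linearlyI[of q]) (auto simp: ab(1))
  qed
  have P: "(\<forall>a\<in>carrier A. \<forall>b\<in>carrier B. \<forall>a'\<in>carrier A. \<forall>b'\<in>carrier B.
      p (?t a b) (?t a' b') = ?t (a \<otimes>\<^bsub>A\<^esub> a') (b \<otimes>\<^bsub>B\<^esub> b')) \<longleftrightarrow>
    (\<forall>g\<in>?G. \<forall>h\<in>?G. p (case g of (x, y) \<Rightarrow> ?t x y) (case h of (x, y) \<Rightarrow> ?t x y) = ?\<phi> g h)" for p
    by auto
  note ev = the_bilinear_eval[OF module_tensor_module[OF mA mB] module_tensor_module[OF mA mB]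
      module_tensor_module[OF mA mB] gen gen l r P]
  show "mult (tensor_algebra_product K A B) \<in> bilinear_maps K ?P ?P ?P"
    using ev(1) by (simp add: tensor_algebra_product_def Let_def)
  show "?t a b \<otimes>\<^bsub>tensor_algebra_product K A B\<^esub> ?t a' b' = ?t (a \<otimes>\<^bsub>A\<^esub> a') (b \<otimes>\<^bsub>B\<^esub> b')"
    if "a \<in> carrier A" "b \<in> carrier B" "a' \<in> carrier A" "b' \<in> carrier B"
    using ev(2)[of "(a, b)" "(a', b')"] that by (simp add: tensor_algebra_product_def Let_def)
qed

lemma algebra_tensor_algebra_product:
  assumes A: "algebra K A" and B: "algebra K B"
  shows "algebra K (tensor_algebra_product K A B)"
proof -
  interpret cA: cring A using assms by (simp add: algebra.M_cring)
  interpret mA: module K A using assms by (simp add: algebra.module)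
  interpret A: algebra K A by fact
  interpret cB: cring B using assms by (simp add: algebra.M_cring)
  interpret mB: module K B using assms by (simp add: algebra.module)
  interpret B: algebra K B by fact
  have mA: "module K A" and mB: "module K B" by (rule A.module, rule B.module)
  let ?P = "tensor_algebra_product K A B"
  note s = tensor_algebra_product_simps[of K A B]
  note bil = tensor_algebra_product_bilinear[OF A B]
  note prod = tensor_algebra_product_tensor[OF A B]
  note closed = bilinear_maps_closed[OF tensor_bilinear[OF mA mB]]
  have gen: "generating_family K ?P (\<lambda>(x, y). tensor K A B x y) (carrier A \<times> carrier B)"
    using generating_family_tensor_carrier[OF mA mB]
    by (simp add: generating_family_record_cong[of ?P "tensor_module K A B"] s)
  show ?thesis
  proof (rule algebraI_generators[OF module_record_cong[OF module_tensor_module[OF mA mB]] gen])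
    show "mult ?P \<in> bilinear_maps K ?P ?P ?P"
      using bil by (simp add: bilinear_maps_record_cong[of ?P "tensor_module K A B" ?P "tensor_module K A B"
            ?P "tensor_module K A B"] s)
  qed (auto simp: s closed prod cA.m_ac cB.m_ac)
qed

section \<open>Symmetric algebras\<close>

lemma monomial_rels_cases:
  assumes "r \<in> monomial_rels K M"
  obtains
    (add) x y A where "A \<in> monomials (carrier M)" "x \<in> carrier M" "y \<in> carrier M"
      "r = basis_vec K (add_mset (x \<oplus>\<^bsub>M\<^esub> y) A) \<ominus>\<^bsub>free_module K (monomials (carrier M))\<^esub>
        (basis_vec K (add_mset x A) \<oplus>\<^bsub>free_module K (monomials (carrier M))\<^esub> basis_vec K (add_mset y A))"
  | (smult) k x A where "A \<in> monomials (carrier M)" "k \<in> carrier K" "x \<in> carrier M"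
      "r = basis_vec K (add_mset (k \<odot>\<^bsub>M\<^esub> x) A) \<ominus>\<^bsub>free_module K (monomials (carrier M))\<^esub>
        (k \<odot>\<^bsub>free_module K (monomials (carrier M))\<^esub> basis_vec K (add_mset x A))"
  using assms unfolding monomial_rels_def Let_def by blast

lemma monomial_relsI:
  shows monomial_rels_add: "\<lbrakk>A \<in> monomials (carrier M); x \<in> carrier M; y \<in> carrier M\<rbrakk> \<Longrightarrow>
      basis_vec K (add_mset (x \<oplus>\<^bsub>M\<^esub> y) A) \<ominus>\<^bsub>free_module K (monomials (carrier M))\<^esub>
        (basis_vec K (add_mset x A) \<oplus>\<^bsub>free_module K (monomials (carrier M))\<^esub> basis_vec K (add_mset y A))
      \<in> monomial_rels K M"
    and monomial_rels_smult: "\<lbrakk>A \<in> monomials (carrier M); k \<in> carrier K; x \<in> carrier M\<rbrakk> \<Longrightarrow>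
      basis_vec K (add_mset (k \<odot>\<^bsub>M\<^esub> x) A) \<ominus>\<^bsub>free_module K (monomials (carrier M))\<^esub>
        (k \<odot>\<^bsub>free_module K (monomials (carrier M))\<^esub> basis_vec K (add_mset x A)) \<in> monomial_rels K M"
  unfolding monomial_rels_def Let_def
   apply (rule UnI1, intro CollectI exI conjI, rule refl; assumption)
  apply (rule UnI2, intro CollectI exI conjI, rule refl; assumption)
  done

lemma monomials_simps [simp]:
  "{#} \<in> monomials X" "add_mset x A \<in> monomials X \<longleftrightarrow> x \<in> X \<and> A \<in> monomials X"
  "A + B \<in> monomials X \<longleftrightarrow> A \<in> monomials X \<and> B \<in> monomials X"
  by (auto simp: monomials_def)

lemma monomial_rels_closed:
  assumes "module K M"
  shows "monomial_rels K M \<subseteq> carrier (free_module K (monomials (carrier M)))"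
proof
  interpret M: module K M by fact
  have K: "cring K" ..
  interpret F: module K "free_module K (monomials (carrier M))" by (rule module_free_module[OF K])
  fix r assume "r \<in> monomial_rels K M"
  then show "r \<in> carrier (free_module K (monomials (carrier M)))"
    by (cases rule: monomial_rels_cases) (simp_all add: basis_vec_closed[OF K])
qed

lemma Sym_simps:
  "carrier (Sym K M) = carrier (presented_module K (monomials (carrier M)) (monomial_rels K M))"
  "zero (Sym K M) = zero (presented_module K (monomials (carrier M)) (monomial_rels K M))"
  "add (Sym K M) = add (presented_module K (monomials (carrier M)) (monomial_rels K M))"
  "smult (Sym K M) = smult (presented_module K (monomials (carrier M)) (monomial_rels K M))"
  "one (Sym K M) = monomial K M {#}"
  by (simp_all add: Sym_def Let_def)

lemma module_Sym:
  assumes "module K M" shows "module K (Sym K M)"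
  by (rule module_record_cong[OF module_presented_module[OF module_cring[OF assms] monomial_rels_closed[OF assms]]])
    (simp_all add: Sym_simps)

lemma generating_family_monomial:
  assumes "module K M"
  shows "generating_family K (Sym K M) (monomial K M) (monomials (carrier M))"
  using generating_family_presented_gen[OF module_cring[OF assms] monomial_rels_closed[OF assms]]
  by (simp add: monomial_def[abs_def] generating_family_record_cong[OF Sym_simps(1,3,4,2)])

lemma monomial_linear:
  assumes M: "module K M" and A: "A \<in> monomials (carrier M)"
  shows "(\<lambda>x. monomial K M (add_mset x A)) \<in> linear_maps K M (Sym K M)"
proof -
  interpret M: module K M by fact
  let ?F = "free_module K (monomials (carrier M))"
  let ?T = "presented_module K (monomials (carrier M)) (monomial_rels K M)"
  have K: "cring K" ..
  note F = module_free_module[OF K, of "monomials (carrier M)"]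
  interpret F: module K ?F by (rule F)
  note T = module_presented_module[OF K monomial_rels_closed[OF M]]
  interpret T: module K ?T by (rule T)
  obtain p where p: "p \<in> linear_maps K ?F ?T"
    and pb: "\<And>g. p (basis_vec K g) = presented_gen K (monomials (carrier M)) (monomial_rels K M) g"
    and pz: "\<And>x. x \<in> monomial_rels K M \<Longrightarrow> p x = \<zero>\<^bsub>?T\<^esub>"
    by (rule presented_projection[OF K monomial_rels_closed[OF M]]) (rule that)
  have t: "monomial K M w = p (basis_vec K w)" for w
    by (simp add: monomial_def pb)
  note lin = linear_maps_add[OF p] linear_maps_smult[OF p] linear_maps_minus[OF F T p]
    linear_maps_closed[OF p]
  note bc = basis_vec_closed[OF K, of _ "monomials (carrier M)"]
  have eqI: "p a = p b" if "a \<ominus>\<^bsub>?F\<^esub> b \<in> monomial_rels K M" "a \<in> carrier ?F" "b \<in> carrier ?F" for a b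
    using pz[OF that(1)] that(2,3) by (simp add: lin T.M.minus_eq_zero_iff)
  show ?thesis
  proof (rule linear_mapsI)
    fix x y assume *: "x \<in> carrier M" "y \<in> carrier M"
    have "p (basis_vec K (add_mset (x \<oplus>\<^bsub>M\<^esub> y) A)) =
        p (basis_vec K (add_mset x A) \<oplus>\<^bsub>?F\<^esub> basis_vec K (add_mset y A))"
      by (rule eqI[OF monomial_rels_add]) (use A * in \<open>auto simp: bc\<close>)
    then show "monomial K M (add_mset (x \<oplus>\<^bsub>M\<^esub> y) A) =
        monomial K M (add_mset x A) \<oplus>\<^bsub>Sym K M\<^esub> monomial K M (add_mset y A)"
      using A * by (simp add: t lin bc Sym_simps)
  next
    fix k x assume *: "k \<in> carrier K" "x \<in> carrier M"
    have "p (basis_vec K (add_mset (k \<odot>\<^bsub>M\<^esub> x) A)) = p (k \<odot>\<^bsub>?F\<^esub> basis_vec K (add_mset x A))"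
      by (rule eqI[OF monomial_rels_smult]) (use A * in \<open>auto simp: bc\<close>)
    then show "monomial K M (add_mset (k \<odot>\<^bsub>M\<^esub> x) A) = k \<odot>\<^bsub>Sym K M\<^esub> monomial K M (add_mset x A)"
      using A * by (simp add: t lin bc Sym_simps)
  qed (use A in \<open>simp add: t lin bc Sym_simps\<close>)
qed

text \<open>A multiset has no order, so any factor of a monomial can be displayed by
  \<open>add_mset\<close>; linearity in this one factor covers all of them.\<close>

lemma extends_linearly_Sym:
  assumes M: "module K M" and N: "module K N"
    and closed: "\<And>A. A \<in> monomials (carrier M) \<Longrightarrow> \<phi> A \<in> carrier N"
    and lin: "\<And>A. A \<in> monomials (carrier M) \<Longrightarrow> (\<lambda>x. \<phi> (add_mset x A)) \<in> linear_maps K M N"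
  shows "extends_linearly K (Sym K M) (monomial K M) (monomials (carrier M)) N \<phi>"
proof -
  interpret M: module K M by fact
  interpret N: module K N by fact
  let ?F = "free_module K (monomials (carrier M))"
  have K: "cring K" ..
  note F = module_free_module[OF K, of "monomials (carrier M)"]
  interpret F: module K ?F by (rule F)
  have "extends_linearly K (presented_module K (monomials (carrier M)) (monomial_rels K M))
      (presented_gen K (monomials (carrier M)) (monomial_rels K M)) (monomials (carrier M)) N \<phi>"
  proof (rule extends_linearly_presented_module[OF K monomial_rels_closed[OF M] N closed])
    fix h r
    assume h: "h \<in> linear_maps K ?F N"
      and hb: "\<And>w. w \<in> monomials (carrier M) \<Longrightarrow> h (basis_vec K w) = \<phi> w"
      and r: "r \<in> monomial_rels K M"
    note simps = linear_maps_add[OF h] linear_maps_smult[OF h] linear_maps_minus[OF F N h] hb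
      basis_vec_closed[OF K, of _ "monomials (carrier M)"] N.M.minus_eq_zero_iff closed
    from r show "h r = \<zero>\<^bsub>N\<^esub>"
    proof (cases rule: monomial_rels_cases)
      case (add x y A)
      then show ?thesis
        using linear_maps_add[OF lin[OF add(1)] add(2,3)] by (simp add: simps)
    next
      case (smult k x A)
      then show ?thesis
        using linear_maps_smult[OF lin[OF smult(1)] smult(2,3)] by (simp add: simps)
    qed
  qed
  moreover have "linear_maps K (Sym K M) N =
      linear_maps K (presented_module K (monomials (carrier M)) (monomial_rels K M)) N"
    by (rule linear_maps_record_cong) (simp_all add: Sym_simps)
  ultimately show ?thesis by (simp add: monomial_def[abs_def] extends_linearly_def)
qed

lemma Sym_mult:
  assumes M: "module K M"
  shows Sym_mult_bilinear: "mult (Sym K M) \<in> bilinear_maps K (Sym K M) (Sym K M) (Sym K M)"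
    and Sym_mult_monomial: "\<lbrakk>A \<in> monomials (carrier M); B \<in> monomials (carrier M)\<rbrakk> \<Longrightarrow>
      monomial K M A \<otimes>\<^bsub>Sym K M\<^esub> monomial K M B = monomial K M (A + B)"
proof -
  let ?S = "presented_module K (monomials (carrier M)) (monomial_rels K M)" and ?m = "monomial K M"
  let ?G = "monomials (carrier M)"
  note S = module_presented_module[OF module_cring[OF M] monomial_rels_closed[OF M]]
  note gen = generating_family_monomial[OF M]
  have lin: "linear_maps K (Sym K M) (Sym K M) = linear_maps K ?S ?S"
    and bil: "bilinear_maps K (Sym K M) (Sym K M) (Sym K M) = bilinear_maps K ?S ?S ?S"
    and gen': "generating_family K ?S ?m ?G"
    using gen by (simp_all add: linear_maps_def bilinear_maps_def Sym_simps generating_family_def)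
  have l: "extends_linearly K (Sym K M) ?m ?G (Sym K M) (\<lambda>A. ?m (A + B))" if B: "B \<in> ?G" for B
  proof (rule extends_linearly_Sym[OF M module_Sym[OF M]])
    show "?m (A + B) \<in> carrier (Sym K M)" if "A \<in> ?G" for A
      using B that by (intro generating_family_closed[OF gen]) simp
    show "(\<lambda>x. ?m (add_mset x A + B)) \<in> linear_maps K M (Sym K M)" if "A \<in> ?G" for A
      using monomial_linear[OF M, of "A + B"] B that by simp
  qed
  have l': "extends_linearly K ?S ?m ?G ?S (\<lambda>A. ?m (A + B))" if "B \<in> ?G" for B
    using l[OF that] by (simp add: extends_linearly_def lin)
  have r': "extends_linearly K ?S ?m ?G ?S (\<lambda>B. ?m (A + B))" if "A \<in> ?G" for A
    using l'[OF that] by (simp add: add.commute)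
  have P: "(\<forall>A\<in>?G. \<forall>B\<in>?G. p (?m A) (?m B) = ?m (A + B)) \<longleftrightarrow>
      (\<forall>A\<in>?G. \<forall>B\<in>?G. p (?m A) (?m B) = ?m (A + B))" for p ..
  note ev = the_bilinear_eval[where \<phi> = "\<lambda>A B. ?m (A + B)", OF S S S gen' gen' l' r' P]
  show "mult (Sym K M) \<in> bilinear_maps K (Sym K M) (Sym K M) (Sym K M)"
    unfolding bil using ev(1) by (simp add: Sym_def Let_def)
  show "?m A \<otimes>\<^bsub>Sym K M\<^esub> ?m B = ?m (A + B)" if "A \<in> ?G" "B \<in> ?G"
    using ev(2)[of A B] that by (simp add: Sym_def Let_def)
qed

lemma algebra_Sym:
  assumes M: "module K M" shows "algebra K (Sym K M)"
  by (rule algebraI_generators[OF module_Sym[OF M] generating_family_monomial[OF M] Sym_mult_bilinear[OF M]])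
    (auto simp: Sym_simps(5) Sym_mult_monomial[OF M] add_ac
      intro: generating_family_closed[OF generating_family_monomial[OF M]])

lemma Sym_incl_linear:
  assumes "module K M" shows "Sym_incl K M \<in> linear_maps K M (Sym K M)"
  using monomial_linear[OF assms, of "{#}"] by (simp add: Sym_incl_def[abs_def])

text \<open>An ideal absorbs ring elements, and a scalar acts like the ring element that is its
  multiple of the unit.\<close>

lemma ideal_submodule:
  assumes A: "algebra K A" and J: "ideal J A"
  shows "submodule J K A"
proof -
  interpret cA: cring A using assms by (simp add: algebra.M_cring)
  interpret mA: module K A using assms by (simp add: algebra.module)
  interpret A: algebra K A by fact
  interpret J: ideal J A by fact
  show ?thesis
  proof (rule mA.submoduleI)
    fix k x assume k: "k \<in> carrier K" and x: "x \<in> J"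
    then have "k \<odot>\<^bsub>A\<^esub> x = (k \<odot>\<^bsub>A\<^esub> \<one>\<^bsub>A\<^esub>) \<otimes>\<^bsub>A\<^esub> x"
      using A.smult_assoc2[of k "\<one>\<^bsub>A\<^esub>" x] J.a_Hcarr[OF x] by simp
    then show "k \<odot>\<^bsub>A\<^esub> x \<in> J"
      using k x J.I_l_closed[OF x, of "k \<odot>\<^bsub>A\<^esub> \<one>\<^bsub>A\<^esub>"] by simp
  qed (use J.a_subset in auto)
qed

lemma quotient_module_mult:
  assumes "ideal J A" "x \<in> carrier A" "y \<in> carrier A"
  shows "(J +>\<^bsub>A\<^esub> x) \<otimes>\<^bsub>quotient_module A J\<^esub> (J +>\<^bsub>A\<^esub> y) = J +>\<^bsub>A\<^esub> (x \<otimes>\<^bsub>A\<^esub> y)"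
  using ideal.rcoset_mult_add[OF assms] by (simp add: quotient_module_simps)

lemma algebra_quotient_module:
  assumes A: "algebra K A" and J: "ideal J A"
  shows "algebra K (quotient_module A J)"
proof -
  interpret cA: cring A using assms by (simp add: algebra.M_cring)
  interpret mA: module K A using assms by (simp add: algebra.module)
  interpret A: algebra K A by fact
  note mA = A.module
  note H = ideal_submodule[OF A J]
  note Q = module_quotient_module[OF mA H]
  note lin = coset_linear[OF mA H] and mult = quotient_module_mult[OF J]
  let ?Q = "quotient_module A J"
  note flips = linear_maps_add[OF lin] linear_maps_smult[OF lin]
  show ?thesis
  proof (rule algebraI_generators[OF Q generating_family_quotient_module[OF mA H generating_family_ident]])
    show "mult ?Q \<in> bilinear_maps K ?Q ?Q ?Q"
      by (intro bilinear_mapsI linear_mapsI)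
        (auto elim!: quotient_module_carrierE simp: linear_maps_closed[OF lin] mult cA.r_distr cA.l_distr
          A.smult_assoc2 A.smult_assoc3 simp flip: flips)
    show "\<one>\<^bsub>?Q\<^esub> \<in> carrier ?Q"
      by (simp add: quotient_module_simps(3) linear_maps_closed[OF lin])
  qed (simp_all add: mult quotient_module_simps(3) cA.m_ac)
qed

section \<open>The shuffle product\<close>

lemma (in abelian_monoid) finsum_Suc_front:
  assumes "\<And>i. i < Suc n \<Longrightarrow> f i \<in> carrier G"
  shows "(\<Oplus>i\<in>{0..<Suc n}. f i) = f 0 \<oplus> (\<Oplus>i\<in>{0..<n}. f (Suc i))"
proof -
  have "{0..<Suc n} = insert 0 (Suc ` {0..<n})" by (auto simp: image_iff less_Suc_eq_0_disj)
  then have "(\<Oplus>i\<in>{0..<Suc n}. f i) = f 0 \<oplus> (\<Oplus>i\<in>Suc ` {0..<n}. f i)"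
    using assms by (simp add: Pi_def)
  also have "(\<Oplus>i\<in>Suc ` {0..<n}. f i) = (\<Oplus>i\<in>{0..<n}. f (Suc i))"
    using assms by (intro finsum_reindex) (auto simp: Pi_def)
  finally show ?thesis .
qed

lemma (in abelian_monoid) finsum_swap:
  assumes "\<And>i j. \<lbrakk>i < n; j < m\<rbrakk> \<Longrightarrow> f i j \<in> carrier G"
  shows "(\<Oplus>i\<in>{0..<n::nat}. \<Oplus>j\<in>{0..<m::nat}. f i j) = (\<Oplus>j\<in>{0..<m}. \<Oplus>i\<in>{0..<n}. f i j)"
  using assms
proof (induction n arbitrary: f)
  case 0
  then show ?case by simp
next
  case (Suc n)
  have "(\<Oplus>i\<in>{0..<Suc n}. \<Oplus>j\<in>{0..<m}. f i j) =
      (\<Oplus>j\<in>{0..<m}. f 0 j) \<oplus> (\<Oplus>i\<in>{0..<n}. \<Oplus>j\<in>{0..<m}. f (Suc i) j)"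
    using Suc.prems by (intro finsum_Suc_front finsum_closed) auto
  also have "\<dots> = (\<Oplus>j\<in>{0..<m}. f 0 j) \<oplus> (\<Oplus>j\<in>{0..<m}. \<Oplus>i\<in>{0..<n}. f (Suc i) j)"
    using Suc.IH[of "\<lambda>i. f (Suc i)"] Suc.prems by simp
  also have "\<dots> = (\<Oplus>j\<in>{0..<m}. f 0 j \<oplus> (\<Oplus>i\<in>{0..<n}. f (Suc i) j))"
    using Suc.prems by (intro finsum_addf[symmetric]) (auto intro!: finsum_closed)
  also have "\<dots> = (\<Oplus>j\<in>{0..<m}. \<Oplus>i\<in>{0..<Suc n}. f i j)"
    using Suc.prems
    by (intro finsum_cong' finsum_Suc_front[symmetric]) (auto intro!: finsum_closed)
  finally show ?case .
qed

text \<open>The indices are the lengths of two prefixes. \<open>c\<close>, \<open>a\<close> and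
  \<open>b\<close> are the summands for the words \<open>x # f\<close> and \<open>y # g\<close>, for
  \<open>f\<close> and \<open>y # g\<close>, and for \<open>x # f\<close> and \<open>g\<close>;
  \<open>X\<close> and \<open>Y\<close> prefix the letters \<open>x\<close> and \<open>y\<close>. A
  prefix of length zero cannot supply the first letter, which accounts for the boundary rules, and
  at (0, 0) nothing is left to remove.\<close>

lemma finsum_shuffle_rec:
  assumes M: "module K M" and X: "X \<in> linear_maps K M M" and Y: "Y \<in> linear_maps K M M"
    and a: "\<And>i j. a i j \<in> carrier M" and b: "\<And>i j. b i j \<in> carrier M" and c: "c 0 0 \<in> carrier M"
    and c0: "\<And>j. j < m \<Longrightarrow> c 0 (Suc j) = Y (b 0 j)"
    and cS: "\<And>i. i < n \<Longrightarrow> c (Suc i) 0 = X (a i 0)"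
    and cSS: "\<And>i j. \<lbrakk>i < n; j < m\<rbrakk> \<Longrightarrow> c (Suc i) (Suc j) = X (a i (Suc j)) \<oplus>\<^bsub>M\<^esub> Y (b (Suc i) j)"
  shows "(\<Oplus>\<^bsub>M\<^esub> i\<in>{0..<Suc n}. \<Oplus>\<^bsub>M\<^esub> j\<in>{0..<Suc m}. c i j) =
    c 0 0 \<oplus>\<^bsub>M\<^esub> (X (\<Oplus>\<^bsub>M\<^esub> i\<in>{0..<n}. \<Oplus>\<^bsub>M\<^esub> j\<in>{0..<Suc m}. a i j) \<oplus>\<^bsub>M\<^esub>
      Y (\<Oplus>\<^bsub>M\<^esub> i\<in>{0..<Suc n}. \<Oplus>\<^bsub>M\<^esub> j\<in>{0..<m}. b i j))"
proof -
  interpret M: module K M by fact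
  note Xc = linear_maps_closed[OF X] and Yc = linear_maps_closed[OF Y]
  have c': "c i j \<in> carrier M" if "i < Suc n" "j < Suc m" for i j
    using that c c0 cS cSS a b Xc Yc by (cases i; cases j) auto
  let ?xa = "\<Oplus>\<^bsub>M\<^esub> i\<in>{0..<n}. X (a i 0)"
  let ?xA = "\<Oplus>\<^bsub>M\<^esub> i\<in>{0..<n}. \<Oplus>\<^bsub>M\<^esub> j\<in>{0..<m}. X (a i (Suc j))"
  let ?yb = "\<Oplus>\<^bsub>M\<^esub> j\<in>{0..<m}. Y (b 0 j)"
  let ?yB = "\<Oplus>\<^bsub>M\<^esub> i\<in>{0..<n}. \<Oplus>\<^bsub>M\<^esub> j\<in>{0..<m}. Y (b (Suc i) j)"
  have fc: "finsum M f S \<in> carrier M" if "\<And>i. f i \<in> carrier M" for f and S :: "nat set"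
    using that by (intro M.M.finsum_closed) auto
  note cl = fc Pi_I a b Xc Yc M.M.a_closed
  have "(\<Oplus>\<^bsub>M\<^esub> i\<in>{0..<Suc n}. \<Oplus>\<^bsub>M\<^esub> j\<in>{0..<Suc m}. c i j) =
      (\<Oplus>\<^bsub>M\<^esub> j\<in>{0..<Suc m}. c 0 j) \<oplus>\<^bsub>M\<^esub> (\<Oplus>\<^bsub>M\<^esub> i\<in>{0..<n}. \<Oplus>\<^bsub>M\<^esub> j\<in>{0..<Suc m}. c (Suc i) j)"
    by (intro M.M.finsum_Suc_front M.M.finsum_closed) (auto intro: c')
  also have "(\<Oplus>\<^bsub>M\<^esub> j\<in>{0..<Suc m}. c 0 j) = c 0 0 \<oplus>\<^bsub>M\<^esub> (\<Oplus>\<^bsub>M\<^esub> j\<in>{0..<m}. c 0 (Suc j))"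
    by (intro M.M.finsum_Suc_front) (auto intro: c')
  also have "(\<Oplus>\<^bsub>M\<^esub> j\<in>{0..<m}. c 0 (Suc j)) = ?yb"
    by (intro M.M.finsum_cong') (intro cl | simp add: c0)+
  also have "(\<Oplus>\<^bsub>M\<^esub> i\<in>{0..<n}. \<Oplus>\<^bsub>M\<^esub> j\<in>{0..<Suc m}. c (Suc i) j) =
      (\<Oplus>\<^bsub>M\<^esub> i\<in>{0..<n}. X (a i 0) \<oplus>\<^bsub>M\<^esub>
        ((\<Oplus>\<^bsub>M\<^esub> j\<in>{0..<m}. X (a i (Suc j))) \<oplus>\<^bsub>M\<^esub> (\<Oplus>\<^bsub>M\<^esub> j\<in>{0..<m}. Y (b (Suc i) j))))"
  proof (rule M.M.finsum_cong')
    fix i assume i: "i \<in> {0..<n}"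
    have "(\<Oplus>\<^bsub>M\<^esub> j\<in>{0..<Suc m}. c (Suc i) j) = c (Suc i) 0 \<oplus>\<^bsub>M\<^esub> (\<Oplus>\<^bsub>M\<^esub> j\<in>{0..<m}. c (Suc i) (Suc j))"
      using i by (intro M.M.finsum_Suc_front) (auto intro: c')
    also have "(\<Oplus>\<^bsub>M\<^esub> j\<in>{0..<m}. c (Suc i) (Suc j)) =
        (\<Oplus>\<^bsub>M\<^esub> j\<in>{0..<m}. X (a i (Suc j)) \<oplus>\<^bsub>M\<^esub> Y (b (Suc i) j))"
      using i by (intro M.M.finsum_cong') (intro cl | simp add: cSS)+
    also have "\<dots> = (\<Oplus>\<^bsub>M\<^esub> j\<in>{0..<m}. X (a i (Suc j))) \<oplus>\<^bsub>M\<^esub> (\<Oplus>\<^bsub>M\<^esub> j\<in>{0..<m}. Y (b (Suc i) j))"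
      by (intro M.M.finsum_addf) (intro cl)+
    finally show "(\<Oplus>\<^bsub>M\<^esub> j\<in>{0..<Suc m}. c (Suc i) j) = X (a i 0) \<oplus>\<^bsub>M\<^esub>
        ((\<Oplus>\<^bsub>M\<^esub> j\<in>{0..<m}. X (a i (Suc j))) \<oplus>\<^bsub>M\<^esub> (\<Oplus>\<^bsub>M\<^esub> j\<in>{0..<m}. Y (b (Suc i) j)))"
      using i by (simp add: cS)
  qed (intro cl | simp)+
  also have "\<dots> = ?xa \<oplus>\<^bsub>M\<^esub> (?xA \<oplus>\<^bsub>M\<^esub> ?yB)"
    by (subst M.M.finsum_addf, (intro cl)+, subst M.M.finsum_addf, (intro cl)+, rule refl)
  also have "(c 0 0 \<oplus>\<^bsub>M\<^esub> ?yb) \<oplus>\<^bsub>M\<^esub> (?xa \<oplus>\<^bsub>M\<^esub> (?xA \<oplus>\<^bsub>M\<^esub> ?yB)) =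
      c 0 0 \<oplus>\<^bsub>M\<^esub> ((?xa \<oplus>\<^bsub>M\<^esub> ?xA) \<oplus>\<^bsub>M\<^esub> (?yb \<oplus>\<^bsub>M\<^esub> ?yB))"
  proof -
    have "?xa \<in> carrier M" "?xA \<in> carrier M" "?yb \<in> carrier M" "?yB \<in> carrier M"
      by (intro cl)+
    then show ?thesis using c by (simp add: M.M.a_ac)
  qed
  also have "?xa \<oplus>\<^bsub>M\<^esub> ?xA = X (\<Oplus>\<^bsub>M\<^esub> i\<in>{0..<n}. \<Oplus>\<^bsub>M\<^esub> j\<in>{0..<Suc m}. a i j)"
  proof -
    have "X (\<Oplus>\<^bsub>M\<^esub> i\<in>{0..<n}. \<Oplus>\<^bsub>M\<^esub> j\<in>{0..<Suc m}. a i j) =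
        (\<Oplus>\<^bsub>M\<^esub> i\<in>{0..<n}. X (\<Oplus>\<^bsub>M\<^esub> j\<in>{0..<Suc m}. a i j))"
      by (rule linear_maps_finsum[OF M M X]) (intro cl)+
    also have "\<dots> = (\<Oplus>\<^bsub>M\<^esub> i\<in>{0..<n}. X (a i 0) \<oplus>\<^bsub>M\<^esub> (\<Oplus>\<^bsub>M\<^esub> j\<in>{0..<m}. X (a i (Suc j))))"
    proof (rule M.M.finsum_cong')
      fix i
      have "X (\<Oplus>\<^bsub>M\<^esub> j\<in>{0..<Suc m}. a i j) = (\<Oplus>\<^bsub>M\<^esub> j\<in>{0..<Suc m}. X (a i j))"
        by (rule linear_maps_finsum[OF M M X]) (intro cl)+
      then show "X (\<Oplus>\<^bsub>M\<^esub> j\<in>{0..<Suc m}. a i j) = X (a i 0) \<oplus>\<^bsub>M\<^esub> (\<Oplus>\<^bsub>M\<^esub> j\<in>{0..<m}. X (a i (Suc j)))"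
        by (simp add: M.M.finsum_Suc_front Xc a)
    qed (intro cl | simp)+
    also have "\<dots> = ?xa \<oplus>\<^bsub>M\<^esub> ?xA"
      by (rule M.M.finsum_addf) (intro cl)+
    finally show ?thesis ..
  qed
  also have "?yb \<oplus>\<^bsub>M\<^esub> ?yB = Y (\<Oplus>\<^bsub>M\<^esub> i\<in>{0..<Suc n}. \<Oplus>\<^bsub>M\<^esub> j\<in>{0..<m}. b i j)"
  proof -
    have "Y (\<Oplus>\<^bsub>M\<^esub> i\<in>{0..<Suc n}. \<Oplus>\<^bsub>M\<^esub> j\<in>{0..<m}. b i j) =
        (\<Oplus>\<^bsub>M\<^esub> i\<in>{0..<Suc n}. Y (\<Oplus>\<^bsub>M\<^esub> j\<in>{0..<m}. b i j))"
      by (rule linear_maps_finsum[OF M M Y]) (intro cl)+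
    also have "\<dots> = (\<Oplus>\<^bsub>M\<^esub> i\<in>{0..<Suc n}. \<Oplus>\<^bsub>M\<^esub> j\<in>{0..<m}. Y (b i j))"
      by (intro M.M.finsum_cong' linear_maps_finsum[OF M M Y] refl cl)
    also have "\<dots> = ?yb \<oplus>\<^bsub>M\<^esub> ?yB"
      by (rule M.M.finsum_Suc_front) (intro cl)+
    finally show ?thesis ..
  qed
  finally show ?thesis .
qed

text \<open>Two inductions: the outer one shortens the second word, the inner one shortens the part
  \<open>u\<close> of the first word in front of the varying letter. When this letter is in front,
  the bilinear map \<open>p\<close> takes care of it. The extra term \<open>e\<close> is zero for
  plain shuffles and the pairing of the two full words for the deformed product.\<close>

lemma shuffle_rec_multilinear:
  assumes M: "module K M" and N: "module K N" and p: "p \<in> bilinear_maps K M N N"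
    and closed: "\<And>f g. \<lbrakk>f \<in> lists (carrier M); g \<in> lists (carrier M)\<rbrakk> \<Longrightarrow> F f g \<in> carrier N"
    and nil: "multilinear K M N (\<lambda>f. F f [])"
    and e: "\<And>g. g \<in> lists (carrier M) \<Longrightarrow> multilinear K M N (\<lambda>f. e f g)"
    and rec: "\<And>x f y g. \<lbrakk>x \<in> carrier M; f \<in> lists (carrier M); y \<in> carrier M; g \<in> lists (carrier M)\<rbrakk> \<Longrightarrow>
      F (x # f) (y # g) = (p x (F f (y # g)) \<oplus>\<^bsub>N\<^esub> p y (F (x # f) g)) \<oplus>\<^bsub>N\<^esub> e (x # f) (y # g)"
    and g: "g \<in> lists (carrier M)"
  shows "multilinear K M N (\<lambda>f. F f g)"
  using g
proof (induction g)
  case Nil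
  then show ?case using nil by simp
next
  case (Cons y g)
  then have y: "y \<in> carrier M" and g: "g \<in> lists (carrier M)" and IH: "multilinear K M N (\<lambda>f. F f g)"
    by auto
  have yg: "y # g \<in> lists (carrier M)" using y g by simp
  have "(\<lambda>x. F (u @ [x] @ v) (y # g)) \<in> linear_maps K M N"
    if "u \<in> lists (carrier M)" and v: "v \<in> lists (carrier M)" for u v
    using that(1)
  proof (induction u)
    case Nil
    have "(\<lambda>x. (p x (F v (y # g)) \<oplus>\<^bsub>N\<^esub> p y (F (x # v) g)) \<oplus>\<^bsub>N\<^esub> e (x # v) (y # g)) \<in> linear_maps K M N"
      by (rule linear_maps_add_map[OF N linear_maps_add_map[OF N bilinear_maps_left[OF p closed[OF v yg]]
            linear_maps_compose[OF multilinear_ConsD(2)[OF IH v] bilinear_maps_right[OF p y]]]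
            multilinear_ConsD(2)[OF e[OF yg] v]])
    then show ?case
      by (rule linear_maps_cong[OF M]) (use rec v y g in simp)
  next
    case (Cons a u)
    then have a: "a \<in> carrier M" and u: "u \<in> lists (carrier M)"
      and IH': "(\<lambda>x. F (u @ [x] @ v) (y # g)) \<in> linear_maps K M N" by auto
    have au: "a # u \<in> lists (carrier M)" using a u by simp
    have "(\<lambda>x. (p a (F (u @ [x] @ v) (y # g)) \<oplus>\<^bsub>N\<^esub> p y (F ((a # u) @ [x] @ v) g)) \<oplus>\<^bsub>N\<^esub>
        e ((a # u) @ [x] @ v) (y # g)) \<in> linear_maps K M N"
      by (rule linear_maps_add_map[OF N linear_maps_add_map[OF N
              linear_maps_compose[OF IH' bilinear_maps_right[OF p a]]
              linear_maps_compose[OF multilinear_linear[OF IH au v] bilinear_maps_right[OF p y]]]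
            multilinear_linear[OF e[OF yg] au v]])
    then show ?case
      by (rule linear_maps_cong[OF M]) (use rec[of a "u @ [_] @ v" y g] a u v y g in simp)
  qed
  then show ?case
    unfolding multilinear_def using closed yg by auto
qed

lemma shuffle_algebra_simps:
  "carrier (shuffle_algebra K M) = carrier (word_module K M)"
  "zero (shuffle_algebra K M) = zero (word_module K M)"
  "add (shuffle_algebra K M) = add (word_module K M)"
  "smult (shuffle_algebra K M) = smult (word_module K M)"
  "one (shuffle_algebra K M) = pure_tensor K M []"
  by (simp_all add: shuffle_algebra_def Let_def)

lemma linear_maps_shuffle_algebra:
  "linear_maps K (shuffle_algebra K M) N = linear_maps K (word_module K M) N"
  "linear_maps K L (shuffle_algebra K M) = linear_maps K L (word_module K M)"
  by (simp_all add: linear_maps_def shuffle_algebra_simps)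

lemma module_shuffle_algebra:
  assumes "module K M" shows "module K (shuffle_algebra K M)"
  by (rule module_record_cong[OF module_word_module[OF assms]]) (simp_all add: shuffle_algebra_simps)

lemma generating_family_shuffle_algebra:
  assumes "module K M"
  shows "generating_family K (shuffle_algebra K M) (pure_tensor K M) (lists (carrier M))"
  using generating_family_pure_tensor[OF assms]
  by (simp add: generating_family_record_cong[OF shuffle_algebra_simps(1,3,4,2)])

lemma multilinear_pure_shuffle_algebra:
  assumes "module K M" shows "multilinear K M (shuffle_algebra K M) (pure_tensor K M)"
  using multilinear_pure_tensor[OF assms]
  by (simp add: multilinear_def linear_maps_shuffle_algebra shuffle_algebra_simps)

lemma extends_linearly_shuffle_algebra:
  assumes "module K M" "module K N" "multilinear K M N \<phi>"
  shows "extends_linearly K (shuffle_algebra K M) (pure_tensor K M) (lists (carrier M)) N \<phi>"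
  using extends_linearly_word_module[OF assms]
  by (simp add: extends_linearly_def linear_maps_shuffle_algebra)

text \<open>Left tensoring by a letter, as an operator on arbitrary tensors: in the shuffle
  recursion it is applied to sums of words.\<close>

definition word_cons ::
    "('k, 'x) ring_scheme \<Rightarrow> ('k, 'm, 'y) module_scheme \<Rightarrow> 'm \<Rightarrow> ('m list \<Rightarrow> 'k) set \<Rightarrow> ('m list \<Rightarrow> 'k) set"
  where "word_cons K M = (SOME b. b \<in> bilinear_maps K M (shuffle_algebra K M) (shuffle_algebra K M) \<and>
    (\<forall>x\<in>carrier M. \<forall>u\<in>lists (carrier M). b x (pure_tensor K M u) = pure_tensor K M (x # u)))"

lemma word_cons:
  assumes M: "module K M"
  shows word_cons_bilinear: "word_cons K M \<in> bilinear_maps K M (shuffle_algebra K M) (shuffle_algebra K M)"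
    and word_cons_pure: "\<lbrakk>x \<in> carrier M; u \<in> lists (carrier M)\<rbrakk> \<Longrightarrow>
      word_cons K M x (pure_tensor K M u) = pure_tensor K M (x # u)"
proof -
  let ?T = "shuffle_algebra K M"
  note T = module_shuffle_algebra[OF M] and ml = multilinear_pure_shuffle_algebra[OF M]
  have l: "extends_linearly K M (\<lambda>x. x) (carrier M) ?T (\<lambda>x. pure_tensor K M (x # u))"
    if "u \<in> lists (carrier M)" for u
    by (rule extends_linearly_ident[OF multilinear_ConsD(2)[OF ml that]])
  have r: "extends_linearly K ?T (pure_tensor K M) (lists (carrier M)) ?T (\<lambda>u. pure_tensor K M (x # u))"
    if "x \<in> carrier M" for x
    by (rule extends_linearly_shuffle_algebra[OF M T multilinear_ConsD(1)[OF ml that]])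
  obtain b where b: "b \<in> bilinear_maps K M ?T ?T"
    "\<And>x u. \<lbrakk>x \<in> carrier M; u \<in> lists (carrier M)\<rbrakk> \<Longrightarrow> b x (pure_tensor K M u) = pure_tensor K M (x # u)"
    by (rule bilinear_extension[OF M T T generating_family_ident generating_family_shuffle_algebra[OF M] l r])
      (assumption | rule that)+
  have *: "word_cons K M \<in> bilinear_maps K M ?T ?T \<and>
      (\<forall>x\<in>carrier M. \<forall>u\<in>lists (carrier M). word_cons K M x (pure_tensor K M u) = pure_tensor K M (x # u))"
    unfolding word_cons_def by (rule someI[of _ b]) (simp add: b del: in_lists_conv_set)
  show "word_cons K M \<in> bilinear_maps K M ?T ?T"
    using * by (rule conjunct1)
  show "word_cons K M x (pure_tensor K M u) = pure_tensor K M (x # u)"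
    if "x \<in> carrier M" "u \<in> lists (carrier M)"
    using *[THEN conjunct2, rule_format, OF that] .
qed

lemma take_drop_lists:
  "f \<in> lists X \<Longrightarrow> take i f \<in> lists X" "f \<in> lists X \<Longrightarrow> drop i f \<in> lists X"
  by (auto dest: in_set_takeD in_set_dropD)

lemma set_word_shuffle: "h \<in> set (word_shuffle f g) \<Longrightarrow> set h = set f \<union> set g"
proof (induction f g arbitrary: h rule: word_shuffle.induct)
  case (3 x xs y ys)
  from "3.prems" consider h' where "h = x # h'" "h' \<in> set (word_shuffle xs (y # ys))"
    | h' where "h = y # h'" "h' \<in> set (word_shuffle (x # xs) ys)" by auto
  then show ?case
  proof cases
    case 1
    then show ?thesis using "3.IH"(1)[OF 1(2)] by auto
  next
    case 2
    then show ?thesis using "3.IH"(2)[OF 2(2)] by auto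
  qed
qed simp_all

lemma word_shuffle_lists:
  "\<lbrakk>f \<in> lists X; g \<in> lists X; h \<in> set (word_shuffle f g)\<rbrakk> \<Longrightarrow> h \<in> lists X"
  using set_word_shuffle[of h f g] by (auto simp: in_lists_conv_set)

lemma word_shuffle_Nil2 [simp]: "word_shuffle f [] = [f]"
  by (cases f) auto

text \<open>The product is defined through the list of all shuffles. Prefixing a letter is linear,
  so the recursion of \<open>word_shuffle\<close> carries over to the sums \<open>F\<close>; from
  the recursion follows multilinearity, and only then is the product known to exist.\<close>

lemma shuffle_algebra_mult:
  assumes M: "module K M"
  shows shuffle_bilinear:
      "mult (shuffle_algebra K M) \<in> bilinear_maps K (shuffle_algebra K M) (shuffle_algebra K M) (shuffle_algebra K M)"
    and shuffle_Nil_left: "f \<in> lists (carrier M) \<Longrightarrow>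
      pure_tensor K M [] \<otimes>\<^bsub>shuffle_algebra K M\<^esub> pure_tensor K M f = pure_tensor K M f"
    and shuffle_Nil_right: "f \<in> lists (carrier M) \<Longrightarrow>
      pure_tensor K M f \<otimes>\<^bsub>shuffle_algebra K M\<^esub> pure_tensor K M [] = pure_tensor K M f"
    and shuffle_Cons: "\<lbrakk>x \<in> carrier M; f \<in> lists (carrier M); y \<in> carrier M; g \<in> lists (carrier M)\<rbrakk> \<Longrightarrow>
      pure_tensor K M (x # f) \<otimes>\<^bsub>shuffle_algebra K M\<^esub> pure_tensor K M (y # g) =
      word_cons K M x (pure_tensor K M f \<otimes>\<^bsub>shuffle_algebra K M\<^esub> pure_tensor K M (y # g)) \<oplus>\<^bsub>shuffle_algebra K M\<^esub>
      word_cons K M y (pure_tensor K M (x # f) \<otimes>\<^bsub>shuffle_algebra K M\<^esub> pure_tensor K M g)"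
proof -
  let ?T = "shuffle_algebra K M" and ?w = "pure_tensor K M" and ?W = "lists (carrier M)"
  note T = module_shuffle_algebra[OF M] and gen = generating_family_shuffle_algebra[OF M]
  note ml = multilinear_pure_shuffle_algebra[OF M] and cb = word_cons_bilinear[OF M]
  interpret T: module K ?T by (rule T)
  note wc = multilinear_closed[OF ml]
  define s where "s hs = foldr (\<lambda>h s. ?w h \<oplus>\<^bsub>?T\<^esub> s) hs \<zero>\<^bsub>?T\<^esub>" for hs
  have s_closed: "s hs \<in> carrier ?T" if "set hs \<subseteq> ?W" for hs
    using that by (induction hs) (auto simp: s_def wc)
  have s_append: "s (hs @ hs') = s hs \<oplus>\<^bsub>?T\<^esub> s hs'" if "set hs \<subseteq> ?W" "set hs' \<subseteq> ?W" for hs hs'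
    using that
  proof (induction hs)
    case Nil
    then show ?case using s_closed[of hs'] by (simp add: s_def)
  next
    case (Cons h hs)
    then have "s ((h # hs) @ hs') = ?w h \<oplus>\<^bsub>?T\<^esub> (s hs \<oplus>\<^bsub>?T\<^esub> s hs')" by (simp add: s_def)
    also have "\<dots> = s (h # hs) \<oplus>\<^bsub>?T\<^esub> s hs'"
      using Cons.prems s_closed[of hs] s_closed[of hs'] wc[of h] by (simp add: s_def T.M.a_assoc)
    finally show ?case .
  qed
  have s_map: "s (map ((#) x) hs) = word_cons K M x (s hs)" if "x \<in> carrier M" "set hs \<subseteq> ?W" for x hs
    using that(2)
  proof (induction hs)
    case Nil
    then show ?case using bilinear_maps_zero_right[OF T T cb that(1)] by (simp add: s_def)
  next
    case (Cons h hs)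
    then have h: "h \<in> ?W" and hs: "set hs \<subseteq> ?W" by auto
    have "s (map ((#) x) (h # hs)) = ?w (x # h) \<oplus>\<^bsub>?T\<^esub> s (map ((#) x) hs)" by (simp add: s_def)
    also have "\<dots> = word_cons K M x (?w h) \<oplus>\<^bsub>?T\<^esub> word_cons K M x (s hs)"
      using Cons.IH[OF hs] word_cons_pure[OF M that(1) h] by simp
    also have "\<dots> = word_cons K M x (s (h # hs))"
      using bilinear_maps_add_right[OF cb that(1) wc[OF h] s_closed[OF hs]] by (simp add: s_def)
    finally show ?case .
  qed
  define F where "F f g = s (word_shuffle f g)" for f g
  have sub: "set (word_shuffle f g) \<subseteq> ?W" if "f \<in> ?W" "g \<in> ?W" for f g
    using word_shuffle_lists[OF that] by blast
  have F_closed: "F f g \<in> carrier ?T" if "f \<in> ?W" "g \<in> ?W" for f g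
    unfolding F_def by (rule s_closed[OF sub[OF that]])
  have F_Nil: "F f [] = ?w f" "F [] f = ?w f" if "f \<in> ?W" for f
    using wc[OF that] by (simp_all add: F_def s_def)
  have F_Cons: "F (x # f) (y # g) = word_cons K M x (F f (y # g)) \<oplus>\<^bsub>?T\<^esub> word_cons K M y (F (x # f) g)"
    if "x \<in> carrier M" "f \<in> ?W" "y \<in> carrier M" "g \<in> ?W" for x f y g
  proof -
    have 1: "set (word_shuffle f (y # g)) \<subseteq> ?W" and 2: "set (word_shuffle (x # f) g) \<subseteq> ?W"
      using that by (intro sub; simp)+
    have 3: "set (map ((#) x) (word_shuffle f (y # g))) \<subseteq> ?W"
      "set (map ((#) y) (word_shuffle (x # f) g)) \<subseteq> ?W"
      using 1 2 that by (simp_all add: image_subset_iff del: in_lists_conv_set) blast+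
    show ?thesis
      using s_append[OF 3] s_map[OF that(1) 1] s_map[OF that(3) 2] by (simp add: F_def)
  qed
  note ml0 = multilinear_zero[OF T, of M]
  have nil: "multilinear K M ?T (\<lambda>f. F f [])" "multilinear K M ?T (\<lambda>f. F [] f)"
    by (rule multilinear_cong[OF M ml], simp only: F_Nil)+
  have left: "multilinear K M ?T (\<lambda>f. F f g)" if "g \<in> ?W" for g
  proof (rule shuffle_rec_multilinear[where e = "\<lambda>_ _. \<zero>\<^bsub>?T\<^esub>" and F = F, OF M T cb F_closed nil(1) ml0 _ that])
    fix x f y g assume *: "x \<in> carrier M" "f \<in> ?W" "y \<in> carrier M" "g \<in> ?W"
    have "F f (y # g) \<in> carrier ?T" "F (x # f) g \<in> carrier ?T"
      using * by (intro F_closed; simp)+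
    then show "F (x # f) (y # g) = (word_cons K M x (F f (y # g)) \<oplus>\<^bsub>?T\<^esub> word_cons K M y (F (x # f) g)) \<oplus>\<^bsub>?T\<^esub> \<zero>\<^bsub>?T\<^esub>"
      using F_Cons[OF *] * by (simp add: bilinear_maps_closed[OF cb])
  qed
  \<comment> \<open>Exchanging the two words only permutes the summands of the recursion, so the
    same lemma applies to the flipped function.\<close>
  have right: "multilinear K M ?T (F f)" if "f \<in> ?W" for f
  proof (rule shuffle_rec_multilinear[where e = "\<lambda>_ _. \<zero>\<^bsub>?T\<^esub>" and F = "\<lambda>g f. F f g",
        OF M T cb F_closed nil(2) ml0 _ that])
    fix y g x f assume *: "y \<in> carrier M" "g \<in> ?W" "x \<in> carrier M" "f \<in> ?W"
    have "F f (y # g) \<in> carrier ?T" "F (x # f) g \<in> carrier ?T"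
      using * by (intro F_closed; simp)+
    then show "F (x # f) (y # g) = (word_cons K M y (F (x # f) g) \<oplus>\<^bsub>?T\<^esub> word_cons K M x (F f (y # g))) \<oplus>\<^bsub>?T\<^esub> \<zero>\<^bsub>?T\<^esub>"
      using F_Cons[OF *(3,4,1,2)] * by (simp add: bilinear_maps_closed[OF cb] T.M.a_comm)
  qed
  have P: "(\<forall>f\<in>?W. \<forall>g\<in>?W. p (?w f) (?w g) =
        foldr (\<lambda>h s. ?w h \<oplus>\<^bsub>word_module K M\<^esub> s) (word_shuffle f g) \<zero>\<^bsub>word_module K M\<^esub>) \<longleftrightarrow>
      (\<forall>f\<in>?W. \<forall>g\<in>?W. p (?w f) (?w g) = F f g)" for p
    by (simp add: F_def s_def shuffle_algebra_simps)
  have lin: "bilinear_maps K (word_module K M) (word_module K M) (word_module K M) = bilinear_maps K ?T ?T ?T"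
    by (simp add: bilinear_maps_def linear_maps_shuffle_algebra shuffle_algebra_simps)
  \<comment> \<open>The definition selects the product over the record \<open>word_module\<close>,
    whose carrier, addition and scalar multiplication are those of the algebra being
    defined.\<close>
  have the: "the_bilinear K (word_module K M) (word_module K M) (word_module K M) =
      the_bilinear K ?T ?T ?T"
    by (simp add: the_bilinear_def fun_eq_iff lin shuffle_algebra_simps)
  note ev = the_bilinear_eval[where \<phi> = F, OF T T T gen gen
      extends_linearly_shuffle_algebra[OF M T left] extends_linearly_shuffle_algebra[OF M T right] P]
  have mult: "mult ?T = the_bilinear K (word_module K M) (word_module K M) (word_module K M) (\<lambda>p. \<forall>f\<in>?W. \<forall>g\<in>?W. p (?w f) (?w g) =
        foldr (\<lambda>h s. ?w h \<oplus>\<^bsub>word_module K M\<^esub> s) (word_shuffle f g) \<zero>\<^bsub>word_module K M\<^esub>)"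
    by (simp add: shuffle_algebra_def Let_def)
  show "mult ?T \<in> bilinear_maps K ?T ?T ?T"
    unfolding mult the by (rule ev(1))
  have F: "?w f \<otimes>\<^bsub>?T\<^esub> ?w g = F f g" if "f \<in> ?W" "g \<in> ?W" for f g
    unfolding mult the by (rule ev(2)[OF _ _ that])
  show "f \<in> ?W \<Longrightarrow> ?w [] \<otimes>\<^bsub>?T\<^esub> ?w f = ?w f" and "f \<in> ?W \<Longrightarrow> ?w f \<otimes>\<^bsub>?T\<^esub> ?w [] = ?w f"
    by (simp_all only: F F_Nil lists.Nil)
  show "?w (x # f) \<otimes>\<^bsub>?T\<^esub> ?w (y # g) = word_cons K M x (?w f \<otimes>\<^bsub>?T\<^esub> ?w (y # g)) \<oplus>\<^bsub>?T\<^esub>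
      word_cons K M y (?w (x # f) \<otimes>\<^bsub>?T\<^esub> ?w g)"
    if "x \<in> carrier M" "f \<in> ?W" "y \<in> carrier M" "g \<in> ?W"
    using that F_Cons[OF that] by (simp add: F)
qed

section \<open>Products on \<open>A \<otimes> T\<close> from shuffles and a pairing\<close>

text \<open>\<open>K\<close>, \<open>V\<close>, \<open>A\<close> and \<open>E\<close> stand for
  \<open>C\<close>, \<open>RT\<close>, \<open>C2\<close> and \<epsilon> extended by zero. This
  locale collects what holds before the relations of \<open>J2\<close> are imposed: the product on
  \<open>A\<close> tensor \<open>T\<close> is well defined and commutative on generators.\<close>

locale shuffle_pairing =
  fixes K :: "('k, 'x) ring_scheme" and V :: "('k, 'v, 'y) module_scheme"
    and A :: "('k, 'a, 'z) module_scheme"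
    and E :: "('v list \<Rightarrow> 'k) set \<Rightarrow> ('v list \<Rightarrow> 'k) set \<Rightarrow> 'a"
  assumes module_V: "module K V" and algebra_A: "algebra K A"
    and E_bilinear: "E \<in> bilinear_maps K (shuffle_algebra K V) (shuffle_algebra K V) A"
    and E_commute: "\<lbrakk>f \<in> lists (carrier V); g \<in> lists (carrier V)\<rbrakk> \<Longrightarrow>
      E (pure_tensor K V f) (pure_tensor K V g) = E (pure_tensor K V g) (pure_tensor K V f)"
    and E_Nil: "g \<in> lists (carrier V) \<Longrightarrow> E (pure_tensor K V []) (pure_tensor K V g) = \<zero>\<^bsub>A\<^esub>"
begin

abbreviation "T \<equiv> shuffle_algebra K V"
abbreviation "w \<equiv> pure_tensor K V"
abbreviation "W \<equiv> lists (carrier V)"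
abbreviation "P \<equiv> tensor_module K A T"
abbreviation "t \<equiv> tensor K A T"

lemma module_A: "module K A" and cring_A: "cring A"
  using algebra_A by (simp_all add: algebra.module algebra.M_cring)

lemmas module_T = module_shuffle_algebra[OF module_V]

lemmas module_P = module_tensor_module[OF module_A module_T]

interpretation cA: cring A by (rule cring_A)
interpretation mA: module K A by (rule module_A)
interpretation V: module K V by (rule module_V)
interpretation T: module K T by (rule module_T)
interpretation P: module K P by (rule module_P)

lemmas t_bilinear = tensor_bilinear[OF module_A module_T]
lemmas A_bilinear = algebra_mult_bilinear[OF algebra_A]
lemmas T_bilinear = shuffle_bilinear[OF module_V]
lemmas cons_bilinear = word_cons_bilinear[OF module_V]
lemmas gen_T = generating_family_shuffle_algebra[OF module_V]
lemmas w_multilinear = multilinear_pure_shuffle_algebra[OF module_V]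

lemmas w_closed [simp] = multilinear_closed[OF w_multilinear]
lemmas t_closed [simp] = bilinear_maps_closed[OF t_bilinear]
lemmas T_closed [simp] = bilinear_maps_closed[OF T_bilinear]
lemmas E_closed [simp] = bilinear_maps_closed[OF E_bilinear]

declare take_drop_lists [simp]
declare in_lists_conv_set [simp del]

lemmas gen_P = generating_family_tensor[OF module_A module_T generating_family_ident gen_T]

lemma linear_maps_P_eqI:
  assumes "module K N" "h \<in> linear_maps K P N" "h' \<in> linear_maps K P N"
    and "\<And>c f. \<lbrakk>c \<in> carrier A; f \<in> W\<rbrakk> \<Longrightarrow> h (t c (w f)) = h' (t c (w f))" and "p \<in> carrier P"
  shows "h p = h' p"
  by (rule linear_maps_eqI[OF module_P assms(1) gen_P assms(2,3) _ assms(5)]) (use assms(4) in auto)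

text \<open>The operator \<open>word_cons\<close> on the tensor factor, with the coefficient in
  \<open>A\<close> untouched.\<close>

definition pre :: "'v \<Rightarrow> ('a \<times> ('v list \<Rightarrow> 'k) set \<Rightarrow> 'k) set \<Rightarrow> ('a \<times> ('v list \<Rightarrow> 'k) set \<Rightarrow> 'k) set"
  where "pre = (SOME b. b \<in> bilinear_maps K V P P \<and>
    (\<forall>x\<in>carrier V. \<forall>c\<in>carrier A. \<forall>s\<in>carrier T. b x (t c s) = t c (word_cons K V x s)))"

lemma pre_properties:
  "pre \<in> bilinear_maps K V P P \<and>
    (\<forall>x\<in>carrier V. \<forall>c\<in>carrier A. \<forall>s\<in>carrier T. pre x (t c s) = t c (word_cons K V x s))"
proof -
  let ?G = "carrier A \<times> carrier T"
  have l: "extends_linearly K V (\<lambda>x. x) (carrier V) P (\<lambda>x. case h of (c, s) \<Rightarrow> t c (word_cons K V x s))"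
    if hG: "h \<in> ?G" for h
  proof -
    obtain c s where h: "h = (c, s)" "c \<in> carrier A" "s \<in> carrier T" using hG by auto
    have "(\<lambda>x. t c (word_cons K V x s)) \<in> linear_maps K V P"
      by (rule linear_maps_compose[OF bilinear_maps_left[OF cons_bilinear h(3)] bilinear_maps_right[OF t_bilinear h(2)]])
    from extends_linearly_ident[OF this] show ?thesis by (simp add: h(1))
  qed
  have r: "extends_linearly K P (\<lambda>(c, s). t c s) ?G P (\<lambda>h. case h of (c, s) \<Rightarrow> t c (word_cons K V x s))"
    if x: "x \<in> carrier V" for x
  proof -
    obtain q where q: "q \<in> linear_maps K P P"
      "\<And>c s. \<lbrakk>c \<in> carrier A; s \<in> carrier T\<rbrakk> \<Longrightarrow> q (t c s) = t c (word_cons K V x s)"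
      by (rule linear_map_tensor[OF module_A module_T module_P bilinear_maps_precompose[OF t_bilinear
            linear_maps_ident bilinear_maps_right[OF cons_bilinear x]]]) (rule that)
    show ?thesis by (rule extends_linearlyI[OF q(1)]) (auto simp: q(2))
  qed
  obtain b where b: "b \<in> bilinear_maps K V P P"
    "\<And>x h. \<lbrakk>x \<in> carrier V; h \<in> ?G\<rbrakk> \<Longrightarrow> b x (case h of (c, s) \<Rightarrow> t c s) = (case h of (c, s) \<Rightarrow> t c (word_cons K V x s))"
    by (rule bilinear_extension[OF module_V module_P module_P generating_family_ident
          generating_family_tensor_carrier[OF module_A module_T] l r]) (assumption | rule that)+
  have "b x (t c s) = t c (word_cons K V x s)" if "x \<in> carrier V" "c \<in> carrier A" "s \<in> carrier T" for x c s
    using b(2)[of x "(c, s)"] that by simp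
  then show ?thesis
    unfolding pre_def by - (rule someI[of _ b], simp add: b(1))
qed

lemmas pre_bilinear = pre_properties[THEN conjunct1]
lemmas pre_t = pre_properties[THEN conjunct2, rule_format]
lemmas pre_closed [simp] = bilinear_maps_closed[OF pre_bilinear]

lemma pre_word: "\<lbrakk>x \<in> carrier V; c \<in> carrier A; f \<in> W\<rbrakk> \<Longrightarrow> pre x (t c (w f)) = t c (w (x # f))"
  by (simp add: pre_t word_cons_pure[OF module_V])

text \<open>The product of two pure elements depends on their coefficients only through the product
  of the coefficients, which is the single parameter \<open>c\<close>.\<close>

definition word_prod :: "'a \<Rightarrow> 'v list \<Rightarrow> 'v list \<Rightarrow> ('a \<times> ('v list \<Rightarrow> 'k) set \<Rightarrow> 'k) set"
  where "word_prod c f g = t c (w f \<otimes>\<^bsub>T\<^esub> w g) \<oplus>\<^bsub>P\<^esub>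
    (\<Oplus>\<^bsub>P\<^esub> i\<in>{0..<length f}. \<Oplus>\<^bsub>P\<^esub> j\<in>{0..<length g}.
      t (c \<otimes>\<^bsub>A\<^esub> E (w (drop i f)) (w (drop j g))) (w (take i f) \<otimes>\<^bsub>T\<^esub> w (take j g)))"

lemma word_prod_closed [simp]: "\<lbrakk>c \<in> carrier A; f \<in> W; g \<in> W\<rbrakk> \<Longrightarrow> word_prod c f g \<in> carrier P"
  unfolding word_prod_def by (intro P.M.a_closed P.M.finsum_closed Pi_I) simp_all

lemma word_prod_Nil:
  assumes "c \<in> carrier A" "f \<in> W"
  shows word_prod_Nil_left: "word_prod c [] f = t c (w f)"
    and word_prod_Nil_right: "word_prod c f [] = t c (w f)"
  using assms by (simp_all add: word_prod_def shuffle_Nil_left[OF module_V] shuffle_Nil_right[OF module_V])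

text \<open>In every summand with a nonempty prefix, each word of the shuffle starts with
  \<open>x\<close> or with \<open>y\<close>. Sorting by this letter yields the products in which it
  has been removed. The summand with both prefixes empty is the pairing of the two full
  words.\<close>

lemma word_prod_Cons:
  assumes c: "c \<in> carrier A" and x: "x \<in> carrier V" and f: "f \<in> W" and y: "y \<in> carrier V" and g: "g \<in> W"
  shows "word_prod c (x # f) (y # g) =
    (pre x (word_prod c f (y # g)) \<oplus>\<^bsub>P\<^esub> pre y (word_prod c (x # f) g)) \<oplus>\<^bsub>P\<^esub>
    t (c \<otimes>\<^bsub>A\<^esub> E (w (x # f)) (w (y # g))) (w [])"
proof -
  note pl = bilinear_maps_right[OF pre_bilinear]
  note sh = shuffle_Cons[OF module_V] shuffle_Nil_left[OF module_V] shuffle_Nil_right[OF module_V]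
  note tadd = bilinear_maps_add_right[OF t_bilinear]
  have xf: "x # f \<in> W" and yg: "y # g \<in> W" using assms by simp_all
  let ?\<tau> = "\<lambda>f g i j. t (c \<otimes>\<^bsub>A\<^esub> E (w (drop i f)) (w (drop j g))) (w (take i f) \<otimes>\<^bsub>T\<^esub> w (take j g))"
  let ?S = "\<lambda>f g. \<Oplus>\<^bsub>P\<^esub> i\<in>{0..<length f}. \<Oplus>\<^bsub>P\<^esub> j\<in>{0..<length g}. ?\<tau> f g i j"
  have \<tau>: "?\<tau> f g i j \<in> carrier P" if "f \<in> W" "g \<in> W" for f g i j
    using that c by simp
  have S: "?S f g \<in> carrier P" if "f \<in> W" "g \<in> W" for f g
    by (intro P.M.finsum_closed Pi_I \<tau> that)
  have E1: "?S (x # f) (y # g) = ?\<tau> (x # f) (y # g) 0 0 \<oplus>\<^bsub>P\<^esub>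
      (pre x (?S f (y # g)) \<oplus>\<^bsub>P\<^esub> pre y (?S (x # f) g))"
    unfolding list.size(4) One_nat_def add_Suc_right add_0_right
  proof (rule finsum_shuffle_rec[OF module_P pl[OF x] pl[OF y] \<tau>[OF f yg] \<tau>[OF xf g] \<tau>[OF xf yg]])
    show "?\<tau> (x # f) (y # g) 0 (Suc j) = pre y (?\<tau> (x # f) g 0 j)" for j
      using assms by (simp add: pre_t word_cons_pure[OF module_V] sh)
    show "?\<tau> (x # f) (y # g) (Suc i) 0 = pre x (?\<tau> f (y # g) i 0)" for i
      using assms by (simp add: pre_t word_cons_pure[OF module_V] sh)
    show "?\<tau> (x # f) (y # g) (Suc i) (Suc j) =
        pre x (?\<tau> f (y # g) i (Suc j)) \<oplus>\<^bsub>P\<^esub> pre y (?\<tau> (x # f) g (Suc i) j)" for i j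
      using assms by (simp add: pre_t sh tadd bilinear_maps_closed[OF cons_bilinear])
  qed
  have E2: "t c (w (x # f) \<otimes>\<^bsub>T\<^esub> w (y # g)) =
      pre x (t c (w f \<otimes>\<^bsub>T\<^esub> w (y # g))) \<oplus>\<^bsub>P\<^esub> pre y (t c (w (x # f) \<otimes>\<^bsub>T\<^esub> w g))"
    using assms by (simp add: pre_t sh tadd bilinear_maps_closed[OF cons_bilinear])
  have E3: "?\<tau> (x # f) (y # g) 0 0 = t (c \<otimes>\<^bsub>A\<^esub> E (w (x # f)) (w (y # g))) (w [])"
    by (simp add: sh)
  have E4: "pre x (word_prod c f (y # g)) = pre x (t c (w f \<otimes>\<^bsub>T\<^esub> w (y # g))) \<oplus>\<^bsub>P\<^esub> pre x (?S f (y # g))"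
    unfolding word_prod_def
    by (rule bilinear_maps_add_right[OF pre_bilinear x _ S[OF f yg]]) (use c f yg in simp)
  have E5: "pre y (word_prod c (x # f) g) = pre y (t c (w (x # f) \<otimes>\<^bsub>T\<^esub> w g)) \<oplus>\<^bsub>P\<^esub> pre y (?S (x # f) g)"
    unfolding word_prod_def
    by (rule bilinear_maps_add_right[OF pre_bilinear y _ S[OF xf g]]) (use c g xf in simp)
  have E6: "t c (w f \<otimes>\<^bsub>T\<^esub> w (y # g)) \<in> carrier P" "t c (w (x # f) \<otimes>\<^bsub>T\<^esub> w g) \<in> carrier P"
    "t (c \<otimes>\<^bsub>A\<^esub> E (w (x # f)) (w (y # g))) (w []) \<in> carrier P"
    using c f g xf yg by simp_all
  have ac: "(a \<oplus>\<^bsub>P\<^esub> b) \<oplus>\<^bsub>P\<^esub> (k \<oplus>\<^bsub>P\<^esub> (r \<oplus>\<^bsub>P\<^esub> s)) = ((a \<oplus>\<^bsub>P\<^esub> r) \<oplus>\<^bsub>P\<^esub> (b \<oplus>\<^bsub>P\<^esub> s)) \<oplus>\<^bsub>P\<^esub> k"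
    if "a \<in> carrier P" "b \<in> carrier P" "k \<in> carrier P" "r \<in> carrier P" "s \<in> carrier P" for a b k r s
    using that by (simp add: P.M.a_ac)
  show ?thesis
    unfolding E4 E5 word_prod_def[of c "x # f" "y # g"] E1 E2 E3
    by (rule ac[OF pre_closed[OF x E6(1)] pre_closed[OF y E6(2)] E6(3)
          pre_closed[OF x S[OF f yg]] pre_closed[OF y S[OF xf g]]])
qed

lemma word_prod_linear:
  assumes "f \<in> W" "g \<in> W"
  shows "(\<lambda>c. word_prod c f g) \<in> linear_maps K A P"
  using assms
proof (induction f g rule: word_shuffle.induct)
  case (1 g)
  have "(\<lambda>c. t c (w g)) \<in> linear_maps K A P"
    using 1 by (intro bilinear_maps_left[OF t_bilinear]) simp
  then show ?case
    by (rule linear_maps_cong[OF module_A]) (use 1 in \<open>simp add: word_prod_Nil\<close>)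
next
  case (2 x f)
  have "(\<lambda>c. t c (w (x # f))) \<in> linear_maps K A P"
    using 2 by (intro bilinear_maps_left[OF t_bilinear]) simp
  then show ?case
    by (rule linear_maps_cong[OF module_A]) (use 2 in \<open>simp add: word_prod_Nil\<close>)
next
  case (3 x f y g)
  then have *: "x \<in> carrier V" "f \<in> W" "y \<in> carrier V" "g \<in> W" by simp_all
  have "(\<lambda>c. (pre x (word_prod c f (y # g)) \<oplus>\<^bsub>P\<^esub> pre y (word_prod c (x # f) g)) \<oplus>\<^bsub>P\<^esub>
      t (c \<otimes>\<^bsub>A\<^esub> E (w (x # f)) (w (y # g))) (w [])) \<in> linear_maps K A P"
  proof (rule linear_maps_add_map[OF module_P linear_maps_add_map[OF module_P]])
    show "(\<lambda>c. pre x (word_prod c f (y # g))) \<in> linear_maps K A P"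
      by (rule linear_maps_compose[OF "3.IH"(1) bilinear_maps_right[OF pre_bilinear *(1)]]) (use * in simp_all)
    show "(\<lambda>c. pre y (word_prod c (x # f) g)) \<in> linear_maps K A P"
      by (rule linear_maps_compose[OF "3.IH"(2) bilinear_maps_right[OF pre_bilinear *(3)]]) (use * in simp_all)
    show "(\<lambda>c. t (c \<otimes>\<^bsub>A\<^esub> E (w (x # f)) (w (y # g))) (w [])) \<in> linear_maps K A P"
      by (rule linear_maps_compose[OF bilinear_maps_left[OF A_bilinear] bilinear_maps_left[OF t_bilinear]])
        (use * in simp_all)
  qed
  then show ?case
    by (rule linear_maps_cong[OF module_A]) (use * in \<open>simp add: word_prod_Cons\<close>)
qed

lemma word_prod_commute:
  assumes "c \<in> carrier A" "f \<in> W" "g \<in> W"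
  shows "word_prod c f g = word_prod c g f"
  using assms(2,3)
proof (induction f g rule: word_shuffle.induct)
  case (3 x f y g)
  then have *: "x \<in> carrier V" "f \<in> W" "y \<in> carrier V" "g \<in> W" by simp_all
  then show ?case
    using "3.IH" assms(1) E_commute[of "x # f" "y # g"] by (simp add: word_prod_Cons P.M.a_comm)
qed (use assms(1) in \<open>simp_all add: word_prod_Nil\<close>)

lemma pairing_multilinear:
  assumes "c \<in> carrier A" "g \<in> W"
  shows "multilinear K V P (\<lambda>f. t (c \<otimes>\<^bsub>A\<^esub> E (w f) (w g)) (w []))"
  by (rule multilinear_compose[OF multilinear_compose[OF w_multilinear bilinear_maps_left[OF E_bilinear]]
        linear_maps_compose[OF bilinear_maps_right[OF A_bilinear assms(1)] bilinear_maps_left[OF t_bilinear]]])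
    (use assms in simp_all)

text \<open>The recursion is fed into the general lemma for the first word, and commutativity
  transfers the result to the second.\<close>

lemma word_prod_multilinear:
  assumes c: "c \<in> carrier A" and g: "g \<in> W"
  shows word_prod_multilinear_left: "multilinear K V P (\<lambda>f. word_prod c f g)"
    and word_prod_multilinear_right: "multilinear K V P (\<lambda>f. word_prod c g f)"
proof -
  have "multilinear K V P (\<lambda>f. t c (w f))"
    by (rule multilinear_compose[OF w_multilinear bilinear_maps_right[OF t_bilinear c]])
  then have nil: "multilinear K V P (\<lambda>f. word_prod c f [])"
    by (rule multilinear_cong[OF module_V]) (use c in \<open>simp add: word_prod_Nil\<close>)
  show *: "multilinear K V P (\<lambda>f. word_prod c f g)"
    by (rule shuffle_rec_multilinear[OF module_V module_P pre_bilinear word_prod_closed[OF c] nil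
          pairing_multilinear[OF c] word_prod_Cons[OF c] g])
  show "multilinear K V P (\<lambda>f. word_prod c g f)"
    by (rule multilinear_cong[OF module_V *]) (rule word_prod_commute[OF c _ g])
qed

abbreviation "gens \<equiv> carrier A \<times> W"

lemma word_prod_extends:
  shows word_prod_extends_left: "h \<in> gens \<Longrightarrow> extends_linearly K P (\<lambda>(c, f). t c (w f)) gens P
      (\<lambda>g. case g of (c, f) \<Rightarrow> case h of (d, g) \<Rightarrow> word_prod (c \<otimes>\<^bsub>A\<^esub> d) f g)"
    and word_prod_extends_right: "g \<in> gens \<Longrightarrow> extends_linearly K P (\<lambda>(c, f). t c (w f)) gens P
      (\<lambda>h. case g of (c, f) \<Rightarrow> case h of (d, g) \<Rightarrow> word_prod (c \<otimes>\<^bsub>A\<^esub> d) f g)"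
proof -
  have left: "extends_linearly K P (\<lambda>(c, f). t c (w f)) gens P (\<lambda>(c, f). word_prod (c \<otimes>\<^bsub>A\<^esub> d) f g)"
    if d: "d \<in> carrier A" and g: "g \<in> W" for d g
  proof (rule extends_linearly_tensor[OF module_A module_T module_P generating_family_ident gen_T])
    show "extends_linearly K A (\<lambda>x. x) (carrier A) P (\<lambda>c. word_prod (c \<otimes>\<^bsub>A\<^esub> d) f g)" if "f \<in> W" for f
      by (rule extends_linearly_ident[OF linear_maps_compose[OF bilinear_maps_left[OF A_bilinear d]
              word_prod_linear[OF that g]]])
    show "extends_linearly K T w W P (\<lambda>f. word_prod (c \<otimes>\<^bsub>A\<^esub> d) f g)" if "c \<in> carrier A" for c
      by (rule extends_linearly_shuffle_algebra[OF module_V module_P word_prod_multilinear_left[OF _ g]])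
        (use that d in simp)
  qed
  show "extends_linearly K P (\<lambda>(c, f). t c (w f)) gens P
      (\<lambda>g. case g of (c, f) \<Rightarrow> case h of (d, g) \<Rightarrow> word_prod (c \<otimes>\<^bsub>A\<^esub> d) f g)" if "h \<in> gens" for h
    using left that by auto
  show "extends_linearly K P (\<lambda>(c, f). t c (w f)) gens P
      (\<lambda>h. case g of (c, f) \<Rightarrow> case h of (d, g) \<Rightarrow> word_prod (c \<otimes>\<^bsub>A\<^esub> d) f g)" if "g \<in> gens" for g
  proof -
    obtain c f where g: "g = (c, f)" "c \<in> carrier A" "f \<in> W" using \<open>g \<in> gens\<close> by auto
    have "word_prod (d \<otimes>\<^bsub>A\<^esub> c) g f = word_prod (c \<otimes>\<^bsub>A\<^esub> d) f g" if "d \<in> carrier A" "g \<in> W" for d g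
      using that g word_prod_commute[of "c \<otimes>\<^bsub>A\<^esub> d" f g] by (simp add: cA.m_comm[of d c])
    then show ?thesis
      unfolding g(1) prod.case
      by (intro iffD1[OF extends_linearly_cong left[OF g(2,3)]]) auto
  qed
qed

text \<open>For \<open>E = \<epsilon>(\<cdot> \<odot> \<cdot>)\<close> the identity below, cyclically permuted, says that the generators of \<open>J\<^sub>2\<close> vanish.\<close>

definition triple :: "'v list \<Rightarrow> 'v list \<Rightarrow> 'v list \<Rightarrow> 'a"
  where "triple f g h = E (w f \<otimes>\<^bsub>T\<^esub> w g) (w h) \<oplus>\<^bsub>A\<^esub>
    (\<Oplus>\<^bsub>A\<^esub> i\<in>{0..<length f}. \<Oplus>\<^bsub>A\<^esub> j\<in>{0..<length g}.
      E (w (drop i f)) (w (drop j g)) \<otimes>\<^bsub>A\<^esub> E (w (take i f) \<otimes>\<^bsub>T\<^esub> w (take j g)) (w h))"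

end

section \<open>Associativity of the product\<close>

locale associative_shuffle_pairing = shuffle_pairing K V A E
  for K :: "('k, 'x) ring_scheme" and V :: "('k, 'v, 'y) module_scheme"
    and A :: "('k, 'a, 'z) module_scheme"
    and E :: "('v list \<Rightarrow> 'k) set \<Rightarrow> ('v list \<Rightarrow> 'k) set \<Rightarrow> 'a" +
  assumes triple_rotate: "\<lbrakk>f \<in> lists (carrier V); g \<in> lists (carrier V); h \<in> lists (carrier V);
      f \<noteq> []; g \<noteq> []; h \<noteq> []\<rbrakk> \<Longrightarrow> triple f g h = triple g h f"
begin

interpretation cA: cring A by (rule cring_A)
interpretation A: algebra K A by (rule algebra_A)
interpretation mA: module K A by (rule module_A)
interpretation V: module K V by (rule module_V)
interpretation T: module K T by (rule module_T)
interpretation P: module K P by (rule module_P)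

declare in_lists_conv_set [simp del]

text \<open>\<open>B\<close> pairs the tensor part of an element with \<open>h\<close>. On a product
  of two words it collects exactly the sum \<open>triple\<close>, so the length-zero contributions
  to a triple product can be tracked by linearity instead of by expanding nested double
  sums.\<close>

lemma triple_functional:
  assumes h: "h \<in> W"
  obtains B where "B \<in> linear_maps K P A"
    "\<And>c s. \<lbrakk>c \<in> carrier A; s \<in> carrier T\<rbrakk> \<Longrightarrow> B (t c s) = c \<otimes>\<^bsub>A\<^esub> E s (w h)"
    "\<And>c f g. \<lbrakk>c \<in> carrier A; f \<in> W; g \<in> W\<rbrakk> \<Longrightarrow> B (word_prod c f g) = c \<otimes>\<^bsub>A\<^esub> triple f g h"
proof -
  obtain B where B: "B \<in> linear_maps K P A"
    "\<And>c s. \<lbrakk>c \<in> carrier A; s \<in> carrier T\<rbrakk> \<Longrightarrow> B (t c s) = c \<otimes>\<^bsub>A\<^esub> E s (w h)"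
    by (rule linear_map_tensor[OF module_A module_T module_A bilinear_maps_precompose[OF A_bilinear
          linear_maps_ident bilinear_maps_left[OF E_bilinear w_closed[OF h]]]]) (rule that)
  have "B (word_prod c f g) = c \<otimes>\<^bsub>A\<^esub> triple f g h" if c: "c \<in> carrier A" and f: "f \<in> W" and g: "g \<in> W" for c f g
  proof -
    let ?e = "\<lambda>i j. E (w (drop i f)) (w (drop j g))" and ?s = "\<lambda>i j. w (take i f) \<otimes>\<^bsub>T\<^esub> w (take j g)"
    have [simp]: "?e i j \<in> carrier A" "?s i j \<in> carrier T" for i j
      using f g by simp_all
    have 1: "(\<Oplus>\<^bsub>P\<^esub> j\<in>{0..<length g}. t (c \<otimes>\<^bsub>A\<^esub> ?e i j) (?s i j)) \<in> carrier P" for i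
      using c by (intro P.M.finsum_closed Pi_I) simp
    have 2: "(\<Oplus>\<^bsub>A\<^esub> j\<in>{0..<length g}. ?e i j \<otimes>\<^bsub>A\<^esub> E (?s i j) (w h)) \<in> carrier A" for i
      using h by (intro cA.finsum_closed Pi_I) simp
    have "B (\<Oplus>\<^bsub>P\<^esub> i\<in>{0..<length f}. \<Oplus>\<^bsub>P\<^esub> j\<in>{0..<length g}. t (c \<otimes>\<^bsub>A\<^esub> ?e i j) (?s i j)) =
        (\<Oplus>\<^bsub>A\<^esub> i\<in>{0..<length f}. B (\<Oplus>\<^bsub>P\<^esub> j\<in>{0..<length g}. t (c \<otimes>\<^bsub>A\<^esub> ?e i j) (?s i j)))"
      by (rule linear_maps_finsum[OF module_P module_A B(1)]) (intro Pi_I 1)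
    also have "\<dots> = (\<Oplus>\<^bsub>A\<^esub> i\<in>{0..<length f}. c \<otimes>\<^bsub>A\<^esub> (\<Oplus>\<^bsub>A\<^esub> j\<in>{0..<length g}. ?e i j \<otimes>\<^bsub>A\<^esub> E (?s i j) (w h)))"
    proof (rule cA.finsum_cong')
      fix i
      have "B (\<Oplus>\<^bsub>P\<^esub> j\<in>{0..<length g}. t (c \<otimes>\<^bsub>A\<^esub> ?e i j) (?s i j)) =
          (\<Oplus>\<^bsub>A\<^esub> j\<in>{0..<length g}. B (t (c \<otimes>\<^bsub>A\<^esub> ?e i j) (?s i j)))"
        by (rule linear_maps_finsum[OF module_P module_A B(1)]) (use c in simp)
      also have "\<dots> = (\<Oplus>\<^bsub>A\<^esub> j\<in>{0..<length g}. c \<otimes>\<^bsub>A\<^esub> (?e i j \<otimes>\<^bsub>A\<^esub> E (?s i j) (w h)))"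
        using c h by (intro cA.finsum_cong') (simp_all add: B(2) cA.m_assoc)
      also have "\<dots> = c \<otimes>\<^bsub>A\<^esub> (\<Oplus>\<^bsub>A\<^esub> j\<in>{0..<length g}. ?e i j \<otimes>\<^bsub>A\<^esub> E (?s i j) (w h))"
        using c h by (intro cA.finsum_rdistr[symmetric]) simp_all
      finally show "B (\<Oplus>\<^bsub>P\<^esub> j\<in>{0..<length g}. t (c \<otimes>\<^bsub>A\<^esub> ?e i j) (?s i j)) =
          c \<otimes>\<^bsub>A\<^esub> (\<Oplus>\<^bsub>A\<^esub> j\<in>{0..<length g}. ?e i j \<otimes>\<^bsub>A\<^esub> E (?s i j) (w h))" .
    qed (use c 2 in simp_all)
    also have "\<dots> = c \<otimes>\<^bsub>A\<^esub> (\<Oplus>\<^bsub>A\<^esub> i\<in>{0..<length f}. \<Oplus>\<^bsub>A\<^esub> j\<in>{0..<length g}. ?e i j \<otimes>\<^bsub>A\<^esub> E (?s i j) (w h))"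
      using c 2 by (intro cA.finsum_rdistr[symmetric]) simp_all
    finally show ?thesis
      unfolding word_prod_def triple_def
      using c f g h 1 2
      by (simp add: linear_maps_add[OF B(1)] B(2) cA.r_distr P.M.finsum_closed cA.finsum_closed)
  qed
  with B show ?thesis by (rule that)
qed

text \<open>\<open>P'\<close> is any record on the module \<open>P\<close> with the prescribed
  products of generators, so the result applies to \<open>C2_T\<close> without unfolding its
  definition.\<close>

lemma algebra_word_prod:
  fixes P' :: "('k, ('a \<times> ('v list \<Rightarrow> 'k) set \<Rightarrow> 'k) set) module"
  assumes P': "carrier P' = carrier P" "add P' = add P" "zero P' = zero P" "smult P' = smult P"
    and one: "\<one>\<^bsub>P'\<^esub> = t \<one>\<^bsub>A\<^esub> (w [])"
    and b: "mult P' \<in> bilinear_maps K P P P"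
    and prod: "\<And>c d f g. \<lbrakk>c \<in> carrier A; d \<in> carrier A; f \<in> W; g \<in> W\<rbrakk> \<Longrightarrow>
      t c (w f) \<otimes>\<^bsub>P'\<^esub> t d (w g) = word_prod (c \<otimes>\<^bsub>A\<^esub> d) f g"
  shows "algebra K P'"
proof -
  note bl = bilinear_maps_left[OF b] and br = bilinear_maps_right[OF b]
  note pr = bilinear_maps_right[OF pre_bilinear]
  note b_add = bilinear_maps_add_left[OF b] and [simp] = bilinear_maps_closed[OF b]
  \<comment> \<open>A factor with empty tensor part only rescales coefficients; it commutes with
    prefixing, and hence by the recursion multiplies the coefficient of every product.\<close>
  have scalar: "t c (w []) \<otimes>\<^bsub>P'\<^esub> pre x p = pre x (t c (w []) \<otimes>\<^bsub>P'\<^esub> p)"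
    if c: "c \<in> carrier A" and x: "x \<in> carrier V" and p: "p \<in> carrier P" for c x p
    by (rule linear_maps_P_eqI[OF module_P linear_maps_compose[OF pr br] linear_maps_compose[OF br pr] _ p])
      (use c x in \<open>simp_all add: pre_word prod word_prod_Nil\<close>)
  have scale: "t c (w []) \<otimes>\<^bsub>P'\<^esub> word_prod d f g = word_prod (c \<otimes>\<^bsub>A\<^esub> d) f g"
    if c: "c \<in> carrier A" and d: "d \<in> carrier A" and "f \<in> W" "g \<in> W" for c d f g
    using that(3,4)
  proof (induction f g rule: word_shuffle.induct)
    case (3 x f y g)
    then have *: "x \<in> carrier V" "f \<in> W" "y \<in> carrier V" "g \<in> W" by simp_all
    then show ?case
      using "3.IH" c d
      by (simp add: word_prod_Cons bilinear_maps_add_right[OF b] scalar prod word_prod_Nil cA.m_assoc)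
  qed (use c d in \<open>simp_all add: prod word_prod_Nil\<close>)
  have gcomm: "t c (w f) \<otimes>\<^bsub>P'\<^esub> t d (w g) = t d (w g) \<otimes>\<^bsub>P'\<^esub> t c (w f)"
    if "c \<in> carrier A" "d \<in> carrier A" "f \<in> W" "g \<in> W" for c d f g
    using that prod[of c d f g] prod[of d c g f] cA.m_comm[of c d] word_prod_commute[of "c \<otimes>\<^bsub>A\<^esub> d" f g] by simp
  have commute: "p \<otimes>\<^bsub>P'\<^esub> q = q \<otimes>\<^bsub>P'\<^esub> p" if "p \<in> carrier P" "q \<in> carrier P" for p q
    by (rule bilinear_maps_eqI[OF module_P module_P module_P gen_P gen_P b bilinear_maps_flip[OF b] _ that])
      (simp add: mem_Times_iff split_beta gcomm)
  \<comment> \<open>The first letter of a term of positive length is taken from one of the three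
    words; removing it leaves a triple product with that word shortened. What remains has length
    zero and is collected in \<open>triple\<close>.\<close>
  have triple_rec: "q \<otimes>\<^bsub>P'\<^esub> t e (w (z # h)) =
      (pre x (q1 \<otimes>\<^bsub>P'\<^esub> t e (w (z # h))) \<oplus>\<^bsub>P\<^esub> pre y (q2 \<otimes>\<^bsub>P'\<^esub> t e (w (z # h)))) \<oplus>\<^bsub>P\<^esub>
      (pre z (q \<otimes>\<^bsub>P'\<^esub> t e (w h)) \<oplus>\<^bsub>P\<^esub> t (c \<otimes>\<^bsub>A\<^esub> e \<otimes>\<^bsub>A\<^esub> triple (x # f) (y # g) (z # h)) (w []))"
    if c: "c \<in> carrier A" and e: "e \<in> carrier A" and x: "x \<in> carrier V" and y: "y \<in> carrier V"
      and z: "z \<in> carrier V" and f: "f \<in> W" and g: "g \<in> W" and h: "h \<in> W"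
      and q: "q = word_prod c (x # f) (y # g)" and q1: "q1 = word_prod c f (y # g)"
      and q2: "q2 = word_prod c (x # f) g" for c e x y z f g h q q1 q2
  proof -
    have zh: "z # h \<in> W" using z h by simp
    obtain B where B: "B \<in> linear_maps K P A"
      "\<And>c s. \<lbrakk>c \<in> carrier A; s \<in> carrier T\<rbrakk> \<Longrightarrow> B (t c s) = c \<otimes>\<^bsub>A\<^esub> E s (w (z # h))"
      and B_prod: "\<And>c f g. \<lbrakk>c \<in> carrier A; f \<in> W; g \<in> W\<rbrakk> \<Longrightarrow> B (word_prod c f g) = c \<otimes>\<^bsub>A\<^esub> triple f g (z # h)"
      by (rule triple_functional[OF zh]) (rule that)
    note Bc = linear_maps_closed[OF B(1)]
    let ?eh = "t e (w (z # h))" and ?eh' = "t e (w h)"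
    have eh: "?eh \<in> carrier P" "?eh' \<in> carrier P" using e zh h by simp_all
    \<comment> \<open>The two-word recursion in its first factor, extended by linearity from words
      to arbitrary \<open>p\<close>, since \<open>q1\<close> and \<open>q2\<close> are sums of words
      with coefficients.\<close>
    have step: "pre x p \<otimes>\<^bsub>P'\<^esub> ?eh = (pre x (p \<otimes>\<^bsub>P'\<^esub> ?eh) \<oplus>\<^bsub>P\<^esub> pre z (pre x p \<otimes>\<^bsub>P'\<^esub> ?eh')) \<oplus>\<^bsub>P\<^esub>
        t (e \<otimes>\<^bsub>A\<^esub> B (pre x p)) (w [])"
      if x: "x \<in> carrier V" and p: "p \<in> carrier P" for x p
    proof (rule linear_maps_P_eqI[OF module_P _ _ _ p])
      show "(\<lambda>p. pre x p \<otimes>\<^bsub>P'\<^esub> ?eh) \<in> linear_maps K P P"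
        by (rule linear_maps_compose[OF pr[OF x] bl[OF eh(1)]])
      have "(\<lambda>p. t (e \<otimes>\<^bsub>A\<^esub> B (pre x p)) (w [])) \<in> linear_maps K P P"
        by (rule linear_maps_compose[OF linear_maps_compose[OF pr[OF x] B(1)]
              linear_maps_compose[OF bilinear_maps_right[OF A_bilinear e] bilinear_maps_left[OF t_bilinear]]])
          simp
      then show "(\<lambda>p. (pre x (p \<otimes>\<^bsub>P'\<^esub> ?eh) \<oplus>\<^bsub>P\<^esub> pre z (pre x p \<otimes>\<^bsub>P'\<^esub> ?eh')) \<oplus>\<^bsub>P\<^esub>
          t (e \<otimes>\<^bsub>A\<^esub> B (pre x p)) (w [])) \<in> linear_maps K P P"
        by (rule linear_maps_add_map[OF module_P linear_maps_add_map[OF module_P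
                linear_maps_compose[OF bl[OF eh(1)] pr[OF x]]
                linear_maps_compose[OF linear_maps_compose[OF pr[OF x] bl[OF eh(2)]] pr[OF z]]]])
      fix a u assume a: "a \<in> carrier A" and u: "u \<in> W"
      have "e \<otimes>\<^bsub>A\<^esub> (a \<otimes>\<^bsub>A\<^esub> E (w (x # u)) (w (z # h))) = (a \<otimes>\<^bsub>A\<^esub> e) \<otimes>\<^bsub>A\<^esub> E (w (x # u)) (w (z # h))"
        using a u e x zh by (simp add: cA.m_ac)
      then show "pre x (t a (w u)) \<otimes>\<^bsub>P'\<^esub> ?eh =
          (pre x (t a (w u) \<otimes>\<^bsub>P'\<^esub> ?eh) \<oplus>\<^bsub>P\<^esub> pre z (pre x (t a (w u)) \<otimes>\<^bsub>P'\<^esub> ?eh')) \<oplus>\<^bsub>P\<^esub>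
          t (e \<otimes>\<^bsub>A\<^esub> B (pre x (t a (w u)))) (w [])"
        using a u e x z h by (simp add: pre_word prod word_prod_Cons B(2))
    qed
    have const: "t a (w []) \<otimes>\<^bsub>P'\<^esub> ?eh = pre z (t a (w []) \<otimes>\<^bsub>P'\<^esub> ?eh')" if "a \<in> carrier A" for a
      using that e h z by (simp add: prod word_prod_Nil pre_word)
    define a where "a = c \<otimes>\<^bsub>A\<^esub> E (w (x # f)) (w (y # g))"
    have a: "a \<in> carrier A" using c x y f g by (simp add: a_def)
    have q12: "q1 \<in> carrier P" "q2 \<in> carrier P" using q1 q2 c x y f g by simp_all
    have qe: "q = (pre x q1 \<oplus>\<^bsub>P\<^esub> pre y q2) \<oplus>\<^bsub>P\<^esub> t a (w [])"
      unfolding q q1 q2 a_def by (rule word_prod_Cons[OF c x f y g])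
    \<comment> \<open>The length-zero part of \<open>q\<close> pairs to zero with
      \<open>z # h\<close> by \<open>E_Nil\<close>. So applying \<open>B\<close> to the remaining
      two parts of \<open>q\<close> already gives all of \<open>triple\<close>.\<close>
    have B0: "B (t a (w [])) = \<zero>\<^bsub>A\<^esub>" using a zh by (simp add: B(2) E_Nil)
    have Bq: "B (pre x q1) \<oplus>\<^bsub>A\<^esub> B (pre y q2) = c \<otimes>\<^bsub>A\<^esub> triple (x # f) (y # g) (z # h)"
      using B_prod[of c "x # f" "y # g"] c x y f g a q12
      unfolding q[symmetric] qe by (simp add: linear_maps_add[OF B(1)] B0 Bc)
    have c1: "B (pre x q1) \<in> carrier A" "B (pre y q2) \<in> carrier A" using x y q12 by (simp_all add: Bc)
    have "t (e \<otimes>\<^bsub>A\<^esub> B (pre x q1)) (w []) \<oplus>\<^bsub>P\<^esub> t (e \<otimes>\<^bsub>A\<^esub> B (pre y q2)) (w []) =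
        t (e \<otimes>\<^bsub>A\<^esub> (B (pre x q1) \<oplus>\<^bsub>A\<^esub> B (pre y q2))) (w [])"
      using e c1 by (simp add: cA.r_distr bilinear_maps_add_left[OF t_bilinear])
    also have "\<dots> = t (c \<otimes>\<^bsub>A\<^esub> e \<otimes>\<^bsub>A\<^esub> triple (x # f) (y # g) (z # h)) (w [])"
    proof -
      have "triple (x # f) (y # g) (z # h) \<in> carrier A"
        unfolding triple_def using x y z f g h
        by (intro cA.a_closed cA.finsum_closed Pi_I) simp_all
      then have "e \<otimes>\<^bsub>A\<^esub> (c \<otimes>\<^bsub>A\<^esub> triple (x # f) (y # g) (z # h)) = c \<otimes>\<^bsub>A\<^esub> e \<otimes>\<^bsub>A\<^esub> triple (x # f) (y # g) (z # h)"
        using c e by (simp add: cA.m_ac)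
      then show ?thesis by (simp only: Bq)
    qed
    finally have tt: "t (e \<otimes>\<^bsub>A\<^esub> B (pre x q1)) (w []) \<oplus>\<^bsub>P\<^esub> t (e \<otimes>\<^bsub>A\<^esub> B (pre y q2)) (w []) =
        t (c \<otimes>\<^bsub>A\<^esub> e \<otimes>\<^bsub>A\<^esub> triple (x # f) (y # g) (z # h)) (w [])" .
    let ?u1 = "pre x (q1 \<otimes>\<^bsub>P'\<^esub> ?eh)" and ?u2 = "pre y (q2 \<otimes>\<^bsub>P'\<^esub> ?eh)"
    let ?v1 = "pre z (pre x q1 \<otimes>\<^bsub>P'\<^esub> ?eh')" and ?v2 = "pre z (pre y q2 \<otimes>\<^bsub>P'\<^esub> ?eh')"
    let ?v3 = "pre z (t a (w []) \<otimes>\<^bsub>P'\<^esub> ?eh')"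
    let ?s1 = "t (e \<otimes>\<^bsub>A\<^esub> B (pre x q1)) (w [])" and ?s2 = "t (e \<otimes>\<^bsub>A\<^esub> B (pre y q2)) (w [])"
    have cl: "?u1 \<in> carrier P" "?u2 \<in> carrier P" "?v1 \<in> carrier P" "?v2 \<in> carrier P" "?v3 \<in> carrier P"
      "?s1 \<in> carrier P" "?s2 \<in> carrier P"
      using x y z a e q12 eh c1 by simp_all
    have "q \<otimes>\<^bsub>P'\<^esub> ?eh = (((?u1 \<oplus>\<^bsub>P\<^esub> ?v1) \<oplus>\<^bsub>P\<^esub> ?s1) \<oplus>\<^bsub>P\<^esub> ((?u2 \<oplus>\<^bsub>P\<^esub> ?v2) \<oplus>\<^bsub>P\<^esub> ?s2)) \<oplus>\<^bsub>P\<^esub> ?v3"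
      unfolding qe using x y a q12 eh step[OF x q12(1)] step[OF y q12(2)] const[OF a]
      by (simp add: b_add)
    also have "\<dots> = (?u1 \<oplus>\<^bsub>P\<^esub> ?u2) \<oplus>\<^bsub>P\<^esub> (((?v1 \<oplus>\<^bsub>P\<^esub> ?v2) \<oplus>\<^bsub>P\<^esub> ?v3) \<oplus>\<^bsub>P\<^esub> (?s1 \<oplus>\<^bsub>P\<^esub> ?s2))"
      using cl by (simp add: P.M.a_ac)
    also have "(?v1 \<oplus>\<^bsub>P\<^esub> ?v2) \<oplus>\<^bsub>P\<^esub> ?v3 = pre z (q \<otimes>\<^bsub>P'\<^esub> ?eh')"
      unfolding qe using x y z a q12 eh by (simp add: b_add bilinear_maps_add_right[OF pre_bilinear])
    finally show ?thesis by (simp only: tt)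
  qed
  \<comment> \<open>Both sides are bracketed to the left, so \<open>triple_rec\<close> applies to
    each of them. The induction is on the total length because any of the three words may lose a
    letter.\<close>
  have rotate: "(t c (w f) \<otimes>\<^bsub>P'\<^esub> t d (w g)) \<otimes>\<^bsub>P'\<^esub> t e (w h) = (t d (w g) \<otimes>\<^bsub>P'\<^esub> t e (w h)) \<otimes>\<^bsub>P'\<^esub> t c (w f)"
    if "c \<in> carrier A" "d \<in> carrier A" "e \<in> carrier A" "f \<in> W" "g \<in> W" "h \<in> W" for c d e f g h
    using that
  proof (induction "length f + length g + length h" arbitrary: f g h rule: less_induct)
    case less
    note cde = less.prems(1-3) and fgh = less.prems(4-6)
    \<comment> \<open>With an empty word among the three, the product by that factor is a mere
      rescaling, and commutativity of two factors suffices. This matches the relations of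
      \<open>J2\<close>, which are imposed for nonempty words only.\<close>
    consider "f = []" | "g = []" | "h = []"
      | x f' y g' z h' where "f = x # f'" "g = y # g'" "h = z # h'"
      by (cases f; cases g; cases h) auto
    then show ?case
    proof cases
      case 1
      then show ?thesis
        using cde fgh commute[of "word_prod (d \<otimes>\<^bsub>A\<^esub> e) g h" "t c (w [])"]
        by (simp add: prod word_prod_Nil scale cA.m_assoc)
    next
      case 2
      then show ?thesis
        using cde fgh word_prod_commute[of "c \<otimes>\<^bsub>A\<^esub> (d \<otimes>\<^bsub>A\<^esub> e)" f h]
        by (simp add: prod word_prod_Nil cA.m_ac)
    next
      case 3
      then show ?thesis
        using cde fgh commute[of "word_prod (c \<otimes>\<^bsub>A\<^esub> d) f g" "t e (w [])"]
          word_prod_commute[of "e \<otimes>\<^bsub>A\<^esub> (c \<otimes>\<^bsub>A\<^esub> d)" f g]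
        by (simp add: prod word_prod_Nil scale cA.m_ac)
    next
      case 4
      then have l: "x \<in> carrier V" "f' \<in> W" "y \<in> carrier V" "g' \<in> W" "z \<in> carrier V" "h' \<in> W"
        using fgh by simp_all
      let ?f = "t c (w f)" and ?g = "t d (w g)" and ?h = "t e (w h)"
      let ?f' = "t c (w f')" and ?g' = "t d (w g')" and ?h' = "t e (w h')"
      have IH: "(?f' \<otimes>\<^bsub>P'\<^esub> ?g) \<otimes>\<^bsub>P'\<^esub> ?h = (?g \<otimes>\<^bsub>P'\<^esub> ?h) \<otimes>\<^bsub>P'\<^esub> ?f'"
        "(?f \<otimes>\<^bsub>P'\<^esub> ?g') \<otimes>\<^bsub>P'\<^esub> ?h = (?g' \<otimes>\<^bsub>P'\<^esub> ?h) \<otimes>\<^bsub>P'\<^esub> ?f"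
        "(?f \<otimes>\<^bsub>P'\<^esub> ?g) \<otimes>\<^bsub>P'\<^esub> ?h' = (?g \<otimes>\<^bsub>P'\<^esub> ?h') \<otimes>\<^bsub>P'\<^esub> ?f"
        by (rule less.hyps; use 4 cde fgh l in simp)+
      have cl: "?f \<in> carrier P" "?g \<in> carrier P" "?h \<in> carrier P" "?f' \<in> carrier P" "?g' \<in> carrier P" "?h' \<in> carrier P"
        using cde fgh l by simp_all
      \<comment> \<open>The only place where \<open>triple_rotate\<close> enters; the other three
        terms of the recursion agree by the induction hypothesis.\<close>
      have trip: "(c \<otimes>\<^bsub>A\<^esub> d) \<otimes>\<^bsub>A\<^esub> e \<otimes>\<^bsub>A\<^esub> triple f g h = (d \<otimes>\<^bsub>A\<^esub> e) \<otimes>\<^bsub>A\<^esub> c \<otimes>\<^bsub>A\<^esub> triple g h f"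
        using triple_rotate[of f g h] fgh 4 cde by (simp add: cA.m_ac)
      have rec1: "(?f \<otimes>\<^bsub>P'\<^esub> ?g) \<otimes>\<^bsub>P'\<^esub> ?h =
          (pre x ((?f' \<otimes>\<^bsub>P'\<^esub> ?g) \<otimes>\<^bsub>P'\<^esub> ?h) \<oplus>\<^bsub>P\<^esub> pre y ((?f \<otimes>\<^bsub>P'\<^esub> ?g') \<otimes>\<^bsub>P'\<^esub> ?h)) \<oplus>\<^bsub>P\<^esub>
          (pre z ((?f \<otimes>\<^bsub>P'\<^esub> ?g) \<otimes>\<^bsub>P'\<^esub> ?h') \<oplus>\<^bsub>P\<^esub> t ((c \<otimes>\<^bsub>A\<^esub> d) \<otimes>\<^bsub>A\<^esub> e \<otimes>\<^bsub>A\<^esub> triple f g h) (w []))"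
        unfolding 4 by (rule triple_rec) (use cde l in \<open>simp_all add: prod\<close>)
      have rec2: "(?g \<otimes>\<^bsub>P'\<^esub> ?h) \<otimes>\<^bsub>P'\<^esub> ?f =
          (pre y ((?g' \<otimes>\<^bsub>P'\<^esub> ?h) \<otimes>\<^bsub>P'\<^esub> ?f) \<oplus>\<^bsub>P\<^esub> pre z ((?g \<otimes>\<^bsub>P'\<^esub> ?h') \<otimes>\<^bsub>P'\<^esub> ?f)) \<oplus>\<^bsub>P\<^esub>
          (pre x ((?g \<otimes>\<^bsub>P'\<^esub> ?h) \<otimes>\<^bsub>P'\<^esub> ?f') \<oplus>\<^bsub>P\<^esub> t ((d \<otimes>\<^bsub>A\<^esub> e) \<otimes>\<^bsub>A\<^esub> c \<otimes>\<^bsub>A\<^esub> triple g h f) (w []))"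
        unfolding 4 by (rule triple_rec) (use cde l in \<open>simp_all add: prod\<close>)
      have tc: "t ((d \<otimes>\<^bsub>A\<^esub> e) \<otimes>\<^bsub>A\<^esub> c \<otimes>\<^bsub>A\<^esub> triple g h f) (w []) \<in> carrier P"
      proof -
        have "triple g h f \<in> carrier A"
          unfolding triple_def using fgh by (intro cA.a_closed cA.finsum_closed Pi_I) simp_all
        then show ?thesis using cde by simp
      qed
      show ?thesis
        unfolding rec1 rec2 IH trip using tc cl l by (simp add: P.M.a_ac)
    qed
  qed
  have gen: "generating_family K P' (\<lambda>(c, f). t c (w f)) gens"
    using gen_P by (simp add: generating_family_record_cong[OF P'(1,2,4,3)])
  show ?thesis
  proof (rule algebraI_generators[OF module_record_cong[OF module_P P'] gen])
    show "mult P' \<in> bilinear_maps K P' P' P'"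
      using b by (simp add: bilinear_maps_record_cong[OF P'(1,2,4) P'(1,2,4) P'(1,2,4)])
    show "\<one>\<^bsub>P'\<^esub> \<in> carrier P'" by (simp add: one P')
  next
    fix g h assume "g \<in> gens" "h \<in> gens"
    then show "(case g of (c, f) \<Rightarrow> t c (w f)) \<otimes>\<^bsub>P'\<^esub> (case h of (c, f) \<Rightarrow> t c (w f)) =
      (case h of (c, f) \<Rightarrow> t c (w f)) \<otimes>\<^bsub>P'\<^esub> (case g of (c, f) \<Rightarrow> t c (w f))"
      unfolding split_beta by (intro gcomm) (simp_all add: mem_Times_iff)
  next
    fix g h k assume "g \<in> gens" "h \<in> gens" "k \<in> gens"
    then obtain c f d g' e h' where eq: "g = (c, f)" "h = (d, g')" "k = (e, h')"
      and *: "c \<in> carrier A" "d \<in> carrier A" "e \<in> carrier A" "f \<in> W" "g' \<in> W" "h' \<in> W"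
      by blast
    show "((case g of (c, f) \<Rightarrow> t c (w f)) \<otimes>\<^bsub>P'\<^esub> (case h of (c, f) \<Rightarrow> t c (w f))) \<otimes>\<^bsub>P'\<^esub> (case k of (c, f) \<Rightarrow> t c (w f)) =
      (case g of (c, f) \<Rightarrow> t c (w f)) \<otimes>\<^bsub>P'\<^esub> ((case h of (c, f) \<Rightarrow> t c (w f)) \<otimes>\<^bsub>P'\<^esub> (case k of (c, f) \<Rightarrow> t c (w f)))"
      \<comment> \<open>One rotation followed by one commutation is associativity.\<close>
      unfolding eq prod.case rotate[OF *] by (rule commute) (use * in simp_all)
  qed (simp_all add: one prod word_prod_Nil gcomm mem_Times_iff split_beta)
qed

end

section \<open>Derivation and integration\<close>

lemma bilinear_maps_add_map:
  assumes "module K L" "b \<in> bilinear_maps K M N L" "b' \<in> bilinear_maps K M N L"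
  shows "(\<lambda>x y. b x y \<oplus>\<^bsub>L\<^esub> b' x y) \<in> bilinear_maps K M N L"
  using assms
  by (intro bilinear_mapsI linear_maps_add_map) (auto dest: bilinear_maps_right bilinear_maps_left)

lemma (in abelian_group) eq_minusI:
  assumes "x \<oplus> y = z" "x \<in> carrier G" "z \<in> carrier G" "y \<in> carrier G"
  shows "x = z \<ominus> y"
  using assms(2-) by (simp add: a_minus_def a_assoc r_neg flip: assms(1))

section \<open>Elementary rules for derivations and their constants\<close>

context comm_differential_ring
begin

lemma D_zero: "D \<zero> = \<zero>"
proof -
  have "D \<zero> \<oplus> D \<zero> = D \<zero>" using D_add[of \<zero> \<zero>] by simp
  then show ?thesis using D_closed[of \<zero>] by (metis zero_closed add.r_cancel_one')
qed

lemma D_one: "D \<one> = \<zero>"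
proof -
  have "D \<one> \<oplus> D \<one> = D \<one>" using D_mult[of \<one> \<one>] D_closed[of \<one>] by simp
  then show ?thesis using D_closed[of \<one>] by (metis one_closed add.r_cancel_one')
qed

lemma D_minus:
  assumes "x \<in> carrier R" "y \<in> carrier R"
  shows "D (x \<ominus> y) = D x \<ominus> D y"
proof -
  have "D (x \<ominus> y) \<oplus> D y = D x"
    using assms D_add[of "x \<ominus> y" y] by (simp add: a_minus_def a_assoc l_neg)
  moreover have "D (x \<ominus> y) \<in> carrier R" "D x \<in> carrier R" "D y \<in> carrier R"
    using assms by (simp_all add: D_closed)
  ultimately show ?thesis by (rule eq_minusI)
qed

lemma constants_closed: "c \<in> constants R D \<Longrightarrow> c \<in> carrier R"
  and D_constants: "c \<in> constants R D \<Longrightarrow> D c = \<zero>"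
  by (simp_all add: constants_def)

lemma constants_closed_ops:
  "\<zero> \<in> constants R D" "\<one> \<in> constants R D"
  "x \<in> constants R D \<Longrightarrow> \<ominus> x \<in> constants R D"
  "\<lbrakk>x \<in> constants R D; y \<in> constants R D\<rbrakk> \<Longrightarrow> x \<oplus> y \<in> constants R D"
  "\<lbrakk>x \<in> constants R D; y \<in> constants R D\<rbrakk> \<Longrightarrow> x \<otimes> y \<in> constants R D"
  using D_minus[of \<zero> x] by (simp_all add: constants_def D_zero D_one D_add D_mult a_minus_def)

end

section \<open>The base ring and its two complements as modules over the constants\<close>

context quasi_integration
begin

lemma C_simps: "carrier C = constants R D" "\<zero>\<^bsub>C\<^esub> = \<zero>" "\<one>\<^bsub>C\<^esub> = \<one>" "add C = add R" "mult C = mult R"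
  by (simp_all add: C_def)

lemma RC_simps: "carrier RC = carrier R" "\<zero>\<^bsub>RC\<^esub> = \<zero>" "\<one>\<^bsub>RC\<^esub> = \<one>" "add RC = add R" "mult RC = mult R"
    "smult RC = mult R"
  by (simp_all add: RC_def)

lemma RJ_RT_simps: "carrier RJ = Q ` carrier R" "carrier RT = {f \<in> carrier R. Q f = \<zero>}"
    "\<zero>\<^bsub>RJ\<^esub> = \<zero>" "\<zero>\<^bsub>RT\<^esub> = \<zero>" "add RJ = add R" "add RT = add R" "smult RJ = mult R" "smult RT = mult R"
  by (simp_all add: RJ_def RT_def RC_def)

lemma cring_C: "cring C"
proof (intro cringI abelian_groupI comm_monoidI)
  show "\<exists>y\<in>carrier C. y \<oplus>\<^bsub>C\<^esub> x = \<zero>\<^bsub>C\<^esub>" if "x \<in> carrier C" for x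
    using that by (intro bexI[of _ "\<ominus> x"]) (simp_all add: C_simps constants_closed_ops constants_closed l_neg)
qed (simp_all add: C_simps constants_closed_ops constants_closed a_ac m_ac l_distr[symmetric] r_distr[symmetric])

lemma cring_RC: "cring RC"
proof (intro cringI abelian_groupI comm_monoidI)
  show "\<exists>y\<in>carrier RC. y \<oplus>\<^bsub>RC\<^esub> x = \<zero>\<^bsub>RC\<^esub>" if "x \<in> carrier RC" for x
    using that by (intro bexI[of _ "\<ominus> x"]) (simp_all add: RC_simps l_neg)
qed (simp_all add: RC_simps a_ac m_ac l_distr[symmetric] r_distr[symmetric])

lemma algebra_RC: "algebra C RC"
  by (rule algebraI[OF cring_C cring_RC])
    (auto simp: RC_simps C_simps constants_closed l_distr r_distr m_assoc)

lemmas module_RC = algebra.module[OF algebra_RC]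

lemma D_linear: "D \<in> linear_maps C RC RC"
  by (rule linear_mapsI)
    (auto simp: RC_simps C_simps D_closed D_add D_mult constants_closed D_constants)

lemma Q_linear_map: "Q \<in> linear_maps C RC RC"
  by (rule linear_mapsI) (auto simp: RC_simps C_simps Q_closed Q_add Q_linear)

lemma submodule_RJ: "submodule (carrier RJ) C RC"
proof -
  interpret RC: module C RC by (rule module_RC)
  show ?thesis
  proof (rule RC.submoduleI)
    show "\<zero>\<^bsub>RC\<^esub> \<in> carrier RJ"
      using linear_maps_zero[OF module_RC module_RC Q_linear_map]
      by (auto simp: RJ_RT_simps RC_simps intro: rev_image_eqI[of \<zero>])
    show "\<ominus>\<^bsub>RC\<^esub> a \<in> carrier RJ" if a: "a \<in> carrier RJ" for a
    proof -
      obtain f where f: "f \<in> carrier RC" "a = Q f" using a by (auto simp: RJ_RT_simps RC_simps)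
      then have "\<ominus>\<^bsub>RC\<^esub> a = Q (\<ominus>\<^bsub>RC\<^esub> f)"
        by (simp add: linear_maps_neg[OF module_RC module_RC Q_linear_map])
      then show ?thesis using RC.M.a_inv_closed[OF f(1)] by (simp add: RJ_RT_simps RC_simps)
    qed
  qed (auto simp: RJ_RT_simps RC_simps C_simps constants_closed Q_closed
      simp flip: Q_add Q_linear)
qed

lemma module_RJ: "module C RJ"
  using submodule.submodule_is_module[OF submodule_RJ module_RC] by (simp add: RJ_def)

lemma submodule_RT: "submodule (carrier RT) C RC"
proof -
  have "carrier RT = {x \<in> carrier RC. Q x = \<zero>\<^bsub>RC\<^esub>}"
    by (simp add: RJ_RT_simps RC_simps)
  then show ?thesis
    using submodule_kernel[OF module_RC module_RC Q_linear_map] by simp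
qed

lemma module_RT: "module C RT"
  using submodule.submodule_is_module[OF submodule_RT module_RC] by (simp add: RT_def)

lemma RT_closed: "x \<in> carrier RT \<Longrightarrow> x \<in> carrier R"
  and Q_RT: "x \<in> carrier RT \<Longrightarrow> Q x = \<zero>"
  by (simp_all add: RJ_RT_simps)

lemma Q_RJ: "f \<in> carrier R \<Longrightarrow> Q f \<in> carrier RJ"
  by (simp add: RJ_RT_simps)

lemma Q_minus:
  assumes "x \<in> carrier R" "y \<in> carrier R"
  shows "Q (x \<ominus> y) = Q x \<ominus> Q y"
proof -
  have "Q (x \<ominus> y) \<oplus> Q y = Q x"
    using assms Q_add[of "x \<ominus> y" y] by (simp add: a_minus_def a_assoc l_neg)
  moreover have "Q (x \<ominus> y) \<in> carrier R" "Q x \<in> carrier R" "Q y \<in> carrier R"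
    using assms by (simp_all add: Q_closed)
  ultimately show ?thesis by (rule eq_minusI)
qed

text \<open>The projection of \<open>R\<close> onto \<open>RT\<close> along the image of
  \<open>D\<close>: it vanishes on every \<open>D g\<close> by \<open>D_Q_D\<close>, and its values
  are killed by \<open>Q\<close> because of \<open>Q_D_Q\<close>.\<close>

definition proj_T :: "'a \<Rightarrow> 'a"
  where "proj_T f = f \<ominus> D (Q f)"

lemma proj_T_RT: "f \<in> carrier R \<Longrightarrow> proj_T f \<in> carrier RT"
  using Q_minus[of f "D (Q f)"]
  by (simp add: proj_T_def RJ_RT_simps Q_D_Q Q_closed D_closed a_minus_def r_neg)

lemma proj_T_linear: "proj_T \<in> linear_maps C RC RT"
proof -
  have lin: "(\<lambda>f. f \<ominus>\<^bsub>RC\<^esub> D (Q f)) \<in> linear_maps C RC RC"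
    by (rule linear_maps_minus_map[OF module_RC linear_maps_ident linear_maps_compose[OF Q_linear_map D_linear]])
  \<comment> \<open>Negation is defined from the carrier, the addition and zero alone, and these
    fields agree in \<open>RC\<close> and \<open>R\<close>.\<close>
  have inv: "\<ominus>\<^bsub>RC\<^esub> x = \<ominus> x" for x
    by (simp add: a_inv_def m_inv_def RC_simps)
  have eq: "f \<ominus>\<^bsub>RC\<^esub> D (Q f) = proj_T f" for f
    by (simp add: proj_T_def a_minus_def inv RC_simps)
  show ?thesis
    by (rule linear_mapsI)
      (use proj_T_RT linear_maps_add[OF lin] linear_maps_smult[OF lin] in
        \<open>simp_all add: eq RC_simps RJ_RT_simps\<close>)
qed

lemma Q_linear_RJ: "Q \<in> linear_maps C RC RJ"
  using Q_linear_map by (simp add: linear_maps_def RC_simps RJ_RT_simps Pi_def)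

lemma RT_mult_linear: "a \<in> carrier R \<Longrightarrow> (\<lambda>x. a \<otimes> x) \<in> linear_maps C RT RC"
  by (rule linear_mapsI)
    (auto simp: RJ_RT_simps RC_simps C_simps r_distr constants_closed m_lcomm)

lemma RC_mult_linear: "x \<in> carrier R \<Longrightarrow> (\<lambda>a. a \<otimes> x) \<in> linear_maps C RC RC"
  by (rule linear_mapsI)
    (auto simp: RC_simps C_simps l_distr constants_closed m_assoc)

end

text \<open>
  Here \<open>P\<close> plays the role of \<open>C\<^sub>2 \<otimes> T\<close> with \<open>\<tau> c f = c \<otimes> f\<close>, \<open>I\<close> that of the whole ring with
  \<open>el a c p = a \<otimes> c \<otimes> p\<close>, and \<open>e r f\<close> that of \<open>\<epsilon>(r \<otimes> f)\<close>.
\<close>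

locale idr_data = quasi_integration R D Q
  for R :: "('a, 'b) ring_scheme" (structure) and D Q :: "'a \<Rightarrow> 'a" +
  fixes A1 :: "('a, 'c1) module" and A2 :: "('a, 'c2) module"
    and P :: "('a, 'p) module" and I :: "('a, 'i) module"
    and \<tau> :: "'c2 \<Rightarrow> 'a list \<Rightarrow> 'p" and pre :: "'a \<Rightarrow> 'p \<Rightarrow> 'p"
    and el :: "'a \<Rightarrow> 'c1 \<Rightarrow> 'p \<Rightarrow> 'i" and e :: "'a \<Rightarrow> 'a list \<Rightarrow> 'c1"
  assumes algebra_A1: "algebra C A1" and algebra_A2: "algebra C A2"
    and algebra_P: "algebra C P" and algebra_I: "algebra C I"
    and \<tau>_linear: "f \<in> RT_words \<Longrightarrow> (\<lambda>d. \<tau> d f) \<in> linear_maps C A2 P"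
    and \<tau>_multilinear: "d \<in> carrier A2 \<Longrightarrow> multilinear C RT P (\<tau> d)"
    and gen_P: "generating_family C P (\<lambda>(c, f). \<tau> c f) (carrier A2 \<times> RT_words)"
    and one_P: "\<one>\<^bsub>P\<^esub> = \<tau> \<one>\<^bsub>A2\<^esub> []"
    and pre_bilinear: "pre \<in> bilinear_maps C RT P P"
    and pre_\<tau>: "\<lbrakk>x \<in> carrier RT; d \<in> carrier A2; f \<in> RT_words\<rbrakk> \<Longrightarrow> pre x (\<tau> d f) = \<tau> d (x # f)"
    and \<tau>_mult_Nil: "\<lbrakk>d \<in> carrier A2; d' \<in> carrier A2; f \<in> RT_words\<rbrakk> \<Longrightarrow>
      \<tau> d [] \<otimes>\<^bsub>P\<^esub> \<tau> d' f = \<tau> (d \<otimes>\<^bsub>A2\<^esub> d') f"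
    and \<tau>_mult_Cons: "\<lbrakk>d \<in> carrier A2; d' \<in> carrier A2; x \<in> carrier RT; f \<in> RT_words; y \<in> carrier RT; g \<in> RT_words\<rbrakk> \<Longrightarrow>
      \<exists>u\<in>carrier A2. \<tau> d (x # f) \<otimes>\<^bsub>P\<^esub> \<tau> d' (y # g) =
        (pre x (\<tau> d f \<otimes>\<^bsub>P\<^esub> \<tau> d' (y # g)) \<oplus>\<^bsub>P\<^esub> pre y (\<tau> d (x # f) \<otimes>\<^bsub>P\<^esub> \<tau> d' g)) \<oplus>\<^bsub>P\<^esub> \<tau> u []"
    and el_linear1: "\<lbrakk>c \<in> carrier A1; p \<in> carrier P\<rbrakk> \<Longrightarrow> (\<lambda>a. el a c p) \<in> linear_maps C RC I"
    and el_linear2: "\<lbrakk>a \<in> carrier R; p \<in> carrier P\<rbrakk> \<Longrightarrow> (\<lambda>c. el a c p) \<in> linear_maps C A1 I"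
    and el_linear3: "\<lbrakk>a \<in> carrier R; c \<in> carrier A1\<rbrakk> \<Longrightarrow> el a c \<in> linear_maps C P I"
    and gen_I: "generating_family C I (\<lambda>(a, c, d, f). el a c (\<tau> d f))
      (carrier R \<times> carrier A1 \<times> carrier A2 \<times> RT_words)"
    and one_I: "\<one>\<^bsub>I\<^esub> = el \<one> \<one>\<^bsub>A1\<^esub> \<one>\<^bsub>P\<^esub>"
    and el_mult: "\<lbrakk>a \<in> carrier R; b \<in> carrier R; c \<in> carrier A1; c' \<in> carrier A1; p \<in> carrier P; q \<in> carrier P\<rbrakk> \<Longrightarrow>
      el a c p \<otimes>\<^bsub>I\<^esub> el b c' q = el (a \<otimes> b) (c \<otimes>\<^bsub>A1\<^esub> c') (p \<otimes>\<^bsub>P\<^esub> q)"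
    and extends_I: "\<lbrakk>\<And>c d f. \<lbrakk>c \<in> carrier A1; d \<in> carrier A2; f \<in> RT_words\<rbrakk> \<Longrightarrow> (\<lambda>a. \<phi> a c d f) \<in> linear_maps C RC I;
        \<And>a d f. \<lbrakk>a \<in> carrier R; d \<in> carrier A2; f \<in> RT_words\<rbrakk> \<Longrightarrow> (\<lambda>c. \<phi> a c d f) \<in> linear_maps C A1 I;
        \<And>a c f. \<lbrakk>a \<in> carrier R; c \<in> carrier A1; f \<in> RT_words\<rbrakk> \<Longrightarrow> (\<lambda>d. \<phi> a c d f) \<in> linear_maps C A2 I;
        \<And>a c d. \<lbrakk>a \<in> carrier R; c \<in> carrier A1; d \<in> carrier A2\<rbrakk> \<Longrightarrow> multilinear C RT I (\<phi> a c d)\<rbrakk> \<Longrightarrow>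
      extends_linearly C I (\<lambda>(a, c, d, f). el a c (\<tau> d f))
        (carrier R \<times> carrier A1 \<times> carrier A2 \<times> RT_words) I (\<lambda>(a, c, d, f). \<phi> a c d f)"
    and e_linear: "f \<in> RT_words \<Longrightarrow> (\<lambda>r. e r f) \<in> linear_maps C RJ A1"
    and e_multilinear: "r \<in> carrier RJ \<Longrightarrow> multilinear C RT A1 (e r)"
begin

lemmas module_A1 = algebra.module[OF algebra_A1] and module_A2 = algebra.module[OF algebra_A2]
  and module_P = algebra.module[OF algebra_P] and module_I = algebra.module[OF algebra_I]

interpretation c1: cring A1 by (rule algebra.M_cring[OF algebra_A1])
interpretation c2: cring A2 by (rule algebra.M_cring[OF algebra_A2])
interpretation cP: cring P by (rule algebra.M_cring[OF algebra_P])
interpretation cI: cring I by (rule algebra.M_cring[OF algebra_I])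
interpretation mI: module C I by (rule module_I)

declare in_lists_conv_set [simp del]

lemma closed [simp]:
  "a \<in> carrier R \<Longrightarrow> D a \<in> carrier R" "a \<in> carrier R \<Longrightarrow> Q a \<in> carrier R"
  "x \<in> carrier RT \<Longrightarrow> x \<in> carrier R"
  "\<lbrakk>d \<in> carrier A2; f \<in> RT_words\<rbrakk> \<Longrightarrow> \<tau> d f \<in> carrier P"
  "\<lbrakk>x \<in> carrier RT; p \<in> carrier P\<rbrakk> \<Longrightarrow> pre x p \<in> carrier P"
  "\<lbrakk>a \<in> carrier R; c \<in> carrier A1; p \<in> carrier P\<rbrakk> \<Longrightarrow> el a c p \<in> carrier I"
  "\<lbrakk>a \<in> carrier R; f \<in> RT_words\<rbrakk> \<Longrightarrow> e (Q a) f \<in> carrier A1"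
  "a \<in> carrier R \<Longrightarrow> proj_T a \<in> carrier RT"
  by (simp_all add: D_closed Q_closed RT_closed multilinear_closed[OF \<tau>_multilinear]
      bilinear_maps_closed[OF pre_bilinear] linear_maps_closed[OF el_linear3]
      multilinear_closed[OF e_multilinear] Q_RJ proj_T_RT)

lemma el_add1: "\<lbrakk>a \<in> carrier R; b \<in> carrier R; c \<in> carrier A1; p \<in> carrier P\<rbrakk> \<Longrightarrow>
    el (a \<oplus> b) c p = el a c p \<oplus>\<^bsub>I\<^esub> el b c p"
  using linear_maps_add[OF el_linear1, of c p a b] by (simp add: RC_simps)

lemma el_smult1: "\<lbrakk>k \<in> constants R D; a \<in> carrier R; c \<in> carrier A1; p \<in> carrier P\<rbrakk> \<Longrightarrow>
    el (k \<otimes> a) c p = k \<odot>\<^bsub>I\<^esub> el a c p"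
  using linear_maps_smult[OF el_linear1, of c p k a] by (simp add: RC_simps C_simps)

lemma el_zero: 
  "\<lbrakk>c \<in> carrier A1; p \<in> carrier P\<rbrakk> \<Longrightarrow> el \<zero> c p = \<zero>\<^bsub>I\<^esub>"
  "\<lbrakk>a \<in> carrier R; p \<in> carrier P\<rbrakk> \<Longrightarrow> el a \<zero>\<^bsub>A1\<^esub> p = \<zero>\<^bsub>I\<^esub>"
  "\<lbrakk>a \<in> carrier R; c \<in> carrier A1\<rbrakk> \<Longrightarrow> el a c \<zero>\<^bsub>P\<^esub> = \<zero>\<^bsub>I\<^esub>"
  using linear_maps_zero[OF module_RC module_I el_linear1, of c p]
    linear_maps_zero[OF module_A1 module_I el_linear2, of a p]
    linear_maps_zero[OF module_P module_I el_linear3, of a c] by (simp_all add: RC_simps)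

lemma \<tau>_Cons_zero: "\<lbrakk>d \<in> carrier A2; f \<in> RT_words\<rbrakk> \<Longrightarrow> \<tau> d (\<zero> # f) = \<zero>\<^bsub>P\<^esub>"
  using linear_maps_zero[OF module_RT module_P multilinear_ConsD(2)[OF \<tau>_multilinear], of d f]
  by (simp add: RJ_RT_simps(3,4))

lemma e_zero: "f \<in> RT_words \<Longrightarrow> e \<zero> f = \<zero>\<^bsub>A1\<^esub>"
  using linear_maps_zero[OF module_RJ module_A1 e_linear, of f] by (simp add: RJ_RT_simps(3,4))

abbreviation "gens \<equiv> carrier R \<times> carrier A1 \<times> carrier A2 \<times> RT_words"

lemma linear_maps_I_eqI:
  assumes "h \<in> linear_maps C I I" "h' \<in> linear_maps C I I"
    and "\<And>a c d f. \<lbrakk>a \<in> carrier R; c \<in> carrier A1; d \<in> carrier A2; f \<in> RT_words\<rbrakk> \<Longrightarrow>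
      h (el a c (\<tau> d f)) = h' (el a c (\<tau> d f))"
    and "z \<in> carrier I"
  shows "h z = h' z"
  by (rule linear_maps_eqI[OF module_I module_I gen_I assms(1,2) _ assms(4)])
    (simp add: mem_Times_iff split_beta assms(3))

section \<open>The derivation and its Leibniz rule\<close>

definition deriv' :: "'i \<Rightarrow> 'i" where
  "deriv' = the_linear C I I (\<lambda>E. \<forall>a\<in>carrier R. \<forall>c\<in>carrier A1. \<forall>d\<in>carrier A2.
     E (el a c (\<tau> d [])) = el (D a) c (\<tau> d []) \<and>
     (\<forall>x\<in>carrier RT. \<forall>f\<in>RT_words.
       E (el a c (\<tau> d (x # f))) = el (D a) c (\<tau> d (x # f)) \<oplus>\<^bsub>I\<^esub> el (a \<otimes> x) c (\<tau> d f)))"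

fun deriv_word :: "'a \<Rightarrow> 'c1 \<Rightarrow> 'c2 \<Rightarrow> 'a list \<Rightarrow> 'i" where
  "deriv_word a c d [] = el (D a) c (\<tau> d [])"
| "deriv_word a c d (x # f) = el (D a) c (\<tau> d (x # f)) \<oplus>\<^bsub>I\<^esub> el (a \<otimes> x) c (\<tau> d f)"

text \<open>The removed letter is multiplied into the coefficient from \<open>R\<close>, so
  linearity in the first letter is linearity of that multiplication. At all later positions it is
  inherited from the pure tensors.\<close>

lemma deriv_word_extends:
  "extends_linearly C I (\<lambda>(a, c, d, f). el a c (\<tau> d f)) gens I (\<lambda>(a, c, d, f). deriv_word a c d f)"
proof (rule extends_I)
  fix c d f assume *: "c \<in> carrier A1" "d \<in> carrier A2" "f \<in> RT_words"
  have D: "(\<lambda>a. el (D a) c (\<tau> d f)) \<in> linear_maps C RC I"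
    by (rule linear_maps_compose[OF D_linear el_linear1]) (use * in simp_all)
  show "(\<lambda>a. deriv_word a c d f) \<in> linear_maps C RC I"
  proof (cases f)
    case Nil
    then show ?thesis using D by simp
  next
    case (Cons x f')
    then have x: "x \<in> carrier RT" and f': "f' \<in> RT_words" using *(3) by simp_all
    have "(\<lambda>a. el (a \<otimes> x) c (\<tau> d f')) \<in> linear_maps C RC I"
      by (rule linear_maps_compose[OF RC_mult_linear el_linear1]) (use * x f' in simp_all)
    from linear_maps_add_map[OF module_I D this] show ?thesis by (simp add: Cons)
  qed
next
  fix a d f assume *: "a \<in> carrier R" "d \<in> carrier A2" "f \<in> RT_words"
  show "(\<lambda>c. deriv_word a c d f) \<in> linear_maps C A1 I"
  proof (cases f)
    case Nil
    then show ?thesis using * by (simp add: el_linear2)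
  next
    case (Cons x f')
    have "(\<lambda>c. el (D a) c (\<tau> d (x # f')) \<oplus>\<^bsub>I\<^esub> el (a \<otimes> x) c (\<tau> d f')) \<in> linear_maps C A1 I"
      by (rule linear_maps_add_map[OF module_I el_linear2 el_linear2]) (use * Cons in simp_all)
    then show ?thesis by (simp add: Cons)
  qed
next
  fix a c f assume *: "a \<in> carrier R" "c \<in> carrier A1" "f \<in> RT_words"
  have D: "(\<lambda>d. el (D a) c (\<tau> d f)) \<in> linear_maps C A2 I"
    by (rule linear_maps_compose[OF \<tau>_linear el_linear3]) (use * in simp_all)
  show "(\<lambda>d. deriv_word a c d f) \<in> linear_maps C A2 I"
  proof (cases f)
    case Nil
    then show ?thesis using D by simp
  next
    case (Cons x f')
    have "(\<lambda>d. el (a \<otimes> x) c (\<tau> d f')) \<in> linear_maps C A2 I"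
      by (rule linear_maps_compose[OF \<tau>_linear el_linear3]) (use * Cons in simp_all)
    from linear_maps_add_map[OF module_I D this] show ?thesis by (simp add: Cons)
  qed
next
  fix a c d assume *: "a \<in> carrier R" "c \<in> carrier A1" "d \<in> carrier A2"
  have D: "multilinear C RT I (\<lambda>f. el (D a) c (\<tau> d f))"
    by (rule multilinear_compose[OF \<tau>_multilinear el_linear3]) (use * in simp_all)
  show "multilinear C RT I (deriv_word a c d)"
  proof (rule multilinear_ConsI)
    show "deriv_word a c d [] \<in> carrier I" using * by simp
    fix x assume x: "x \<in> carrier RT"
    have "multilinear C RT I (\<lambda>f. el (a \<otimes> x) c (\<tau> d f))"
      by (rule multilinear_compose[OF \<tau>_multilinear el_linear3]) (use * x in simp_all)
    from multilinear_add[OF module_I multilinear_ConsD(1)[OF D x] this]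
    show "multilinear C RT I (\<lambda>f. deriv_word a c d (x # f))" by simp
  next
    fix f assume f: "f \<in> RT_words"
    have "(\<lambda>x. el (a \<otimes> x) c (\<tau> d f)) \<in> linear_maps C RT I"
      by (rule linear_maps_compose[OF RT_mult_linear el_linear1]) (use * f in simp_all)
    from linear_maps_add_map[OF module_I multilinear_ConsD(2)[OF D f] this]
    show "(\<lambda>x. deriv_word a c d (x # f)) \<in> linear_maps C RT I" by simp
  qed
qed

lemma deriv_properties:
  shows deriv_linear: "deriv' \<in> linear_maps C I I"
    and deriv_el: "\<lbrakk>a \<in> carrier R; c \<in> carrier A1; d \<in> carrier A2; f \<in> RT_words\<rbrakk> \<Longrightarrow>
      deriv' (el a c (\<tau> d f)) = deriv_word a c d f"
proof -
  have "(\<forall>a\<in>carrier R. \<forall>c\<in>carrier A1. \<forall>d\<in>carrier A2.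
     E (el a c (\<tau> d [])) = el (D a) c (\<tau> d []) \<and>
     (\<forall>x\<in>carrier RT. \<forall>f\<in>RT_words.
       E (el a c (\<tau> d (x # f))) = el (D a) c (\<tau> d (x # f)) \<oplus>\<^bsub>I\<^esub> el (a \<otimes> x) c (\<tau> d f))) \<longleftrightarrow>
     (\<forall>g\<in>gens. E ((\<lambda>(a, c, d, f). el a c (\<tau> d f)) g) = (\<lambda>(a, c, d, f). deriv_word a c d f) g)" (is "?L E \<longleftrightarrow> ?R E") for E
  proof
    assume L: "?L E"
    have "E (el a c (\<tau> d f)) = deriv_word a c d f"
      if "a \<in> carrier R" "c \<in> carrier A1" "d \<in> carrier A2" "f \<in> RT_words" for a c d f
      using L that by (cases f) simp_all
    then show "?R E" by (simp add: mem_Times_iff split_beta)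
  next
    assume R: "?R E"
    have "E (el a c (\<tau> d f)) = deriv_word a c d f"
      if "a \<in> carrier R" "c \<in> carrier A1" "d \<in> carrier A2" "f \<in> RT_words" for a c d f
      using bspec[OF R, of "(a, c, d, f)"] that by simp
    then show "?L E" by simp
  qed
  note ev = the_linear_eval[OF module_I module_I gen_I deriv_word_extends this, folded deriv'_def]
  show "deriv' \<in> linear_maps C I I" by (rule ev(1))
  show "deriv' (el a c (\<tau> d f)) = deriv_word a c d f"
    if "a \<in> carrier R" "c \<in> carrier A1" "d \<in> carrier A2" "f \<in> RT_words"
    using ev(2)[of "(a, c, d, f)"] that by simp
qed

lemmas deriv_closed [simp] = linear_maps_closed[OF deriv_linear]
lemmas deriv_add = linear_maps_add[OF deriv_linear]
lemmas deriv_minus = linear_maps_minus[OF module_I module_I deriv_linear]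

text \<open>The rule for words with a first letter, for arbitrary \<open>p\<close>: the recursion
  for the product of two words puts letters in front of sums of words.\<close>

lemma deriv_pre:
  assumes "a \<in> carrier R" "c \<in> carrier A1" "x \<in> carrier RT" "p \<in> carrier P"
  shows "deriv' (el a c (pre x p)) = el (D a) c (pre x p) \<oplus>\<^bsub>I\<^esub> el (a \<otimes> x) c p"
proof (rule linear_maps_eqI[OF module_P module_I gen_P _ _ _ assms(4)])
  note pre_x = bilinear_maps_right[OF pre_bilinear assms(3)]
  show "(\<lambda>p. deriv' (el a c (pre x p))) \<in> linear_maps C P I"
    by (rule linear_maps_compose[OF linear_maps_compose[OF pre_x el_linear3] deriv_linear]) (use assms in simp_all)
  show "(\<lambda>p. el (D a) c (pre x p) \<oplus>\<^bsub>I\<^esub> el (a \<otimes> x) c p) \<in> linear_maps C P I"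
    by (rule linear_maps_add_map[OF module_I linear_maps_compose[OF pre_x el_linear3] el_linear3])
      (use assms in simp_all)
qed (use assms in \<open>simp add: mem_Times_iff split_beta pre_\<tau> deriv_el\<close>)

text \<open>For two nonempty words the product begins with the first letter of one of them, followed
  by the product in which this letter is missing. Deriving the tensor part removes that letter,
  which is what differentiating the respective factor does. The remainder \<open>\<tau> u []\<close>
  has no letter to lose, so only its length matters, and \<open>u\<close> stays unspecified in the
  locale.\<close>

lemma deriv_mult_el:
  assumes "a \<in> carrier R" "b \<in> carrier R" "c \<in> carrier A1" "c' \<in> carrier A1"
    and "d \<in> carrier A2" "d' \<in> carrier A2" "f \<in> RT_words" "g \<in> RT_words"
  shows "deriv' (el a c (\<tau> d f) \<otimes>\<^bsub>I\<^esub> el b c' (\<tau> d' g)) =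
    deriv' (el a c (\<tau> d f)) \<otimes>\<^bsub>I\<^esub> el b c' (\<tau> d' g) \<oplus>\<^bsub>I\<^esub> el a c (\<tau> d f) \<otimes>\<^bsub>I\<^esub> deriv' (el b c' (\<tau> d' g))"
proof -
  note [simp] = D_mult el_mult el_add1 deriv_el
  let ?p = "\<tau> d f \<otimes>\<^bsub>P\<^esub> \<tau> d' g"
  consider "f = []" "g = []" | y g' where "f = []" "g = y # g'" | x f' where "f = x # f'" "g = []"
    | x f' y g' where "f = x # f'" "g = y # g'"
    by (cases f; cases g) auto
  then show ?thesis
  proof cases
    case 1
    then show ?thesis using assms by (simp add: \<tau>_mult_Nil)
  next
    case 2
    then have y: "y \<in> carrier RT" "g' \<in> RT_words" using assms(8) by simp_all
    have "el a c (\<tau> d []) \<otimes>\<^bsub>I\<^esub> (el (D b) c' (\<tau> d' g) \<oplus>\<^bsub>I\<^esub> el (b \<otimes> y) c' (\<tau> d' g')) =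
        el (a \<otimes> D b) (c \<otimes>\<^bsub>A1\<^esub> c') (\<tau> (d \<otimes>\<^bsub>A2\<^esub> d') g) \<oplus>\<^bsub>I\<^esub> el (a \<otimes> (b \<otimes> y)) (c \<otimes>\<^bsub>A1\<^esub> c') (\<tau> (d \<otimes>\<^bsub>A2\<^esub> d') g')"
      using assms y by (simp add: cI.r_distr \<tau>_mult_Nil)
    then show ?thesis
      using assms 2 y by (simp add: \<tau>_mult_Nil m_assoc cI.a_assoc)
  next
    case 3
    then have x: "x \<in> carrier RT" "f' \<in> RT_words" using assms(7) by simp_all
    have comm: "\<tau> d h \<otimes>\<^bsub>P\<^esub> \<tau> d' [] = \<tau> (d \<otimes>\<^bsub>A2\<^esub> d') h" if "h \<in> RT_words" for h
      using that assms cP.m_comm[of "\<tau> d h" "\<tau> d' []"] c2.m_comm[of d d'] by (simp add: \<tau>_mult_Nil)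
    have "(el (D a) c (\<tau> d f) \<oplus>\<^bsub>I\<^esub> el (a \<otimes> x) c (\<tau> d f')) \<otimes>\<^bsub>I\<^esub> el b c' (\<tau> d' []) =
        el (D a \<otimes> b) (c \<otimes>\<^bsub>A1\<^esub> c') (\<tau> (d \<otimes>\<^bsub>A2\<^esub> d') f) \<oplus>\<^bsub>I\<^esub> el (a \<otimes> x \<otimes> b) (c \<otimes>\<^bsub>A1\<^esub> c') (\<tau> (d \<otimes>\<^bsub>A2\<^esub> d') f')"
      using assms x by (simp add: cI.l_distr comm)
    moreover have "a \<otimes> b \<otimes> x = a \<otimes> x \<otimes> b" using assms x by (simp add: m_ac)
    ultimately show ?thesis
      using assms 3 x by (simp add: comm cI.a_ac)
  next
    case 4
    then have l: "x \<in> carrier RT" "f' \<in> RT_words" "y \<in> carrier RT" "g' \<in> RT_words"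
      using assms(7,8) by simp_all
    obtain u where u: "u \<in> carrier A2" and p: "?p =
        (pre x (\<tau> d f' \<otimes>\<^bsub>P\<^esub> \<tau> d' g) \<oplus>\<^bsub>P\<^esub> pre y (\<tau> d f \<otimes>\<^bsub>P\<^esub> \<tau> d' g')) \<oplus>\<^bsub>P\<^esub> \<tau> u []"
      using \<tau>_mult_Cons[OF assms(5,6) l] by (auto simp: 4)
    let ?c = "c \<otimes>\<^bsub>A1\<^esub> c'" and ?p1 = "\<tau> d f' \<otimes>\<^bsub>P\<^esub> \<tau> d' g" and ?p2 = "\<tau> d f \<otimes>\<^bsub>P\<^esub> \<tau> d' g'"
    let ?ab = "a \<otimes> b"
    have cl: "?ab \<in> carrier R" "?c \<in> carrier A1" "?p1 \<in> carrier P" "?p2 \<in> carrier P" "?p \<in> carrier P"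
      using assms l by simp_all
    note add3 = linear_maps_add[OF el_linear3]
    have el_p: "el r ?c ?p = (el r ?c (pre x ?p1) \<oplus>\<^bsub>I\<^esub> el r ?c (pre y ?p2)) \<oplus>\<^bsub>I\<^esub> el r ?c (\<tau> u [])"
      if "r \<in> carrier R" for r
      unfolding p using that cl l u by (simp add: add3)
    have "deriv' (el ?ab ?c ?p) =
        ((el (D ?ab) ?c (pre x ?p1) \<oplus>\<^bsub>I\<^esub> el (?ab \<otimes> x) ?c ?p1) \<oplus>\<^bsub>I\<^esub>
         (el (D ?ab) ?c (pre y ?p2) \<oplus>\<^bsub>I\<^esub> el (?ab \<otimes> y) ?c ?p2)) \<oplus>\<^bsub>I\<^esub> el (D ?ab) ?c (\<tau> u [])"
      unfolding el_p[OF cl(1)] using cl l u by (simp add: deriv_add deriv_pre del: D_mult)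
    also have "\<dots> = el (D ?ab) ?c ?p \<oplus>\<^bsub>I\<^esub> (el (?ab \<otimes> x) ?c ?p1 \<oplus>\<^bsub>I\<^esub> el (?ab \<otimes> y) ?c ?p2)"
    proof -
      have "D ?ab \<in> carrier R" using cl by simp
      then show ?thesis unfolding el_p[OF \<open>D ?ab \<in> carrier R\<close>] using cl l u by (simp add: cI.a_ac del: D_mult)
    qed
    finally have L: "deriv' (el ?ab ?c ?p) =
        el (D ?ab) ?c ?p \<oplus>\<^bsub>I\<^esub> (el (?ab \<otimes> x) ?c ?p1 \<oplus>\<^bsub>I\<^esub> el (?ab \<otimes> y) ?c ?p2)" .
    have D: "el (D ?ab) ?c ?p = el (D a \<otimes> b) ?c ?p \<oplus>\<^bsub>I\<^esub> el (a \<otimes> D b) ?c ?p"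
      using assms cl by simp
    have m: "a \<otimes> x \<otimes> b = ?ab \<otimes> x" "a \<otimes> (b \<otimes> y) = ?ab \<otimes> y" using assms l by (simp_all add: m_ac)
    have R1: "(el (D a) c (\<tau> d f) \<oplus>\<^bsub>I\<^esub> el (a \<otimes> x) c (\<tau> d f')) \<otimes>\<^bsub>I\<^esub> el b c' (\<tau> d' g) =
        el (D a \<otimes> b) ?c ?p \<oplus>\<^bsub>I\<^esub> el (?ab \<otimes> x) ?c ?p1"
      unfolding m(1)[symmetric] using assms l by (simp add: cI.l_distr)
    have R2: "el a c (\<tau> d f) \<otimes>\<^bsub>I\<^esub> (el (D b) c' (\<tau> d' g) \<oplus>\<^bsub>I\<^esub> el (b \<otimes> y) c' (\<tau> d' g')) =
        el (a \<otimes> D b) ?c ?p \<oplus>\<^bsub>I\<^esub> el (?ab \<otimes> y) ?c ?p2"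
      unfolding m(2)[symmetric] using assms l by (simp add: cI.r_distr)
    have df: "deriv' (el a c (\<tau> d f)) = el (D a) c (\<tau> d f) \<oplus>\<^bsub>I\<^esub> el (a \<otimes> x) c (\<tau> d f')"
      and dg: "deriv' (el b c' (\<tau> d' g)) = el (D b) c' (\<tau> d' g) \<oplus>\<^bsub>I\<^esub> el (b \<otimes> y) c' (\<tau> d' g')"
      using assms l by (simp_all add: 4)
    have ac: "(s \<oplus>\<^bsub>I\<^esub> t) \<oplus>\<^bsub>I\<^esub> (v \<oplus>\<^bsub>I\<^esub> w) = (s \<oplus>\<^bsub>I\<^esub> v) \<oplus>\<^bsub>I\<^esub> (t \<oplus>\<^bsub>I\<^esub> w)"
      if "s \<in> carrier I" "t \<in> carrier I" "v \<in> carrier I" "w \<in> carrier I" for s t v w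
      using that by (simp add: cI.a_ac)
    have prod: "el a c (\<tau> d f) \<otimes>\<^bsub>I\<^esub> el b c' (\<tau> d' g) = el ?ab ?c ?p"
      using assms by simp
    show ?thesis
      unfolding df dg R1 R2 prod L D
      by (rule ac) (use assms l cl in simp_all)
  qed
qed

lemma deriv_mult:
  assumes "y \<in> carrier I" "z \<in> carrier I"
  shows "deriv' (y \<otimes>\<^bsub>I\<^esub> z) = deriv' y \<otimes>\<^bsub>I\<^esub> z \<oplus>\<^bsub>I\<^esub> y \<otimes>\<^bsub>I\<^esub> deriv' z"
proof (rule bilinear_maps_eqI[OF module_I module_I module_I gen_I gen_I _ _ _ assms])
  note m = algebra_mult_bilinear[OF algebra_I]
  show "(\<lambda>y z. deriv' (y \<otimes>\<^bsub>I\<^esub> z)) \<in> bilinear_maps C I I I"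
    by (rule bilinear_maps_compose[OF m deriv_linear])
  show "(\<lambda>y z. deriv' y \<otimes>\<^bsub>I\<^esub> z \<oplus>\<^bsub>I\<^esub> y \<otimes>\<^bsub>I\<^esub> deriv' z) \<in> bilinear_maps C I I I"
    by (rule bilinear_maps_add_map[OF module_I bilinear_maps_precompose[OF m deriv_linear linear_maps_ident]
          bilinear_maps_precompose[OF m linear_maps_ident deriv_linear]])
qed (simp add: mem_Times_iff split_beta deriv_mult_el)

interpretation aI: algebra C I by (rule algebra_I)

section \<open>The integral\<close>

definition integral' :: "'i \<Rightarrow> 'i" where
  "integral' = the_linear C I I (\<lambda>J. \<forall>a\<in>carrier R. \<forall>c\<in>carrier A1. \<forall>d\<in>carrier A2.
     J (el a c (\<tau> d [])) =
       (el (Q a) c (\<tau> d []) \<ominus>\<^bsub>I\<^esub> el \<one> (c \<otimes>\<^bsub>A1\<^esub> e (Q a) []) (\<tau> d []))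
       \<oplus>\<^bsub>I\<^esub> el \<one> c (\<tau> d [a \<ominus> D (Q a)]) \<and>
     (\<forall>x\<in>carrier RT. \<forall>f\<in>RT_words.
       J (el a c (\<tau> d (x # f))) =
         ((el (Q a) c (\<tau> d (x # f)) \<ominus>\<^bsub>I\<^esub> el \<one> (c \<otimes>\<^bsub>A1\<^esub> e (Q a) (x # f)) (\<tau> d []))
         \<ominus>\<^bsub>I\<^esub> J (el (Q a \<otimes> x) c (\<tau> d f)))
         \<oplus>\<^bsub>I\<^esub> el \<one> c (\<tau> d ((a \<ominus> D (Q a)) # x # f))))"

text \<open>The subtracted term acts as a constant of integration: it has coefficient one in
  \<open>R\<close> and empty tensor part, so \<open>deriv'\<close> annihilates it. It is grouped
  with the leading term because neither involves the recursion.\<close>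

definition int_base :: "'a \<Rightarrow> 'c1 \<Rightarrow> 'c2 \<Rightarrow> 'a list \<Rightarrow> 'i" where
  "int_base a c d f = el (Q a) c (\<tau> d f) \<ominus>\<^bsub>I\<^esub> el \<one> (c \<otimes>\<^bsub>A1\<^esub> e (Q a) f) (\<tau> d [])"

definition int_tail :: "'a \<Rightarrow> 'c1 \<Rightarrow> 'c2 \<Rightarrow> 'a list \<Rightarrow> 'i" where
  "int_tail a c d f = el \<one> c (\<tau> d (proj_T a # f))"

text \<open>Integration by parts: the first letter is absorbed into the coefficient as
  \<open>Q a \<otimes> x\<close> while the word gets shorter. The coefficient thus changes along the
  recursion, and inductions on the word have to keep \<open>a\<close> arbitrary.\<close>

fun int_word :: "'a \<Rightarrow> 'c1 \<Rightarrow> 'c2 \<Rightarrow> 'a list \<Rightarrow> 'i" where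
  "int_word a c d [] = int_base a c d [] \<oplus>\<^bsub>I\<^esub> int_tail a c d []"
| "int_word a c d (x # f) =
    (int_base a c d (x # f) \<ominus>\<^bsub>I\<^esub> int_word (Q a \<otimes> x) c d f) \<oplus>\<^bsub>I\<^esub> int_tail a c d (x # f)"

lemma int_closed [simp]:
  assumes "a \<in> carrier R" "c \<in> carrier A1" "d \<in> carrier A2" "f \<in> RT_words"
  shows "int_base a c d f \<in> carrier I" "int_tail a c d f \<in> carrier I" "int_word a c d f \<in> carrier I"
proof -
  have base: "int_base a c d f \<in> carrier I" and tail: "int_tail a c d f \<in> carrier I"
    if "a \<in> carrier R" "f \<in> RT_words" for a f
    using that assms(2,3) by (simp_all add: int_base_def int_tail_def)
  show "int_base a c d f \<in> carrier I" "int_tail a c d f \<in> carrier I"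
    using base tail assms by simp_all
  show "int_word a c d f \<in> carrier I"
    using assms(1,4)
  proof (induction f arbitrary: a)
    case (Cons x f)
    then have "int_word (Q a \<otimes> x) c d f \<in> carrier I" by simp
    then show ?case using base[of a "x # f"] tail[of a "x # f"] Cons.prems by simp
  qed (use base tail in simp)
qed

lemma int_linear1:
  assumes c: "c \<in> carrier A1" and d: "d \<in> carrier A2"
  shows int_base_linear1: "f \<in> RT_words \<Longrightarrow> (\<lambda>a. int_base a c d f) \<in> linear_maps C RC I"
    and int_tail_linear1: "f \<in> RT_words \<Longrightarrow> (\<lambda>a. int_tail a c d f) \<in> linear_maps C RC I"
    and int_word_linear1: "f \<in> RT_words \<Longrightarrow> (\<lambda>a. int_word a c d f) \<in> linear_maps C RC I"
proof -
  note bA1 = algebra_mult_bilinear[OF algebra_A1]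
  show base: "(\<lambda>a. int_base a c d f) \<in> linear_maps C RC I" if f: "f \<in> RT_words" for f
    unfolding int_base_def
  proof (rule linear_maps_minus_map[OF module_I])
    show "(\<lambda>a. el (Q a) c (\<tau> d f)) \<in> linear_maps C RC I"
      by (rule linear_maps_compose[OF Q_linear_map el_linear1]) (use c d f in simp_all)
    show "(\<lambda>a. el \<one> (c \<otimes>\<^bsub>A1\<^esub> e (Q a) f) (\<tau> d [])) \<in> linear_maps C RC I"
      by (rule linear_maps_compose[OF linear_maps_compose[OF Q_linear_RJ e_linear[OF f]]
            linear_maps_compose[OF bilinear_maps_right[OF bA1 c] el_linear2]]) (use d in simp_all)
  qed
  show tail: "(\<lambda>a. int_tail a c d f) \<in> linear_maps C RC I" if f: "f \<in> RT_words" for f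
    unfolding int_tail_def
    by (rule linear_maps_compose[OF proj_T_linear
          linear_maps_compose[OF multilinear_ConsD(2)[OF \<tau>_multilinear[OF d] f] el_linear3]]) (use c in simp_all)
  show "(\<lambda>a. int_word a c d f) \<in> linear_maps C RC I" if "f \<in> RT_words"
    using that
  proof (induction f)
    case Nil
    show ?case using linear_maps_add_map[OF module_I base[OF lists.Nil] tail[OF lists.Nil]] by simp
  next
    case (Cons x f)
    then have x: "x \<in> carrier RT" and f: "f \<in> RT_words"
      and IH: "(\<lambda>a. int_word a c d f) \<in> linear_maps C RC I" by simp_all
    have "(\<lambda>a. int_word (Q a \<otimes> x) c d f) \<in> linear_maps C RC I"
      by (rule linear_maps_compose[OF linear_maps_compose[OF Q_linear_map RC_mult_linear] IH]) (use x in simp)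
    from linear_maps_add_map[OF module_I linear_maps_minus_map[OF module_I base this] tail, of "x # f" "x # f"]
    show ?case using x f by simp
  qed
qed

lemma int_word_linear2:
  assumes "a \<in> carrier R" "d \<in> carrier A2" "f \<in> RT_words"
  shows "(\<lambda>c. int_word a c d f) \<in> linear_maps C A1 I"
proof -
  note bA1 = algebra_mult_bilinear[OF algebra_A1]
  have base: "(\<lambda>c. int_base a c d f) \<in> linear_maps C A1 I" if "a \<in> carrier R" "f \<in> RT_words" for a f
    unfolding int_base_def
  proof (rule linear_maps_minus_map[OF module_I])
    show "(\<lambda>c. el (Q a) c (\<tau> d f)) \<in> linear_maps C A1 I"
      by (rule el_linear2) (use that assms in simp_all)
    show "(\<lambda>c. el \<one> (c \<otimes>\<^bsub>A1\<^esub> e (Q a) f) (\<tau> d [])) \<in> linear_maps C A1 I"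
      by (rule linear_maps_compose[OF bilinear_maps_left[OF bA1] el_linear2]) (use that assms in simp_all)
  qed
  have tail: "(\<lambda>c. int_tail a c d f) \<in> linear_maps C A1 I" if "a \<in> carrier R" "f \<in> RT_words" for a f
    unfolding int_tail_def by (rule el_linear2) (use that assms in simp_all)
  show ?thesis
    using assms(1,3)
  proof (induction f arbitrary: a)
    case Nil
    show ?case using linear_maps_add_map[OF module_I base[OF Nil] tail[OF Nil]] by simp
  next
    case (Cons x f)
    then have IH: "(\<lambda>c. int_word (Q a \<otimes> x) c d f) \<in> linear_maps C A1 I" by simp
    show ?case
      using linear_maps_add_map[OF module_I linear_maps_minus_map[OF module_I base[OF Cons.prems] IH] tail[OF Cons.prems]]
      by simp
  qed
qed

lemma int_word_linear3:
  assumes "a \<in> carrier R" "c \<in> carrier A1" "f \<in> RT_words"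
  shows "(\<lambda>d. int_word a c d f) \<in> linear_maps C A2 I"
proof -
  have base: "(\<lambda>d. int_base a c d f) \<in> linear_maps C A2 I" if "a \<in> carrier R" "f \<in> RT_words" for a f
    unfolding int_base_def
    by (rule linear_maps_minus_map[OF module_I linear_maps_compose[OF \<tau>_linear el_linear3]
          linear_maps_compose[OF \<tau>_linear el_linear3]]) (use that assms in simp_all)
  have tail: "(\<lambda>d. int_tail a c d f) \<in> linear_maps C A2 I" if "a \<in> carrier R" "f \<in> RT_words" for a f
    unfolding int_tail_def
    by (rule linear_maps_compose[OF \<tau>_linear el_linear3]) (use that assms in simp_all)
  show ?thesis
    using assms(1,3)
  proof (induction f arbitrary: a)
    case Nil
    show ?case using linear_maps_add_map[OF module_I base[OF Nil] tail[OF Nil]] by simp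
  next
    case (Cons x f)
    then have IH: "(\<lambda>d. int_word (Q a \<otimes> x) c d f) \<in> linear_maps C A2 I" by simp
    show ?case
      using linear_maps_add_map[OF module_I linear_maps_minus_map[OF module_I base[OF Cons.prems] IH] tail[OF Cons.prems]]
      by simp
  qed
qed

text \<open>Behind a prefix \<open>u\<close>, the varying letter reaches the coefficient after
  \<open>length u\<close> recursive calls plus one. From then on linearity in the coefficient, that
  is \<open>int_word_linear1\<close>, gives linearity in the letter. The nonrecursive terms are
  multilinear outright.\<close>

lemma int_word_multilinear:
  assumes a: "a \<in> carrier R" and c: "c \<in> carrier A1" and d: "d \<in> carrier A2"
  shows "multilinear C RT I (int_word a c d)"
proof -
  note bA1 = algebra_mult_bilinear[OF algebra_A1]
  note \<tau>m = \<tau>_multilinear[OF d]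
  have base: "multilinear C RT I (int_base a c d)" if a: "a \<in> carrier R" for a
    unfolding int_base_def[abs_def]
  proof (rule multilinear_minus[OF module_I])
    show "multilinear C RT I (\<lambda>f. el (Q a) c (\<tau> d f))"
      by (rule multilinear_compose[OF \<tau>m el_linear3]) (use a c in simp_all)
    show "multilinear C RT I (\<lambda>f. el \<one> (c \<otimes>\<^bsub>A1\<^esub> e (Q a) f) (\<tau> d []))"
      by (rule multilinear_compose[OF e_multilinear[OF Q_RJ[OF a]]
            linear_maps_compose[OF bilinear_maps_right[OF bA1 c] el_linear2]]) (use d in simp_all)
  qed
  have tail: "multilinear C RT I (int_tail a c d)" if a: "a \<in> carrier R" for a
    unfolding int_tail_def[abs_def]
    by (rule multilinear_compose[OF multilinear_ConsD(1)[OF \<tau>m] el_linear3]) (use a c in simp_all)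
  have "(\<lambda>x. int_word a c d (u @ [x] @ v)) \<in> linear_maps C RT I"
    if "a \<in> carrier R" "u \<in> RT_words" and v: "v \<in> RT_words" for a u v
    using that(1,2)
  proof (induction u arbitrary: a)
    case Nil
    have rec: "(\<lambda>x. int_word (Q a \<otimes> x) c d v) \<in> linear_maps C RT I"
      by (rule linear_maps_compose[OF RT_mult_linear int_word_linear1[OF c d v]]) (use Nil in simp)
    show ?case
      using linear_maps_add_map[OF module_I linear_maps_minus_map[OF module_I
            multilinear_ConsD(2)[OF base v] rec] multilinear_ConsD(2)[OF tail v]] Nil
      by simp
  next
    case (Cons y u)
    then have yu: "y # u \<in> RT_words"
      and IH: "(\<lambda>x. int_word (Q a \<otimes> y) c d (u @ [x] @ v)) \<in> linear_maps C RT I" by simp_all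
    show ?case
      using linear_maps_add_map[OF module_I linear_maps_minus_map[OF module_I
            multilinear_linear[OF base[OF Cons.prems(1)] yu v] IH] multilinear_linear[OF tail[OF Cons.prems(1)] yu v]]
      by simp
  qed
  then show ?thesis
    unfolding multilinear_def using a c d by (intro conjI ballI funcsetI int_closed) blast+
qed

lemma integral_properties:
  shows integral_linear: "integral' \<in> linear_maps C I I"
    and integral_el: "\<lbrakk>a \<in> carrier R; c \<in> carrier A1; d \<in> carrier A2; f \<in> RT_words\<rbrakk> \<Longrightarrow>
      integral' (el a c (\<tau> d f)) = int_word a c d f"
proof -
  have ext: "extends_linearly C I (\<lambda>(a, c, d, f). el a c (\<tau> d f)) gens I (\<lambda>(a, c, d, f). int_word a c d f)"
    by (intro extends_I int_word_linear1 int_word_linear2 int_word_linear3 int_word_multilinear)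
  \<comment> \<open>The defining condition mentions \<open>J\<close> on the right-hand side, but
    only at a shorter word. Induction on the word shows that it amounts to prescribing the values
    \<open>int_word\<close>.\<close>
  have P: "(\<forall>a\<in>carrier R. \<forall>c\<in>carrier A1. \<forall>d\<in>carrier A2.
     J (el a c (\<tau> d [])) =
       (el (Q a) c (\<tau> d []) \<ominus>\<^bsub>I\<^esub> el \<one> (c \<otimes>\<^bsub>A1\<^esub> e (Q a) []) (\<tau> d []))
       \<oplus>\<^bsub>I\<^esub> el \<one> c (\<tau> d [a \<ominus> D (Q a)]) \<and>
     (\<forall>x\<in>carrier RT. \<forall>f\<in>RT_words.
       J (el a c (\<tau> d (x # f))) =
         ((el (Q a) c (\<tau> d (x # f)) \<ominus>\<^bsub>I\<^esub> el \<one> (c \<otimes>\<^bsub>A1\<^esub> e (Q a) (x # f)) (\<tau> d []))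
         \<ominus>\<^bsub>I\<^esub> J (el (Q a \<otimes> x) c (\<tau> d f)))
         \<oplus>\<^bsub>I\<^esub> el \<one> c (\<tau> d ((a \<ominus> D (Q a)) # x # f)))) \<longleftrightarrow>
     (\<forall>g\<in>gens. J ((\<lambda>(a, c, d, f). el a c (\<tau> d f)) g) = (\<lambda>(a, c, d, f). int_word a c d f) g)" (is "?L J \<longleftrightarrow> ?R J") for J
  proof
    assume L: "?L J"
    have "J (el a c (\<tau> d f)) = int_word a c d f"
      if "a \<in> carrier R" "c \<in> carrier A1" "d \<in> carrier A2" "f \<in> RT_words" for a c d f
      using that(1,4)
    proof (induction f arbitrary: a)
      case Nil
      then show ?case
        using L that by (simp add: int_base_def int_tail_def proj_T_def)
    next
      case (Cons x f)
      then have x: "x \<in> carrier RT" "f \<in> RT_words" by simp_all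
      have "J (el (Q a \<otimes> x) c (\<tau> d f)) = int_word (Q a \<otimes> x) c d f"
        using Cons x by simp
      then show ?case
        using L[rule_format, THEN conjunct2, rule_format, OF Cons.prems(1) that(2,3) x]
        by (simp add: int_base_def int_tail_def proj_T_def)
    qed
    then show "?R J" by (simp add: mem_Times_iff split_beta)
  next
    assume R: "?R J"
    have J: "J (el a c (\<tau> d f)) = int_word a c d f"
      if "a \<in> carrier R" "c \<in> carrier A1" "d \<in> carrier A2" "f \<in> RT_words" for a c d f
      using bspec[OF R, of "(a, c, d, f)"] that by simp
    show "?L J"
      by (intro ballI conjI) (simp_all add: J int_base_def int_tail_def proj_T_def)
  qed
  note ev = the_linear_eval[OF module_I module_I gen_I ext P, folded integral'_def]
  show "integral' \<in> linear_maps C I I" by (rule ev(1))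
  show "integral' (el a c (\<tau> d f)) = int_word a c d f"
    if "a \<in> carrier R" "c \<in> carrier A1" "d \<in> carrier A2" "f \<in> RT_words"
    using ev(2)[of "(a, c, d, f)"] that by simp
qed

lemmas integral_closed [simp] = linear_maps_closed[OF integral_linear]

lemma int_word_zero: "\<lbrakk>c \<in> carrier A1; d \<in> carrier A2; f \<in> RT_words\<rbrakk> \<Longrightarrow> int_word \<zero> c d f = \<zero>\<^bsub>I\<^esub>"
  using linear_maps_zero[OF module_RC module_I int_word_linear1, of c d f] by (simp add: RC_simps)

lemma proj_T_of_RT: "x \<in> carrier RT \<Longrightarrow> proj_T x = x"
  by (simp add: proj_T_def Q_RT D_zero a_minus_def)

text \<open>If \<open>Q x\<close> is zero, the base part and the recursive part vanish and
  \<open>proj_T\<close> fixes \<open>x\<close>, so integrating merely prefixes \<open>x\<close>.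
  This is what makes nested integrals equal to pure tensors.\<close>

lemma int_word_RT:
  assumes "x \<in> carrier RT" "c \<in> carrier A1" "d \<in> carrier A2" "f \<in> RT_words"
  shows "int_word x c d f = el \<one> c (\<tau> d (x # f))"
proof -
  have base: "int_base x c d g = \<zero>\<^bsub>I\<^esub>" if "g \<in> RT_words" for g
    using that assms by (simp add: int_base_def Q_RT el_zero e_zero a_minus_def)
  show ?thesis
    using assms base[OF assms(4)]
    by (cases f) (simp_all add: int_tail_def proj_T_of_RT Q_RT int_word_zero a_minus_def)
qed

lemma integral_RT:
  "\<lbrakk>x \<in> carrier RT; c \<in> carrier A1; d \<in> carrier A2; f \<in> RT_words\<rbrakk> \<Longrightarrow>
    integral' (el x c (\<tau> d f)) = el \<one> c (\<tau> d (x # f))"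
  by (simp add: integral_el int_word_RT)

lemma deriv_int_tail:
  assumes "a \<in> carrier R" "c \<in> carrier A1" "d \<in> carrier A2" "f \<in> RT_words"
  shows "deriv' (int_tail a c d f) = el (proj_T a) c (\<tau> d f)"
  using assms by (simp add: int_tail_def deriv_el D_one el_zero)

lemma el_proj_T:
  assumes "a \<in> carrier R" "c \<in> carrier A1" "p \<in> carrier P"
  shows "el (D (Q a)) c p \<oplus>\<^bsub>I\<^esub> el (proj_T a) c p = el a c p"
proof -
  have "D (Q a) \<oplus> proj_T a = a"
    using assms by (simp add: proj_T_def a_minus_def a_comm r_neg1 a_lcomm[of _ a] r_neg)
  then show ?thesis using assms el_add1[of "D (Q a)" "proj_T a" c p] by simp
qed

text \<open>Deriving the base term produces, besides its derivative in \<open>R\<close>, the term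
  \<open>Q a \<otimes> x\<close> with the shortened word; by induction the derivative of the
  recursive integral cancels it. The remaining coefficients \<open>D (Q a)\<close> and
  \<open>proj_T a\<close> add up to \<open>a\<close>.\<close>

lemma deriv_int_word:
  assumes "a \<in> carrier R" "c \<in> carrier A1" "d \<in> carrier A2" "f \<in> RT_words"
  shows "deriv' (int_word a c d f) = el a c (\<tau> d f)"
  using assms(1,4)
proof (induction f arbitrary: a)
  case Nil
  have "deriv' (int_base a c d []) = el (D (Q a)) c (\<tau> d []) \<ominus>\<^bsub>I\<^esub> \<zero>\<^bsub>I\<^esub>"
    using assms Nil by (simp add: int_base_def deriv_minus deriv_el D_one el_zero)
  then show ?case
    using assms Nil el_proj_T[of a c "\<tau> d []"]
    by (simp add: deriv_add deriv_int_tail a_minus_def)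
next
  case (Cons x f)
  then have x: "x \<in> carrier RT" "f \<in> RT_words" by simp_all
  have IH: "deriv' (int_word (Q a \<otimes> x) c d f) = el (Q a \<otimes> x) c (\<tau> d f)"
    using Cons x by simp
  have "deriv' (int_base a c d (x # f)) =
      (el (D (Q a)) c (\<tau> d (x # f)) \<oplus>\<^bsub>I\<^esub> el (Q a \<otimes> x) c (\<tau> d f)) \<ominus>\<^bsub>I\<^esub> \<zero>\<^bsub>I\<^esub>"
    using assms Cons.prems x by (simp add: int_base_def deriv_minus deriv_el D_one el_zero)
  then have base: "deriv' (int_base a c d (x # f)) = el (D (Q a)) c (\<tau> d (x # f)) \<oplus>\<^bsub>I\<^esub> el (Q a \<otimes> x) c (\<tau> d f)"
    using assms Cons.prems x by (simp add: a_minus_def)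
  have cancel: "(u \<oplus>\<^bsub>I\<^esub> v) \<ominus>\<^bsub>I\<^esub> v = u" if "u \<in> carrier I" "v \<in> carrier I" for u v
    using that by (simp add: a_minus_def cI.a_assoc cI.r_neg)
  have "deriv' (int_word a c d (x # f)) =
      ((el (D (Q a)) c (\<tau> d (x # f)) \<oplus>\<^bsub>I\<^esub> el (Q a \<otimes> x) c (\<tau> d f)) \<ominus>\<^bsub>I\<^esub> el (Q a \<otimes> x) c (\<tau> d f))
      \<oplus>\<^bsub>I\<^esub> el (proj_T a) c (\<tau> d (x # f))"
    using assms Cons.prems x by (simp add: deriv_add deriv_minus base IH deriv_int_tail)
  also have "\<dots> = el a c (\<tau> d (x # f))"
    using assms Cons.prems x el_proj_T[of a c "\<tau> d (x # f)"] by (simp add: cancel)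
  finally show ?case .
qed

lemma deriv_integral:
  assumes "z \<in> carrier I" shows "deriv' (integral' z) = z"
  by (rule linear_maps_I_eqI[OF linear_maps_compose[OF integral_linear deriv_linear] linear_maps_ident _ assms])
    (simp add: integral_el deriv_int_word)

text \<open>The elements over which the integral is linear. They form a \<open>C\<close>-submodule,
  so instead of determining the constants it is enough to write each of them as a combination of
  elements that evidently lie here.\<close>

definition scalars :: "'i set" where
  "scalars = {z \<in> carrier I. \<forall>y\<in>carrier I. integral' (z \<otimes>\<^bsub>I\<^esub> y) = z \<otimes>\<^bsub>I\<^esub> integral' y}"

lemma scalars_zero: "\<zero>\<^bsub>I\<^esub> \<in> scalars"
  using linear_maps_zero[OF module_I module_I integral_linear] by (simp add: scalars_def)

lemma scalars_add: "\<lbrakk>y \<in> scalars; z \<in> scalars\<rbrakk> \<Longrightarrow> y \<oplus>\<^bsub>I\<^esub> z \<in> scalars"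
  by (simp add: scalars_def cI.l_distr linear_maps_add[OF integral_linear])

lemma scalars_smult: "\<lbrakk>k \<in> constants R D; z \<in> scalars\<rbrakk> \<Longrightarrow> k \<odot>\<^bsub>I\<^esub> z \<in> scalars"
  using C_simps(1) by (simp add: scalars_def aI.smult_assoc2 linear_maps_smult[OF integral_linear])

text \<open>Multiplication by such an element only changes the coefficients in \<open>A1\<close> and
  \<open>A2\<close>. Every term of the integral carries these coefficients along as factors,
  including the term with \<open>e\<close>, where one more factor is multiplied to the first of
  them.\<close>

lemma scalars_const:
  assumes c: "c \<in> carrier A1" and d: "d \<in> carrier A2"
  shows "el \<one> c (\<tau> d []) \<in> scalars"
  unfolding scalars_def
proof (intro CollectI conjI ballI)
  show "el \<one> c (\<tau> d []) \<in> carrier I" using assms by simp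
  fix y assume y: "y \<in> carrier I"
  note bI = algebra_mult_bilinear[OF algebra_I]
  let ?z = "el \<one> c (\<tau> d [])"
  have z: "?z \<in> carrier I" using assms by simp
  have mult: "?z \<otimes>\<^bsub>I\<^esub> el a c' (\<tau> d' f) = el a (c \<otimes>\<^bsub>A1\<^esub> c') (\<tau> (d \<otimes>\<^bsub>A2\<^esub> d') f)"
    if "a \<in> carrier R" "c' \<in> carrier A1" "d' \<in> carrier A2" "f \<in> RT_words" for a c' d' f
    using that assms by (simp add: el_mult \<tau>_mult_Nil)
  have minus: "?z \<otimes>\<^bsub>I\<^esub> (u \<ominus>\<^bsub>I\<^esub> v) = ?z \<otimes>\<^bsub>I\<^esub> u \<ominus>\<^bsub>I\<^esub> ?z \<otimes>\<^bsub>I\<^esub> v"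
    if "u \<in> carrier I" "v \<in> carrier I" for u v
    using that z by (simp add: a_minus_def cI.r_distr cI.r_minus)
  have word: "int_word a (c \<otimes>\<^bsub>A1\<^esub> c') (d \<otimes>\<^bsub>A2\<^esub> d') f = ?z \<otimes>\<^bsub>I\<^esub> int_word a c' d' f"
    if "a \<in> carrier R" "f \<in> RT_words" and c': "c' \<in> carrier A1" and d': "d' \<in> carrier A2" for a c' d' f
  proof -
    have base: "int_base a (c \<otimes>\<^bsub>A1\<^esub> c') (d \<otimes>\<^bsub>A2\<^esub> d') f = ?z \<otimes>\<^bsub>I\<^esub> int_base a c' d' f"
      and tail: "int_tail a (c \<otimes>\<^bsub>A1\<^esub> c') (d \<otimes>\<^bsub>A2\<^esub> d') f = ?z \<otimes>\<^bsub>I\<^esub> int_tail a c' d' f"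
      if "a \<in> carrier R" "f \<in> RT_words" for a f
      using that c' d' assms by (simp_all add: int_base_def int_tail_def minus mult c1.m_assoc)
    show ?thesis
      using that(1,2)
    proof (induction f arbitrary: a)
      case Nil
      then show ?case using base[OF Nil] tail[OF Nil] c' d' z by (simp add: cI.r_distr)
    next
      case (Cons x f)
      then have x: "x \<in> carrier RT" "f \<in> RT_words" by simp_all
      have IH: "int_word (Q a \<otimes> x) (c \<otimes>\<^bsub>A1\<^esub> c') (d \<otimes>\<^bsub>A2\<^esub> d') f = ?z \<otimes>\<^bsub>I\<^esub> int_word (Q a \<otimes> x) c' d' f"
        using Cons x by simp
      show ?case
        using Cons.prems x base[OF Cons.prems] tail[OF Cons.prems] c' d' z
        by (simp add: IH minus cI.r_distr)
    qed
  qed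
  show "integral' (?z \<otimes>\<^bsub>I\<^esub> y) = ?z \<otimes>\<^bsub>I\<^esub> integral' y"
    by (rule linear_maps_I_eqI[OF linear_maps_compose[OF bilinear_maps_right[OF bI z] integral_linear]
          linear_maps_compose[OF integral_linear bilinear_maps_right[OF bI z]] _ y])
      (use assms in \<open>simp add: mult integral_el word\<close>)
qed

text \<open>On generators, integrating the derivative returns the element up to the constant of
  integration \<open>s\<close> and, for an empty word only, up to the part of \<open>a\<close> that
  \<open>D\<close> annihilates. For a nonempty word that part is recovered from the term in which
  the first letter was removed.\<close>

lemma initial_value_scalar:
  assumes z: "z \<in> carrier I"
  shows "z \<ominus>\<^bsub>I\<^esub> integral' (deriv' z) \<in> scalars"
proof -
  have lin: "(\<lambda>z. z \<ominus>\<^bsub>I\<^esub> integral' (deriv' z)) \<in> linear_maps C I I"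
    by (rule linear_maps_minus_map[OF module_I linear_maps_ident linear_maps_compose[OF deriv_linear integral_linear]])
  have el_case: "el a c (\<tau> d f) \<ominus>\<^bsub>I\<^esub> integral' (deriv' (el a c (\<tau> d f))) \<in> scalars"
    if a: "a \<in> carrier R" and c: "c \<in> carrier A1" and d: "d \<in> carrier A2" and f: "f \<in> RT_words" for a c d f
  proof -
    \<comment> \<open>The component of \<open>a\<close> in the constants, for the decomposition of
      \<open>R\<close> into \<open>C\<close> and \<open>RJ\<close>; the other component is
      \<open>Q (D a)\<close>.\<close>
    define k where "k = a \<ominus> Q (D a)"
    have k: "k \<in> constants R D"
      using a D_minus[of a "Q (D a)"] by (simp add: k_def constants_def D_Q_D minus_eq_zero_iff)
    have kR: "k \<in> carrier R" using a by (simp add: k_def)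
    have ak: "a = Q (D a) \<oplus> k"
      using a by (simp add: k_def a_minus_def a_lcomm[of _ a] r_neg)
    define s where "s = el \<one> (c \<otimes>\<^bsub>A1\<^esub> e (Q (D a)) f) (\<tau> d [])"
    have s: "s \<in> scalars" unfolding s_def by (rule scalars_const) (use a c d f in simp_all)
    have sI: "s \<in> carrier I" using a c d f by (simp add: s_def)
    \<comment> \<open>\<open>D a\<close> lies in the image of \<open>D\<close>, so its integral
      acquires no new letter.\<close>
    have p0: "proj_T (D a) = \<zero>" using a by (simp add: proj_T_def D_Q_D a_minus_def r_neg)
    have tail: "int_tail (D a) c d f = \<zero>\<^bsub>I\<^esub>"
      using a c d f by (simp add: int_tail_def p0 \<tau>_Cons_zero el_zero)
    have base: "int_base (D a) c d f = el (Q (D a)) c (\<tau> d f) \<ominus>\<^bsub>I\<^esub> s"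
      by (simp add: int_base_def s_def)
    have el_a: "el a c (\<tau> d f) = el (Q (D a)) c (\<tau> d f) \<oplus>\<^bsub>I\<^esub> k \<odot>\<^bsub>I\<^esub> el \<one> c (\<tau> d f)"
      using a c d f kR k el_smult1[of k \<one> c "\<tau> d f"] by (subst ak) (simp add: el_add1)
    let ?q = "el (Q (D a)) c (\<tau> d f)" and ?r = "k \<odot>\<^bsub>I\<^esub> el \<one> c (\<tau> d f)"
    have cl: "?q \<in> carrier I" "?r \<in> carrier I"
      using a c d f k by (simp_all add: C_simps)
    show ?thesis
    proof (cases f)
      case Nil
      have "integral' (deriv' (el a c (\<tau> d f))) = ?q \<ominus>\<^bsub>I\<^esub> s"
        using a c d f base tail cl sI by (simp add: Nil deriv_el integral_el)
      moreover have "(?q \<ominus>\<^bsub>I\<^esub> s) \<oplus>\<^bsub>I\<^esub> s = ?q"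
        using cl sI by (simp add: a_minus_def cI.a_assoc cI.l_neg)
      ultimately have "integral' (deriv' (el a c (\<tau> d f))) \<oplus>\<^bsub>I\<^esub> s = ?q" by simp
      then have "?r \<oplus>\<^bsub>I\<^esub> (integral' (deriv' (el a c (\<tau> d f))) \<oplus>\<^bsub>I\<^esub> s) = el a c (\<tau> d f)"
        unfolding el_a using cl by (simp add: cI.a_comm)
      then have "(?r \<oplus>\<^bsub>I\<^esub> s) \<oplus>\<^bsub>I\<^esub> integral' (deriv' (el a c (\<tau> d f))) = el a c (\<tau> d f)"
        using a c d f cl sI by (simp add: cI.a_ac)
      then have "?r \<oplus>\<^bsub>I\<^esub> s = el a c (\<tau> d f) \<ominus>\<^bsub>I\<^esub> integral' (deriv' (el a c (\<tau> d f)))"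
        by (rule cI.eq_minusI) (use a c d f cl sI in simp_all)
      then show ?thesis
        using scalars_add[OF scalars_smult[OF k scalars_const[OF c d]] s] by (simp add: Nil)
    next
      case (Cons x g)
      then have x: "x \<in> carrier RT" "g \<in> RT_words" using f by simp_all
      let ?u = "int_word (Q (D a) \<otimes> x) c d g"
      have u: "?u \<in> carrier I" using a c d x by simp
      \<comment> \<open>The first summand will cancel the recursive part of
        \<open>int_word (D a)\<close>. In the second, \<open>k\<close> comes out by linearity and
        \<open>int_word_RT\<close> puts the letter \<open>x\<close> back in front.\<close>
      have ax: "a \<otimes> x = (Q (D a) \<otimes> x) \<oplus> (k \<otimes> x)"
        using a kR x by (subst ak) (simp add: l_distr)
      note lin1 = int_word_linear1[OF c d x(2)]
      have "int_word (a \<otimes> x) c d g = ?u \<oplus>\<^bsub>I\<^esub> k \<odot>\<^bsub>I\<^esub> int_word x c d g"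
        unfolding ax using a kR k x linear_maps_add[OF lin1, of "Q (D a) \<otimes> x" "k \<otimes> x"]
          linear_maps_smult[OF lin1, of k x] by (simp add: RC_simps C_simps)
      also have "int_word x c d g = el \<one> c (\<tau> d f)"
        using c d x by (simp add: int_word_RT Cons)
      finally have w: "int_word (a \<otimes> x) c d g = ?u \<oplus>\<^bsub>I\<^esub> ?r" .
      have "integral' (deriv' (el a c (\<tau> d f))) = int_word (D a) c d f \<oplus>\<^bsub>I\<^esub> int_word (a \<otimes> x) c d g"
        using a c d f x by (simp add: Cons deriv_el linear_maps_add[OF integral_linear] integral_el del: int_word.simps)
      also have "int_word (D a) c d f = (?q \<ominus>\<^bsub>I\<^esub> s) \<ominus>\<^bsub>I\<^esub> ?u"
        using base tail cl sI u by (simp add: Cons)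
      finally have id: "integral' (deriv' (el a c (\<tau> d f))) = ((?q \<ominus>\<^bsub>I\<^esub> s) \<ominus>\<^bsub>I\<^esub> ?u) \<oplus>\<^bsub>I\<^esub> (?u \<oplus>\<^bsub>I\<^esub> ?r)"
        by (simp add: w)
      have "((q \<ominus>\<^bsub>I\<^esub> s) \<ominus>\<^bsub>I\<^esub> u) \<oplus>\<^bsub>I\<^esub> (u \<oplus>\<^bsub>I\<^esub> r) \<oplus>\<^bsub>I\<^esub> s = q \<oplus>\<^bsub>I\<^esub> r"
        if "q \<in> carrier I" "u \<in> carrier I" "r \<in> carrier I" for q u r
      proof -
        have cancel: "(v \<ominus>\<^bsub>I\<^esub> v') \<oplus>\<^bsub>I\<^esub> v' = v" if "v \<in> carrier I" "v' \<in> carrier I" for v v'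
          using that by (simp add: a_minus_def cI.a_assoc cI.l_neg)
        have ac: "w \<oplus>\<^bsub>I\<^esub> (u \<oplus>\<^bsub>I\<^esub> r) \<oplus>\<^bsub>I\<^esub> s = ((w \<oplus>\<^bsub>I\<^esub> u) \<oplus>\<^bsub>I\<^esub> s) \<oplus>\<^bsub>I\<^esub> r" if "w \<in> carrier I" for w
          using that \<open>u \<in> carrier I\<close> \<open>r \<in> carrier I\<close> sI by (simp add: cI.a_ac)
        show ?thesis using that sI by (subst ac) (simp_all add: cancel)
      qed
      note cancel = this[OF cl(1) u cl(2)]
      have "integral' (deriv' (el a c (\<tau> d f))) \<oplus>\<^bsub>I\<^esub> s = el a c (\<tau> d f)"
        by (subst id, subst el_a) (rule cancel)
      then have "s \<oplus>\<^bsub>I\<^esub> integral' (deriv' (el a c (\<tau> d f))) = el a c (\<tau> d f)"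
        using a c d f sI by (simp add: cI.a_comm)
      then have "s = el a c (\<tau> d f) \<ominus>\<^bsub>I\<^esub> integral' (deriv' (el a c (\<tau> d f)))"
        by (rule cI.eq_minusI) (use a c d f sI in simp_all)
      then show ?thesis using s by simp
    qed
  qed
  show ?thesis
    using module_I gen_I z
  proof (induction rule: generating_family_induct)
    case zero
    show ?case using linear_maps_zero[OF module_I module_I lin] scalars_zero by simp
  next
    case (add x y)
    then show ?case using linear_maps_add[OF lin, of x y] scalars_add by simp
  next
    case (smult k x)
    then show ?case using linear_maps_smult[OF lin, of k x] scalars_smult by (simp add: C_simps)
  next
    case (gen g)
    then show ?case using el_case by (simp add: mem_Times_iff split_beta)
  qed
qed

text \<open>For a constant \<open>z\<close> the subtracted integral of the derivative is zero, so
  the preceding lemma speaks of \<open>z\<close> itself.\<close>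

lemma constants_scalars: "constants I deriv' \<subseteq> scalars"
proof
  fix z assume "z \<in> constants I deriv'"
  then have z: "z \<in> carrier I" "deriv' z = \<zero>\<^bsub>I\<^esub>" by (simp_all add: constants_def)
  then show "z \<in> scalars"
    using initial_value_scalar[OF z(1)] linear_maps_zero[OF module_I module_I integral_linear]
    by (simp add: a_minus_def)
qed

theorem comm_integro_differential_ring_idr: "comm_integro_differential_ring I deriv' integral'"
proof -
  interpret dI: comm_differential_ring I deriv'
    by unfold_locales (simp_all add: deriv_add deriv_mult)
  show ?thesis
  proof unfold_locales
    show "integral' (c \<otimes>\<^bsub>I\<^esub> f) = c \<otimes>\<^bsub>I\<^esub> integral' f" if "c \<in> constants I deriv'" "f \<in> carrier I" for c f
      using constants_scalars that by (auto simp: scalars_def)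
  qed (simp_all add: linear_maps_add[OF integral_linear] deriv_integral)
qed

section \<open>The embedding of the base ring\<close>

definition iota' :: "'a \<Rightarrow> 'i" where
  "iota' a = el a \<one>\<^bsub>A1\<^esub> (\<tau> \<one>\<^bsub>A2\<^esub> [])"

lemma iota_linear: "iota' \<in> linear_maps C RC I"
  unfolding iota'_def[abs_def] by (rule el_linear1) simp_all

lemma iota_mult_el:
  assumes "a \<in> carrier R" "b \<in> carrier R" "c \<in> carrier A1" "d \<in> carrier A2" "f \<in> RT_words"
  shows "iota' a \<otimes>\<^bsub>I\<^esub> el b c (\<tau> d f) = el (a \<otimes> b) c (\<tau> d f)"
  using assms by (simp add: iota'_def el_mult \<tau>_mult_Nil)

lemma iota_algebra_hom: "iota' \<in> algebra_hom C RC I"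
  unfolding algebra_hom_def
proof (intro IntI ring_hom_memI iota_linear)
  show "iota' \<one>\<^bsub>RC\<^esub> = \<one>\<^bsub>I\<^esub>" by (simp add: iota'_def one_I one_P RC_simps)
  show "iota' (x \<otimes>\<^bsub>RC\<^esub> y) = iota' x \<otimes>\<^bsub>I\<^esub> iota' y" if "x \<in> carrier RC" "y \<in> carrier RC" for x y
    using iota_mult_el[of x y "\<one>\<^bsub>A1\<^esub>" "\<one>\<^bsub>A2\<^esub>" "[]"] that by (simp add: iota'_def RC_simps)
qed (simp_all add: linear_maps_closed[OF iota_linear] linear_maps_add[OF iota_linear])

lemma iota_differential_ring_hom: "iota' \<in> differential_ring_hom R D I deriv'"
proof -
  have "iota' \<in> ring_hom R I"
    using iota_algebra_hom by (simp add: algebra_hom_def ring_hom_def RC_simps)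
  then show ?thesis
    by (simp add: differential_ring_hom_def iota'_def deriv_el)
qed

end

section \<open>The construction\<close>

text \<open>Projection to degree zero: the relations of the symmetric algebra only relate monomials
  with at least one factor, so all of these may be sent to zero while the image \<open>u\<close> of
  the unit is free.\<close>

lemma Sym_augmentation:
  assumes M: "module K M" and N: "module K N" and u: "u \<in> carrier N"
  obtains h where "h \<in> linear_maps K (Sym K M) N"
    "h (monomial K M {#}) = u" "\<And>A. \<lbrakk>A \<in> monomials (carrier M); A \<noteq> {#}\<rbrakk> \<Longrightarrow> h (monomial K M A) = \<zero>\<^bsub>N\<^esub>"
proof -
  interpret N: module K N by fact
  have "extends_linearly K (Sym K M) (monomial K M) (monomials (carrier M)) N
      (\<lambda>A. if A = {#} then u else \<zero>\<^bsub>N\<^esub>)"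
    by (rule extends_linearly_Sym[OF M N]) (simp_all add: u linear_maps_zero_map[OF N])
  then obtain h where h: "h \<in> linear_maps K (Sym K M) N"
    "\<And>A. A \<in> monomials (carrier M) \<Longrightarrow> h (monomial K M A) = (if A = {#} then u else \<zero>\<^bsub>N\<^esub>)"
    by (auto elim!: extends_linearlyE)
  show ?thesis by (rule that[OF h(1)]) (simp_all add: h(2))
qed

lemma (in abelian_monoid) finsum_all_zero:
  assumes "\<And>i. i \<in> S \<Longrightarrow> f i = \<zero>"
  shows "(\<Oplus>i\<in>S. f i) = \<zero>"
proof -
  have "(\<Oplus>i\<in>S. f i) = (\<Oplus>i\<in>S. \<zero>)" using assms by (intro finsum_cong') auto
  then show ?thesis by simp
qed

section \<open>Tensors of positive length, and the algebras of formal constants\<close>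

context quasi_integration
begin

declare in_lists_conv_set [simp del]

abbreviation "pos_words \<equiv> RT_words - {[]}"

lemma T_eq: "T = shuffle_algebra C RT"
  and pure_eq: "pure = pure_tensor C RT"
  by (simp_all add: T_def pure_def[abs_def])

lemmas module_T = module_shuffle_algebra[OF module_RT, folded T_eq]
lemmas gen_T = generating_family_shuffle_algebra[OF module_RT, folded T_eq pure_eq]
lemmas pure_multilinear = multilinear_pure_shuffle_algebra[OF module_RT, folded T_eq pure_eq]
lemmas T_bilinear = shuffle_bilinear[OF module_RT, folded T_eq]
lemmas cons_bilinear = word_cons_bilinear[OF module_RT, folded T_eq]
lemmas cons_pure = word_cons_pure[OF module_RT, folded pure_eq]
lemmas pure_shuffle_Nil = shuffle_Nil_left[OF module_RT, folded T_eq pure_eq]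
  shuffle_Nil_right[OF module_RT, folded T_eq pure_eq]
lemmas pure_shuffle_Cons = shuffle_Cons[OF module_RT, folded T_eq pure_eq]
lemmas pure_closed = multilinear_closed[OF pure_multilinear]
lemmas shuffle_closed = bilinear_maps_closed[OF T_bilinear]

lemma T_pos_span: "submodule (submodule_span C T (pure ` pos_words)) C T"
  by (rule submodule_span_submodule[OF module_T]) (simp add: image_subset_iff pure_closed)

lemma module_T_pos: "module C T_pos"
  unfolding T_pos_def by (rule submodule.submodule_is_module[OF T_pos_span module_T])

lemma gen_T_pos: "generating_family C T_pos pure pos_words"
  unfolding T_pos_def by (rule generating_family_submodule_span[OF module_T])
    (simp add: image_subset_iff pure_closed)

lemma T_pos_simps: "add T_pos = add T" "smult T_pos = smult T" "zero T_pos = zero T"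
  by (simp_all add: T_pos_def)

lemma T_pos_incl: "(\<lambda>s. s) \<in> linear_maps C T_pos T"
proof -
  interpret T: module C T by (rule module_T)
  show ?thesis
    by (rule linear_mapsI) (use T.submoduleE(1)[OF T_pos_span] in \<open>auto simp: T_pos_def\<close>)
qed

lemma T_pos_pure: "\<lbrakk>f \<in> RT_words; f \<noteq> []\<rbrakk> \<Longrightarrow> pure f \<in> carrier T_pos"
  by (rule generating_family_closed[OF gen_T_pos]) simp

text \<open>A letter in front makes every word nonempty, whatever tensor it is attached to; this
  keeps shuffles with a nonempty factor inside \<open>T_pos\<close>.\<close>

lemma word_cons_T_pos:
  assumes x: "x \<in> carrier RT" and s: "s \<in> carrier T"
  shows "word_cons C RT x s \<in> carrier T_pos"
proof -
  interpret TP: module C T_pos by (rule module_T_pos)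
  show ?thesis
    using module_T gen_T s
  proof (induction rule: generating_family_induct)
    case zero
    show ?case
      using bilinear_maps_zero_right[OF module_T module_T cons_bilinear x] TP.M.zero_closed
      by (simp add: T_pos_simps)
  next
    case (add s s')
    then show ?case
      using bilinear_maps_add_right[OF cons_bilinear x add(1,2)] TP.M.a_closed[OF add(3,4)]
      by (simp add: T_pos_simps)
  next
    case (smult k s)
    then show ?case
      using bilinear_maps_smult_right[OF cons_bilinear x smult(1,2)] TP.smult_closed[OF smult(1,3)]
      by (simp add: T_pos_simps)
  next
    case (gen f)
    then show ?case using x by (simp add: cons_pure T_pos_pure)
  qed
qed

lemma shuffle_T_pos:
  assumes f: "f \<in> RT_words" and g: "g \<in> RT_words" and ne: "f \<noteq> [] \<or> g \<noteq> []"
  shows "pure f \<otimes>\<^bsub>T\<^esub> pure g \<in> carrier T_pos"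
proof -
  interpret TP: module C T_pos by (rule module_T_pos)
  consider "f = []" "g \<noteq> []" | "g = []" "f \<noteq> []" | x f' y g' where "f = x # f'" "g = y # g'"
    using ne by (cases f; cases g) auto
  then show ?thesis
  proof cases
    case 3
    then have *: "x \<in> carrier RT" "f' \<in> RT_words" "y \<in> carrier RT" "g' \<in> RT_words" using f g by simp_all
    have "word_cons C RT x (pure f' \<otimes>\<^bsub>T\<^esub> pure (y # g')) \<in> carrier T_pos"
      "word_cons C RT y (pure (x # f') \<otimes>\<^bsub>T\<^esub> pure g') \<in> carrier T_pos"
      using * by (simp_all add: word_cons_T_pos shuffle_closed pure_closed)
    from TP.M.a_closed[OF this] show ?thesis
      using 3 * by (simp add: pure_shuffle_Cons T_pos_simps)
  qed (use f g in \<open>simp_all add: pure_shuffle_Nil T_pos_pure\<close>)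
qed

lemma module_M1: "module C M1"
  unfolding M1_def by (rule module_tensor_module[OF module_RJ module_T])

lemma module_M2: "module C M2"
  unfolding M2_def by (rule module_symmetric_square[OF module_T_pos])

lemma algebra_C1: "algebra C C1"
  unfolding C1_def by (rule algebra_Sym[OF module_M1])

abbreviation "S2 \<equiv> Sym C M2"

lemmas algebra_S2 = algebra_Sym[OF module_M2]
lemmas module_S2 = module_Sym[OF module_M2]
lemmas S2_bilinear = Sym_mult_bilinear[OF module_M2]

lemma eps2_Sym_bilinear: "eps2_Sym \<in> bilinear_maps C T_pos T_pos S2"
  unfolding eps2_Sym_def[abs_def]
  by (rule bilinear_maps_compose[OF sym_tensor_bilinear[OF module_T_pos] Sym_incl_linear[OF module_M2, unfolded M2_def],
        folded M2_def])

lemma eps2_Sym_commute: "\<lbrakk>s \<in> carrier T_pos; t \<in> carrier T_pos\<rbrakk> \<Longrightarrow> eps2_Sym s t = eps2_Sym t s"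
  by (simp add: eps2_Sym_def sym_tensor_commute[OF module_T_pos])

lemmas eps2_Sym_closed = bilinear_maps_closed[OF eps2_Sym_bilinear]
lemmas S2_closed = bilinear_maps_closed[OF S2_bilinear]

text \<open>The lower bounds \<open>1 - j\<close> exclude exactly the case of two empty prefixes, so
  all arguments of \<epsilon> have positive length. There are two versions of the bound because the
  outer index of \<open>J2_gen\<close> belongs to the second word in one inner sum and to the first
  word in the other.\<close>

lemma J2_gen_terms:
  assumes f: "f \<in> pos_words" and g: "g \<in> pos_words" and h: "h \<in> pos_words"
  shows "pure f \<otimes>\<^bsub>T\<^esub> pure g \<in> carrier T_pos" "pure f \<in> carrier T_pos"
    and "i < length f \<Longrightarrow> pure (drop i f) \<in> carrier T_pos"
    and "\<lbrakk>i < length f; j < length g; 1 - j \<le> i\<rbrakk> \<Longrightarrow> pure (take i f) \<otimes>\<^bsub>T\<^esub> pure (take j g) \<in> carrier T_pos"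
    and "\<lbrakk>i < length f; j < length g; 1 - i \<le> j\<rbrakk> \<Longrightarrow> pure (take i f) \<otimes>\<^bsub>T\<^esub> pure (take j g) \<in> carrier T_pos"
  using f g by (auto intro!: T_pos_pure shuffle_T_pos take_drop_lists)

lemma J2_gen_inner_closed:
  assumes "f \<in> pos_words" "g \<in> pos_words" "h \<in> pos_words" and j: "j < length g"
  shows "(\<lambda>i. eps2_Sym (pure (drop i f)) (pure (drop j g)) \<otimes>\<^bsub>S2\<^esub>
      eps2_Sym (pure (take i f) \<otimes>\<^bsub>T\<^esub> pure (take j g)) (pure h)) \<in> {1 - j..<length f} \<rightarrow> carrier S2"
    and "(\<lambda>k. eps2_Sym (pure f) (pure (take j g) \<otimes>\<^bsub>T\<^esub> pure (take k h)) \<otimes>\<^bsub>S2\<^esub>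
      eps2_Sym (pure (drop j g)) (pure (drop k h))) \<in> {1 - j..<length h} \<rightarrow> carrier S2"
  using J2_gen_terms[OF assms(1-3)] J2_gen_terms[OF assms(2,3,1)] J2_gen_terms[OF assms(3,1,2)] j
  by (auto intro!: S2_closed eps2_Sym_closed)

lemma J2_gen_closed:
  assumes "f \<in> pos_words" "g \<in> pos_words" "h \<in> pos_words"
  shows "J2_gen f g h \<in> carrier S2"
proof -
  interpret S2: module C S2 by (rule module_S2)
  note inner = J2_gen_inner_closed[OF assms]
  have "(\<Oplus>\<^bsub>S2\<^esub> i \<in> {1 - j..<length f}. eps2_Sym (pure (drop i f)) (pure (drop j g)) \<otimes>\<^bsub>S2\<^esub>
      eps2_Sym (pure (take i f) \<otimes>\<^bsub>T\<^esub> pure (take j g)) (pure h)) \<in> carrier S2"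
    "(\<Oplus>\<^bsub>S2\<^esub> k \<in> {1 - j..<length h}. eps2_Sym (pure f) (pure (take j g) \<otimes>\<^bsub>T\<^esub> pure (take k h)) \<otimes>\<^bsub>S2\<^esub>
      eps2_Sym (pure (drop j g)) (pure (drop k h))) \<in> carrier S2" if "j < length g" for j
    using inner[OF that] by (simp_all add: S2.M.finsum_closed)
  then show ?thesis
    unfolding J2_gen_def Let_def
    by (intro S2.M.a_closed[OF S2.M.minus_closed S2.M.finsum_closed] Pi_I S2.M.minus_closed eps2_Sym_closed
        J2_gen_terms(1,2)[OF assms(1-3)] J2_gen_terms(1,2)[OF assms(2,3,1)] J2_gen_terms(2)[OF assms(3,1,2)])
      simp_all
qed

lemma ideal_J2: "ideal J2 S2"
proof -
  interpret S2: cring S2 by (rule algebra.M_cring[OF algebra_S2])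
  show ?thesis
    unfolding J2_def by (rule S2.genideal_ideal) (auto intro!: J2_gen_closed)
qed

lemma J2_gen_J2:
  assumes "f \<in> pos_words" "g \<in> pos_words" "h \<in> pos_words"
  shows "J2_gen f g h \<in> J2"
proof -
  interpret S2: cring S2 by (rule algebra.M_cring[OF algebra_S2])
  have "{J2_gen f g h | f g h. f \<in> pos_words \<and> g \<in> pos_words \<and> h \<in> pos_words} \<subseteq> J2"
    unfolding J2_def by (rule S2.genideal_self) (auto intro!: J2_gen_closed)
  then show ?thesis using assms by blast
qed

lemma algebra_C2: "algebra C C2"
  unfolding C2_def by (rule algebra_quotient_module[OF algebra_S2 ideal_J2])

lemmas module_C1 = algebra.module[OF algebra_C1] and module_C2 = algebra.module[OF algebra_C2]

lemmas submodule_J2 = ideal_submodule[OF algebra_S2 ideal_J2]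

abbreviation "class2 \<equiv> \<lambda>z. J2 +>\<^bsub>S2\<^esub> z"

lemma class2_linear: "class2 \<in> linear_maps C S2 C2"
  unfolding C2_def by (rule coset_linear[OF module_S2 submodule_J2])

lemma class2_mult:
  "\<lbrakk>x \<in> carrier S2; y \<in> carrier S2\<rbrakk> \<Longrightarrow> class2 (x \<otimes>\<^bsub>S2\<^esub> y) = class2 x \<otimes>\<^bsub>C2\<^esub> class2 y"
  unfolding C2_def by (rule quotient_module_mult[OF ideal_J2, symmetric])

lemma class2_J2: "x \<in> J2 \<Longrightarrow> class2 x = \<zero>\<^bsub>C2\<^esub>"
proof -
  interpret S2: module C S2 by (rule module_S2)
  interpret J2: abelian_subgroup J2 S2 by (rule S2.abelian_subgroup_submodule[OF submodule_J2])
  show "x \<in> J2 \<Longrightarrow> class2 x = \<zero>\<^bsub>C2\<^esub>"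
    by (simp add: C2_def quotient_module_simps J2.a_rcos_const)
qed

lemma eps2_bilinear: "eps2 \<in> bilinear_maps C T_pos T_pos C2"
  unfolding eps2_def[abs_def] by (rule bilinear_maps_compose[OF eps2_Sym_bilinear class2_linear])

lemma eps2_commute: "\<lbrakk>s \<in> carrier T_pos; t \<in> carrier T_pos\<rbrakk> \<Longrightarrow> eps2 s t = eps2 t s"
  by (simp add: eps2_def eps2_Sym_commute)

lemmas eps2_closed = bilinear_maps_closed[OF eps2_bilinear]

text \<open>\<open>\<epsilon>\<close> is extended by zero to pairs with an empty word, so that no case distinctions are needed below.\<close>

definition pairing where
  "pairing = (SOME E. E \<in> bilinear_maps C T T C2 \<and> (\<forall>u\<in>RT_words. \<forall>v\<in>RT_words.
    E (pure u) (pure v) = (if u = [] \<or> v = [] then \<zero>\<^bsub>C2\<^esub> else eps2 (pure u) (pure v))))"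

text \<open>\<open>pure\<close> itself takes a value outside \<open>T_pos\<close> at the empty word,
  so as a multilinear map into \<open>T_pos\<close> it is available only behind a fixed first
  letter, or in the first letter itself.\<close>

lemma pure_Cons_T_pos:
  shows "x \<in> carrier RT \<Longrightarrow> multilinear C RT T_pos (\<lambda>u. pure (x # u))"
    and "u \<in> RT_words \<Longrightarrow> (\<lambda>x. pure (x # u)) \<in> linear_maps C RT T_pos"
proof -
  have lin: "h \<in> linear_maps C RT T_pos"
    if "h \<in> linear_maps C RT T" "\<And>x. x \<in> carrier RT \<Longrightarrow> h x \<in> carrier T_pos" for h
    using that by (auto simp: linear_maps_def T_pos_simps)
  show "(\<lambda>x. pure (x # u)) \<in> linear_maps C RT T_pos" if "u \<in> RT_words"
    by (rule lin[OF multilinear_ConsD(2)[OF pure_multilinear that]]) (use that in \<open>simp add: T_pos_pure\<close>)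
  show "multilinear C RT T_pos (\<lambda>u. pure (x # u))" if "x \<in> carrier RT"
    unfolding multilinear_def
  proof (intro conjI ballI lin)
    show "(\<lambda>u. pure (x # u)) \<in> RT_words \<rightarrow> carrier T_pos" using that by (simp add: T_pos_pure)
    show "(\<lambda>y. pure (x # u @ [y] @ v)) \<in> linear_maps C RT T" if "u \<in> RT_words" "v \<in> RT_words" for u v
      using multilinear_linear[OF multilinear_ConsD(1)[OF pure_multilinear \<open>x \<in> carrier RT\<close>] that] .
  qed (use that in \<open>simp add: T_pos_pure\<close>)
qed

lemma pairing_properties:
  "pairing \<in> bilinear_maps C T T C2 \<and> (\<forall>u\<in>RT_words. \<forall>v\<in>RT_words.
    pairing (pure u) (pure v) = (if u = [] \<or> v = [] then \<zero>\<^bsub>C2\<^esub> else eps2 (pure u) (pure v)))"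
proof -
  let ?e = "\<lambda>u v. if u = [] \<or> v = [] then \<zero>\<^bsub>C2\<^esub> else eps2 (pure u) (pure v)"
  interpret C2: module C C2 by (rule module_C2)
  \<comment> \<open>Extension by zero at the empty word is harmless since multilinearity relates
    words of equal length only.\<close>
  have ml: "multilinear C RT C2 (\<lambda>u. ?e u v)" if v: "v \<in> RT_words" for v
  proof (cases "v = []")
    case True
    then show ?thesis using multilinear_zero[OF module_C2] by simp
  next
    case False
    note lin = bilinear_maps_left[OF eps2_bilinear T_pos_pure[OF v False]]
    show ?thesis
    proof (rule multilinear_ConsI)
      show "multilinear C RT C2 (\<lambda>w. ?e (x # w) v)" if "x \<in> carrier RT" for x
        using multilinear_compose[OF pure_Cons_T_pos(1)[OF that] lin] False by simp
      show "(\<lambda>x. ?e (x # w) v) \<in> linear_maps C RT C2" if "w \<in> RT_words" for w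
        using linear_maps_compose[OF pure_Cons_T_pos(2)[OF that] lin] False by simp
    qed simp
  qed
  have sym: "?e v u = ?e u v" if "u \<in> RT_words" "v \<in> RT_words" for u v
    using that eps2_commute[of "pure u" "pure v"] by (simp add: T_pos_pure)
  have ml': "multilinear C RT C2 (?e u)" if u: "u \<in> RT_words" for u
    by (rule multilinear_cong[OF module_RT ml[OF u]]) (rule sym[OF u])
  obtain E where E: "E \<in> bilinear_maps C T T C2"
    "\<And>u v. \<lbrakk>u \<in> RT_words; v \<in> RT_words\<rbrakk> \<Longrightarrow> E (pure u) (pure v) = ?e u v"
    by (rule bilinear_extension[OF module_T module_T module_C2 gen_T gen_T
          extends_linearly_shuffle_algebra[OF module_RT module_C2 ml, folded T_eq pure_eq]
          extends_linearly_shuffle_algebra[OF module_RT module_C2 ml', folded T_eq pure_eq]])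
      (assumption | rule that)+
  show ?thesis
    unfolding pairing_def by (rule someI[of _ E]) (use E in blast)
qed

lemmas pairing_bilinear = pairing_properties[THEN conjunct1]
lemmas pairing_pure = pairing_properties[THEN conjunct2, rule_format]
lemmas pairing_closed = bilinear_maps_closed[OF pairing_bilinear]

text \<open>The defining property of \<open>pairing\<close> speaks of pure tensors. The relations of
  \<open>J2\<close> apply \<epsilon> to shuffles, which are sums of them, so agreement on all of
  \<open>T_pos\<close> is needed.\<close>

lemma pairing_eps2:
  assumes "s \<in> carrier T_pos" "t \<in> carrier T_pos"
  shows "pairing s t = eps2 s t"
proof (rule bilinear_maps_eqI[OF module_T_pos module_T_pos module_C2 gen_T_pos gen_T_pos _ eps2_bilinear _ assms])
  show "pairing \<in> bilinear_maps C T_pos T_pos C2"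
    using bilinear_maps_precompose[OF pairing_bilinear T_pos_incl T_pos_incl] .
qed (simp add: pairing_pure)

lemma pairing_commute:
  assumes "s \<in> carrier T" "t \<in> carrier T"
  shows "pairing s t = pairing t s"
proof (rule bilinear_maps_eqI[OF module_T module_T module_C2 gen_T gen_T pairing_bilinear
        bilinear_maps_flip[OF pairing_bilinear] _ assms])
  show "pairing (pure u) (pure v) = pairing (pure v) (pure u)" if "u \<in> RT_words" "v \<in> RT_words" for u v
    using that eps2_commute[of "pure u" "pure v"] by (simp add: pairing_pure T_pos_pure)
qed

lemma pairing_Nil: "s \<in> carrier T \<Longrightarrow> pairing (pure []) s = \<zero>\<^bsub>C2\<^esub>"
  by (rule linear_maps_eqI[OF module_T module_C2 gen_T bilinear_maps_right[OF pairing_bilinear]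
        linear_maps_zero_map[OF module_C2]]) (simp_all add: pairing_pure pure_closed)

lemma shuffle_pairing_C2: "shuffle_pairing C RT C2 pairing"
proof (rule shuffle_pairing.intro[OF module_RT algebra_C2])
  show "pairing \<in> bilinear_maps C (shuffle_algebra C RT) (shuffle_algebra C RT) C2"
    using pairing_bilinear by (simp add: T_eq)
qed (use pairing_commute pairing_Nil pure_closed in \<open>simp_all flip: pure_eq\<close>)

text \<open>The vanishing of the class of \<open>J2_gen f g h\<close>, rearranged: each \<epsilon>
  becomes a pairing, the missing summands with two empty prefixes are filled in as zeros, symmetry
  moves \<open>f\<close> to the second argument, and the outer sum over \<open>g\<close> is
  exchanged with the sum over \<open>f\<close>.\<close>

lemma J2_relation:
  assumes "f \<in> pos_words" "g \<in> pos_words" "h \<in> pos_words"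
  shows "pairing (pure f \<otimes>\<^bsub>T\<^esub> pure g) (pure h) \<oplus>\<^bsub>C2\<^esub>
      (\<Oplus>\<^bsub>C2\<^esub> i\<in>{0..<length f}. \<Oplus>\<^bsub>C2\<^esub> j\<in>{0..<length g}.
        pairing (pure (drop i f)) (pure (drop j g)) \<otimes>\<^bsub>C2\<^esub> pairing (pure (take i f) \<otimes>\<^bsub>T\<^esub> pure (take j g)) (pure h)) =
    pairing (pure g \<otimes>\<^bsub>T\<^esub> pure h) (pure f) \<oplus>\<^bsub>C2\<^esub>
      (\<Oplus>\<^bsub>C2\<^esub> j\<in>{0..<length g}. \<Oplus>\<^bsub>C2\<^esub> k\<in>{0..<length h}.
        pairing (pure (drop j g)) (pure (drop k h)) \<otimes>\<^bsub>C2\<^esub> pairing (pure (take j g) \<otimes>\<^bsub>T\<^esub> pure (take k h)) (pure f))"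
    (is "?X \<oplus>\<^bsub>C2\<^esub> ?A = ?Y \<oplus>\<^bsub>C2\<^esub> ?B")
proof -
  interpret S2: module C S2 by (rule module_S2)
  interpret cC2: cring C2 by (rule algebra.M_cring[OF algebra_C2])
  note tf = J2_gen_terms[OF assms] and tg = J2_gen_terms[OF assms(2,3,1)] and th = J2_gen_terms[OF assms(3,1,2)]
  have w: "f \<in> RT_words" "g \<in> RT_words" "h \<in> RT_words" using assms by auto
  note lin = class2_linear
  note l_add = linear_maps_add[OF lin] and l_minus = linear_maps_minus[OF module_S2 module_C2 lin]
    and l_sum = linear_maps_finsum[OF module_S2 module_C2 lin]
  note inner = J2_gen_inner_closed[OF assms]
  note pc = pairing_closed shuffle_closed pure_closed take_drop_lists w
  let ?a = "\<lambda>i j. pairing (pure (drop i f)) (pure (drop j g)) \<otimes>\<^bsub>C2\<^esub> pairing (pure (take i f) \<otimes>\<^bsub>T\<^esub> pure (take j g)) (pure h)"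
  let ?b = "\<lambda>j k. pairing (pure (drop j g)) (pure (drop k h)) \<otimes>\<^bsub>C2\<^esub> pairing (pure (take j g) \<otimes>\<^bsub>T\<^esub> pure (take k h)) (pure f)"
  have ac: "?a i j \<in> carrier C2" and bc: "?b j k \<in> carrier C2" for i j k
    by (simp_all add: pc)
  let ?sa = "\<lambda>j. \<Oplus>\<^bsub>S2\<^esub> i \<in> {1 - j..<length f}. eps2_Sym (pure (drop i f)) (pure (drop j g)) \<otimes>\<^bsub>S2\<^esub>
      eps2_Sym (pure (take i f) \<otimes>\<^bsub>T\<^esub> pure (take j g)) (pure h)"
  let ?sb = "\<lambda>j. \<Oplus>\<^bsub>S2\<^esub> k \<in> {1 - j..<length h}. eps2_Sym (pure f) (pure (take j g) \<otimes>\<^bsub>T\<^esub> pure (take k h)) \<otimes>\<^bsub>S2\<^esub>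
      eps2_Sym (pure (drop j g)) (pure (drop k h))"
  have sc: "?sa j \<in> carrier S2" "?sb j \<in> carrier S2" if "j < length g" for j
    using inner[OF that] by (simp_all add: S2.M.finsum_closed)
  \<comment> \<open>With truncated subtraction, \<open>1 - j\<close> exceeds 0 only for
    \<open>j = 0\<close>. The single index added is then 0, where the pairing has an empty first
    argument and vanishes.\<close>
  have drop0: "(\<Oplus>\<^bsub>C2\<^esub> i \<in> {1 - j..<n}. F i) = (\<Oplus>\<^bsub>C2\<^esub> i \<in> {0..<n}. F i)"
    if "\<And>i. F i \<in> carrier C2" "j = 0 \<Longrightarrow> F 0 = \<zero>\<^bsub>C2\<^esub>" for F n and j :: nat
  proof (rule cC2.add.finprod_mono_neutral_cong_left)
    show "F i = \<zero>\<^bsub>C2\<^esub>" if "i \<in> {0..<n} - {1 - j..<n}" for i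
    proof -
      have "j = 0" "i = 0" using that by (cases j; simp)+
      then show ?thesis using \<open>j = 0 \<Longrightarrow> F 0 = \<zero>\<^bsub>C2\<^esub>\<close> by simp
    qed
  qed (use that(1) in simp_all)
  have a0: "?a 0 0 = \<zero>\<^bsub>C2\<^esub>" and b0: "?b 0 0 = \<zero>\<^bsub>C2\<^esub>"
    by (simp_all add: pure_shuffle_Nil pairing_Nil pc)
  have qa: "class2 (?sa j) = (\<Oplus>\<^bsub>C2\<^esub> i\<in>{0..<length f}. ?a i j)" if j: "j < length g" for j
  proof -
    have "class2 (?sa j) = (\<Oplus>\<^bsub>C2\<^esub> i \<in> {1 - j..<length f}. ?a i j)"
      unfolding l_sum[OF inner(1)[OF j]]
    proof (rule cC2.finsum_cong')
      fix i assume i: "i \<in> {1 - j..<length f}"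
      then have m: "pure (take i f) \<otimes>\<^bsub>T\<^esub> pure (take j g) \<in> carrier T_pos" "pure (drop i f) \<in> carrier T_pos"
        "pure (drop j g) \<in> carrier T_pos" using j tf tg by auto
      show "class2 (eps2_Sym (pure (drop i f)) (pure (drop j g)) \<otimes>\<^bsub>S2\<^esub>
          eps2_Sym (pure (take i f) \<otimes>\<^bsub>T\<^esub> pure (take j g)) (pure h)) = ?a i j"
        using m th(2) by (simp add: class2_mult eps2_Sym_closed pairing_eps2 flip: eps2_def)
    qed (use ac in auto)
    then show ?thesis using drop0[of "\<lambda>i. ?a i j" j "length f"] ac a0 by simp
  qed
  have qb: "class2 (?sb j) = (\<Oplus>\<^bsub>C2\<^esub> k\<in>{0..<length h}. ?b j k)" if j: "j < length g" for j
  proof -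
    have "class2 (?sb j) = (\<Oplus>\<^bsub>C2\<^esub> k \<in> {1 - j..<length h}. ?b j k)"
      unfolding l_sum[OF inner(2)[OF j]]
    proof (rule cC2.finsum_cong')
      fix k assume k: "k \<in> {1 - j..<length h}"
      then have m: "pure (take j g) \<otimes>\<^bsub>T\<^esub> pure (take k h) \<in> carrier T_pos" "pure (drop j g) \<in> carrier T_pos"
        "pure (drop k h) \<in> carrier T_pos" using j tg th by auto
      show "class2 (eps2_Sym (pure f) (pure (take j g) \<otimes>\<^bsub>T\<^esub> pure (take k h)) \<otimes>\<^bsub>S2\<^esub>
          eps2_Sym (pure (drop j g)) (pure (drop k h))) = ?b j k"
        using m tf(2) by (simp add: class2_mult eps2_Sym_closed pairing_eps2 cC2.m_comm eps2_closed
            eps2_commute[of "pure f"] flip: eps2_def)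
    qed (use bc in auto)
    then show ?thesis using drop0[of "\<lambda>k. ?b j k" j "length h"] bc b0 by simp
  qed
  have X: "class2 (eps2_Sym (pure f \<otimes>\<^bsub>T\<^esub> pure g) (pure h)) = ?X"
    using tf th by (simp add: pairing_eps2 eps2_def)
  \<comment> \<open>Here the shuffle stands in the second argument of \<epsilon>; commutativity
    brings it to the first, as \<open>triple\<close> with rotated arguments requires.\<close>
  have Y: "class2 (eps2_Sym (pure f) (pure g \<otimes>\<^bsub>T\<^esub> pure h)) = ?Y"
    using tf tg by (simp add: pairing_eps2 eps2_commute[of "pure g \<otimes>\<^bsub>T\<^esub> pure h"] flip: eps2_def)
  have sum_c: "(\<lambda>j. ?sa j \<ominus>\<^bsub>S2\<^esub> ?sb j) \<in> {0..<length g} \<rightarrow> carrier S2"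
    using sc by (auto intro!: S2.M.minus_closed)
  have Ac: "(\<Oplus>\<^bsub>C2\<^esub> i\<in>{0..<length f}. ?a i j) \<in> carrier C2" "(\<Oplus>\<^bsub>C2\<^esub> k\<in>{0..<length h}. ?b j k) \<in> carrier C2" for j
    using ac bc by (auto intro!: cC2.finsum_closed)
  have "class2 (J2_gen f g h) = (?X \<ominus>\<^bsub>C2\<^esub> ?Y) \<oplus>\<^bsub>C2\<^esub>
      (\<Oplus>\<^bsub>C2\<^esub> j\<in>{0..<length g}. class2 (?sa j \<ominus>\<^bsub>S2\<^esub> ?sb j))"
    unfolding J2_gen_def Let_def X[symmetric] Y[symmetric] l_sum[OF sum_c, symmetric]
    by (subst l_add, (intro S2.M.minus_closed eps2_Sym_closed tf tg th)+, rule S2.M.finsum_closed[OF sum_c],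
        subst l_minus, (intro eps2_Sym_closed tf tg th)+, rule refl)
  also have "(\<Oplus>\<^bsub>C2\<^esub> j\<in>{0..<length g}. class2 (?sa j \<ominus>\<^bsub>S2\<^esub> ?sb j)) =
      (\<Oplus>\<^bsub>C2\<^esub> j\<in>{0..<length g}. (\<Oplus>\<^bsub>C2\<^esub> i\<in>{0..<length f}. ?a i j) \<oplus>\<^bsub>C2\<^esub> \<ominus>\<^bsub>C2\<^esub> (\<Oplus>\<^bsub>C2\<^esub> k\<in>{0..<length h}. ?b j k))"
  proof (rule cC2.finsum_cong')
    fix j assume "j \<in> {0..<length g}"
    then have j: "j < length g" by simp
    show "class2 (?sa j \<ominus>\<^bsub>S2\<^esub> ?sb j) = (\<Oplus>\<^bsub>C2\<^esub> i\<in>{0..<length f}. ?a i j) \<oplus>\<^bsub>C2\<^esub> \<ominus>\<^bsub>C2\<^esub> (\<Oplus>\<^bsub>C2\<^esub> k\<in>{0..<length h}. ?b j k)"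
      by (subst l_minus[OF sc[OF j]], subst qa[OF j], subst qb[OF j]) (simp only: a_minus_def)
  qed (use Ac in auto)
  also have "\<dots> = (\<Oplus>\<^bsub>C2\<^esub> j\<in>{0..<length g}. \<Oplus>\<^bsub>C2\<^esub> i\<in>{0..<length f}. ?a i j) \<oplus>\<^bsub>C2\<^esub>
      (\<Oplus>\<^bsub>C2\<^esub> j\<in>{0..<length g}. \<ominus>\<^bsub>C2\<^esub> (\<Oplus>\<^bsub>C2\<^esub> k\<in>{0..<length h}. ?b j k))"
    using Ac by (intro cC2.finsum_addf) auto
  \<comment> \<open>\<open>J2_gen\<close> sums over positions in \<open>g\<close> outermost, whereas
    \<open>triple f g h\<close> starts with positions in \<open>f\<close>. For the other sum the two
    orders already agree.\<close>
  also have "(\<Oplus>\<^bsub>C2\<^esub> j\<in>{0..<length g}. \<Oplus>\<^bsub>C2\<^esub> i\<in>{0..<length f}. ?a i j) = ?A"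
    by (rule cC2.finsum_swap[OF ac])
  also have "(\<Oplus>\<^bsub>C2\<^esub> j\<in>{0..<length g}. \<ominus>\<^bsub>C2\<^esub> (\<Oplus>\<^bsub>C2\<^esub> k\<in>{0..<length h}. ?b j k)) = \<ominus>\<^bsub>C2\<^esub> ?B"
    by (rule linear_maps_finsum[OF module_C2 module_C2 linear_maps_neg_map[OF module_C2 linear_maps_ident], symmetric])
      (use Ac in auto)
  finally have "(?X \<ominus>\<^bsub>C2\<^esub> ?Y) \<oplus>\<^bsub>C2\<^esub> (?A \<oplus>\<^bsub>C2\<^esub> \<ominus>\<^bsub>C2\<^esub> ?B) = \<zero>\<^bsub>C2\<^esub>"
    using class2_J2[OF J2_gen_J2[OF assms]] by simp
  moreover have "?X \<in> carrier C2" "?Y \<in> carrier C2" by (simp_all add: pc)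
  moreover have "?A \<in> carrier C2" "?B \<in> carrier C2"
    using ac bc by (auto intro!: cC2.finsum_closed)
  moreover have "x \<oplus>\<^bsub>C2\<^esub> a = y \<oplus>\<^bsub>C2\<^esub> b"
    if z: "(x \<ominus>\<^bsub>C2\<^esub> y) \<oplus>\<^bsub>C2\<^esub> (a \<oplus>\<^bsub>C2\<^esub> \<ominus>\<^bsub>C2\<^esub> b) = \<zero>\<^bsub>C2\<^esub>" and
      c: "x \<in> carrier C2" "y \<in> carrier C2" "a \<in> carrier C2" "b \<in> carrier C2" for x y a b
  proof -
    have "(x \<oplus>\<^bsub>C2\<^esub> a) \<ominus>\<^bsub>C2\<^esub> (y \<oplus>\<^bsub>C2\<^esub> b) = \<zero>\<^bsub>C2\<^esub>"
      using z c by (simp add: a_minus_def cC2.minus_add cC2.a_ac)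
    then show ?thesis using c by (simp add: cC2.minus_eq_zero_iff)
  qed
  ultimately show ?thesis by blast
qed

lemma associative_shuffle_pairing_C2: "associative_shuffle_pairing C RT C2 pairing"
proof (intro associative_shuffle_pairing.intro shuffle_pairing_C2 associative_shuffle_pairing_axioms.intro)
  fix f g h assume "f \<in> RT_words" "g \<in> RT_words" "h \<in> RT_words" "f \<noteq> []" "g \<noteq> []" "h \<noteq> []"
  then have *: "f \<in> pos_words" "g \<in> pos_words" "h \<in> pos_words" by simp_all
  show "shuffle_pairing.triple C RT C2 pairing f g h = shuffle_pairing.triple C RT C2 pairing g h f"
    using J2_relation[OF *]
    by (simp add: shuffle_pairing.triple_def[OF shuffle_pairing_C2] T_eq pure_eq)
qed

section \<open>The algebra of constants and tensors, and the full tensor product\<close>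

abbreviation "ten2 \<equiv> tensor C C2 T"

lemma C2_T_simps:
  "carrier C2_T = carrier (tensor_module C C2 T)" "add C2_T = add (tensor_module C C2 T)"
  "zero C2_T = zero (tensor_module C C2 T)" "smult C2_T = smult (tensor_module C C2 T)"
  "one C2_T = ten2 \<one>\<^bsub>C2\<^esub> (pure [])"
  by (simp_all add: C2_T_def Let_def)

text \<open>Identifies the defining formula of \<open>C2_T\<close>, written with
  \<open>eps2\<close>, with the abstract \<open>word_prod\<close> for \<open>pairing\<close>, whose
  extension properties show that the selected product exists.\<close>

lemma C2_T_mult:
  shows C2_T_mult_bilinear: "mult C2_T \<in> bilinear_maps C (tensor_module C C2 T) (tensor_module C C2 T) (tensor_module C C2 T)"
    and C2_T_mult_pure: "\<lbrakk>c \<in> carrier C2; d \<in> carrier C2; f \<in> RT_words; g \<in> RT_words\<rbrakk> \<Longrightarrow>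
      ten2 c (pure f) \<otimes>\<^bsub>C2_T\<^esub> ten2 d (pure g) = shuffle_pairing.word_prod C RT C2 pairing (c \<otimes>\<^bsub>C2\<^esub> d) f g"
proof -
  interpret sh: associative_shuffle_pairing C RT C2 pairing by (rule associative_shuffle_pairing_C2)
  interpret C2: cring C2 by (rule algebra.M_cring[OF algebra_C2])
  let ?P = "tensor_module C C2 T"
  note fold = T_eq[symmetric] pure_eq[symmetric]
  interpret P: module C ?P by (rule sh.module_P[unfolded fold])
  have word_prod: "sh.word_prod c f g = ten2 c (pure f \<otimes>\<^bsub>T\<^esub> pure g) \<oplus>\<^bsub>?P\<^esub>
      (\<Oplus>\<^bsub>?P\<^esub> i\<in>{0..<length f}. \<Oplus>\<^bsub>?P\<^esub> j\<in>{0..<length g}.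
        ten2 (c \<otimes>\<^bsub>C2\<^esub> eps2 (pure (drop i f)) (pure (drop j g))) (pure (take i f) \<otimes>\<^bsub>T\<^esub> pure (take j g)))"
    if "c \<in> carrier C2" "f \<in> RT_words" "g \<in> RT_words" for c f g
  proof -
    note tc = bilinear_maps_closed[OF tensor_bilinear[OF module_C2 module_T]]
    have tp: "ten2 (c \<otimes>\<^bsub>C2\<^esub> pairing (pure (drop i f)) (pure (drop j g))) (pure (take i f) \<otimes>\<^bsub>T\<^esub> pure (take j g)) \<in> carrier ?P"
      for i j
      using that by (intro tc C2.m_closed pairing_closed shuffle_closed pure_closed take_drop_lists)
    \<comment> \<open>Both suffixes are nonempty because the indices stay below the lengths, so the
      zero values of \<open>pairing\<close> do not occur.\<close>
    have eq: "pairing (pure (drop i f)) (pure (drop j g)) = eps2 (pure (drop i f)) (pure (drop j g))"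
      if "i < length f" "j < length g" for i j
      using that \<open>f \<in> RT_words\<close> \<open>g \<in> RT_words\<close> by (simp add: pairing_pure take_drop_lists)
    have "(\<Oplus>\<^bsub>?P\<^esub> i\<in>{0..<length f}. \<Oplus>\<^bsub>?P\<^esub> j\<in>{0..<length g}.
          ten2 (c \<otimes>\<^bsub>C2\<^esub> eps2 (pure (drop i f)) (pure (drop j g))) (pure (take i f) \<otimes>\<^bsub>T\<^esub> pure (take j g))) =
        (\<Oplus>\<^bsub>?P\<^esub> i\<in>{0..<length f}. \<Oplus>\<^bsub>?P\<^esub> j\<in>{0..<length g}.
          ten2 (c \<otimes>\<^bsub>C2\<^esub> pairing (pure (drop i f)) (pure (drop j g))) (pure (take i f) \<otimes>\<^bsub>T\<^esub> pure (take j g)))"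
    proof (intro P.M.finsum_cong')
      fix i j assume ij: "i \<in> {0..<length f}" "j \<in> {0..<length g}"
      then show "ten2 (c \<otimes>\<^bsub>C2\<^esub> eps2 (pure (drop i f)) (pure (drop j g))) (pure (take i f) \<otimes>\<^bsub>T\<^esub> pure (take j g)) =
          ten2 (c \<otimes>\<^bsub>C2\<^esub> pairing (pure (drop i f)) (pure (drop j g))) (pure (take i f) \<otimes>\<^bsub>T\<^esub> pure (take j g))"
        by (simp add: eq)
    qed (intro refl funcsetI P.M.finsum_closed tp)+
    then show ?thesis by (simp add: sh.word_prod_def fold)
  qed
  let ?gens = "carrier C2 \<times> RT_words"
  have P: "(\<forall>c\<in>carrier C2. \<forall>d\<in>carrier C2. \<forall>f\<in>RT_words. \<forall>g\<in>RT_words.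
      p (ten2 c (pure f)) (ten2 d (pure g)) =
        ten2 (c \<otimes>\<^bsub>C2\<^esub> d) (pure f \<otimes>\<^bsub>T\<^esub> pure g) \<oplus>\<^bsub>?P\<^esub>
        (\<Oplus>\<^bsub>?P\<^esub> i \<in> {0..<length f}. \<Oplus>\<^bsub>?P\<^esub> j \<in> {0..<length g}.
           ten2 (c \<otimes>\<^bsub>C2\<^esub> d \<otimes>\<^bsub>C2\<^esub> eps2 (pure (drop i f)) (pure (drop j g))) (pure (take i f) \<otimes>\<^bsub>T\<^esub> pure (take j g)))) \<longleftrightarrow>
    (\<forall>g\<in>?gens. \<forall>h\<in>?gens. p (case g of (c, f) \<Rightarrow> ten2 c (pure f)) (case h of (c, f) \<Rightarrow> ten2 c (pure f)) =
      (case g of (c, f) \<Rightarrow> case h of (d, g) \<Rightarrow> sh.word_prod (c \<otimes>\<^bsub>C2\<^esub> d) f g))" (is "?L p \<longleftrightarrow> ?R p") for p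
  proof
    assume L: "?L p"
    show "?R p"
    proof (intro ballI)
      fix g h assume "g \<in> ?gens" "h \<in> ?gens"
      then show "p (case g of (c, f) \<Rightarrow> ten2 c (pure f)) (case h of (c, f) \<Rightarrow> ten2 c (pure f)) =
          (case g of (c, f) \<Rightarrow> case h of (d, g) \<Rightarrow> sh.word_prod (c \<otimes>\<^bsub>C2\<^esub> d) f g)"
        using L by (simp add: mem_Times_iff split_beta word_prod)
    qed
  next
    assume R: "?R p"
    show "?L p"
    proof (intro ballI)
      fix c d f g assume *: "c \<in> carrier C2" "d \<in> carrier C2" "f \<in> RT_words" "g \<in> RT_words"
      then have "p (ten2 c (pure f)) (ten2 d (pure g)) = sh.word_prod (c \<otimes>\<^bsub>C2\<^esub> d) f g"
        using bspec[OF bspec[OF R, of "(c, f)"], of "(d, g)"] by simp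
      then show "p (ten2 c (pure f)) (ten2 d (pure g)) =
        ten2 (c \<otimes>\<^bsub>C2\<^esub> d) (pure f \<otimes>\<^bsub>T\<^esub> pure g) \<oplus>\<^bsub>?P\<^esub>
        (\<Oplus>\<^bsub>?P\<^esub> i \<in> {0..<length f}. \<Oplus>\<^bsub>?P\<^esub> j \<in> {0..<length g}.
           ten2 (c \<otimes>\<^bsub>C2\<^esub> d \<otimes>\<^bsub>C2\<^esub> eps2 (pure (drop i f)) (pure (drop j g))) (pure (take i f) \<otimes>\<^bsub>T\<^esub> pure (take j g)))"
        using * by (simp add: word_prod)
    qed
  qed
  note modP = sh.module_P[unfolded fold] and genP = sh.gen_P[unfolded fold]
  have mult: "mult C2_T = the_bilinear C ?P ?P ?P (\<lambda>p. \<forall>c\<in>carrier C2. \<forall>d\<in>carrier C2. \<forall>f\<in>RT_words. \<forall>g\<in>RT_words.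
      p (ten2 c (pure f)) (ten2 d (pure g)) =
        ten2 (c \<otimes>\<^bsub>C2\<^esub> d) (pure f \<otimes>\<^bsub>T\<^esub> pure g) \<oplus>\<^bsub>?P\<^esub>
        (\<Oplus>\<^bsub>?P\<^esub> i \<in> {0..<length f}. \<Oplus>\<^bsub>?P\<^esub> j \<in> {0..<length g}.
           ten2 (c \<otimes>\<^bsub>C2\<^esub> d \<otimes>\<^bsub>C2\<^esub> eps2 (pure (drop i f)) (pure (drop j g))) (pure (take i f) \<otimes>\<^bsub>T\<^esub> pure (take j g))))"
    by (simp add: C2_T_def Let_def)
  note ev = the_bilinear_eval[OF modP modP modP genP genP sh.word_prod_extends_left[unfolded fold]
      sh.word_prod_extends_right[unfolded fold] P]
  show "mult C2_T \<in> bilinear_maps C ?P ?P ?P"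
    unfolding mult by (rule ev(1))
  show "ten2 c (pure f) \<otimes>\<^bsub>C2_T\<^esub> ten2 d (pure g) = sh.word_prod (c \<otimes>\<^bsub>C2\<^esub> d) f g"
    if "c \<in> carrier C2" "d \<in> carrier C2" "f \<in> RT_words" "g \<in> RT_words"
    unfolding mult using ev(2)[of "(c, f)" "(d, g)"] that by simp
qed

lemma algebra_C2_T: "algebra C C2_T"
proof -
  interpret sh: associative_shuffle_pairing C RT C2 pairing by (rule associative_shuffle_pairing_C2)
  note fold = T_eq[symmetric] pure_eq[symmetric]
  show ?thesis
    by (rule sh.algebra_word_prod[unfolded fold, OF C2_T_simps C2_T_mult_bilinear C2_T_mult_pure])
qed

lemmas module_C2_T = algebra.module[OF algebra_C2_T]

lemma linear_maps_C2_T: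
  "linear_maps C C2_T N = linear_maps C (tensor_module C C2 T) N"
  "linear_maps C M C2_T = linear_maps C M (tensor_module C C2 T)"
  by (simp_all add: linear_maps_def C2_T_simps)

lemma ten2_bilinear: "ten2 \<in> bilinear_maps C C2 T C2_T"
  using tensor_bilinear[OF module_C2 module_T] by (simp add: bilinear_maps_def linear_maps_C2_T)

lemma gen_C2_T: "generating_family C C2_T (\<lambda>(d, f). ten2 d (pure f)) (carrier C2 \<times> RT_words)"
  using generating_family_tensor[OF module_C2 module_T generating_family_ident gen_T]
  by (simp add: generating_family_record_cong[OF C2_T_simps(1,2,4,3)])

lemma algebra_C1_C2_T: "algebra C C1_C2_T"
  unfolding C1_C2_T_def by (rule algebra_tensor_algebra_product[OF algebra_C1 algebra_C2_T])

lemmas module_C1_C2_T = algebra.module[OF algebra_C1_C2_T]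

lemma algebra_IDR: "algebra C IDR"
  unfolding IDR_def by (rule algebra_tensor_algebra_product[OF algebra_RC algebra_C1_C2_T])

lemmas module_IDR = algebra.module[OF algebra_IDR]

lemmas IDR_simps = tensor_algebra_product_simps[of C RC C1_C2_T, folded IDR_def]
lemmas C1_C2_T_simps = tensor_algebra_product_simps[of C C1 C2_T, folded C1_C2_T_def]

lemma linear_maps_IDR:
  "linear_maps C IDR N = linear_maps C (tensor_module C RC C1_C2_T) N"
  "linear_maps C M IDR = linear_maps C M (tensor_module C RC C1_C2_T)"
  by (simp_all add: linear_maps_def IDR_simps)

lemma linear_maps_C1_C2_T:
  "linear_maps C C1_C2_T N = linear_maps C (tensor_module C C1 C2_T) N"
  "linear_maps C M C1_C2_T = linear_maps C M (tensor_module C C1 C2_T)"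
  by (simp_all add: linear_maps_def C1_C2_T_simps)

definition ten4 where "ten4 a c p = tensor C RC C1_C2_T a (tensor C C1 C2_T c p)"

lemma elt_ten4: "elt a c d f = ten4 a c (ten2 d (pure f))"
  by (simp add: elt_def ten4_def)

lemma ten_bilinear:
  shows ten_RC_bilinear: "tensor C RC C1_C2_T \<in> bilinear_maps C RC C1_C2_T IDR"
    and ten_C1_bilinear: "tensor C C1 C2_T \<in> bilinear_maps C C1 C2_T C1_C2_T"
  using tensor_bilinear[OF module_RC module_C1_C2_T] tensor_bilinear[OF module_C1 module_C2_T]
  by (simp_all add: bilinear_maps_def linear_maps_IDR linear_maps_C1_C2_T)

lemma gen_C1_C2_T: "generating_family C C1_C2_T (\<lambda>(c, d, f). tensor C C1 C2_T c (ten2 d (pure f)))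
    (carrier C1 \<times> carrier C2 \<times> RT_words)"
proof -
  have "generating_family C C1_C2_T (\<lambda>(c, p). tensor C C1 C2_T c (case p of (d, f) \<Rightarrow> ten2 d (pure f)))
      (carrier C1 \<times> carrier C2 \<times> RT_words)"
    using generating_family_tensor[OF module_C1 module_C2_T generating_family_ident gen_C2_T]
    by (simp add: generating_family_record_cong[OF C1_C2_T_simps(1,3,4,2)])
  then show ?thesis by (simp add: split_def)
qed

lemma gen_IDR: "generating_family C IDR (\<lambda>(a, c, d, f). ten4 a c (ten2 d (pure f)))
    (carrier R \<times> carrier C1 \<times> carrier C2 \<times> RT_words)"
proof -
  have "generating_family C IDR
      (\<lambda>(a, p). tensor C RC C1_C2_T a (case p of (c, d, f) \<Rightarrow> tensor C C1 C2_T c (ten2 d (pure f))))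
      (carrier RC \<times> carrier C1 \<times> carrier C2 \<times> RT_words)"
    using generating_family_tensor[OF module_RC module_C1_C2_T generating_family_ident gen_C1_C2_T]
    by (simp add: generating_family_record_cong[OF IDR_simps(1,3,4,2)])
  then show ?thesis by (simp add: split_def ten4_def RC_simps)
qed

text \<open>The fourfold tensor product is nested to the right. The extension is built from the
  innermost factors outwards, each time with the outer arguments held fixed.\<close>

lemma extends_linearly_IDR:
  assumes N: "module C N"
    and R: "\<And>c d f. \<lbrakk>c \<in> carrier C1; d \<in> carrier C2; f \<in> RT_words\<rbrakk> \<Longrightarrow> (\<lambda>a. \<phi> a c d f) \<in> linear_maps C RC N"
    and C1: "\<And>a d f. \<lbrakk>a \<in> carrier R; d \<in> carrier C2; f \<in> RT_words\<rbrakk> \<Longrightarrow> (\<lambda>c. \<phi> a c d f) \<in> linear_maps C C1 N"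
    and C2: "\<And>a c f. \<lbrakk>a \<in> carrier R; c \<in> carrier C1; f \<in> RT_words\<rbrakk> \<Longrightarrow> (\<lambda>d. \<phi> a c d f) \<in> linear_maps C C2 N"
    and T: "\<And>a c d. \<lbrakk>a \<in> carrier R; c \<in> carrier C1; d \<in> carrier C2\<rbrakk> \<Longrightarrow> multilinear C RT N (\<phi> a c d)"
  shows "extends_linearly C IDR (\<lambda>(a, c, d, f). ten4 a c (ten2 d (pure f)))
    (carrier R \<times> carrier C1 \<times> carrier C2 \<times> RT_words) N (\<lambda>(a, c, d, f). \<phi> a c d f)"
proof -
  have 2: "extends_linearly C C2_T (\<lambda>(d, f). ten2 d (pure f)) (carrier C2 \<times> RT_words) N (\<lambda>(d, f). \<phi> a c d f)"
    if a: "a \<in> carrier R" and c: "c \<in> carrier C1" for a c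
    using extends_linearly_tensor[OF module_C2 module_T N generating_family_ident gen_T
        extends_linearly_ident[OF C2[OF a c]]
        extends_linearly_shuffle_algebra[OF module_RT N T[OF a c], folded T_eq pure_eq]]
    by (simp add: extends_linearly_def linear_maps_C2_T)
  have 1: "extends_linearly C C1_C2_T (\<lambda>(c, d, f). tensor C C1 C2_T c (ten2 d (pure f)))
      (carrier C1 \<times> carrier C2 \<times> RT_words) N (\<lambda>(c, d, f). \<phi> a c d f)" if a: "a \<in> carrier R" for a
  proof -
    have "extends_linearly C (tensor_module C C1 C2_T)
        (\<lambda>(c, p). tensor C C1 C2_T c (case p of (d, f) \<Rightarrow> ten2 d (pure f)))
        (carrier C1 \<times> carrier C2 \<times> RT_words) N (\<lambda>(c, p). case p of (d, f) \<Rightarrow> \<phi> a c d f)"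
    proof (rule extends_linearly_tensor[OF module_C1 module_C2_T N generating_family_ident gen_C2_T])
      show "extends_linearly C C1 (\<lambda>c. c) (carrier C1) N (\<lambda>c. case p of (d, f) \<Rightarrow> \<phi> a c d f)"
        if "p \<in> carrier C2 \<times> RT_words" for p
        using extends_linearly_ident[OF C1[OF a, of "fst p" "snd p"]] that
        by (simp add: mem_Times_iff split_beta)
    qed (rule 2[OF a])
    then show ?thesis by (simp add: extends_linearly_def linear_maps_C1_C2_T split_def)
  qed
  have "extends_linearly C (tensor_module C RC C1_C2_T)
      (\<lambda>(a, p). tensor C RC C1_C2_T a (case p of (c, d, f) \<Rightarrow> tensor C C1 C2_T c (ten2 d (pure f))))
      (carrier RC \<times> carrier C1 \<times> carrier C2 \<times> RT_words) N (\<lambda>(a, p). case p of (c, d, f) \<Rightarrow> \<phi> a c d f)"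
  proof (rule extends_linearly_tensor[OF module_RC module_C1_C2_T N generating_family_ident gen_C1_C2_T])
    show "extends_linearly C RC (\<lambda>a. a) (carrier RC) N (\<lambda>a. case p of (c, d, f) \<Rightarrow> \<phi> a c d f)"
      if "p \<in> carrier C1 \<times> carrier C2 \<times> RT_words" for p
      using extends_linearly_ident[OF R[of "fst p" "fst (snd p)" "snd (snd p)"]] that
      by (simp add: mem_Times_iff split_beta)
  qed (simp add: 1 RC_simps)
  then show ?thesis by (simp add: extends_linearly_def linear_maps_IDR split_def ten4_def RC_simps)
qed

lemma eps1_bilinear: "eps1 \<in> bilinear_maps C RJ T C1"
  unfolding eps1_def[abs_def] C1_def
  by (rule bilinear_maps_compose[OF tensor_bilinear[OF module_RJ module_T] Sym_incl_linear[OF module_M1, unfolded M1_def],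
        folded M1_def])

lemma idr_data_IDR:
  "idr_data R D Q C1 C2 C2_T IDR (\<lambda>d f. ten2 d (pure f)) (shuffle_pairing.pre C RT C2)
    ten4 (\<lambda>r f. eps1 r (pure f))"
proof -
  interpret sh: associative_shuffle_pairing C RT C2 pairing by (rule associative_shuffle_pairing_C2)
  interpret C2: cring C2 by (rule algebra.M_cring[OF algebra_C2])
  interpret P: cring C2_T by (rule algebra.M_cring[OF algebra_C2_T])
  note fold = T_eq[symmetric] pure_eq[symmetric]
  note closed = bilinear_maps_closed[OF ten2_bilinear] bilinear_maps_closed[OF ten_C1_bilinear]
    bilinear_maps_closed[OF ten_RC_bilinear] pure_closed
  have pre: "sh.pre \<in> bilinear_maps C RT C2_T C2_T"
    using sh.pre_bilinear[unfolded fold] by (simp add: bilinear_maps_def linear_maps_C2_T C2_T_simps)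
  show ?thesis
  proof (intro idr_data.intro idr_data_axioms.intro algebra_C1 algebra_C2 algebra_C2_T algebra_IDR
      gen_C2_T gen_IDR pre extends_linearly_IDR[OF module_IDR])
    show "quasi_integration R D Q" ..
    show "(\<lambda>d. ten2 d (pure f)) \<in> linear_maps C C2 C2_T" if "f \<in> RT_words" for f
      by (rule bilinear_maps_left[OF ten2_bilinear pure_closed[OF that]])
    show "multilinear C RT C2_T (\<lambda>f. ten2 d (pure f))" if "d \<in> carrier C2" for d
      by (rule multilinear_compose[OF pure_multilinear bilinear_maps_right[OF ten2_bilinear that]])
    show "\<one>\<^bsub>C2_T\<^esub> = ten2 \<one>\<^bsub>C2\<^esub> (pure [])" by (rule C2_T_simps)
    show "sh.pre x (ten2 d (pure f)) = ten2 d (pure (x # f))"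
      if "x \<in> carrier RT" "d \<in> carrier C2" "f \<in> RT_words" for x d f
      using sh.pre_word[unfolded fold] that by simp
    show "ten2 d (pure []) \<otimes>\<^bsub>C2_T\<^esub> ten2 d' (pure f) = ten2 (d \<otimes>\<^bsub>C2\<^esub> d') (pure f)"
      if "d \<in> carrier C2" "d' \<in> carrier C2" "f \<in> RT_words" for d d' f
      using that sh.word_prod_Nil_left[unfolded fold] by (simp add: C2_T_mult_pure)
    show "\<exists>u\<in>carrier C2. ten2 d (pure (x # f)) \<otimes>\<^bsub>C2_T\<^esub> ten2 d' (pure (y # g)) =
        (sh.pre x (ten2 d (pure f) \<otimes>\<^bsub>C2_T\<^esub> ten2 d' (pure (y # g))) \<oplus>\<^bsub>C2_T\<^esub>
         sh.pre y (ten2 d (pure (x # f)) \<otimes>\<^bsub>C2_T\<^esub> ten2 d' (pure g))) \<oplus>\<^bsub>C2_T\<^esub> ten2 u (pure [])"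
      if "d \<in> carrier C2" "d' \<in> carrier C2" "x \<in> carrier RT" "f \<in> RT_words" "y \<in> carrier RT" "g \<in> RT_words"
      for d d' x f y g
      \<comment> \<open>The coefficient of the length-zero term in the product recursion, which
        consists of the two given coefficients and the pairing of the full words.\<close>
      by (rule bexI[of _ "d \<otimes>\<^bsub>C2\<^esub> d' \<otimes>\<^bsub>C2\<^esub> pairing (pure (x # f)) (pure (y # g))"])
        (use that in \<open>simp_all add: C2_T_mult_pure sh.word_prod_Cons[unfolded fold] C2_T_simps
          pairing_closed pure_closed\<close>)
    show "(\<lambda>a. ten4 a c p) \<in> linear_maps C RC IDR" if "c \<in> carrier C1" "p \<in> carrier C2_T" for c p
      unfolding ten4_def[abs_def] by (rule bilinear_maps_left[OF ten_RC_bilinear closed(2)[OF that]])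
    show "(\<lambda>c. ten4 a c p) \<in> linear_maps C C1 IDR" if "a \<in> carrier R" "p \<in> carrier C2_T" for a p
      unfolding ten4_def[abs_def]
      by (rule linear_maps_compose[OF bilinear_maps_left[OF ten_C1_bilinear] bilinear_maps_right[OF ten_RC_bilinear]])
        (use that in \<open>simp_all add: RC_simps\<close>)
    show "ten4 a c \<in> linear_maps C C2_T IDR" if "a \<in> carrier R" "c \<in> carrier C1" for a c
      unfolding ten4_def[abs_def]
      by (rule linear_maps_compose[OF bilinear_maps_right[OF ten_C1_bilinear] bilinear_maps_right[OF ten_RC_bilinear]])
        (use that in \<open>simp_all add: RC_simps\<close>)
    show "\<one>\<^bsub>IDR\<^esub> = ten4 \<one> \<one>\<^bsub>C1\<^esub> \<one>\<^bsub>C2_T\<^esub>"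
      by (simp add: ten4_def IDR_simps C1_C2_T_simps RC_simps)
    show "ten4 a c p \<otimes>\<^bsub>IDR\<^esub> ten4 b c' q = ten4 (a \<otimes> b) (c \<otimes>\<^bsub>C1\<^esub> c') (p \<otimes>\<^bsub>C2_T\<^esub> q)"
      if "a \<in> carrier R" "b \<in> carrier R" "c \<in> carrier C1" "c' \<in> carrier C1" "p \<in> carrier C2_T" "q \<in> carrier C2_T"
      for a b c c' p q
      using that tensor_algebra_product_tensor[OF algebra_RC algebra_C1_C2_T, folded IDR_def]
        tensor_algebra_product_tensor[OF algebra_C1 algebra_C2_T, folded C1_C2_T_def]
      by (simp add: ten4_def RC_simps closed)
    show "(\<lambda>r. eps1 r (pure f)) \<in> linear_maps C RJ C1" if "f \<in> RT_words" for f
      by (rule bilinear_maps_left[OF eps1_bilinear pure_closed[OF that]])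
    show "multilinear C RT C1 (\<lambda>f. eps1 r (pure f))" if "r \<in> carrier RJ" for r
      by (rule multilinear_compose[OF pure_multilinear bilinear_maps_right[OF eps1_bilinear that]])
  qed
qed

section \<open>Augmentations and injectivity of the embedding\<close>

lemma augmentation_C1:
  obtains h where "h \<in> linear_maps C C1 RC" "h \<one>\<^bsub>C1\<^esub> = \<one>"
  by (rule Sym_augmentation[OF module_M1 module_RC, of \<one>, folded C1_def])
    (use that in \<open>auto simp: RC_simps C1_def Sym_simps\<close>)

text \<open>The augmentation of \<open>Sym C M2\<close> factors through \<open>C2\<close>, since every term of \<open>J2_gen\<close> contains an \<open>\<epsilon>\<close>.\<close>

lemma augmentation_C2:
  obtains h where "h \<in> linear_maps C C2 RC" "h \<one>\<^bsub>C2\<^esub> = \<one>"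
proof -
  interpret cRC: cring RC by (rule cring_RC)
  interpret S2: cring S2 by (rule algebra.M_cring[OF algebra_S2])
  interpret mS2: module C S2 by (rule module_S2)
  obtain h where h: "h \<in> linear_maps C S2 RC" and h1: "h (monomial C M2 {#}) = \<one>\<^bsub>RC\<^esub>"
    and h0: "\<And>A. \<lbrakk>A \<in> monomials (carrier M2); A \<noteq> {#}\<rbrakk> \<Longrightarrow> h (monomial C M2 A) = \<zero>\<^bsub>RC\<^esub>"
    by (rule Sym_augmentation[OF module_M2 module_RC cRC.one_closed]) (rule that)
  note hc = linear_maps_closed[OF h]
  \<comment> \<open>A product of monomials is the empty monomial only if both factors are, so the
    projection to degree zero is multiplicative.\<close>
  have mult: "h (x \<otimes>\<^bsub>S2\<^esub> y) = h x \<otimes>\<^bsub>RC\<^esub> h y" if "x \<in> carrier S2" "y \<in> carrier S2" for x y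
  proof (rule bilinear_maps_eqI[OF module_S2 module_S2 module_RC generating_family_monomial[OF module_M2]
        generating_family_monomial[OF module_M2] bilinear_maps_compose[OF S2_bilinear h]
        bilinear_maps_precompose[OF algebra_mult_bilinear[OF algebra_RC] h h] _ that])
    fix A B assume "A \<in> monomials (carrier M2)" "B \<in> monomials (carrier M2)"
    then show "h (monomial C M2 A \<otimes>\<^bsub>S2\<^esub> monomial C M2 B) = h (monomial C M2 A) \<otimes>\<^bsub>RC\<^esub> h (monomial C M2 B)"
      by (cases "A = {#}"; cases "B = {#}") (simp_all add: Sym_mult_monomial[OF module_M2] h0 h1)
  qed
  have eps: "h (eps2_Sym s t) = \<zero>\<^bsub>RC\<^esub>" if "s \<in> carrier T_pos" "t \<in> carrier T_pos" for s t
  proof -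
    have "sym_tensor C T_pos s t \<in> carrier M2"
      unfolding M2_def by (rule bilinear_maps_closed[OF sym_tensor_bilinear[OF module_T_pos] that])
    then show ?thesis by (simp add: eps2_Sym_def Sym_incl_def h0)
  qed
  let ?J = "{x \<in> carrier S2. h x = \<zero>\<^bsub>RC\<^esub>}"
  \<comment> \<open>Because the kernel is an ideal, minimality reduces the inclusion of
    \<open>J2\<close> to its generators.\<close>
  have ideal: "ideal ?J S2"
  proof (rule idealI[OF S2.ring_axioms])
    show "subgroup ?J (add_monoid S2)"
      using submodule_kernel[OF module_S2 module_RC h] by (simp add: submodule_def)
  qed (simp_all add: mult hc)
  have gen: "h (J2_gen f g k) = \<zero>\<^bsub>RC\<^esub>" if fgk: "f \<in> pos_words" "g \<in> pos_words" "k \<in> pos_words" for f g k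
  proof -
    note l_add = linear_maps_add[OF h] and l_minus = linear_maps_minus[OF module_S2 module_RC h]
      and l_sum = linear_maps_finsum[OF module_S2 module_RC h]
    note tf = J2_gen_terms[OF fgk] and tg = J2_gen_terms[OF fgk(2,3,1)] and tk = J2_gen_terms[OF fgk(3,1,2)]
    note inner = J2_gen_inner_closed[OF fgk]
    let ?sa = "\<lambda>j. \<Oplus>\<^bsub>S2\<^esub> i \<in> {1 - j..<length f}. eps2_Sym (pure (drop i f)) (pure (drop j g)) \<otimes>\<^bsub>S2\<^esub>
        eps2_Sym (pure (take i f) \<otimes>\<^bsub>T\<^esub> pure (take j g)) (pure k)"
    let ?sb = "\<lambda>j. \<Oplus>\<^bsub>S2\<^esub> i \<in> {1 - j..<length k}. eps2_Sym (pure f) (pure (take j g) \<otimes>\<^bsub>T\<^esub> pure (take i k)) \<otimes>\<^bsub>S2\<^esub>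
        eps2_Sym (pure (drop j g)) (pure (drop i k))"
    have sc: "?sa j \<in> carrier S2" "?sb j \<in> carrier S2" if "j < length g" for j
      using inner[OF that] by (simp_all add: S2.finsum_closed)
    have sa: "h (?sa j) = \<zero>\<^bsub>RC\<^esub>" if j: "j < length g" for j
      unfolding l_sum[OF inner(1)[OF j]]
    proof (rule cRC.finsum_all_zero)
      fix i assume i: "i \<in> {1 - j..<length f}"
      then have "pure (drop i f) \<in> carrier T_pos" "pure (drop j g) \<in> carrier T_pos"
        "pure (take i f) \<otimes>\<^bsub>T\<^esub> pure (take j g) \<in> carrier T_pos" using tf tg j by auto
      then show "h (eps2_Sym (pure (drop i f)) (pure (drop j g)) \<otimes>\<^bsub>S2\<^esub>
          eps2_Sym (pure (take i f) \<otimes>\<^bsub>T\<^esub> pure (take j g)) (pure k)) = \<zero>\<^bsub>RC\<^esub>"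
        using tk(2) by (simp add: mult eps2_Sym_closed eps)
    qed
    have sb: "h (?sb j) = \<zero>\<^bsub>RC\<^esub>" if j: "j < length g" for j
      unfolding l_sum[OF inner(2)[OF j]]
    proof (rule cRC.finsum_all_zero)
      fix i assume i: "i \<in> {1 - j..<length k}"
      then have "pure (take j g) \<otimes>\<^bsub>T\<^esub> pure (take i k) \<in> carrier T_pos" "pure (drop j g) \<in> carrier T_pos"
        "pure (drop i k) \<in> carrier T_pos" using tg tk j by auto
      then show "h (eps2_Sym (pure f) (pure (take j g) \<otimes>\<^bsub>T\<^esub> pure (take i k)) \<otimes>\<^bsub>S2\<^esub>
          eps2_Sym (pure (drop j g)) (pure (drop i k))) = \<zero>\<^bsub>RC\<^esub>"
        using tf(2) by (simp add: mult eps2_Sym_closed eps)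
    qed
    have sum_c: "(\<lambda>j. ?sa j \<ominus>\<^bsub>S2\<^esub> ?sb j) \<in> {0..<length g} \<rightarrow> carrier S2"
      using sc by (auto intro!: S2.minus_closed)
    have sum0: "h (\<Oplus>\<^bsub>S2\<^esub> j \<in> {0..<length g}. ?sa j \<ominus>\<^bsub>S2\<^esub> ?sb j) = \<zero>\<^bsub>RC\<^esub>"
      unfolding l_sum[OF sum_c]
    proof (rule cRC.finsum_all_zero)
      fix j assume "j \<in> {0..<length g}"
      then have j: "j < length g" by simp
      show "h (?sa j \<ominus>\<^bsub>S2\<^esub> ?sb j) = \<zero>\<^bsub>RC\<^esub>"
        by (subst l_minus[OF sc[OF j]], subst sa[OF j], subst sb[OF j]) (simp add: a_minus_def)
    qed
    have e1: "eps2_Sym (pure f \<otimes>\<^bsub>T\<^esub> pure g) (pure k) \<in> carrier S2" "eps2_Sym (pure f) (pure g \<otimes>\<^bsub>T\<^esub> pure k) \<in> carrier S2"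
      using tf tg tk by (simp_all add: eps2_Sym_closed)
    have e2: "h (eps2_Sym (pure f \<otimes>\<^bsub>T\<^esub> pure g) (pure k) \<ominus>\<^bsub>S2\<^esub> eps2_Sym (pure f) (pure g \<otimes>\<^bsub>T\<^esub> pure k)) = \<zero>\<^bsub>RC\<^esub>"
      by (subst l_minus[OF e1]) (use tf tg tk in \<open>simp add: eps a_minus_def\<close>)
    show ?thesis
      unfolding J2_gen_def Let_def
      by (subst l_add[OF S2.minus_closed[OF e1] S2.finsum_closed[OF sum_c]], subst sum0, subst e2) simp
  qed
  have J2: "J2 \<subseteq> ?J"
    unfolding J2_def by (rule S2.genideal_minimal[OF ideal]) (use gen J2_gen_closed in blast)
  obtain h' where h': "h' \<in> linear_maps C (quotient_module S2 J2) RC"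
    "\<And>x. x \<in> carrier S2 \<Longrightarrow> h' (J2 +>\<^bsub>S2\<^esub> x) = h x"
    by (rule linear_map_quotient_module[OF module_S2 module_RC submodule_J2 h])
      (use J2 that in blast)+
  have "h' \<one>\<^bsub>C2\<^esub> = h \<one>\<^bsub>S2\<^esub>"
    unfolding C2_def quotient_module_simps(3) by (rule h'(2)) (rule S2.one_closed)
  also have "\<dots> = \<one>"
    using h1 by (simp add: Sym_simps(5) RC_simps)
  finally show ?thesis
    using h'(1) by (intro that[of h']) (simp_all add: C2_def)
qed

text \<open>A left inverse is obtained by evaluating the formal constants through the augmentations
  and discarding tensors of positive length. The units of \<open>C1\<close> and \<open>C2\<close>
  are sent to one, so the value at \<open>iota a\<close> is \<open>a\<close>; this in particular
  rules out a collapse of \<open>C2\<close> by its relations.\<close>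

lemma iota_inj: "inj_on iota (carrier R)"
proof -
  obtain h1 where h1: "h1 \<in> linear_maps C C1 RC" "h1 \<one>\<^bsub>C1\<^esub> = \<one>" by (rule augmentation_C1) (rule that)
  obtain h2 where h2: "h2 \<in> linear_maps C C2 RC" "h2 \<one>\<^bsub>C2\<^esub> = \<one>" by (rule augmentation_C2) (rule that)
  have hc1: "h1 c \<in> carrier R" if "c \<in> carrier C1" for c
    using linear_maps_closed[OF h1(1) that] by (simp add: RC_simps)
  have hc2: "h2 d \<in> carrier R" if "d \<in> carrier C2" for d
    using linear_maps_closed[OF h2(1) that] by (simp add: RC_simps)
  have mr: "(\<lambda>x. a \<otimes> x) \<in> linear_maps C RC RC" if "a \<in> carrier R" for a
    by (rule linear_mapsI) (use that in \<open>auto simp: RC_simps C_simps r_distr constants_closed m_lcomm\<close>)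
  let ?\<phi> = "\<lambda>a c d f. if f = [] then a \<otimes> (h1 c \<otimes> h2 d) else \<zero>"
  have zero: "(\<lambda>_. \<zero>) \<in> linear_maps C M RC" for M :: "('a, 'm, 'y) module_scheme"
    using linear_maps_zero_map[OF module_RC] by (simp add: RC_simps)
  have ext: "extends_linearly C IDR (\<lambda>(a, c, d, f). ten4 a c (ten2 d (pure f)))
      (carrier R \<times> carrier C1 \<times> carrier C2 \<times> RT_words) RC (\<lambda>(a, c, d, f). ?\<phi> a c d f)"
  proof (rule extends_linearly_IDR[OF module_RC])
    show "(\<lambda>a. ?\<phi> a c d f) \<in> linear_maps C RC RC" if "c \<in> carrier C1" "d \<in> carrier C2" for c d f
      using RC_mult_linear[OF m_closed[OF hc1[OF that(1)] hc2[OF that(2)]]] zero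
      by (cases "f = []") simp_all
    show "(\<lambda>c. ?\<phi> a c d f) \<in> linear_maps C C1 RC" if "a \<in> carrier R" "d \<in> carrier C2" for a d f
      using linear_maps_compose[OF linear_maps_compose[OF h1(1) RC_mult_linear[OF hc2[OF that(2)]]] mr[OF that(1)]] zero
      by (cases "f = []") simp_all
    show "(\<lambda>d. ?\<phi> a c d f) \<in> linear_maps C C2 RC" if "a \<in> carrier R" "c \<in> carrier C1" for a c f
      using linear_maps_compose[OF linear_maps_compose[OF h2(1) mr[OF hc1[OF that(2)]]] mr[OF that(1)]] zero
      by (cases "f = []") simp_all
    show "multilinear C RT RC (?\<phi> a c d)" if "a \<in> carrier R" "c \<in> carrier C1" "d \<in> carrier C2" for a c d
      by (rule multilinear_ConsI)
        (use that hc1 hc2 zero multilinear_zero[OF module_RC] in \<open>simp_all add: RC_simps\<close>)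
  qed
  obtain r where r: "\<And>g. g \<in> carrier R \<times> carrier C1 \<times> carrier C2 \<times> RT_words \<Longrightarrow>
      r ((\<lambda>(a, c, d, f). ten4 a c (ten2 d (pure f))) g) = (\<lambda>(a, c, d, f). ?\<phi> a c d f) g"
    by (rule extends_linearlyE[OF ext]) (rule that)
  have "r (iota a) = a" if "a \<in> carrier R" for a
    using r[of "(a, \<one>\<^bsub>C1\<^esub>, \<one>\<^bsub>C2\<^esub>, [])"] that algebra.M_cring[OF algebra_C1] algebra.M_cring[OF algebra_C2]
    by (simp add: iota_def elt_ten4 h1 h2 cring.cring_simprules(6))
  then show ?thesis by (rule inj_on_inverseI)
qed

text \<open>The abstract results are instantiated by recognizing \<open>deriv\<close>,
  \<open>integral\<close> and \<open>iota\<close> as the maps of \<open>idr_data\<close>. The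
  statement on nested integrals combines two moves: \<open>iota a\<close> multiplies into the
  coefficient, and integrating a letter of \<open>RT\<close> with coefficient one moves it to the
  front of the word.\<close>

theorem IDR_properties:
  "comm_integro_differential_ring IDR deriv integral \<and>
   iota \<in> algebra_hom C RC IDR \<and> iota \<in> differential_ring_hom R D IDR deriv \<and>
   (\<forall>f\<^sub>0\<in>carrier R. \<forall>fs. fs \<noteq> [] \<and> set fs \<subseteq> carrier RT \<longrightarrow>
      iota f\<^sub>0 \<otimes>\<^bsub>IDR\<^esub> iterated_integral fs = elt f\<^sub>0 \<one>\<^bsub>C1\<^esub> \<one>\<^bsub>C2\<^esub> fs)"
proof -
  interpret idr: idr_data R D Q C1 C2 C2_T IDR "\<lambda>d f. ten2 d (pure f)" "shuffle_pairing.pre C RT C2"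
    ten4 "\<lambda>r f. eps1 r (pure f)"
    by (rule idr_data_IDR)
  have one: "\<one>\<^bsub>C1\<^esub> \<in> carrier C1" "\<one>\<^bsub>C2\<^esub> \<in> carrier C2"
    using algebra.M_cring[OF algebra_C1] algebra.M_cring[OF algebra_C2] by (simp_all add: cring.cring_simprules(6))
  have deriv: "deriv = idr.deriv'" and integral: "integral = idr.integral'" and iota: "iota = idr.iota'"
    by (simp_all add: deriv_def idr.deriv'_def integral_def idr.integral'_def iota_def idr.iota'_def elt_ten4 fun_eq_iff)
  have iota_elt: "iota a \<otimes>\<^bsub>IDR\<^esub> elt \<one> \<one>\<^bsub>C1\<^esub> \<one>\<^bsub>C2\<^esub> f = elt a \<one>\<^bsub>C1\<^esub> \<one>\<^bsub>C2\<^esub> f" if "a \<in> carrier R" "f \<in> RT_words" for a f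
    using that one idr.iota_mult_el[of a \<one> "\<one>\<^bsub>C1\<^esub>" "\<one>\<^bsub>C2\<^esub>" f] by (simp add: iota elt_ten4)
  have int_elt: "integral (elt x \<one>\<^bsub>C1\<^esub> \<one>\<^bsub>C2\<^esub> f) = elt \<one> \<one>\<^bsub>C1\<^esub> \<one>\<^bsub>C2\<^esub> (x # f)"
    if "x \<in> carrier RT" "f \<in> RT_words" for x f
    using that one idr.integral_RT by (simp add: integral elt_ten4)
  \<comment> \<open>The word is built from its last letter backwards, and after each integral the
    coefficient in \<open>R\<close> is one again, ready to receive the next letter.\<close>
  have iterated: "iterated_integral fs = elt \<one> \<one>\<^bsub>C1\<^esub> \<one>\<^bsub>C2\<^esub> fs" if "fs \<noteq> []" "fs \<in> RT_words" for fs
    using that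
  proof (induction fs rule: iterated_integral.induct)
    case (1 f)
    then show ?case using int_elt[of f "[]"] by (simp add: iota_def)
  next
    case (2 f g fs)
    then show ?case using iota_elt[of f "g # fs"] int_elt[of f "g # fs"] by (simp add: RT_closed)
  qed simp
  show ?thesis
    using idr.comm_integro_differential_ring_idr idr.iota_algebra_hom idr.iota_differential_ring_hom
      iterated iota_elt
    by (auto simp: deriv integral iota in_lists_conv_set subset_iff)
qed

end

theorem theorem19:
  fixes R :: "('a, 'b) ring_scheme" and D Q :: "'a \<Rightarrow> 'a"
  assumes "comm_differential_ring R D"
    and "quasi_integration R D Q"
  shows "comm_integro_differential_ring
           (quasi_integration.IDR R D Q)
           (quasi_integration.deriv R D Q)
           (quasi_integration.integral R D Q)
    \<and> quasi_integration.iota R D Q \<in> algebra_hom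
           (quasi_integration.C R D) (quasi_integration.RC R) (quasi_integration.IDR R D Q)
    \<and> quasi_integration.iota R D Q \<in> differential_ring_hom R D
           (quasi_integration.IDR R D Q) (quasi_integration.deriv R D Q)
    \<and> inj_on (quasi_integration.iota R D Q) (carrier R)
    \<and> (\<forall>f\<^sub>0\<in>carrier R. \<forall>fs. fs \<noteq> [] \<and> set fs \<subseteq> carrier (quasi_integration.RT R Q) \<longrightarrow>
         quasi_integration.iota R D Q f\<^sub>0 \<otimes>\<^bsub>quasi_integration.IDR R D Q\<^esub>
           quasi_integration.iterated_integral R D Q fs =
         quasi_integration.elt R D Q f\<^sub>0
           \<one>\<^bsub>quasi_integration.C1 R D Q\<^esub> \<one>\<^bsub>quasi_integration.C2 R D Q\<^esub> fs)"
  using quasi_integration.IDR_properties[OF assms(2)] quasi_integration.iota_inj[OF assms(2)] by blast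

end
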